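(* Let $(M,g,V,\lambda,\mu)$ be an $\eta$-Ricci-Yamabe soliton of type $(0,1)$ with vertical potential field $V$, and let $\pi:(M,g)\to(N,g_N)$ be a Riemannian submersion between Riemannian manifolds. If the vertical distribution $\mathcal{V}$ is parallel, then any fiber of $\pi$ is an $\eta$-Yamabe soliton.
   Context: All manifolds, maps and tensor fields are smooth. A Riemannian submersion $\pi:(M,g)\to(N,g_N)$, with $\dim M>\dim N$, is a surjective map of rank $\dim N$ whose differential preserves the lengths of horizontal vectors. The vertical distribution is $\mathcal{V}=\ker\pi_*$; the horizontal distribution is its $g$-orthogonal complement. A vector field is vertical if it is a section of $\mathcal{V}$. $\mathcal{V}$ is parallel if $\nabla_E F$ is vertical for every vector field $E$ on $M$ and every vertical $F$, where $\nabla$ is the Levi-Civita connection of $g$. Given a $1$-form $\eta$, a vector field $V$ (the potential field) and real constants $\lambda,\mu$, the data $(M,g,V,\lambda,\mu)$ is an $\eta$-Ricci-Yamabe soliton of type $(0,1)$, also called an $\eta$-Yamabe soliton, if $\mathcal{L}_V g+(2\lambda-R)g+2\mu\,\eta\otimes\eta=0$, where $R$ is the scalar curvature of $g$. A fiber $\pi^{-1}(q)$ with induced metric $\hat g$ and scalar curvature $\hat R$ is an $\eta$-Yamabe soliton if this equation holds on the fiber, for some real constants in the places of $\lambda,\mu$, with $\hat g,\hat R$ in place of $g,R$ and with $V$ and $\eta$ restricted to the fiber. *)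

theory Defs
  imports "HOL-Analysis.Analysis"
begin

section \<open>Smooth functions on open subsets of a coordinate space\<close>

text \<open>
  The model space of an \<open>n\<close>-dimensional manifold is the coordinate space \<open>span B\<close> for a set
  \<open>B \<subseteq> Basis\<close> of \<open>n\<close> standard basis vectors of some Euclidean space.  Thus the dimension is a
  number, \<open>card B\<close>, and not a type: a manifold and its submanifolds can be treated in the same
  statement, and dimension \<open>0\<close> (\<open>B = {}\<close>) is included.  Sets \<open>W\<close> below are open in \<open>span B\<close>,
  and only directions in \<open>B\<close> are used, so only the values of \<open>f\<close> on \<open>W\<close> matter.
\<close>

definition partial_deriv :: "'e::euclidean_space \<Rightarrow> ('e \<Rightarrow> real) \<Rightarrow> 'e \<Rightarrow> real" where
  "partial_deriv b f x = deriv (\<lambda>t. f (x + t *\<^sub>R b)) 0"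

primrec Ck_on :: "nat \<Rightarrow> 'e::euclidean_space set \<Rightarrow> 'e set \<Rightarrow> ('e \<Rightarrow> real) \<Rightarrow> bool" where
  "Ck_on 0 B W f \<longleftrightarrow> continuous_on W f"
| "Ck_on (Suc k) B W f \<longleftrightarrow> continuous_on W f \<and>
     (\<forall>b\<in>B. (\<forall>x\<in>W. (\<lambda>t. f (x + t *\<^sub>R b)) differentiable (at 0)) \<and>
            Ck_on k B W (partial_deriv b f))"

definition smooth_on :: "'e::euclidean_space set \<Rightarrow> 'e set \<Rightarrow> ('e \<Rightarrow> real) \<Rightarrow> bool" where
  "smooth_on B W f \<longleftrightarrow> (\<forall>k. Ck_on k B W f)"


section \<open>Smooth manifolds\<close>

text \<open>A chart is a pair \<open>(U, \<phi>)\<close>; the values of \<open>\<phi>\<close> outside \<open>U\<close> are irrelevant.\<close>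

record ('a, 'e) manifold =
  mtop :: "'a topology"
  mcoords :: "'e set"
  matlas :: "('a set \<times> ('a \<Rightarrow> 'e)) set"

abbreviation mcarrier :: "('a, 'e) manifold \<Rightarrow> 'a set" where
  "mcarrier M \<equiv> topspace (mtop M)"

definition mdim :: "('a, 'e) manifold \<Rightarrow> nat" where
  "mdim M = card (mcoords M)"

definition is_chart :: "('a, 'e::euclidean_space) manifold \<Rightarrow> 'a set \<times> ('a \<Rightarrow> 'e) \<Rightarrow> bool" where
  "is_chart M = (\<lambda>(U, \<phi>). openin (mtop M) U \<and>
     openin (top_of_set (span (mcoords M))) (\<phi> ` U) \<and>
     homeomorphic_map (subtopology (mtop M) U) (top_of_set (\<phi> ` U)) \<phi>)"

definition smooth_transition ::
    "('a, 'e::euclidean_space) manifold \<Rightarrow> 'a set \<times> ('a \<Rightarrow> 'e) \<Rightarrow> 'a set \<times> ('a \<Rightarrow> 'e) \<Rightarrow> bool" where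
  "smooth_transition M = (\<lambda>(U, \<phi>) (U', \<phi>').
     \<forall>b\<in>mcoords M. smooth_on (mcoords M) (\<phi> ` (U \<inter> U')) (\<lambda>x. \<phi>' (inv_into U \<phi> x) \<bullet> b))"

definition smooth_manifold :: "('a, 'e::euclidean_space) manifold \<Rightarrow> bool" where
  "smooth_manifold M \<longleftrightarrow>
     mcoords M \<subseteq> Basis \<and>
     Hausdorff_space (mtop M) \<and> second_countable (mtop M) \<and>
     (\<forall>c\<in>matlas M. is_chart M c) \<and>
     (\<forall>c\<in>matlas M. \<forall>c'\<in>matlas M. smooth_transition M c c') \<and>
     \<Union> (fst ` matlas M) = mcarrier M"

definition max_atlas :: "('a, 'e::euclidean_space) manifold \<Rightarrow> ('a set \<times> ('a \<Rightarrow> 'e)) set" where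
  "max_atlas M = {c. is_chart M c \<and>
     (\<forall>c'\<in>matlas M. smooth_transition M c c' \<and> smooth_transition M c' c)}"

definition smooth_functions :: "('a, 'e::euclidean_space) manifold \<Rightarrow> ('a \<Rightarrow> real) set" where
  "smooth_functions M = {f. \<forall>(U, \<phi>)\<in>matlas M.
     smooth_on (mcoords M) (\<phi> ` U) (\<lambda>x. f (inv_into U \<phi> x))}"

definition smooth_map ::
    "('a, 'e::euclidean_space) manifold \<Rightarrow> ('b, 'f::euclidean_space) manifold \<Rightarrow> ('a \<Rightarrow> 'b) \<Rightarrow> bool" where
  "smooth_map M N F \<longleftrightarrow>
     continuous_map (mtop M) (mtop N) F \<and>
     (\<forall>(U, \<phi>)\<in>matlas M. \<forall>(W, \<psi>)\<in>matlas N. \<forall>b\<in>mcoords N.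
        smooth_on (mcoords M) (\<phi> ` (U \<inter> F -` W)) (\<lambda>x. \<psi> (F (inv_into U \<phi> x)) \<bullet> b))"

text \<open>
  The subset \<open>S\<close> of \<open>M\<close> as an embedded submanifold of dimension \<open>card K\<close>: subspace topology and,
  as atlas, the restrictions to \<open>S\<close> of the slice charts, that is of the charts \<open>(U, \<phi>)\<close> of \<open>M\<close>
  which identify \<open>U \<inter> S\<close> with the slice of \<open>\<phi> ` U\<close> by the coordinate subspace \<open>span K\<close>,
  \<open>K \<subseteq> mcoords M\<close>.
\<close>

definition submanifold ::
    "('a, 'e::euclidean_space) manifold \<Rightarrow> 'a set \<Rightarrow> 'e set \<Rightarrow> ('a, 'e) manifold" where
  "submanifold M S K =
     \<lparr>mtop = subtopology (mtop M) S,
      mcoords = K,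
      matlas = {(U \<inter> S, \<phi>) | U \<phi>. (U, \<phi>) \<in> max_atlas M \<and> \<phi> ` (U \<inter> S) = \<phi> ` U \<inter> span K}\<rparr>"


section \<open>Tangent vectors and vector fields\<close>

text \<open>
  Tangent vectors at \<open>p\<close> are derivations at \<open>p\<close> of the algebra of smooth functions.  They are set to
  \<open>0\<close> on non-smooth functions, so that equality of tangent vectors is equality in HOL.
\<close>

type_synonym 'a tvec = "('a \<Rightarrow> real) \<Rightarrow> real"
type_synonym 'a vfield = "'a \<Rightarrow> 'a tvec"

definition tangent_space :: "('a, 'e::euclidean_space) manifold \<Rightarrow> 'a \<Rightarrow> 'a tvec set" where
  "tangent_space M p = {v.
     (\<forall>f\<in>smooth_functions M. \<forall>h\<in>smooth_functions M. v (\<lambda>x. f x + h x) = v f + v h) \<and>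
     (\<forall>c. \<forall>f\<in>smooth_functions M. v (\<lambda>x. c * f x) = c * v f) \<and>
     (\<forall>f\<in>smooth_functions M. \<forall>h\<in>smooth_functions M.
        v (\<lambda>x. f x * h x) = f p * v h + h p * v f) \<and>
     (\<forall>f. f \<notin> smooth_functions M \<longrightarrow> v f = 0)}"

definition differential ::
    "('a, 'e::euclidean_space) manifold \<Rightarrow> ('b, 'f::euclidean_space) manifold \<Rightarrow> ('a \<Rightarrow> 'b) \<Rightarrow>
     'a tvec \<Rightarrow> 'b tvec" where
  "differential M N F v = (\<lambda>h. if h \<in> smooth_functions N then v (\<lambda>x. h (F x)) else 0)"

definition vector_fields :: "('a, 'e::euclidean_space) manifold \<Rightarrow> 'a vfield set" where
  "vector_fields M = {X.
     (\<forall>p\<in>mcarrier M. X p \<in> tangent_space M p) \<and>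
     (\<forall>f\<in>smooth_functions M. (\<lambda>p. X p f) \<in> smooth_functions M)}"

definition lie_bracket :: "'a vfield \<Rightarrow> 'a vfield \<Rightarrow> 'a vfield" where
  "lie_bracket X Y = (\<lambda>p f. X p (\<lambda>q. Y q f) - Y p (\<lambda>q. X q f))"


section \<open>Tensor fields\<close>

type_synonym 'a form1 = "'a \<Rightarrow> 'a tvec \<Rightarrow> real"
type_synonym 'a form2 = "'a \<Rightarrow> 'a tvec \<Rightarrow> 'a tvec \<Rightarrow> real"

definition one_form :: "('a, 'e::euclidean_space) manifold \<Rightarrow> 'a form1 \<Rightarrow> bool" where
  "one_form M \<eta> \<longleftrightarrow>
     (\<forall>p\<in>mcarrier M. \<forall>v\<in>tangent_space M p. \<forall>w\<in>tangent_space M p. \<forall>c.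
        \<eta> p (\<lambda>f. v f + w f) = \<eta> p v + \<eta> p w \<and> \<eta> p (\<lambda>f. c * v f) = c * \<eta> p v) \<and>
     (\<forall>X\<in>vector_fields M. (\<lambda>p. \<eta> p (X p)) \<in> smooth_functions M)"

definition riemannian_metric :: "('a, 'e::euclidean_space) manifold \<Rightarrow> 'a form2 \<Rightarrow> bool" where
  "riemannian_metric M g \<longleftrightarrow>
     (\<forall>p\<in>mcarrier M.
        (\<forall>u\<in>tangent_space M p. \<forall>v\<in>tangent_space M p. \<forall>w\<in>tangent_space M p. \<forall>c.
           g p (\<lambda>f. u f + v f) w = g p u w + g p v w \<and>
           g p (\<lambda>f. c * u f) w = c * g p u w) \<and>
        (\<forall>v\<in>tangent_space M p. \<forall>w\<in>tangent_space M p. g p v w = g p w v) \<and>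
        (\<forall>v\<in>tangent_space M p. v \<noteq> (\<lambda>f. 0) \<longrightarrow> g p v v > 0)) \<and>
     (\<forall>X\<in>vector_fields M. \<forall>Y\<in>vector_fields M. (\<lambda>p. g p (X p) (Y p)) \<in> smooth_functions M)"

definition riemannian_manifold :: "('a, 'e::euclidean_space) manifold \<Rightarrow> 'a form2 \<Rightarrow> bool" where
  "riemannian_manifold M g \<longleftrightarrow> smooth_manifold M \<and> riemannian_metric M g"

definition lie_derivative2 :: "'a vfield \<Rightarrow> 'a form2 \<Rightarrow> 'a vfield \<Rightarrow> 'a vfield \<Rightarrow> 'a \<Rightarrow> real" where
  "lie_derivative2 V g X Y p =
     V p (\<lambda>q. g q (X q) (Y q)) - g p (lie_bracket V X p) (Y p) - g p (X p) (lie_bracket V Y p)"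


section \<open>Levi-Civita connection and scalar curvature\<close>

type_synonym 'a connection = "'a vfield \<Rightarrow> 'a vfield \<Rightarrow> 'a vfield"

definition affine_connection :: "('a, 'e::euclidean_space) manifold \<Rightarrow> 'a connection \<Rightarrow> bool" where
  "affine_connection M D \<longleftrightarrow>
     (\<forall>X\<in>vector_fields M. \<forall>Y\<in>vector_fields M. \<forall>Z\<in>vector_fields M. \<forall>h\<in>smooth_functions M.
        D X Y \<in> vector_fields M \<and>
        (\<forall>p\<in>mcarrier M.
           D (\<lambda>q f. X q f + Y q f) Z p = (\<lambda>f. D X Z p f + D Y Z p f) \<and>
           D (\<lambda>q f. h q * X q f) Y p = (\<lambda>f. h p * D X Y p f) \<and>
           D X (\<lambda>q f. Y q f + Z q f) p = (\<lambda>f. D X Y p f + D X Z p f) \<and>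
           D X (\<lambda>q f. h q * Y q f) p = (\<lambda>f. X p h * Y p f + h p * D X Y p f)))"

definition is_levi_civita ::
    "('a, 'e::euclidean_space) manifold \<Rightarrow> 'a form2 \<Rightarrow> 'a connection \<Rightarrow> bool" where
  "is_levi_civita M g D \<longleftrightarrow>
     affine_connection M D \<and>
     (\<forall>X\<in>vector_fields M. \<forall>Y\<in>vector_fields M. \<forall>p\<in>mcarrier M.
        (\<lambda>f. D X Y p f - D Y X p f) = lie_bracket X Y p) \<and>
     (\<forall>X\<in>vector_fields M. \<forall>Y\<in>vector_fields M. \<forall>Z\<in>vector_fields M. \<forall>p\<in>mcarrier M.
        X p (\<lambda>q. g q (Y q) (Z q)) = g p (D X Y p) (Z p) + g p (Y p) (D X Z p))"

text \<open>
  The Levi-Civita connection is unique only on vector fields of \<open>M\<close> and at points of \<open>M\<close>, hence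
  \<open>SOME\<close> and not \<open>THE\<close>; nothing below depends on the choice.
\<close>

definition levi_civita ::
    "('a, 'e::euclidean_space) manifold \<Rightarrow> 'a form2 \<Rightarrow> 'a connection" where
  "levi_civita M g = (SOME D. is_levi_civita M g D)"

definition curvature ::
    "('a, 'e::euclidean_space) manifold \<Rightarrow> 'a form2 \<Rightarrow>
     'a vfield \<Rightarrow> 'a vfield \<Rightarrow> 'a vfield \<Rightarrow> 'a vfield" where
  "curvature M g X Y Z =
     (let D = levi_civita M g
      in (\<lambda>p f. D X (D Y Z) p f - D Y (D X Z) p f - D (lie_bracket X Y) Z p f))"

definition orthonormal_at ::
    "('a, 'e::euclidean_space) manifold \<Rightarrow> 'a form2 \<Rightarrow> 'a \<Rightarrow> ('e \<Rightarrow> 'a vfield) \<Rightarrow> bool" where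
  "orthonormal_at M g p E \<longleftrightarrow>
     (\<forall>b\<in>mcoords M. E b \<in> vector_fields M) \<and>
     (\<forall>b\<in>mcoords M. \<forall>c\<in>mcoords M. g p (E b p) (E c p) = (if b = c then 1 else 0))"

text \<open>
  Since \<open>Ric(Y, Z)\<close> is the trace of \<open>X \<mapsto> R(X, Y)Z\<close>, its metric trace is
  \<open>\<Sum>\<^sub>c \<Sum>\<^sub>b g(R(E\<^sub>b, E\<^sub>c)E\<^sub>c, E\<^sub>b)\<close> for every orthonormal frame at \<open>p\<close>.
\<close>

definition ricci_frame ::
    "('a, 'e::euclidean_space) manifold \<Rightarrow> 'a form2 \<Rightarrow> ('e \<Rightarrow> 'a vfield) \<Rightarrow>
     'a vfield \<Rightarrow> 'a vfield \<Rightarrow> 'a \<Rightarrow> real" where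
  "ricci_frame M g E Y Z p = (\<Sum>b\<in>mcoords M. g p (curvature M g (E b) Y Z p) (E b p))"

definition scalar_curvature ::
    "('a, 'e::euclidean_space) manifold \<Rightarrow> 'a form2 \<Rightarrow> 'a \<Rightarrow> real" where
  "scalar_curvature M g p =
     (THE r. \<exists>E. orthonormal_at M g p E \<and> r = (\<Sum>c\<in>mcoords M. ricci_frame M g E (E c) (E c) p))"


section \<open>\<open>\<eta>\<close>-Yamabe solitons\<close>

definition eta_yamabe_soliton ::
    "('a, 'e::euclidean_space) manifold \<Rightarrow> 'a form2 \<Rightarrow> 'a vfield \<Rightarrow> 'a form1 \<Rightarrow> real \<Rightarrow> real \<Rightarrow> bool" where
  "eta_yamabe_soliton M g V \<eta> lam mu \<longleftrightarrow>
     riemannian_manifold M g \<and> V \<in> vector_fields M \<and> one_form M \<eta> \<and>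
     (\<forall>X\<in>vector_fields M. \<forall>Y\<in>vector_fields M. \<forall>p\<in>mcarrier M.
        lie_derivative2 V g X Y p
        + (2 * lam - scalar_curvature M g p) * g p (X p) (Y p)
        + 2 * mu * (\<eta> p (X p) * \<eta> p (Y p)) = 0)"


section \<open>Riemannian submersions\<close>

definition vertical_space ::
    "('a, 'e::euclidean_space) manifold \<Rightarrow> ('b, 'f::euclidean_space) manifold \<Rightarrow> ('a \<Rightarrow> 'b) \<Rightarrow>
     'a \<Rightarrow> 'a tvec set" where
  "vertical_space M N \<pi> p = {v \<in> tangent_space M p. differential M N \<pi> v = (\<lambda>h. 0)}"

definition horizontal_space ::
    "('a, 'e::euclidean_space) manifold \<Rightarrow> 'a form2 \<Rightarrow> ('b, 'f::euclidean_space) manifold \<Rightarrow>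
     ('a \<Rightarrow> 'b) \<Rightarrow> 'a \<Rightarrow> 'a tvec set" where
  "horizontal_space M g N \<pi> p =
     {v \<in> tangent_space M p. \<forall>w\<in>vertical_space M N \<pi> p. g p v w = 0}"

text \<open>
  That \<open>\<pi>\<close> has rank \<open>mdim N\<close> at \<open>p\<close> is expressed by surjectivity of the differential onto the
  tangent space of \<open>N\<close>, which has dimension \<open>mdim N\<close>.
\<close>

definition riemannian_submersion ::
    "('a, 'e::euclidean_space) manifold \<Rightarrow> 'a form2 \<Rightarrow>
     ('b, 'f::euclidean_space) manifold \<Rightarrow> 'b form2 \<Rightarrow> ('a \<Rightarrow> 'b) \<Rightarrow> bool" where
  "riemannian_submersion M g N gN \<pi> \<longleftrightarrow>
     riemannian_manifold M g \<and> riemannian_manifold N gN \<and> mdim N < mdim M \<and>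
     smooth_map M N \<pi> \<and> \<pi> ` mcarrier M = mcarrier N \<and>
     (\<forall>p\<in>mcarrier M.
        differential M N \<pi> ` tangent_space M p = tangent_space N (\<pi> p) \<and>
        (\<forall>v\<in>horizontal_space M g N \<pi> p.
           gN (\<pi> p) (differential M N \<pi> v) (differential M N \<pi> v) = g p v v))"

definition vertical_fields ::
    "('a, 'e::euclidean_space) manifold \<Rightarrow> ('b, 'f::euclidean_space) manifold \<Rightarrow> ('a \<Rightarrow> 'b) \<Rightarrow>
     'a vfield set" where
  "vertical_fields M N \<pi> = {X \<in> vector_fields M. \<forall>p\<in>mcarrier M. X p \<in> vertical_space M N \<pi> p}"

definition vertical_parallel ::
    "('a, 'e::euclidean_space) manifold \<Rightarrow> 'a form2 \<Rightarrow> ('b, 'f::euclidean_space) manifold \<Rightarrow>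
     ('a \<Rightarrow> 'b) \<Rightarrow> bool" where
  "vertical_parallel M g N \<pi> \<longleftrightarrow>
     (\<forall>E\<in>vector_fields M. \<forall>F\<in>vertical_fields M N \<pi>. levi_civita M g E F \<in> vertical_fields M N \<pi>)"


section \<open>Restriction to a submanifold\<close>

definition fiber :: "('a, 'e) manifold \<Rightarrow> ('a \<Rightarrow> 'b) \<Rightarrow> 'b \<Rightarrow> 'a set" where
  "fiber M \<pi> q = {p \<in> mcarrier M. \<pi> p = q}"

text \<open>
  In the following \<open>S\<close> is a submanifold of \<open>M\<close>, with the identity as inclusion map.  The
  restriction of a field \<open>V\<close> tangent to \<open>S\<close> is the field on \<open>S\<close> which the inclusion sends to \<open>V\<close>.
\<close>

abbreviation incl ::
    "('a, 'e::euclidean_space) manifold \<Rightarrow> ('a, 'e) manifold \<Rightarrow> 'a tvec \<Rightarrow> 'a tvec" where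
  "incl S M \<equiv> differential S M (\<lambda>x. x)"

definition induced_metric ::
    "('a, 'e::euclidean_space) manifold \<Rightarrow> ('a, 'e) manifold \<Rightarrow> 'a form2 \<Rightarrow> 'a form2" where
  "induced_metric S M g = (\<lambda>p v w. g p (incl S M v) (incl S M w))"

definition restrict_form ::
    "('a, 'e::euclidean_space) manifold \<Rightarrow> ('a, 'e) manifold \<Rightarrow> 'a form1 \<Rightarrow> 'a form1" where
  "restrict_form S M \<eta> = (\<lambda>p v. \<eta> p (incl S M v))"

definition restrict_field ::
    "('a, 'e::euclidean_space) manifold \<Rightarrow> ('a, 'e) manifold \<Rightarrow> 'a vfield \<Rightarrow> 'a vfield" where
  "restrict_field S M V = (\<lambda>p. THE v. v \<in> tangent_space S p \<and> incl S M v = V p)"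

end

theory Submission
  imports Defs
begin

text \<open>
  If the vertical distribution is parallel, then so is the horizontal one, and mixed curvature terms
  vanish.  Hence the restriction of vertical fields to a fiber and the horizontal lift of fields on
  \<open>N\<close> both respect Levi-Civita connections and curvature, and along the fiber over \<open>q\<close> the scalar
  curvature of \<open>M\<close> is that of the fiber plus the constant \<open>R\<^sub>N(q)\<close>.  Evaluating the soliton equation
  on vertical fields gives the soliton equation of the fiber with \<open>\<lambda> - R\<^sub>N(q)/2\<close> and the same \<open>\<mu>\<close>.
\<close>

subsection \<open>Calculus in coordinate subspaces\<close>

text \<open>Around a short geometric core the proof has to build the theory it lives in, and three
  features of the definitions dictate how. Tangent vectors are derivations of the globally defined
  smooth functions, so every local object (coordinate, frame, coefficient) is replaced by a global
  one with the same germ, by means of bump functions. \<open>levi_civita\<close> is a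
  \<open>SOME\<close> and \<open>scalar_curvature\<close> a \<open>THE\<close>, so the existence of
  the connection (Koszul formula plus Riesz representation) and the independence of the trace from
  the frame (tensoriality) come before any statement about either. A fiber carries the atlas of
  slice charts, and that these cover it rests on a smooth inverse function theorem inside
  \<open>span B\<close>. The Koszul formula involves only the metric and brackets, hence it is
  carried over by every map that matches two parallel distributions isometrically. The projection
  (horizontal vectors against all tangent vectors of \<open>N\<close>) and the inclusion of a fiber
  (all its tangent vectors against vertical ones) are two instances of this one situation, so
  connection and curvature are compared only once.\<close>

lemma Ck_on_continuous: "Ck_on k B W f \<Longrightarrow> continuous_on W f"
  by (cases k) auto

lemma Ck_on_Suc_imp: "Ck_on (Suc k) B W f \<Longrightarrow> Ck_on k B W f"
  by (induction k arbitrary: f) auto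

lemma Ck_on_mono: "Ck_on k B W f \<Longrightarrow> W' \<subseteq> W \<Longrightarrow> B' \<subseteq> B \<Longrightarrow> Ck_on k B' W' f"
  by (induction k arbitrary: f) (force intro: continuous_on_subset)+

text \<open>A subset of \<open>Basis\<close> is orthonormal, so its inner products are the
  coordinates. The calculus below sees vectors of \<open>span B\<close> only through these
  coordinates.\<close>

lemma span_lincomb:
  assumes "B \<subseteq> Basis" "v \<in> span B"
  shows "(\<Sum>b\<in>B. (v \<bullet> b) *\<^sub>R b) = (v::'e::euclidean_space)"
proof -
  have fin: "finite B"
    using assms(1) finite_Basis finite_subset by blast
  show ?thesis
    using assms(2)
  proof (induction rule: span_induct_alt)
    case base
    then show ?case by simp
  next
    case (step c x y)
    have "(\<Sum>b\<in>B. (x \<bullet> b) *\<^sub>R b) = (\<Sum>b\<in>B. (if b = x then 1 else 0) *\<^sub>R b)"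
      using assms(1) step(1) by (intro sum.cong) (auto simp: inner_Basis subset_iff)
    also have "\<dots> = (\<Sum>b\<in>B. if b = x then b else 0)"
      by (rule sum.cong) auto
    also have "\<dots> = x"
      using step(1) fin by simp
    finally show ?case
      using step by (simp add: inner_add_left scaleR_add_left sum.distrib
          flip: scaleR_scaleR scaleR_sum_right)
  qed
qed

text \<open>\<open>W\<close> is open only relative to \<open>span B\<close>, but moving in a
  direction of \<open>B\<close> does not leave \<open>span B\<close>. Hence partial derivatives at a
  point of \<open>W\<close> depend only on values on \<open>W\<close>.\<close>

lemma eventually_line_in:
  fixes B :: "'e::euclidean_space set"
  assumes "openin (top_of_set (span B)) W" "x \<in> W" "b \<in> B"
  shows "\<forall>\<^sub>F t in nhds 0. x + t *\<^sub>R b \<in> W"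
proof -
  obtain T where T: "open T" "W = span B \<inter> T"
    using assms(1) by (auto simp: openin_open)
  have "open ((\<lambda>t. x + t *\<^sub>R b) -` T)"
    by (intro open_vimage T(1)) (intro continuous_intros)
  then have "\<forall>\<^sub>F t in nhds 0. x + t *\<^sub>R b \<in> T"
    unfolding eventually_nhds using T assms(2) by (intro exI[of _ "(\<lambda>t. x + t *\<^sub>R b) -` T"]) auto
  moreover have "x + t *\<^sub>R b \<in> span B" for t
    using T assms(2,3) by (auto intro: span_add span_scale span_base)
  ultimately show ?thesis
    using T(2) by simp
qed

lemma Ck_on_SucD:
  assumes "Ck_on (Suc k) B W f" "b \<in> B"
  shows "x \<in> W \<Longrightarrow> ((\<lambda>t. f (x + t *\<^sub>R b)) has_real_derivative partial_deriv b f x) (at 0)"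
    and "Ck_on k B W (partial_deriv b f)"
  using assms by (auto simp: partial_deriv_def DERIV_deriv_iff_real_differentiable)

context
  fixes B W :: "'e::euclidean_space set"
  assumes W: "openin (top_of_set (span B)) W"
begin

lemma partial_cong:
  assumes "\<And>x. x \<in> W \<Longrightarrow> f x = h x" "x \<in> W" "b \<in> B"
  shows "partial_deriv b f x = partial_deriv b h x"
    and "((\<lambda>t. f (x + t *\<^sub>R b)) has_real_derivative D) (at 0) \<longleftrightarrow>
         ((\<lambda>t. h (x + t *\<^sub>R b)) has_real_derivative D) (at 0)"
proof -
  have ev: "\<forall>\<^sub>F t in nhds 0. f (x + t *\<^sub>R b) = h (x + t *\<^sub>R b)"
    using eventually_line_in[OF W assms(2,3)] by eventually_elim (simp add: assms(1))
  show "partial_deriv b f x = partial_deriv b h x"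
    unfolding partial_deriv_def by (rule deriv_cong_ev[OF ev refl])
  show "((\<lambda>t. f (x + t *\<^sub>R b)) has_real_derivative D) (at 0) \<longleftrightarrow>
         ((\<lambda>t. h (x + t *\<^sub>R b)) has_real_derivative D) (at 0)"
    by (rule DERIV_cong_ev[OF refl ev refl])
qed

lemma Ck_on_cong:
  assumes "Ck_on k B W f" "\<And>x. x \<in> W \<Longrightarrow> f x = h x"
  shows "Ck_on k B W h"
  using assms
proof (induction k arbitrary: f h)
  case 0
  then show ?case by (simp cong: continuous_on_cong)
next
  case (Suc k)
  have "continuous_on W h"
    using Suc.prems(1) Suc.prems(2)
    by (metis Ck_on_continuous continuous_on_cong)
  moreover have "(\<lambda>t. h (x + t *\<^sub>R b)) differentiable at 0" if "b \<in> B" "x \<in> W" for b x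
    using Ck_on_SucD(1)[OF Suc.prems(1) that] partial_cong(2)[of f h, OF Suc.prems(2) that(2,1)]
    by (auto simp: real_differentiable_def)
  moreover have "Ck_on k B W (partial_deriv b h)" if "b \<in> B" for b
    using Suc.IH[OF Ck_on_SucD(2)[OF Suc.prems(1) that]] partial_cong(1)[of f h, OF Suc.prems(2) _ that]
    by blast
  ultimately show ?case by simp
qed

text \<open>\<open>Ck_on\<close> refers to \<open>partial_deriv\<close> itself. Here any explicit
  formula \<open>d\<close> that is the derivative on \<open>W\<close> may stand in for it; the
  closure properties below are inductions with such a formula.\<close>

lemma Ck_on_SucI:
  assumes "continuous_on W f"
    and "\<And>b x. b \<in> B \<Longrightarrow> x \<in> W \<Longrightarrow> ((\<lambda>t. f (x + t *\<^sub>R b)) has_real_derivative d b x) (at 0)"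
    and "\<And>b. b \<in> B \<Longrightarrow> Ck_on k B W (d b)"
  shows "Ck_on (Suc k) B W f"
proof -
  have "partial_deriv b f x = d b x" if "b \<in> B" "x \<in> W" for b x
    unfolding partial_deriv_def using assms(2)[OF that] by (rule DERIV_imp_deriv)
  then have "Ck_on k B W (partial_deriv b f)" if "b \<in> B" for b
    using Ck_on_cong[OF assms(3)[OF that]] that by metis
  then show ?thesis
    using assms(1,2) by (auto simp: real_differentiable_def)
qed

lemma Ck_on_const: "Ck_on k B W (\<lambda>x. c)"
proof (induction k arbitrary: c)
  case (Suc k)
  show ?case
    by (rule Ck_on_SucI[where d="\<lambda>_ _. 0"]) (auto intro: Suc)
qed auto

lemma Ck_on_inner: "Ck_on k B W (\<lambda>x. x \<bullet> c)"
proof (cases k)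
  case (Suc k)
  show ?thesis
    unfolding Suc by (rule Ck_on_SucI[where d="\<lambda>b _. b \<bullet> c"])
      (auto intro!: Ck_on_const continuous_intros derivative_eq_intros simp: inner_add_left)
qed (auto intro: continuous_intros)

lemma Ck_on_add: "Ck_on k B W f \<Longrightarrow> Ck_on k B W h \<Longrightarrow> Ck_on k B W (\<lambda>x. f x + h x)"
proof (induction k arbitrary: f h)
  case 0
  then show ?case by (auto intro: continuous_intros)
next
  case (Suc k)
  show ?case
    by (rule Ck_on_SucI[where d="\<lambda>b x. partial_deriv b f x + partial_deriv b h x"])
      (use Suc in \<open>auto intro!: continuous_intros DERIV_add Ck_on_SucD Suc.IH
          dest: Ck_on_continuous simp del: Ck_on.simps\<close>)
qed

lemma Ck_on_mult: "Ck_on k B W f \<Longrightarrow> Ck_on k B W h \<Longrightarrow> Ck_on k B W (\<lambda>x. f x * h x)"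
proof (induction k arbitrary: f h)
  case 0
  then show ?case by (auto intro: continuous_intros)
next
  case (Suc k)
  show ?case
  proof (rule Ck_on_SucI[where d="\<lambda>b x. partial_deriv b f x * h x + f x * partial_deriv b h x"])
    show "continuous_on W (\<lambda>x. f x * h x)"
      using Suc.prems by (intro continuous_intros Ck_on_continuous)
    fix b x assume b: "b \<in> B" "x \<in> W"
    show "((\<lambda>t. f (x + t *\<^sub>R b) * h (x + t *\<^sub>R b)) has_real_derivative
         partial_deriv b f x * h x + f x * partial_deriv b h x) (at 0)"
      using DERIV_mult[OF Ck_on_SucD(1)[OF Suc.prems(1) b] Ck_on_SucD(1)[OF Suc.prems(2) b]]
      by (simp add: algebra_simps)
  next
    fix b assume b: "b \<in> B"
    show "Ck_on k B W (\<lambda>x. partial_deriv b f x * h x + f x * partial_deriv b h x)"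
      using Suc.prems b by (intro Ck_on_add Suc.IH Ck_on_SucD(2)) (auto dest: Ck_on_Suc_imp simp del: Ck_on.simps)
  qed
qed

lemma Ck_on_sum:
  "(\<And>i. i \<in> I \<Longrightarrow> Ck_on k B W (f i)) \<Longrightarrow> Ck_on k B W (\<lambda>x. \<Sum>i\<in>I. f i x)"
  by (induction I rule: infinite_finite_induct) (auto intro: Ck_on_const Ck_on_add)

text \<open>With w = f^(-1/2) the derivative is -f' w^3 / 2, a polynomial in f' and w, so the
  induction closes. This is used to normalize vectors, and the square of w supplies a
  reciprocal.\<close>

lemma Ck_on_inverse_sqrt:
  "Ck_on k B W f \<Longrightarrow> (\<And>x. x \<in> W \<Longrightarrow> f x > 0) \<Longrightarrow> Ck_on k B W (\<lambda>x. 1 / sqrt (f x))"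
proof (induction k)
  case 0
  then show ?case by (auto intro!: continuous_intros simp: less_imp_neq[symmetric])
next
  case (Suc k)
  let ?w = "\<lambda>x. 1 / sqrt (f x)"
  have w: "Ck_on k B W ?w"
    using Suc by (auto dest: Ck_on_Suc_imp simp del: Ck_on.simps)
  show ?case
  proof (rule Ck_on_SucI[where d="\<lambda>b x. (-1/2) * partial_deriv b f x * (?w x * ?w x * ?w x)"])
    show "continuous_on W ?w"
      using w by (rule Ck_on_continuous)
    fix b x assume b: "b \<in> B" "x \<in> W"
    have "((\<lambda>t. sqrt (f (x + t *\<^sub>R b))) has_real_derivative
        inverse (sqrt (f x)) / 2 * partial_deriv b f x) (at 0)"
      using DERIV_chain2[OF DERIV_real_sqrt, where g="\<lambda>t. f (x + t *\<^sub>R b)" and x=0]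
        Ck_on_SucD(1)[OF Suc.prems(1) b] Suc.prems(2)[OF b(2)] by simp
    from DERIV_inverse_fun[OF this]
    show "((\<lambda>t. 1 / sqrt (f (x + t *\<^sub>R b))) has_real_derivative
         (-1/2) * partial_deriv b f x * (?w x * ?w x * ?w x)) (at 0)"
      using Suc.prems(2)[OF b(2)]
      by (simp add: inverse_eq_divide field_simps power2_eq_square)
  next
    fix b assume b: "b \<in> B"
    show "Ck_on k B W (\<lambda>x. (-1/2) * partial_deriv b f x * (?w x * ?w x * ?w x))"
      using b Suc.prems by (intro Ck_on_mult w Ck_on_const Ck_on_SucD(2))
  qed
qed

end

text \<open>Each clause of \<open>Ck_on\<close> concerns a point and its surroundings in
  \<open>span B\<close>. This reduces smoothness on a whole chart image to smoothness near each of
  its points.\<close>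

lemma Ck_on_locally:
  fixes B :: "'e::euclidean_space set"
  assumes "V \<subseteq> span B"
    and "\<And>x. x \<in> V \<Longrightarrow> \<exists>V'. openin (top_of_set (span B)) V' \<and> x \<in> V' \<and> Ck_on k B V' f"
  shows "Ck_on k B V f"
  using assms
proof (induction k arbitrary: f)
  case 0
  show ?case
    unfolding Ck_on.simps continuous_on_eq_continuous_within
  proof
    fix x assume x: "x \<in> V"
    obtain V' where V': "openin (top_of_set (span B)) V'" "x \<in> V'" "continuous_on V' f"
      using 0(2)[OF x] unfolding Ck_on.simps by blast
    obtain T where T: "open T" "V' = span B \<inter> T"
      using V'(1) unfolding openin_open by blast
    have "continuous (at x within span B \<inter> T) f"
      using V'(2,3) unfolding T(2) continuous_on_eq_continuous_within by blast
    then have "continuous (at x within span B) f"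
    proof -
      have "at x within span B \<inter> T = at x within span B"
      proof (rule at_within_nhd[OF _ T(1)])
        show "x \<in> T"
          using V'(2) T(2) by simp
      qed auto
      with \<open>continuous (at x within span B \<inter> T) f\<close> show ?thesis
        by simp
    qed
    then show "continuous (at x within V) f"
      using 0(1) by (rule continuous_within_subset)
  qed
next
  case (Suc k)
  have "Ck_on k B V f"
  proof (rule Suc.IH[OF Suc.prems(1)])
    fix x assume "x \<in> V"
    then show "\<exists>V'. openin (top_of_set (span B)) V' \<and> x \<in> V' \<and> Ck_on k B V' f"
      using Suc.prems(2)[of x] Ck_on_Suc_imp[of k B _ f] by metis
  qed
  moreover have "(\<lambda>t. f (x + t *\<^sub>R b)) differentiable at 0" if "b \<in> B" "x \<in> V" for b x
    using Suc.prems(2)[OF that(2)] that(1) unfolding Ck_on.simps by blast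
  moreover have "Ck_on k B V (partial_deriv b f)" if "b \<in> B" for b
  proof (rule Suc.IH[OF Suc.prems(1)])
    fix x assume "x \<in> V"
    then show "\<exists>V'. openin (top_of_set (span B)) V' \<and> x \<in> V' \<and> Ck_on k B V' (partial_deriv b f)"
      using Suc.prems(2)[of x] that unfolding Ck_on.simps by blast
  qed
  moreover have "continuous_on V f"
    using \<open>Ck_on k B V f\<close> by (rule Ck_on_continuous)
  ultimately show ?case
    unfolding Ck_on.simps by blast
qed

text \<open>Continuity of the partial derivatives yields a Frechet derivative: the increment is made
  one coordinate at a time, and each step is controlled by the mean value inequality for f minus its
  linear part in that coordinate.\<close>

lemma Ck_on_has_derivative:
  fixes B :: "'e::euclidean_space set"
  assumes B: "B \<subseteq> Basis" and W: "openin (top_of_set (span B)) W"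
    and f: "Ck_on (Suc k) B W f" and x: "x \<in> W"
  shows "(f has_derivative (\<lambda>h. \<Sum>b\<in>B. (h \<bullet> b) * partial_deriv b f x)) (at x within W)"
  unfolding has_derivative_within_alt
proof (intro conjI allI impI)
  have fin: "finite B"
    using B finite_Basis finite_subset by blast
  show "bounded_linear (\<lambda>h. \<Sum>b\<in>B. (h \<bullet> b) * partial_deriv b f x)"
    by (intro bounded_linear_sum bounded_linear_mult_const bounded_linear_inner_left)
  fix e :: real assume e: "e > 0"
  \<comment> \<open>Each of the \<open>card B\<close> coordinates may contribute an error of
    \<open>e'\<close> times the norm of the increment. The \<open>+ 1\<close> covers
    \<open>B = {}\<close>; it returns in the final radius, because the coordinate sizes add up to at
    most \<open>card B\<close> times the norm.\<close>
  define e' where "e' = e / (real (card B) + 1)"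
  have e': "e' > 0" "e' * real (card B) \<le> e"
    using e by (auto simp: e'_def field_simps)
  have "\<exists>\<delta>>0. \<forall>y\<in>W. dist y x < \<delta> \<longrightarrow> \<bar>partial_deriv b f y - partial_deriv b f x\<bar> < e'" if "b \<in> B" for b
    using Ck_on_continuous[OF Ck_on_SucD(2)[OF f that]] x e'(1)
    by (auto simp: continuous_on_iff dist_real_def)
  then obtain \<delta>' where \<delta>': "\<And>b. b \<in> B \<Longrightarrow> \<delta>' b > 0"
    "\<And>b y. b \<in> B \<Longrightarrow> y \<in> W \<Longrightarrow> dist y x < \<delta>' b \<Longrightarrow> \<bar>partial_deriv b f y - partial_deriv b f x\<bar> < e'"
    by metis
  obtain \<delta>0 where \<delta>0: "\<delta>0 > 0" "ball x \<delta>0 \<inter> span B \<subseteq> W"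
    using W x by (metis openin_contains_ball)
  define \<delta> where "\<delta> = Min (insert \<delta>0 (\<delta>' ` B))"
  have \<delta>: "\<delta> > 0" "\<delta> \<le> \<delta>0" "\<And>b. b \<in> B \<Longrightarrow> \<delta> \<le> \<delta>' b"
    using fin \<delta>' \<delta>0 by (auto simp: \<delta>_def)
  have xB: "x \<in> span B"
    using openin_subset[OF W] x by auto
  have inW: "y \<in> W" if "y \<in> span B" "norm (y - x) < \<delta>" for y
    using \<delta>0(2) \<delta>(2) that by (auto simp: dist_norm norm_minus_commute)
  \<comment> \<open>\<open>A\<close> is the set of coordinates still to be changed and y the current
    corner of the path. The bound on the sum of the steps keeps every corner within \<delta> of x,
    hence in \<open>W\<close>.\<close>
  have part: "\<bar>f (y + (\<Sum>b\<in>A. c b *\<^sub>R b)) - f y - (\<Sum>b\<in>A. c b * partial_deriv b f x)\<bar> \<le> e' * (\<Sum>b\<in>A. \<bar>c b\<bar>)"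
    if "A \<subseteq> B" "y \<in> span B" "norm (y - x) + (\<Sum>b\<in>A. \<bar>c b\<bar>) < \<delta>" for A y c
    using finite_subset[OF that(1) fin] that
  proof (induction A arbitrary: y rule: finite_induct)
    case empty
    then show ?case by simp
  next
    case (insert b A)
    let ?y = "y + c b *\<^sub>R b"
    have b: "b \<in> B" and nb: "norm b = 1"
      using insert.prems B by auto
    have yB: "y + t *\<^sub>R b \<in> span B" for t
      using insert.prems(2) b by (auto intro: span_add span_scale span_base)
    have near: "norm (y + t *\<^sub>R b - x) \<le> norm (y - x) + \<bar>t\<bar>" for t
      using norm_triangle_ineq[of "y - x" "t *\<^sub>R b"] nb by (simp add: algebra_simps)
    have "norm (?y - x) + (\<Sum>b\<in>A. \<bar>c b\<bar>) < \<delta>"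
      using near[of "c b"] insert.prems(3) insert.hyps by simp
    from insert.IH[OF _ yB this] insert.prems(1)
    have 1: "\<bar>f (?y + (\<Sum>b\<in>A. c b *\<^sub>R b)) - f ?y - (\<Sum>b\<in>A. c b * partial_deriv b f x)\<bar> \<le> e' * (\<Sum>b\<in>A. \<bar>c b\<bar>)"
      by simp
    have cb: "norm (y - x) + \<bar>c b\<bar> < \<delta>"
    proof -
      have "(\<Sum>b\<in>A. \<bar>c b\<bar>) \<ge> 0"
        by (rule sum_nonneg) simp
      then have "\<bar>c b\<bar> \<le> (\<Sum>b\<in>insert b A. \<bar>c b\<bar>)"
        using insert.hyps by simp
      then have "norm (y - x) + \<bar>c b\<bar> \<le> norm (y - x) + (\<Sum>b\<in>insert b A. \<bar>c b\<bar>)"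
        by (rule add_left_mono)
      then show ?thesis
        using insert.prems(3) by (rule le_less_trans)
    qed
    let ?S = "{- \<bar>c b\<bar>..\<bar>c b\<bar>}"
    let ?p = "\<lambda>t. f (y + t *\<^sub>R b) - t * partial_deriv b f x"
    have nearS: "norm (y + t *\<^sub>R b - x) < \<delta>" if "t \<in> ?S" for t
      using near[of t] cb that by auto
    have der: "(?p has_real_derivative (partial_deriv b f (y + t *\<^sub>R b) - partial_deriv b f x)) (at t within ?S)"
      if "t \<in> ?S" for t
    proof -
      have "((\<lambda>s. f ((y + t *\<^sub>R b) + s *\<^sub>R b)) has_real_derivative partial_deriv b f (y + t *\<^sub>R b)) (at 0)"
        using Ck_on_SucD(1)[OF f b inW[OF yB nearS[OF that]]] .
      then have "((\<lambda>s. f (y + (s + t) *\<^sub>R b)) has_real_derivative partial_deriv b f (y + t *\<^sub>R b)) (at 0)"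
        by (simp add: algebra_simps)
      then have "((\<lambda>s. f (y + s *\<^sub>R b)) has_real_derivative partial_deriv b f (y + t *\<^sub>R b)) (at t)"
        using DERIV_shift[of "\<lambda>s. f (y + s *\<^sub>R b)" _ 0 t] by (simp add: add.commute)
      then show ?thesis
        by (rule DERIV_subset[OF DERIV_diff]) (auto intro!: derivative_eq_intros)
    qed
    have bd: "norm (partial_deriv b f (y + t *\<^sub>R b) - partial_deriv b f x) \<le> e'" if "t \<in> ?S" for t
      using \<delta>'(2)[OF b inW[OF yB nearS[OF that]]] \<delta>(3)[OF b] nearS[OF that]
      by (simp add: dist_norm)
    have "norm (?p (c b) - ?p 0) \<le> e' * norm (c b - 0)"
      by (rule field_differentiable_bound[OF _ der bd]) auto
    then have 2: "\<bar>f ?y - f y - c b * partial_deriv b f x\<bar> \<le> e' * \<bar>c b\<bar>"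
      by (simp add: algebra_simps)
    have "y + (\<Sum>b\<in>insert b A. c b *\<^sub>R b) = ?y + (\<Sum>b\<in>A. c b *\<^sub>R b)"
      using insert.hyps by (simp add: algebra_simps)
    then show ?case
      using 1 2 insert.hyps by (simp add: algebra_simps abs_le_iff)
  qed
  show "\<exists>d>0. \<forall>y\<in>W. norm (y - x) < d \<longrightarrow>
      norm (f y - f x - (\<Sum>b\<in>B. (y - x) \<bullet> b * partial_deriv b f x)) \<le> e * norm (y - x)"
  proof (intro exI[of _ "\<delta> / (real (card B) + 1)"] conjI ballI impI)
    show "\<delta> / (real (card B) + 1) > 0"
      using \<delta>(1) by simp
    fix y assume y: "y \<in> W" "norm (y - x) < \<delta> / (real (card B) + 1)"
    have sum_le: "(\<Sum>b\<in>B. \<bar>(y - x) \<bullet> b\<bar>) \<le> real (card B) * norm (y - x)"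
      using B by (intro sum_bounded_above) (auto intro: Basis_le_norm)
    also have "\<dots> < \<delta>"
      using y(2) by (auto simp: field_simps) (smt (verit) norm_ge_zero)
    finally have "(\<Sum>b\<in>B. \<bar>(y - x) \<bullet> b\<bar>) < \<delta>" .
    then have "\<bar>f (x + (\<Sum>b\<in>B. ((y - x) \<bullet> b) *\<^sub>R b)) - f x - (\<Sum>b\<in>B. ((y - x) \<bullet> b) * partial_deriv b f x)\<bar>
        \<le> e' * (\<Sum>b\<in>B. \<bar>(y - x) \<bullet> b\<bar>)"
      using part[of B x] xB by simp
    moreover have "y \<in> span B"
      using openin_subset[OF W] y(1) by auto
    then have "(\<Sum>b\<in>B. ((y - x) \<bullet> b) *\<^sub>R b) = y - x"
      using span_lincomb[OF B] xB span_diff by blast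
    moreover have "e' * (\<Sum>b\<in>B. \<bar>(y - x) \<bullet> b\<bar>) \<le> e * norm (y - x)"
      using mult_left_mono[OF sum_le less_imp_le[OF e'(1)]] mult_right_mono[OF e'(2) norm_ge_zero[of "y - x"]]
      by (simp add: mult.assoc)
    ultimately show "norm (f y - f x - (\<Sum>b\<in>B. (y - x) \<bullet> b * partial_deriv b f x)) \<le> e * norm (y - x)"
      by simp
  qed
qed

text \<open>The derivative is taken within \<open>T\<close>, so that one rule serves both at the end
  points of \<open>{0..1}\<close> in Hadamard's lemma and on open sets of times in the chain
  rule.\<close>

lemma has_real_derivative_along_curve:
  fixes B :: "'e::euclidean_space set" and \<gamma> :: "real \<Rightarrow> 'e"
  assumes B: "B \<subseteq> Basis" and W: "openin (top_of_set (span B)) W"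
    and f: "Ck_on (Suc k) B W f"
    and \<gamma>: "(\<gamma> has_vector_derivative \<gamma>') (at t within T)" "\<And>s. s \<in> T \<Longrightarrow> \<gamma> s \<in> W" "t \<in> T"
  shows "((\<lambda>s. f (\<gamma> s)) has_real_derivative (\<Sum>b\<in>B. (\<gamma>' \<bullet> b) * partial_deriv b f (\<gamma> t))) (at t within T)"
proof -
  have "(f has_derivative (\<lambda>h. \<Sum>b\<in>B. (h \<bullet> b) * partial_deriv b f (\<gamma> t))) (at (\<gamma> t) within \<gamma> ` T)"
    using Ck_on_has_derivative[OF B W f] \<gamma>(2,3) by (meson has_derivative_subset image_subsetI)
  note has_derivative_in_compose[OF \<gamma>(1)[unfolded has_vector_derivative_def] this]
  moreover have "(\<lambda>x. \<Sum>b\<in>B. (x *\<^sub>R \<gamma>' \<bullet> b) * partial_deriv b f (\<gamma> t)) =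
      (*) (\<Sum>b\<in>B. (\<gamma>' \<bullet> b) * partial_deriv b f (\<gamma> t))"
  proof (rule ext)
    fix x :: real
    show "(\<Sum>b\<in>B. (x *\<^sub>R \<gamma>' \<bullet> b) * partial_deriv b f (\<gamma> t)) =
      (\<Sum>b\<in>B. (\<gamma>' \<bullet> b) * partial_deriv b f (\<gamma> t)) * x"
      unfolding sum_distrib_right by (rule sum.cong) auto
  qed
  ultimately show ?thesis
    unfolding has_field_derivative_def by (simp only:)
qed

text \<open>By the chain rule a partial derivative of f after H is a sum of products of partial
  derivatives of H with a partial derivative of f after H, and the induction hypothesis applies to
  the latter.\<close>

lemma Ck_on_compose:
  fixes B :: "'e::euclidean_space set" and C :: "'f::euclidean_space set"
  assumes B: "B \<subseteq> Basis" and C: "C \<subseteq> Basis" and W: "openin (top_of_set (span B)) W"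
    and W': "openin (top_of_set (span C)) W'"
    and H: "\<And>c. c \<in> C \<Longrightarrow> Ck_on k B W (\<lambda>x. H x \<bullet> c)" "\<And>x. x \<in> W \<Longrightarrow> H x \<in> W'"
    and f: "Ck_on k C W' f"
  shows "Ck_on k B W (\<lambda>x. f (H x))"
proof -
  \<comment> \<open>The hypotheses on smoothness speak of the coordinates of H, so the continuity
    and the derivative of H are obtained from its expansion in these coordinates.\<close>
  have lin: "(\<Sum>c\<in>C. (H x \<bullet> c) *\<^sub>R c) = H x" if "x \<in> W" for x
    using H(2)[OF that] openin_subset[OF W'] by (intro span_lincomb[OF C]) auto
  have cont: "continuous_on W (\<lambda>x. f (H x))"
    if "\<And>c. c \<in> C \<Longrightarrow> continuous_on W (\<lambda>x. H x \<bullet> c)" "continuous_on W' f" for f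
  proof -
    have "continuous_on W (\<lambda>x. \<Sum>c\<in>C. (H x \<bullet> c) *\<^sub>R c)"
      using that(1) by (intro continuous_on_sum continuous_on_scaleR continuous_on_const) auto
    then have "continuous_on W H"
      by (rule continuous_on_eq) (rule lin)
    then show ?thesis
      by (rule continuous_on_compose2[OF that(2)]) (use H(2) in blast)
  qed
  show ?thesis
    using f H(1)
  proof (induction k arbitrary: f)
    case 0
    then show ?case using cont by simp
  next
    case (Suc k)
    have finC: "finite C"
      using C finite_Basis finite_subset by blast
    let ?d = "\<lambda>b x. \<Sum>c\<in>C. partial_deriv b (\<lambda>x. H x \<bullet> c) x * partial_deriv c f (H x)"
    show ?case
    proof (rule Ck_on_SucI[OF W, where d="?d"])
      show "continuous_on W (\<lambda>x. f (H x))"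
        by (rule cont[OF Ck_on_continuous[OF Suc.prems(2)] Ck_on_continuous[OF Suc.prems(1)]])
      fix b assume b: "b \<in> B"
      show "Ck_on k B W (?d b)"
      proof (intro Ck_on_sum[OF W] Ck_on_mult[OF W])
        fix c assume c: "c \<in> C"
        show "Ck_on k B W (partial_deriv b (\<lambda>x. H x \<bullet> c))"
          using Ck_on_SucD(2)[OF Suc.prems(2)[OF c] b] .
        show "Ck_on k B W (\<lambda>x. partial_deriv c f (H x))"
          by (rule Suc.IH[OF Ck_on_SucD(2)[OF Suc.prems(1) c] Ck_on_Suc_imp[OF Suc.prems(2)]])
      qed
      fix x assume x: "x \<in> W"
      obtain T where T: "open T" "0 \<in> T" "\<And>t. t \<in> T \<Longrightarrow> x + t *\<^sub>R b \<in> W"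
        using eventually_line_in[OF W x b] by (auto simp: eventually_nhds)
      let ?\<gamma>' = "\<Sum>c\<in>C. partial_deriv b (\<lambda>x. H x \<bullet> c) x *\<^sub>R c"
      have "((\<lambda>t. \<Sum>c\<in>C. (H (x + t *\<^sub>R b) \<bullet> c) *\<^sub>R c) has_vector_derivative ?\<gamma>') (at 0 within T)"
      proof (rule has_vector_derivative_sum)
        fix c assume c: "c \<in> C"
        have "((\<lambda>t. H (x + t *\<^sub>R b) \<bullet> c) has_real_derivative partial_deriv b (\<lambda>x. H x \<bullet> c) x) (at 0 within T)"
          using Ck_on_SucD(1)[OF Suc.prems(2)[OF c] b x] by (rule DERIV_subset) simp
        then show "((\<lambda>t. (H (x + t *\<^sub>R b) \<bullet> c) *\<^sub>R c) has_vector_derivative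
             partial_deriv b (\<lambda>x. H x \<bullet> c) x *\<^sub>R c) (at 0 within T)"
          using has_vector_derivative_scaleR[OF _ has_vector_derivative_const] by fastforce
      qed
      then have \<gamma>: "((\<lambda>t. H (x + t *\<^sub>R b)) has_vector_derivative ?\<gamma>') (at 0 within T)"
        by (rule has_vector_derivative_transform[rotated 2]) (use T lin in auto)
      have "((\<lambda>s. f (H (x + s *\<^sub>R b))) has_real_derivative
          (\<Sum>c\<in>C. (?\<gamma>' \<bullet> c) * partial_deriv c f (H (x + 0 *\<^sub>R b)))) (at 0 within T)"
        by (rule has_real_derivative_along_curve[OF C W' Suc.prems(1) \<gamma>]) (use T H(2) in auto)
      moreover have "?\<gamma>' \<bullet> c = partial_deriv b (\<lambda>x. H x \<bullet> c) x" if "c \<in> C" for c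
      proof -
        have "?\<gamma>' \<bullet> c = (\<Sum>c'\<in>C. if c' = c then partial_deriv b (\<lambda>x. H x \<bullet> c) x else 0)"
          unfolding inner_sum_left using C that by (intro sum.cong) (auto simp: inner_Basis subset_iff)
        then show ?thesis
          using finC that by simp
      qed
      then have "(\<Sum>c\<in>C. (?\<gamma>' \<bullet> c) * partial_deriv c f (H (x + 0 *\<^sub>R b))) = ?d b x"
        by (intro sum.cong) simp_all
      ultimately show "((\<lambda>t. f (H (x + t *\<^sub>R b))) has_real_derivative ?d b x) (at 0)"
        using at_within_open[OF T(2,1)] by metis
    qed
  qed
qed


section \<open>Smooth functions: the same facts for all orders at once\<close>

lemma smooth_on_mono: "smooth_on B W f \<Longrightarrow> W' \<subseteq> W \<Longrightarrow> B' \<subseteq> B \<Longrightarrow> smooth_on B' W' f"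
  unfolding smooth_on_def using Ck_on_mono by blast

lemma smooth_on_continuous: "smooth_on B W f \<Longrightarrow> continuous_on W f"
  unfolding smooth_on_def using Ck_on_continuous by blast

lemma smooth_on_partial: "smooth_on B W f \<Longrightarrow> b \<in> B \<Longrightarrow> smooth_on B W (partial_deriv b f)"
  unfolding smooth_on_def using Ck_on_SucD(2) by blast

lemma smooth_on_has_partial:
  "smooth_on B W f \<Longrightarrow> b \<in> B \<Longrightarrow> x \<in> W \<Longrightarrow>
   ((\<lambda>t. f (x + t *\<^sub>R b)) has_real_derivative partial_deriv b f x) (at 0)"
  unfolding smooth_on_def using Ck_on_SucD(1) by blast

lemma smooth_on_locally:
  fixes B :: "'e::euclidean_space set"
  assumes "V \<subseteq> span B"
    and "\<And>x. x \<in> V \<Longrightarrow> \<exists>V'. openin (top_of_set (span B)) V' \<and> x \<in> V' \<and> smooth_on B V' f"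
  shows "smooth_on B V f"
  unfolding smooth_on_def
proof
  fix k
  show "Ck_on k B V f"
    using assms(2) unfolding smooth_on_def by (intro Ck_on_locally[OF assms(1)]) blast
qed

context
  fixes B W :: "'e::euclidean_space set"
  assumes W: "openin (top_of_set (span B)) W"
begin

lemma smooth_on_cong: "smooth_on B W f \<Longrightarrow> (\<And>x. x \<in> W \<Longrightarrow> f x = h x) \<Longrightarrow> smooth_on B W h"
  unfolding smooth_on_def using Ck_on_cong[OF W] by blast

lemma smooth_on_const: "smooth_on B W (\<lambda>x. c)"
  unfolding smooth_on_def using Ck_on_const[OF W] by blast

lemma smooth_on_inner: "smooth_on B W (\<lambda>x. x \<bullet> c)"
  unfolding smooth_on_def using Ck_on_inner[OF W] by blast

lemma smooth_on_add: "smooth_on B W f \<Longrightarrow> smooth_on B W h \<Longrightarrow> smooth_on B W (\<lambda>x. f x + h x)"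
  unfolding smooth_on_def using Ck_on_add[OF W] by blast

lemma smooth_on_mult: "smooth_on B W f \<Longrightarrow> smooth_on B W h \<Longrightarrow> smooth_on B W (\<lambda>x. f x * h x)"
  unfolding smooth_on_def using Ck_on_mult[OF W] by blast

lemma smooth_on_sum:
  "(\<And>i. i \<in> I \<Longrightarrow> smooth_on B W (f i)) \<Longrightarrow> smooth_on B W (\<lambda>x. \<Sum>i\<in>I. f i x)"
  unfolding smooth_on_def by (intro allI Ck_on_sum[OF W]) blast

lemma smooth_on_diff: "smooth_on B W f \<Longrightarrow> smooth_on B W h \<Longrightarrow> smooth_on B W (\<lambda>x. f x - h x)"
  using smooth_on_add[OF _ smooth_on_mult[OF smooth_on_const[of "-1"]], of f h] by simp

lemma smooth_on_inverse_sqrt: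
  "smooth_on B W f \<Longrightarrow> (\<And>x. x \<in> W \<Longrightarrow> f x > 0) \<Longrightarrow> smooth_on B W (\<lambda>x. 1 / sqrt (f x))"
  unfolding smooth_on_def using Ck_on_inverse_sqrt[OF W] by blast

lemma smooth_on_compose:
  fixes C :: "'f::euclidean_space set"
  assumes B: "B \<subseteq> Basis" and C: "C \<subseteq> Basis"
    and W': "openin (top_of_set (span C)) W'"
    and H: "\<And>c. c \<in> C \<Longrightarrow> smooth_on B W (\<lambda>x. H x \<bullet> c)" "\<And>x. x \<in> W \<Longrightarrow> H x \<in> W'"
    and f: "smooth_on C W' f"
  shows "smooth_on B W (\<lambda>x. f (H x))"
  unfolding smooth_on_def
proof
  fix k
  show "Ck_on k B W (\<lambda>x. f (H x))"
    by (rule Ck_on_compose[OF B C W W' _ H(2)]) (use H(1) f in \<open>simp_all add: smooth_on_def\<close>)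
qed

end


subsection \<open>Bump functions\<close>

text \<open>For n = 0 this is the standard flat function exp(-1/t). Differentiation produces the
  members n + 2 and n + 1, so with the factor (1/t)^n the family is closed under derivatives and its
  smoothness is a single induction on the order, for all n simultaneously.\<close>

definition flat_exp :: "nat \<Rightarrow> real \<Rightarrow> real" where
  "flat_exp n t = (if t > 0 then (1 / t) ^ n * exp (- (1 / t)) else 0)"

lemma flat_exp_tendsto_0: "flat_exp n \<midarrow>0\<rightarrow> 0"
proof (rule filterlim_split_at)
  have "\<forall>\<^sub>F t in at_left 0. flat_exp n t = 0"
    by (auto simp: eventually_at_filter flat_exp_def)
  then show "(flat_exp n \<longlongrightarrow> 0) (at_left 0)"
    by (rule tendsto_eventually)
  have "((\<lambda>s. s ^ n / exp s) \<longlongrightarrow> (0::real)) at_top"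
    by (rule tendsto_power_div_exp_0)
  moreover have "\<forall>\<^sub>F s in at_top. s ^ n / exp s = flat_exp n (inverse s)"
    using eventually_gt_at_top[of "0::real"]
    by eventually_elim (simp add: flat_exp_def exp_minus divide_inverse)
  ultimately show "(flat_exp n \<longlongrightarrow> 0) (at_right 0)"
    unfolding filterlim_at_right_to_top by (rule Lim_transform_eventually)
qed

lemma has_real_derivative_flat_exp:
  "(flat_exp n has_real_derivative flat_exp (n + 2) x - real n * flat_exp (n + 1) x) (at x)"
proof -
  consider "x > 0" | "x < 0" | "x = 0" by linarith
  then show ?thesis
  proof cases
    case 1
    have d: "((\<lambda>t. 1 / t) has_real_derivative - (1 / x * (1 / x))) (at x)"
      using 1 by (auto intro!: derivative_eq_intros)
    have "((\<lambda>t. (1 / t) ^ n) has_real_derivative - real n * (1 / x) ^ (n + 1)) (at x)"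
    proof (cases n)
      case (Suc m)
      show ?thesis
        unfolding Suc using 1 by (intro DERIV_cong[OF DERIV_power_Suc[OF d]]) (simp add: field_simps)
    qed simp
    moreover have "((\<lambda>t. exp (- (1 / t))) has_real_derivative exp (- (1 / x)) * (1 / x * (1 / x))) (at x)"
      using DERIV_fun_exp[OF DERIV_minus[OF d]] by simp
    ultimately have "((\<lambda>t. (1 / t) ^ n * exp (- (1 / t))) has_real_derivative
        - real n * (1 / x) ^ (n + 1) * exp (- (1 / x)) + exp (- (1 / x)) * (1 / x * (1 / x)) * (1 / x) ^ n) (at x)"
      by (rule DERIV_mult)
    moreover have "- real n * (1 / x) ^ (n + 1) * exp (- (1 / x)) + exp (- (1 / x)) * (1 / x * (1 / x)) * (1 / x) ^ n
        = flat_exp (n + 2) x - real n * flat_exp (n + 1) x"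
      using 1 by (simp add: flat_exp_def algebra_simps)
    ultimately have "((\<lambda>t. (1 / t) ^ n * exp (- (1 / t))) has_real_derivative
        flat_exp (n + 2) x - real n * flat_exp (n + 1) x) (at x)"
      by simp
    then show ?thesis
      by (rule has_field_derivative_transform_within_open[where S="{0<..}"])
        (use 1 in \<open>auto simp: flat_exp_def\<close>)
  next
    case 2
    have "((\<lambda>t. 0) has_real_derivative flat_exp (n + 2) x - real n * flat_exp (n + 1) x) (at x)"
      using 2 by (simp add: flat_exp_def)
    then show ?thesis
      by (rule has_field_derivative_transform_within_open[where S="{..<0}"])
        (use 2 in \<open>auto simp: flat_exp_def\<close>)
  next
    case 3
    \<comment> \<open>Dividing by h adds one more factor 1/h, so the difference quotient at 0 is the
      next member of the family, which tends to 0. At h = 0 both sides are 0 since division by zero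
      gives 0.\<close>
    have "(\<lambda>h. (flat_exp n (0 + h) - flat_exp n 0) / h) = flat_exp (n + 1)"
      by (auto simp: flat_exp_def fun_eq_iff)
    then show ?thesis
      using 3 flat_exp_tendsto_0[of "n + 1"] by (simp add: DERIV_def flat_exp_def)
  qed
qed

lemma smooth_on_flat_exp: "smooth_on Basis UNIV (flat_exp n)"
  unfolding smooth_on_def
proof
  have W: "openin (top_of_set (span Basis)) (UNIV :: real set)"
    unfolding span_Basis by simp
  fix k
  show "Ck_on k Basis UNIV (flat_exp n)"
  proof (induction k arbitrary: n)
    case 0
    show ?case
      using DERIV_isCont[OF has_real_derivative_flat_exp[of n]]
      by (auto intro!: continuous_at_imp_continuous_on)
  next
    case (Suc k)
    show ?case
    proof (rule Ck_on_SucI[OF W])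
      show "continuous_on UNIV (flat_exp n)"
        using Suc Ck_on_continuous by blast
      fix b x :: real assume "b \<in> Basis"
      then show "((\<lambda>t. flat_exp n (x + t *\<^sub>R b)) has_real_derivative
          flat_exp (n + 2) x + (- real n) * flat_exp (n + 1) x) (at 0)"
        using has_real_derivative_flat_exp[of n x] DERIV_shift[of "flat_exp n" _ 0 x]
        by (simp add: add.commute)
    next
      show "Ck_on k Basis UNIV (\<lambda>x. flat_exp (n + 2) x + (- real n) * flat_exp (n + 1) x)"
        by (intro Ck_on_add[OF W] Ck_on_mult[OF W] Ck_on_const[OF W] Suc)
    qed
  qed
qed

text \<open>The function is u/(u + v), where u is positive exactly inside the ball of radius r and v
  exactly outside the closed ball of radius r/2; they never vanish together. The reciprocal of u + v
  is written as the square of its inverse root.\<close>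

lemma bump_function:
  fixes B :: "'e::euclidean_space set"
  assumes B: "B \<subseteq> Basis" and a: "a \<in> span B" and r: "r > 0"
  obtains \<rho> where "smooth_on B (span B) \<rho>"
    "\<And>x. x \<in> span B \<Longrightarrow> dist a x < r / 2 \<Longrightarrow> \<rho> x = 1"
    "\<And>x. x \<in> span B \<Longrightarrow> r \<le> dist a x \<Longrightarrow> \<rho> x = (0::real)"
proof -
  have W: "openin (top_of_set (span B)) (span B)"
    by simp
  let ?s = "\<lambda>x. \<Sum>b\<in>B. (x \<bullet> b - a \<bullet> b) * (x \<bullet> b - a \<bullet> b)"
  have s: "smooth_on B (span B) ?s"
    by (intro smooth_on_sum[OF W] smooth_on_mult[OF W] smooth_on_diff[OF W] smooth_on_inner[OF W]
        smooth_on_const[OF W])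
  have sd: "?s x = (dist a x)\<^sup>2" if "x \<in> span B" for x
  proof -
    have "(\<Sum>b\<in>B. ((x - a) \<bullet> b) *\<^sub>R b) \<bullet> (x - a) = ?s x"
      unfolding inner_sum_left
      by (rule sum.cong) (auto simp: inner_commute inner_diff_left inner_diff_right)
    moreover have "(dist a x)\<^sup>2 = (x - a) \<bullet> (x - a)"
      by (subst dist_commute) (simp add: dist_norm power2_norm_eq_inner)
    ultimately show ?thesis
      using span_lincomb[OF B span_diff[OF that a]] by simp
  qed
  have fe: "smooth_on B (span B) (\<lambda>x. flat_exp 0 (h x))" if "smooth_on B (span B) h" for h
  proof (rule smooth_on_compose[OF W B order_refl _ _ _ smooth_on_flat_exp])
    show "openin (top_of_set (span Basis)) (UNIV :: real set)"
      unfolding span_Basis by simp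
  qed (use that in auto)
  let ?u = "\<lambda>x. flat_exp 0 (r\<^sup>2 - ?s x)" and ?v = "\<lambda>x. flat_exp 0 (?s x - (r/2)\<^sup>2)"
  have u: "smooth_on B (span B) ?u" and v: "smooth_on B (span B) ?v"
    by (intro fe smooth_on_diff[OF W] smooth_on_const[OF W] s)+
  let ?w = "\<lambda>x. 1 / sqrt (?u x + ?v x)"
  have rr: "(r/2)\<^sup>2 < r\<^sup>2"
    using r by (intro power_strict_mono) auto
  have pos: "?u x + ?v x > 0" for x
    using rr by (auto simp: flat_exp_def add_pos_nonneg add_nonneg_pos)
  have w: "smooth_on B (span B) ?w"
    using pos by (intro smooth_on_inverse_sqrt[OF W] smooth_on_add[OF W] u v)
  show ?thesis
  proof
    show "smooth_on B (span B) (\<lambda>x. ?u x * (?w x * ?w x))"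
      by (intro smooth_on_mult[OF W] u w)
    fix x assume x: "x \<in> span B"
    {
      assume "dist a x < r / 2"
      then have "?s x < (r/2)\<^sup>2"
        unfolding sd[OF x] by (intro power_strict_mono) auto
      then have v0: "?v x = 0"
        by (simp add: flat_exp_def)
      then show "?u x * (?w x * ?w x) = 1"
        using pos[of x] unfolding v0 by simp
    }
    {
      assume "r \<le> dist a x"
      then have "r\<^sup>2 \<le> ?s x"
        unfolding sd[OF x] using r by (intro power_mono) auto
      then have "?u x = 0"
        by (simp add: flat_exp_def)
      then show "?u x * (?w x * ?w x) = 0"
        by simp
    }
  qed
qed


subsection \<open>Hadamard's lemma\<close>

text \<open>Differentiation under the integral sign. Each partial derivative of h(a + t (x - a))
  with respect to x brings out a factor t, which is why the statement carries the weight t^j through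
  the induction.\<close>

lemma Ck_on_integral_segment:
  fixes B :: "'e::euclidean_space set"
  assumes B: "B \<subseteq> Basis" and W: "openin (top_of_set (span B)) W"
    and cvx: "convex W" and a: "a \<in> W"
  shows "Ck_on k B W h \<Longrightarrow> Ck_on k B W (\<lambda>x. integral {0..1} (\<lambda>t. t ^ j * h (a + t *\<^sub>R (x - a))))"
proof (induction k arbitrary: h j)
  have seg: "a + t *\<^sub>R (x - a) \<in> W" if "x \<in> W" "t \<in> {0..1}" for x t
    using convexD_alt[OF cvx a that(1), of t] that(2) by (simp add: algebra_simps)
  have joint: "continuous_on (W \<times> {0..1}) (\<lambda>(x, t). t ^ j * h (a + t *\<^sub>R (x - a)))"
    if "continuous_on W h" for h j
  proof -
    have "continuous_on (W \<times> {0..1}) (\<lambda>p. h (a + snd p *\<^sub>R (fst p - a)))"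
      by (rule continuous_on_compose2[OF that]) (use seg in \<open>auto intro!: continuous_intros\<close>)
    then show ?thesis
      unfolding case_prod_beta by (intro continuous_intros)
  qed
  have cont: "continuous_on W (\<lambda>x. integral {0..1} (\<lambda>t. t ^ j * h (a + t *\<^sub>R (x - a))))"
    if "continuous_on W h" for h j
    using integral_continuous_on_param[of W 0 1 "\<lambda>x t. t ^ j * h (a + t *\<^sub>R (x - a))"]
      joint[OF that, of j] by simp
  {
    case 0
    then show ?case using cont by simp
  next
    case (Suc k)
    show ?case
    proof (rule Ck_on_SucI[OF W])
      show "continuous_on W (\<lambda>x. integral {0..1} (\<lambda>t. t ^ j * h (a + t *\<^sub>R (x - a))))"
        using cont[OF Ck_on_continuous[OF Suc.prems]] .
      fix b assume b: "b \<in> B"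
      have pd: "Ck_on k B W (partial_deriv b h)"
        using Ck_on_SucD(2)[OF Suc.prems b] .
      show "Ck_on k B W (\<lambda>x. integral {0..1} (\<lambda>t. t ^ Suc j * partial_deriv b h (a + t *\<^sub>R (x - a))))"
        using Suc.IH[OF pd] .
      fix x assume x: "x \<in> W"
      \<comment> \<open>The Leibniz rule asks for a convex set of parameters: convexity of
        \<open>W\<close> makes \<open>U\<close> convex, and openness of \<open>W\<close> makes 0 an
        interior point, so that the derivative within \<open>U\<close> is the ordinary one.\<close>
      define U where "U = {s. x + s *\<^sub>R b \<in> W}"
      have U0: "0 \<in> U"
        using x by (simp add: U_def)
      have "convex U"
      proof (rule convexI)
        fix s s' u v :: real assume *: "s \<in> U" "s' \<in> U" "0 \<le> u" "0 \<le> v" "u + v = 1"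
        have "u *\<^sub>R (x + s *\<^sub>R b) + v *\<^sub>R (x + s' *\<^sub>R b) \<in> W"
          using * cvx by (auto simp: U_def intro: convexD)
        moreover have "u *\<^sub>R (x + s *\<^sub>R b) + v *\<^sub>R (x + s' *\<^sub>R b) =
            (u + v) *\<^sub>R x + (u * s + v * s') *\<^sub>R b"
          by (simp add: algebra_simps)
        ultimately show "u *\<^sub>R s + v *\<^sub>R s' \<in> U"
          using * by (simp add: U_def)
      qed
      have der: "((\<lambda>s. t ^ j * h (a + t *\<^sub>R (x + s *\<^sub>R b - a))) has_field_derivative
          t ^ Suc j * partial_deriv b h (a + t *\<^sub>R (x + s *\<^sub>R b - a))) (at s within U)"
        if "s \<in> U" "t \<in> cbox 0 1" for s t
      proof -
        let ?y = "a + t *\<^sub>R (x + s *\<^sub>R b - a)"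
        have "?y \<in> W"
          using seg[of "x + s *\<^sub>R b" t] that by (simp add: U_def)
        then have "((\<lambda>u. h (?y + u *\<^sub>R b)) has_real_derivative partial_deriv b h ?y) (at (t * (s - s)))"
          using Ck_on_SucD(1)[OF Suc.prems b] by simp
        moreover have "((\<lambda>s'. t * (s' - s)) has_real_derivative t) (at s)"
          by (auto intro!: derivative_eq_intros)
        ultimately have "((\<lambda>s'. h (?y + (t * (s' - s)) *\<^sub>R b)) has_real_derivative partial_deriv b h ?y * t) (at s)"
          by (rule DERIV_chain2)
        moreover have "?y + (t * (s' - s)) *\<^sub>R b = a + t *\<^sub>R (x + s' *\<^sub>R b - a)" for s'
          by (simp add: algebra_simps)
        ultimately have "((\<lambda>s'. h (a + t *\<^sub>R (x + s' *\<^sub>R b - a))) has_real_derivative partial_deriv b h ?y * t) (at s within U)"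
          by (simp add: has_field_derivative_at_within)
        from DERIV_cmult[OF this, of "t ^ j"] show ?thesis
          by (simp add: mult_ac)
      qed
      have "((\<lambda>s. integral (cbox 0 1) (\<lambda>t. t ^ j * h (a + t *\<^sub>R (x + s *\<^sub>R b - a)))) has_field_derivative
          integral (cbox 0 1) (\<lambda>t. t ^ Suc j * partial_deriv b h (a + t *\<^sub>R (x + 0 *\<^sub>R b - a)))) (at 0 within U)"
      proof (rule leibniz_rule_field_derivative[OF der _ _ U0 \<open>convex U\<close>])
        fix s assume s: "s \<in> U"
        have "continuous_on {0..1} (\<lambda>t. case (x + s *\<^sub>R b, t) of (x, t) \<Rightarrow> t ^ j * h (a + t *\<^sub>R (x - a)))"
          by (rule continuous_on_compose2[OF joint[OF Ck_on_continuous[OF Suc.prems], of j]])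
            (use s in \<open>auto simp: U_def intro!: continuous_intros\<close>)
        then have "continuous_on {0..1} (\<lambda>t. t ^ j * h (a + t *\<^sub>R (x + s *\<^sub>R b - a)))"
          by simp
        then show "(\<lambda>t. t ^ j * h (a + t *\<^sub>R (x + s *\<^sub>R b - a))) integrable_on cbox 0 1"
          by (intro integrable_continuous) simp
      next
        have "continuous_on (U \<times> {0..1}) (\<lambda>p. case (x + fst p *\<^sub>R b, snd p) of
            (x, t) \<Rightarrow> t ^ Suc j * partial_deriv b h (a + t *\<^sub>R (x - a)))"
          by (rule continuous_on_compose2[OF joint[OF Ck_on_continuous[OF pd]]])
            (auto simp: U_def intro!: continuous_intros)
        then show "continuous_on (U \<times> cbox 0 1) (\<lambda>(s, t). t ^ Suc j * partial_deriv b h (a + t *\<^sub>R (x + s *\<^sub>R b - a)))"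
          by (simp add: case_prod_beta)
      qed
      moreover obtain T where T: "open T" "0 \<in> T" "T \<subseteq> U"
        using eventually_line_in[OF W x b] by (auto simp: eventually_nhds U_def)
      moreover have "at 0 within U = at (0::real)"
        using T by (intro at_within_interior) (auto simp: interior_def)
      ultimately show "((\<lambda>s. integral {0..1} (\<lambda>t. t ^ j * h (a + t *\<^sub>R (x + s *\<^sub>R b - a)))) has_real_derivative
          integral {0..1} (\<lambda>t. t ^ Suc j * partial_deriv b h (a + t *\<^sub>R (x - a)))) (at 0)"
        by simp
    qed
  }
qed

text \<open>Integrating the derivative of f along the segment from a to x gives the coefficient
  functions; at x = a the integrand is constant, which yields their value there. The lemma is what
  turns abstract derivations into combinations of coordinate derivatives.\<close>

lemma smooth_on_hadamard:
  fixes B :: "'e::euclidean_space set"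
  assumes B: "B \<subseteq> Basis" and W: "openin (top_of_set (span B)) W"
    and cvx: "convex W" and a: "a \<in> W" and f: "smooth_on B W f"
  obtains h where "\<And>b. b \<in> B \<Longrightarrow> smooth_on B W (h b)" "\<And>b. h b a = partial_deriv b f a"
    "\<And>x. x \<in> W \<Longrightarrow> f x = f a + (\<Sum>b\<in>B. ((x - a) \<bullet> b) * h b x)"
proof
  let ?h = "\<lambda>b x. integral {0..1} (\<lambda>t. partial_deriv b f (a + t *\<^sub>R (x - a)))"
  show "smooth_on B W (?h b)" if "b \<in> B" for b
    using Ck_on_integral_segment[OF B W cvx a, of _ "partial_deriv b f" 0] smooth_on_partial[OF f that]
    unfolding smooth_on_def by simp
  show "?h b a = partial_deriv b f a" for b
    by simp
  fix x assume x: "x \<in> W"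
  have seg: "a + t *\<^sub>R (x - a) \<in> W" if "t \<in> {0..1}" for t
    using convexD_alt[OF cvx a x, of t] that by (simp add: algebra_simps)
  have fC: "Ck_on (Suc 0) B W f"
    using f by (simp add: smooth_on_def del: Ck_on.simps)
  have d: "((\<lambda>t. f (a + t *\<^sub>R (x - a))) has_vector_derivative
      (\<Sum>b\<in>B. ((x - a) \<bullet> b) * partial_deriv b f (a + t *\<^sub>R (x - a)))) (at t within {0..1})"
    if "t \<in> {0..1}" for t
    unfolding has_real_derivative_iff_has_vector_derivative[symmetric]
  proof (rule has_real_derivative_along_curve[OF B W fC])
    show "((\<lambda>t. a + t *\<^sub>R (x - a)) has_vector_derivative x - a) (at t within {0..1})"
      by (auto intro!: derivative_eq_intros)
  qed (use seg that in auto)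
  have int: "(\<lambda>t. ((x - a) \<bullet> b) * partial_deriv b f (a + t *\<^sub>R (x - a))) integrable_on {0..1}" if "b \<in> B" for b
  proof (intro integrable_continuous_interval continuous_on_mult continuous_on_const)
    show "continuous_on {0..1} (\<lambda>t. partial_deriv b f (a + t *\<^sub>R (x - a)))"
      by (rule continuous_on_compose2[OF smooth_on_continuous[OF smooth_on_partial[OF f that]]])
        (use seg in \<open>auto intro!: continuous_intros\<close>)
  qed
  have "((\<lambda>t. \<Sum>b\<in>B. ((x - a) \<bullet> b) * partial_deriv b f (a + t *\<^sub>R (x - a))) has_integral
      (f (a + 1 *\<^sub>R (x - a)) - f (a + 0 *\<^sub>R (x - a)))) {0..1}"
    by (rule fundamental_theorem_of_calculus) (use d in auto)
  then have "f x - f a = integral {0..1} (\<lambda>t. \<Sum>b\<in>B. ((x - a) \<bullet> b) * partial_deriv b f (a + t *\<^sub>R (x - a)))"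
    by (simp add: integral_unique)
  also have "\<dots> = (\<Sum>b\<in>B. integral {0..1} (\<lambda>t. ((x - a) \<bullet> b) * partial_deriv b f (a + t *\<^sub>R (x - a))))"
    by (rule integral_sum) (use finite_subset[OF B finite_Basis] int in auto)
  finally show "f x = f a + (\<Sum>b\<in>B. ((x - a) \<bullet> b) * ?h b x)"
    by simp
qed


subsection \<open>The smooth inverse function theorem\<close>

text \<open>An inverse matrix m of a inherits the regularity of a without determinants: the identity
  m(x) - m(y) = m(x) (a(y) - a(x)) m(y) first gives continuity, then the derivative -m a' m, and the
  rest is induction.\<close>

lemma Ck_on_matrix_inverse:
  fixes B :: "'e::euclidean_space set" and a m :: "'e \<Rightarrow> 'e \<Rightarrow> 'e \<Rightarrow> real"
  assumes B: "B \<subseteq> Basis" and W: "openin (top_of_set (span B)) W"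
    and left: "\<And>b d x. b \<in> B \<Longrightarrow> d \<in> B \<Longrightarrow> x \<in> W \<Longrightarrow> (\<Sum>c\<in>B. m b c x * a c d x) = (if b = d then 1 else 0)"
    and right: "\<And>b d x. b \<in> B \<Longrightarrow> d \<in> B \<Longrightarrow> x \<in> W \<Longrightarrow> (\<Sum>c\<in>B. a b c x * m c d x) = (if b = d then 1 else 0)"
    and a: "\<And>b c. b \<in> B \<Longrightarrow> c \<in> B \<Longrightarrow> Ck_on k B W (a b c)"
    and bd: "b \<in> B" "d \<in> B"
  shows "Ck_on k B W (m b d)"
proof -
  have fin: "finite B"
    using B finite_Basis finite_subset by blast
  have diff: "m b d x - m b d y = (\<Sum>c\<in>B. \<Sum>e\<in>B. m b c x * (a c e y - a c e x) * m e d y)"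
    if "x \<in> W" "y \<in> W" "b \<in> B" "d \<in> B" for b d x y
  proof -
    have 1: "(\<Sum>c\<in>B. \<Sum>e\<in>B. m b c x * a c e y * m e d y) = m b d x"
    proof -
      have "(\<Sum>c\<in>B. \<Sum>e\<in>B. m b c x * a c e y * m e d y) = (\<Sum>c\<in>B. m b c x * (\<Sum>e\<in>B. a c e y * m e d y))"
        by (simp add: sum_distrib_left mult.assoc)
      also have "\<dots> = (\<Sum>c\<in>B. if c = d then m b c x else 0)"
        using that by (intro sum.cong) (simp_all add: right)
      finally show ?thesis
        using fin that by simp
    qed
    have 2: "(\<Sum>c\<in>B. \<Sum>e\<in>B. m b c x * a c e x * m e d y) = m b d y"
    proof -
      have "(\<Sum>c\<in>B. \<Sum>e\<in>B. m b c x * a c e x * m e d y) = (\<Sum>e\<in>B. (\<Sum>c\<in>B. m b c x * a c e x) * m e d y)"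
        unfolding sum_distrib_right by (rule sum.swap)
      also have "\<dots> = (\<Sum>e\<in>B. if e = b then m e d y else 0)"
        using that by (intro sum.cong) (auto simp: left)
      finally show ?thesis
        using fin that by simp
    qed
    show ?thesis
      using 1 2 by (simp add: right_diff_distrib left_diff_distrib sum_subtractf)
  qed
  have cont: "continuous_on W (m b d)"
    if a0: "\<And>b c. b \<in> B \<Longrightarrow> c \<in> B \<Longrightarrow> continuous_on W (a b c)" and bd: "b \<in> B" "d \<in> B" for b d
    unfolding continuous_on_eq_continuous_within
  proof
    fix y assume y: "y \<in> W"
    \<comment> \<open>\<open>N\<close> and \<open>D\<close> are sums over all entries, used as
      norms. \<open>est\<close> bounds the change of m by N x * D x * N y, where D x tends to 0 but
      N x is not yet known to be bounded.\<close>
    define N where "N x = (\<Sum>b\<in>B. \<Sum>d\<in>B. \<bar>m b d x\<bar>)" for x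
    define D where "D x = (\<Sum>c\<in>B. \<Sum>e\<in>B. \<bar>a c e y - a c e x\<bar>)" for x
    have entry: "\<bar>m b d x\<bar> \<le> N x" if "b \<in> B" "d \<in> B" for b d x
    proof -
      have "\<bar>m b d x\<bar> \<le> (\<Sum>d\<in>B. \<bar>m b d x\<bar>)"
        using fin that(2) by (intro member_le_sum) auto
      also have "\<dots> \<le> N x"
        unfolding N_def using fin that(1) by (intro member_le_sum[of b B "\<lambda>b. \<Sum>d\<in>B. \<bar>m b d x\<bar>"]) (auto intro: sum_nonneg)
      finally show ?thesis .
    qed
    have N0: "N x \<ge> 0" for x
      unfolding N_def by (intro sum_nonneg) auto
    have est: "\<bar>m b d x - m b d y\<bar> \<le> N x * D x * N y" if "x \<in> W" "b \<in> B" "d \<in> B" for b d x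
    proof -
      have "\<bar>m b d x - m b d y\<bar> \<le> (\<Sum>c\<in>B. \<Sum>e\<in>B. \<bar>m b c x * (a c e y - a c e x) * m e d y\<bar>)"
        unfolding diff[OF that(1) y that(2,3)]
        by (rule order_trans[OF sum_abs sum_mono[OF sum_abs]])
      also have "\<dots> \<le> (\<Sum>c\<in>B. \<Sum>e\<in>B. N x * \<bar>a c e y - a c e x\<bar> * N y)"
        unfolding abs_mult using that entry N0 by (intro sum_mono mult_mono) auto
      also have "\<dots> = N x * D x * N y"
        by (simp add: D_def sum_distrib_left sum_distrib_right)
      finally show ?thesis .
    qed
    have D0: "D x \<ge> 0" for x
      unfolding D_def by (intro sum_nonneg) auto
    have "((\<lambda>x. D x) \<longlongrightarrow> (\<Sum>c\<in>B. \<Sum>e\<in>B. \<bar>a c e y - a c e y\<bar>)) (at y within W)"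
      unfolding D_def using a0 y by (intro tendsto_intros) (auto simp: continuous_on_def)
    then have Dlim: "(D \<longlongrightarrow> 0) (at y within W)"
      by simp
    \<comment> \<open>The number of matrix entries. Summing \<open>est\<close> over them gives N x -
      N y \<le> N x * (n * D x * N y); once the bracket is below 1/2, N x is absorbed and N x \<le>
      2 * N y remains.\<close>
    define n where "n = real (card B) * real (card B)"
    have "((\<lambda>x. n * (D x * N y)) \<longlongrightarrow> n * (0 * N y)) (at y within W)"
      by (intro tendsto_intros Dlim)
    then have "\<forall>\<^sub>F x in at y within W. n * (D x * N y) < 1/2"
      by (rule order_tendstoD(2)) simp
    moreover have "\<forall>\<^sub>F x in at y within W. x \<in> W"
      by (simp add: eventually_at_filter)
    ultimately have "\<forall>\<^sub>F x in at y within W. norm (m b d x - m b d y) \<le> 2 * N y * D x * N y"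
    proof eventually_elim
      case (elim x)
      have "N x - N y \<le> (\<Sum>b\<in>B. \<Sum>d\<in>B. \<bar>m b d x - m b d y\<bar>)"
        unfolding N_def sum_subtractf[symmetric] by (intro sum_mono) auto
      also have "\<dots> \<le> (\<Sum>b\<in>B. \<Sum>d\<in>B. N x * D x * N y)"
        using est[OF elim(2)] by (intro sum_mono) auto
      also have "\<dots> = N x * (n * (D x * N y))"
        by (simp add: n_def)
      also have "\<dots> \<le> N x * (1/2)"
        using elim(1) N0 by (intro mult_left_mono) auto
      finally have "N x \<le> 2 * N y"
        by simp
      then have "N x * D x * N y \<le> 2 * N y * D x * N y"
        using N0 D0 by (intro mult_right_mono) auto
      then show ?case
        using est[OF elim(2) bd] by simp
    qed
    moreover have "((\<lambda>x. 2 * N y * D x * N y) \<longlongrightarrow> 2 * N y * 0 * N y) (at y within W)"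
      by (intro tendsto_intros Dlim)
    ultimately have "((\<lambda>x. m b d x - m b d y) \<longlongrightarrow> 0) (at y within W)"
      by (intro Lim_null_comparison[of "\<lambda>x. m b d x - m b d y" "\<lambda>x. 2 * N y * D x * N y"]) simp_all
    then show "continuous (at y within W) (m b d)"
      unfolding continuous_within by (simp add: LIM_zero_iff)
  qed
  show ?thesis
    using a bd
  proof (induction k arbitrary: b d)
    case 0
    show ?case
      using cont[OF _ 0(2,3)] 0(1) by (simp only: Ck_on.simps)
  next
    case (Suc k)
    have mk: "Ck_on k B W (m b d)" if "b \<in> B" "d \<in> B" for b d
      using Suc.IH[OF _ that] Ck_on_Suc_imp[OF Suc.prems(1)] by blast
    let ?d = "\<lambda>v x. \<Sum>c\<in>B. \<Sum>e\<in>B. m b c x * ((-1) * partial_deriv v (a c e) x) * m e d x"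
    show ?case
    proof (rule Ck_on_SucI[OF W])
      show "continuous_on W (m b d)"
        using Ck_on_continuous[OF mk[OF Suc.prems(2,3)]] .
      fix v assume v: "v \<in> B"
      show "Ck_on k B W (?d v)"
        using Ck_on_SucD(2)[OF Suc.prems(1) v] Suc.prems(2,3)
        by (intro Ck_on_sum[OF W] Ck_on_mult[OF W] Ck_on_const[OF W] mk) auto
      fix x assume x: "x \<in> W"
      have ev: "\<forall>\<^sub>F t in at 0. x + t *\<^sub>R v \<in> W"
        using eventually_line_in[OF W x v] by (rule eventually_at_filter[THEN iffD2, OF eventually_mono]) simp
      have mlim: "((\<lambda>t. m b c (x + t *\<^sub>R v)) \<longlongrightarrow> m b c x) (at 0)" if "c \<in> B" for c
      proof -
        have "(m b c \<longlongrightarrow> m b c x) (at x within W)"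
          using Ck_on_continuous[OF mk[OF Suc.prems(2) that]] x by (simp add: continuous_on_def)
        moreover have "((\<lambda>t. x + t *\<^sub>R v) \<longlongrightarrow> x + 0 *\<^sub>R v) (at 0)"
          by (intro tendsto_intros)
        moreover have "\<forall>\<^sub>F t in at (0::real). x + t *\<^sub>R v \<noteq> x"
          using v B by (auto simp: eventually_at_filter)
        ultimately have "filterlim (\<lambda>t. x + t *\<^sub>R v) (at x within W) (at 0)"
          unfolding filterlim_at using ev by (auto simp: eventually_conj_iff)
        with \<open>(m b c \<longlongrightarrow> m b c x) (at x within W)\<close> show ?thesis
          by (rule filterlim_compose)
      qed
      \<comment> \<open>The identity \<open>diff\<close> turns the difference quotient of m into
        that of a, placed between m at the moved point and m at x. The limit then needs only the
        continuity of m.\<close>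
      have "((\<lambda>t. \<Sum>c\<in>B. \<Sum>e\<in>B. m b c (x + t *\<^sub>R v) * ((-1) * ((a c e (x + t *\<^sub>R v) - a c e x) / t)) * m e d x)
          \<longlongrightarrow> ?d v x) (at 0)"
      proof (intro tendsto_sum tendsto_mult tendsto_const mlim)
        fix c e assume "c \<in> B" "e \<in> B"
        then show "((\<lambda>t. (a c e (x + t *\<^sub>R v) - a c e x) / t) \<longlongrightarrow> partial_deriv v (a c e) x) (at 0)"
          using Ck_on_SucD(1)[OF Suc.prems(1) v x] by (simp add: DERIV_def)
      qed
      moreover have "\<forall>\<^sub>F t in at 0. (\<Sum>c\<in>B. \<Sum>e\<in>B. m b c (x + t *\<^sub>R v) *
          ((-1) * ((a c e (x + t *\<^sub>R v) - a c e x) / t)) * m e d x) = (m b d (x + t *\<^sub>R v) - m b d x) / t"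
        using ev
      proof eventually_elim
        case (elim t)
        show ?case
          unfolding diff[OF elim x Suc.prems(2,3)] sum_divide_distrib
          by (intro sum.cong refl) (simp add: algebra_simps diff_divide_distrib)
      qed
      ultimately have "((\<lambda>t. (m b d (x + t *\<^sub>R v) - m b d x) / t) \<longlongrightarrow> ?d v x) (at 0)"
        by (rule Lim_transform_eventually)
      then show "((\<lambda>t. m b d (x + t *\<^sub>R v)) has_real_derivative ?d v x) (at 0)"
        by (simp add: DERIV_def)
    qed
  qed
qed

text \<open>\<open>inverse_function_theorem\<close> concerns open sets of the full space, so H is
  extended to f by the identity on the orthogonal complement of \<open>span B\<close>, with
  \<open>P\<close> the orthogonal projection, and the local inverse of f is restricted back to
  \<open>span B\<close>. Smoothness of the inverse is then a bootstrap through the inverse Jacobian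
  matrix.\<close>

lemma smooth_inverse_function:
  fixes B :: "'e::euclidean_space set" and H :: "'e \<Rightarrow> 'e"
  assumes B: "B \<subseteq> Basis" and W: "openin (top_of_set (span B)) W" and a: "a \<in> W"
    and H: "\<And>c. c \<in> B \<Longrightarrow> smooth_on B W (\<lambda>x. H x \<bullet> c)" "\<And>x. x \<in> W \<Longrightarrow> H x \<in> span B"
    and inj: "\<And>v. v \<in> span B \<Longrightarrow>
        (\<And>c. c \<in> B \<Longrightarrow> (\<Sum>b\<in>B. (v \<bullet> b) * partial_deriv b (\<lambda>x. H x \<bullet> c) a) = 0) \<Longrightarrow> v = 0"
  obtains W1 G where "W1 \<subseteq> W" "a \<in> W1" "openin (top_of_set (span B)) W1"
    "openin (top_of_set (span B)) (H ` W1)" "homeomorphism W1 (H ` W1) H G"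
    "\<And>c. c \<in> B \<Longrightarrow> smooth_on B (H ` W1) (\<lambda>y. G y \<bullet> c)"
proof -
  have fin: "finite B"
    using B finite_Basis finite_subset by blast
  define P where "P x = (\<Sum>b\<in>B. (x \<bullet> b) *\<^sub>R b)" for x :: 'e
  define A where "A b c x = partial_deriv b (\<lambda>x. H x \<bullet> c) x" for b c x
  define L where "L x v = (\<Sum>c\<in>B. (\<Sum>b\<in>B. (v \<bullet> b) * A b c (P x)) *\<^sub>R c) + (v - P v)" for x v
  define f where "f x = H (P x) + (x - P x)" for x
  obtain T where T: "open T" "W = span B \<inter> T"
    using W by (auto simp: openin_open)
  have blP: "bounded_linear P"
    unfolding P_def by (intro bounded_linear_intros)
  then have contP: "continuous_on S P" for S
    by (rule linear_continuous_on)
  have Pspan: "P x \<in> span B" for x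
    unfolding P_def by (intro span_sum span_scale span_base)
  have Pid: "P x = x" if "x \<in> span B" for x
    using span_lincomb[OF B that] by (simp add: P_def)
  have Pinner: "P x \<bullet> b = x \<bullet> b" if "b \<in> B" for x b
  proof -
    have "P x \<bullet> b = (\<Sum>c\<in>B. if c = b then x \<bullet> c else 0)"
      unfolding P_def inner_sum_left using B that by (intro sum.cong) (auto simp: inner_Basis subset_iff)
    then show ?thesis
      using fin that by simp
  qed
  have span0: "v = 0" if "v \<in> span B" "\<And>b. b \<in> B \<Longrightarrow> v \<bullet> b = 0" for v
    using span_lincomb[OF B that(1)] that(2) by simp
  have spaneq: "x - P x \<in> span B \<Longrightarrow> x \<in> span B" for x
    using span_add[OF _ Pspan[of x], of "x - P x"] by simp
  define U where "U = P -` T"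
  have U: "open U"
    unfolding U_def by (rule open_vimage[OF T(1) contP])
  have PU: "P x \<in> W \<longleftrightarrow> x \<in> U" for x
    using T(2) Pspan by (auto simp: U_def)
  have aB: "a \<in> span B" and aU: "a \<in> U"
    using a T(2) Pid by (auto simp: U_def)
  have lin: "bounded_linear (L x)" for x
    unfolding L_def
    by (intro bounded_linear_add bounded_linear_sub bounded_linear_ident blP bounded_linear_sum
        bounded_linear_scaleR_const bounded_linear_mult_const bounded_linear_inner_left)
  define f' where "f' x = Blinfun (L x)" for x
  have f': "blinfun_apply (f' x) = L x" for x
    unfolding f'_def by (rule bounded_linear_Blinfun_apply[OF lin])
  have Lc: "L x v \<bullet> c = (\<Sum>b\<in>B. (v \<bullet> b) * A b c (P x))" if "c \<in> B" for x v c
  proof -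
    have "(\<Sum>c\<in>B. (\<Sum>b\<in>B. (v \<bullet> b) * A b c (P x)) *\<^sub>R c) \<bullet> c =
        (\<Sum>c'\<in>B. if c' = c then (\<Sum>b\<in>B. (v \<bullet> b) * A b c (P x)) else 0)"
      unfolding inner_sum_left using B that by (intro sum.cong) (auto simp: inner_Basis subset_iff)
    also have "\<dots> = (\<Sum>b\<in>B. (v \<bullet> b) * A b c (P x))"
      using fin that by simp
    finally show ?thesis
      using Pinner[OF that] by (simp add: L_def inner_add_left inner_diff_left)
  qed
  have Lspan: "L x v \<in> span B \<longleftrightarrow> v \<in> span B" for x v
  proof -
    have s: "(\<Sum>c\<in>B. (\<Sum>b\<in>B. (v \<bullet> b) * A b c (P x)) *\<^sub>R c) \<in> span B"
      by (intro span_sum span_scale span_base)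
    have "L x v \<in> span B \<longleftrightarrow> v - P v \<in> span B"
      unfolding L_def using s by (rule span_add_eq)
    also have "\<dots> \<longleftrightarrow> v \<in> span B"
      using spaneq Pspan span_diff by blast
    finally show ?thesis .
  qed
  have Ck1: "Ck_on (Suc 0) B W (\<lambda>x. H x \<bullet> c)" if "c \<in> B" for c
    using H(1)[OF that] unfolding smooth_on_def by blast
  have derf: "(f has_derivative blinfun_apply (f' x)) (at x)" if x: "x \<in> U" for x
  proof -
    have dP: "(P has_derivative P) (at x within U)"
      using blP by (rule bounded_linear_imp_has_derivative)
    have dc: "((\<lambda>x. H (P x) \<bullet> c) has_derivative (\<lambda>v. \<Sum>b\<in>B. (v \<bullet> b) * A b c (P x))) (at x within U)"
      if "c \<in> B" for c
    proof -
      have "((\<lambda>x. H x \<bullet> c) has_derivative (\<lambda>h. \<Sum>b\<in>B. (h \<bullet> b) * A b c (P x))) (at (P x) within W)"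
        using Ck_on_has_derivative[OF B W Ck1[OF that]] PU x by (simp add: A_def)
      then have "((\<lambda>x. H x \<bullet> c) has_derivative (\<lambda>h. \<Sum>b\<in>B. (h \<bullet> b) * A b c (P x))) (at (P x) within P ` U)"
        by (rule has_derivative_subset) (use PU in blast)
      from has_derivative_in_compose[OF dP this] show ?thesis
        using Pinner by (simp cong: sum.cong)
    qed
    have "((\<lambda>x. (\<Sum>c\<in>B. (H (P x) \<bullet> c) *\<^sub>R c) + (x - P x)) has_derivative L x) (at x within U)"
      unfolding L_def
      by (intro has_derivative_add has_derivative_diff has_derivative_sum has_derivative_scaleR_left
          dc dP has_derivative_ident)
    then have "(f has_derivative L x) (at x within U)"
    proof (rule has_derivative_transform[OF x, rotated])
      show "f y = (\<Sum>c\<in>B. (H (P y) \<bullet> c) *\<^sub>R c) + (y - P y)" if "y \<in> U" for y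
        using span_lincomb[OF B H(2)] PU that by (simp add: f_def)
    qed
    then show ?thesis
      unfolding f' using at_within_open[OF x U] by simp
  qed
  have contA: "continuous_on U (\<lambda>x. A b c (P x))" if "b \<in> B" "c \<in> B" for b c
    unfolding A_def
    by (rule continuous_on_compose2[OF smooth_on_continuous[OF smooth_on_partial[OF H(1)[OF that(2)] that(1)]] contP])
      (use PU in blast)
  have contf: "continuous_on U f'"
  proof (rule continuous_on_blinfun_componentwise)
    fix i :: 'e
    show "continuous_on U (\<lambda>x. blinfun_apply (f' x) i)"
      unfolding f' L_def
      by (intro continuous_on_add continuous_on_sum continuous_on_scaleR continuous_on_mult
          continuous_on_const contA)
  qed
  \<comment> \<open>A vector killed by \<open>L a\<close> lies in \<open>span B\<close> by
    \<open>Lspan\<close>, since \<open>L a\<close> preserves the component in the complement. On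
    \<open>span B\<close> the map is the derivative of H, which is injective by hypothesis.\<close>
  have "inj (L a)"
  proof (subst linear_injective_0)
    show "linear (L a)"
      using lin by (rule bounded_linear.linear)
    show "\<forall>v. L a v = 0 \<longrightarrow> v = 0"
    proof (intro allI impI)
      fix v assume v: "L a v = 0"
      then have "v \<in> span B"
        using Lspan[of a v] by (simp add: span_zero)
      then show "v = 0"
      proof (rule inj)
        fix c assume "c \<in> B"
        then show "(\<Sum>b\<in>B. (v \<bullet> b) * partial_deriv b (\<lambda>x. H x \<bullet> c) a) = 0"
          using Lc[of c a v] v Pid[OF aB] by (simp add: A_def)
      qed
    qed
  qed
  then obtain J where J: "linear J" "J \<circ> L a = id"
    using linear_injective_left_inverse[OF bounded_linear.linear[OF lin]] by blast
  have "Blinfun J o\<^sub>L f' a = id_blinfun"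
    using J(2) by (intro blinfun_eqI)
      (simp add: f' bounded_linear_Blinfun_apply[OF J(1)[unfolded linear_conv_bounded_linear]] fun_eq_iff)
  from inverse_function_theorem[OF U derf contf aU this]
  obtain U' V G g' where UV: "open U'" "U' \<subseteq> U" "a \<in> U'" "open V" "f a \<in> V" "homeomorphism U' V f G"
    and g': "\<And>y. y \<in> V \<Longrightarrow> (G has_derivative g' y) (at y)"
      "\<And>y. y \<in> V \<Longrightarrow> g' y = inv (L (G y))" "\<And>y. y \<in> V \<Longrightarrow> bij (L (G y))"
    unfolding f' by metis
  define W1 where "W1 = U' \<inter> span B"
  define Y where "Y = V \<inter> span B"
  have fH: "f x = H x" if "x \<in> span B" for x
    using Pid[OF that] by (simp add: f_def)
  have W1W: "W1 \<subseteq> W"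
    using UV(2) Pid PU by (force simp: W1_def)
  have fspan: "f x \<in> span B \<longleftrightarrow> x \<in> span B" if "x \<in> U" for x
  proof -
    have "f x \<in> span B \<longleftrightarrow> x - P x \<in> span B"
      unfolding f_def using H(2) PU that by (intro span_add_eq) blast
    then show ?thesis
      using spaneq Pspan span_diff by blast
  qed
  have GU: "G y \<in> U'" "f (G y) = y" if "y \<in> V" for y
    using UV(6) that by (auto simp: homeomorphism_def)
  have fU: "f x \<in> V" "G (f x) = x" if "x \<in> U'" for x
    using UV(6) that by (auto simp: homeomorphism_def)
  have GW1: "G y \<in> W1" if "y \<in> Y" for y
    using GU[of y] fspan[of "G y"] UV(2) that by (auto simp: W1_def Y_def)
  have HW1: "H ` W1 = Y"
  proof
    show "H ` W1 \<subseteq> Y"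
    proof
      fix y assume "y \<in> H ` W1"
      then obtain x where x: "x \<in> W1" "y = H x" by blast
      then have "y = f x" "x \<in> U'" "x \<in> span B"
        using fH by (auto simp: W1_def)
      then show "y \<in> Y"
        using fU(1) fspan UV(2) by (auto simp: Y_def)
    qed
    show "Y \<subseteq> H ` W1"
    proof
      fix y assume y: "y \<in> Y"
      then have "y = H (G y)"
        using GW1[OF y] GU(2)[of y] fH[of "G y"] by (auto simp: Y_def W1_def)
      then show "y \<in> H ` W1"
        using GW1[OF y] by blast
    qed
  qed
  have opY: "openin (top_of_set (span B)) Y" and opW1: "openin (top_of_set (span B)) W1"
    using openin_open_Int[OF UV(4), of "span B"] openin_open_Int[OF UV(1), of "span B"]
    by (simp_all only: Y_def W1_def Int_commute)
  have hom: "homeomorphism W1 Y H G"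
  proof (rule homeomorphism_cong[OF homeomorphism_of_subsets[OF UV(6)]])
    show "f ` W1 = Y"
      using HW1 fH by (force simp: W1_def image_iff)
  qed (auto simp: W1_def Y_def fH)
  have inverse_mult: "L (G y) (g' y v) = v" "g' y (L (G y) v) = v" if "y \<in> V" for y v
    using g'(2,3)[OF that] by (simp_all add: bij_is_surj bij_is_inj surj_f_inv_f)
  have lin_g': "linear (g' y)" if "y \<in> V" for y
    using has_derivative_linear[OF g'(1)[OF that]] .
  \<comment> \<open>The first index is the direction and the second the component: \<open>?a\<close>
    is the Jacobian matrix of H at G y and \<open>?m\<close> that of G at y.\<close>
  let ?a = "\<lambda>b c y. A b c (G y)" and ?m = "\<lambda>b c y. g' y b \<bullet> c"
  have leftinv: "(\<Sum>c\<in>B. ?m b c y * ?a c d y) = (if b = d then 1 else 0)" if "b \<in> B" "d \<in> B" "y \<in> Y" for b d y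
  proof -
    have yV: "y \<in> V" and Gs: "G y \<in> span B"
      using that(3) GW1[OF that(3)] by (auto simp: Y_def W1_def)
    show ?thesis
      using Lc[OF that(2), of "G y" "g' y b"] inverse_mult(1)[OF yV, of b] Pid[OF Gs] that(1,2) B
      by (auto simp: inner_Basis subset_iff)
  qed
  have rightinv: "(\<Sum>c\<in>B. ?a b c y * ?m c d y) = (if b = d then 1 else 0)" if "b \<in> B" "d \<in> B" "y \<in> Y" for b d y
  proof -
    have yV: "y \<in> V" and Gs: "G y \<in> span B"
      using that(3) GW1[OF that(3)] by (auto simp: Y_def W1_def)
    have bB: "b \<in> span B"
      using that(1) by (rule span_base)
    have "L (G y) b = (\<Sum>c\<in>B. (L (G y) b \<bullet> c) *\<^sub>R c)"
      using span_lincomb[OF B, of "L (G y) b"] Lspan[of "G y" b] bB by simp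
    also have "\<dots> = (\<Sum>c\<in>B. ?a b c y *\<^sub>R c)"
    proof (rule sum.cong)
      fix c assume c: "c \<in> B"
      have "(\<Sum>e\<in>B. (b \<bullet> e) * A e c (P (G y))) = (\<Sum>e\<in>B. if e = b then A e c (P (G y)) else 0)"
        using B that(1) by (intro sum.cong) (auto simp: inner_Basis subset_iff)
      then show "(L (G y) b \<bullet> c) *\<^sub>R c = ?a b c y *\<^sub>R c"
        using Lc[OF c, of "G y" b] Pid[OF Gs] fin that(1) by simp
    qed simp
    finally have "g' y (\<Sum>c\<in>B. ?a b c y *\<^sub>R c) = b"
      using inverse_mult(2)[OF yV, of b] by simp
    then have "(\<Sum>c\<in>B. ?a b c y *\<^sub>R g' y c) \<bullet> d = b \<bullet> d"
      using linear_sum[OF lin_g'[OF yV], of "\<lambda>c. ?a b c y *\<^sub>R c" B] linear_scale[OF lin_g'[OF yV]] by simp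
    then show ?thesis
      using that(1,2) B by (auto simp: inner_sum_left inner_Basis subset_iff)
  qed
  \<comment> \<open>If G is of class k, then so is the Jacobian of H composed with G, hence also its
    inverse matrix. The entries of the latter are the partial derivatives of G, so G is of class k +
    1.\<close>
  have "\<forall>c\<in>B. Ck_on k B Y (\<lambda>y. G y \<bullet> c)" for k
  proof (induction k)
    case 0
    have "continuous_on Y G"
      using hom by (simp add: homeomorphism_def)
    then show ?case
      by (auto intro!: continuous_intros)
  next
    case (Suc k)
    have mk: "Ck_on k B Y (?m b d)" if "b \<in> B" "d \<in> B" for b d
    proof (rule Ck_on_matrix_inverse[OF B opY leftinv rightinv _ that])
      fix b c assume bc: "b \<in> B" "c \<in> B"
      show "Ck_on k B Y (?a b c)"
      proof (rule Ck_on_compose[OF B B opY W])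
        show "Ck_on k B W (A b c)"
          using smooth_on_partial[OF H(1)[OF bc(2)] bc(1)] by (simp add: A_def[abs_def] smooth_on_def)
      qed (use Suc GW1 W1W in auto)
    qed
    show ?case
    proof
      fix c assume c: "c \<in> B"
      show "Ck_on (Suc k) B Y (\<lambda>y. G y \<bullet> c)"
      proof (rule Ck_on_SucI[OF opY])
        show "continuous_on Y (\<lambda>y. G y \<bullet> c)"
          using Suc c Ck_on_continuous by blast
        fix b assume b: "b \<in> B"
        show "Ck_on k B Y (?m b c)"
          by (rule mk[OF b c])
        fix y assume "y \<in> Y"
        then have yV: "y \<in> V"
          by (simp add: Y_def)
        have "((\<lambda>t. y + t *\<^sub>R b) has_derivative (\<lambda>t. t *\<^sub>R b)) (at 0)"
          by (auto intro!: derivative_eq_intros)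
        then have "((\<lambda>t. G (y + t *\<^sub>R b)) has_derivative (\<lambda>t. g' y (t *\<^sub>R b))) (at 0)"
          by (rule has_derivative_compose) (use g'(1)[OF yV] in simp)
        then have "((\<lambda>t. G (y + t *\<^sub>R b) \<bullet> c) has_derivative (\<lambda>t. g' y (t *\<^sub>R b) \<bullet> c)) (at 0)"
          by (rule has_derivative_inner_left)
        moreover have "(\<lambda>t. g' y (t *\<^sub>R b) \<bullet> c) = (*) (?m b c y)"
          using linear_scale[OF lin_g'[OF yV]] by (auto simp: fun_eq_iff)
        ultimately show "((\<lambda>t. G (y + t *\<^sub>R b) \<bullet> c) has_real_derivative ?m b c y) (at 0)"
          by (simp add: has_field_derivative_def)
      qed
    qed
  qed
  then show ?thesis
    using that[OF W1W _ opW1] hom opY HW1 UV(3) aB by (auto simp: smooth_on_def W1_def)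
qed


subsection \<open>Local smoothness on a manifold\<close>

lemma eventually_nhdsin_self: "eventually P (nhdsin X p) \<Longrightarrow> p \<in> topspace X \<Longrightarrow> P p"
  by (auto simp: eventually_nhdsin)

lemma eventually_eventually_nhdsin:
  "eventually P (nhdsin X p) \<Longrightarrow> eventually (\<lambda>q. eventually P (nhdsin X q)) (nhdsin X p)"
  unfolding eventually_nhdsin by blast

lemma eventually_nhdsin_openin: "openin X U \<Longrightarrow> p \<in> U \<Longrightarrow> \<forall>\<^sub>F q in nhdsin X p. q \<in> U"
  unfolding eventually_nhdsin by blast

text \<open>A pointwise substitute for membership in \<open>smooth_functions\<close>, which is a
  global condition. Charts of the maximal atlas are allowed so that restricted, composed and adapted
  charts can serve as well as the given ones.\<close>

definition smooth_at :: "('a, 'e::euclidean_space) manifold \<Rightarrow> 'a \<Rightarrow> ('a \<Rightarrow> real) \<Rightarrow> bool" where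
  "smooth_at M p f \<longleftrightarrow> (\<exists>U \<phi> W. (U, \<phi>) \<in> max_atlas M \<and> p \<in> U \<and>
     openin (top_of_set (span (mcoords M))) W \<and> \<phi> p \<in> W \<and> W \<subseteq> \<phi> ` U \<and>
     smooth_on (mcoords M) W (\<lambda>x. f (inv_into U \<phi> x)))"

section \<open>Charts, transition maps and smoothness at a point\<close>

locale smooth_mfd =
  fixes M :: "('a, 'e::euclidean_space) manifold"
  assumes smooth_manifold: "smooth_manifold M"
begin

abbreviation "near \<equiv> nhdsin (mtop M)"
abbreviation "mopen \<equiv> openin (top_of_set (span (mcoords M)))"

lemma coords_Basis: "mcoords M \<subseteq> Basis"
  using smooth_manifold by (simp add: smooth_manifold_def)

lemma finite_coords: "finite (mcoords M)"
  using coords_Basis finite_Basis finite_subset by blast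

lemma Hausdorff: "Hausdorff_space (mtop M)"
  using smooth_manifold by (simp add: smooth_manifold_def)

lemma matlas_max: "c \<in> matlas M \<Longrightarrow> c \<in> max_atlas M"
  using smooth_manifold by (simp add: smooth_manifold_def max_atlas_def)

lemma atlas_chart_at:
  assumes "p \<in> mcarrier M"
  obtains U \<phi> where "(U, \<phi>) \<in> matlas M" "p \<in> U"
proof -
  have "p \<in> \<Union> (fst ` matlas M)"
    using smooth_manifold assms by (simp add: smooth_manifold_def)
  then show ?thesis
    using that by auto
qed

lemma chart_at:
  assumes "p \<in> mcarrier M"
  obtains U \<phi> where "(U, \<phi>) \<in> max_atlas M" "p \<in> U"
  using atlas_chart_at[OF assms] matlas_max by metis

lemma chart:
  assumes "(U, \<phi>) \<in> max_atlas M"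
  shows chart_openin: "openin (mtop M) U"
    and chart_image: "mopen (\<phi> ` U)"
    and chart_homeo: "homeomorphic_map (subtopology (mtop M) U) (top_of_set (\<phi> ` U)) \<phi>"
    and chart_subset: "U \<subseteq> mcarrier M"
    and chart_inj: "inj_on \<phi> U"
proof -
  have "is_chart M (U, \<phi>)"
    using assms by (simp add: max_atlas_def)
  then show U: "openin (mtop M) U" and "mopen (\<phi> ` U)"
    and h: "homeomorphic_map (subtopology (mtop M) U) (top_of_set (\<phi> ` U)) \<phi>"
    by (auto simp: is_chart_def)
  show sub: "U \<subseteq> mcarrier M"
    using U by (rule openin_subset)
  show "inj_on \<phi> U"
    using homeomorphic_imp_injective_map[OF h] sub by (simp add: topspace_subtopology inf_absorb2)
qed

lemma chart_inv: "(U, \<phi>) \<in> max_atlas M \<Longrightarrow> q \<in> U \<Longrightarrow> inv_into U \<phi> (\<phi> q) = q"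
  using chart_inj by (simp add: inv_into_f_f)

lemma chart_image_openin:
  assumes c: "(U, \<phi>) \<in> max_atlas M" and V: "openin (mtop M) V" "V \<subseteq> U"
  shows "mopen (\<phi> ` V)"
proof -
  have "openin (subtopology (mtop M) U) V"
    using V by (simp add: openin_subtopology_alt) blast
  then have "openin (top_of_set (\<phi> ` U)) (\<phi> ` V)"
    using homeomorphic_imp_open_map[OF chart_homeo[OF c]] by (simp add: open_map_def)
  then show ?thesis
    using chart_image[OF c] openin_trans by blast
qed

lemma chart_vimage_openin:
  assumes c: "(U, \<phi>) \<in> max_atlas M" and W: "mopen W"
  shows "openin (mtop M) {q \<in> U. \<phi> q \<in> W}"
proof -
  have "continuous_map (subtopology (mtop M) U) (top_of_set (\<phi> ` U)) \<phi>"
    using homeomorphic_imp_continuous_map[OF chart_homeo[OF c]] .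
  moreover have "openin (top_of_set (\<phi> ` U)) (\<phi> ` U \<inter> W)"
  proof -
    obtain T where T: "open T" "W = span (mcoords M) \<inter> T"
      using W by (auto simp: openin_open)
    have "\<phi> ` U \<inter> W = \<phi> ` U \<inter> T"
      using openin_subset[OF chart_image[OF c]] T(2) by auto
    then show ?thesis
      using openin_open_Int[OF T(1)] by simp
  qed
  ultimately have "openin (subtopology (mtop M) U)
      {q \<in> topspace (subtopology (mtop M) U). \<phi> q \<in> \<phi> ` U \<inter> W}"
    by (rule openin_continuous_map_preimage)
  then have "openin (mtop M) {q \<in> topspace (subtopology (mtop M) U). \<phi> q \<in> \<phi> ` U \<inter> W}"
    using openin_trans_full chart_openin[OF c] by blast
  moreover have "{q \<in> topspace (subtopology (mtop M) U). \<phi> q \<in> \<phi> ` U \<inter> W} = {q \<in> U. \<phi> q \<in> W}"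
    using chart_subset[OF c] by auto
  ultimately show ?thesis
    by simp
qed

lemma inter_image_openin:
  "(U, \<phi>) \<in> max_atlas M \<Longrightarrow> (U', \<phi>') \<in> max_atlas M \<Longrightarrow> mopen (\<phi> ` (U \<inter> U'))"
  by (intro chart_image_openin openin_Int chart_openin) auto

lemma smooth_transitionD:
  "smooth_transition M (U, \<phi>) (U', \<phi>') \<Longrightarrow> b \<in> mcoords M \<Longrightarrow>
   smooth_on (mcoords M) (\<phi> ` (U \<inter> U')) (\<lambda>x. \<phi>' (inv_into U \<phi> x) \<bullet> b)"
  by (simp add: smooth_transition_def)

text \<open>In the new chart the function is its old representation composed with the transition
  from the new chart to the old one. As compatibility enters only through \<open>t\<close>, the
  lemma applies before two maximal charts are known to be compatible.\<close>

lemma smooth_change_chart: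
  assumes c: "(U, \<phi>) \<in> max_atlas M" and c': "(U', \<phi>') \<in> max_atlas M"
    and t: "smooth_transition M (U', \<phi>') (U, \<phi>)"
    and W: "mopen W" "W \<subseteq> \<phi> ` U" and f: "smooth_on (mcoords M) W (\<lambda>x. f (inv_into U \<phi> x))"
  defines "W' \<equiv> \<phi>' ` (U' \<inter> {q \<in> U. \<phi> q \<in> W})"
  shows "mopen W'" "smooth_on (mcoords M) W' (\<lambda>x. f (inv_into U' \<phi>' x))"
proof -
  show W': "mopen W'"
    unfolding W'_def using c c' W(1)
    by (intro chart_image_openin[OF c'] openin_Int chart_openin[OF c'] chart_vimage_openin) auto
  have "smooth_on (mcoords M) W' (\<lambda>x. f (inv_into U \<phi> (\<phi> (inv_into U' \<phi>' x))))"
  proof (rule smooth_on_compose[OF W' coords_Basis coords_Basis W(1) _ _ f])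
    show "smooth_on (mcoords M) W' (\<lambda>x. \<phi> (inv_into U' \<phi>' x) \<bullet> b)" if "b \<in> mcoords M" for b
      using smooth_transitionD[OF t that] by (rule smooth_on_mono) (auto simp: W'_def)
    show "\<phi> (inv_into U' \<phi>' x) \<in> W" if "x \<in> W'" for x
      using that chart_inv[OF c'] by (auto simp: W'_def)
  qed
  then show "smooth_on (mcoords M) W' (\<lambda>x. f (inv_into U' \<phi>' x))"
  proof (rule smooth_on_cong[OF W'])
    show "f (inv_into U \<phi> (\<phi> (inv_into U' \<phi>' x))) = f (inv_into U' \<phi>' x)" if "x \<in> W'" for x
      using that chart_inv[OF c'] chart_inv[OF c] by (auto simp: W'_def)
  qed
qed

text \<open>\<open>max_atlas\<close> demands compatibility with the charts of the atlas only. Near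
  each point of the overlap the transition factors through an atlas chart around that point.\<close>

lemma max_transition:
  assumes c: "(U, \<phi>) \<in> max_atlas M" and c': "(U', \<phi>') \<in> max_atlas M"
  shows "smooth_transition M (U, \<phi>) (U', \<phi>')"
  unfolding smooth_transition_def case_prod_conv
proof (intro ballI smooth_on_locally)
  show "\<phi> ` (U \<inter> U') \<subseteq> span (mcoords M)"
    using inter_image_openin[OF c c'] openin_subset by fastforce
  fix b x assume b: "b \<in> mcoords M" and x: "x \<in> \<phi> ` (U \<inter> U')"
  then obtain p where p: "p \<in> U" "p \<in> U'" "x = \<phi> p" by blast
  obtain U0 \<phi>0 where c0: "(U0, \<phi>0) \<in> matlas M" "p \<in> U0"
    using atlas_chart_at p(1) chart_subset[OF c] by blast
  have m0: "(U0, \<phi>0) \<in> max_atlas M"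
    using matlas_max[OF c0(1)] .
  have t1: "smooth_transition M (U, \<phi>) (U0, \<phi>0)" and t2: "smooth_transition M (U0, \<phi>0) (U', \<phi>')"
    using c c' c0(1) by (auto simp: max_atlas_def)
  let ?W = "\<phi>0 ` (U0 \<inter> U')"
  note * = smooth_change_chart[OF m0 c t1 inter_image_openin[OF m0 c'] _ smooth_transitionD[OF t2 b]]
  let ?W' = "\<phi> ` (U \<inter> {q \<in> U0. \<phi>0 q \<in> ?W})"
  show "\<exists>V'. mopen V' \<and> x \<in> V' \<and> smooth_on (mcoords M) V' (\<lambda>x. \<phi>' (inv_into U \<phi> x) \<bullet> b)"
    by (rule exI[of _ ?W']) (use * p c0 in auto)
qed

lemma smooth_at_chart:
  assumes f: "smooth_at M p f" and c: "(U, \<phi>) \<in> max_atlas M" "p \<in> U"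
  obtains W where "mopen W" "\<phi> p \<in> W" "W \<subseteq> \<phi> ` U" "smooth_on (mcoords M) W (\<lambda>x. f (inv_into U \<phi> x))"
proof -
  obtain U' \<phi>' W where *: "(U', \<phi>') \<in> max_atlas M" "p \<in> U'" "mopen W" "\<phi>' p \<in> W" "W \<subseteq> \<phi>' ` U'"
    "smooth_on (mcoords M) W (\<lambda>x. f (inv_into U' \<phi>' x))"
    using f unfolding smooth_at_def by blast
  note ** = smooth_change_chart[OF *(1) c(1) max_transition[OF c(1) *(1)] *(3,5,6)]
  show ?thesis
    by (rule that[OF **(1) _ _ **(2)]) (use * c(2) in auto)
qed

lemma smooth_atI:
  "(U, \<phi>) \<in> max_atlas M \<Longrightarrow> p \<in> U \<Longrightarrow> mopen W \<Longrightarrow> \<phi> p \<in> W \<Longrightarrow> W \<subseteq> \<phi> ` U \<Longrightarrow>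
   smooth_on (mcoords M) W (\<lambda>x. f (inv_into U \<phi> x)) \<Longrightarrow> smooth_at M p f"
  unfolding smooth_at_def by blast

lemma smooth_on_chart:
  assumes c: "(U, \<phi>) \<in> max_atlas M" and f: "\<And>p. p \<in> U \<Longrightarrow> smooth_at M p f"
  shows "smooth_on (mcoords M) (\<phi> ` U) (\<lambda>x. f (inv_into U \<phi> x))"
proof (rule smooth_on_locally)
  show "\<phi> ` U \<subseteq> span (mcoords M)"
    using chart_image[OF c] openin_subset by fastforce
  fix x assume "x \<in> \<phi> ` U"
  then obtain p where p: "p \<in> U" "x = \<phi> p" by blast
  show "\<exists>V'. mopen V' \<and> x \<in> V' \<and> smooth_on (mcoords M) V' (\<lambda>x. f (inv_into U \<phi> x))"
    using smooth_at_chart[OF f[OF p(1)] c p(1)] p(2) by metis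
qed

lemma smooth_functions_iff: "f \<in> smooth_functions M \<longleftrightarrow> (\<forall>p\<in>mcarrier M. smooth_at M p f)"
proof
  assume f: "f \<in> smooth_functions M"
  show "\<forall>p\<in>mcarrier M. smooth_at M p f"
  proof
    fix p assume "p \<in> mcarrier M"
    then obtain U \<phi> where c: "(U, \<phi>) \<in> matlas M" "p \<in> U"
      using atlas_chart_at by blast
    show "smooth_at M p f"
      by (rule smooth_atI[OF matlas_max[OF c(1)] c(2) chart_image[OF matlas_max[OF c(1)]]])
        (use c f in \<open>auto simp: smooth_functions_def\<close>)
  qed
next
  assume "\<forall>p\<in>mcarrier M. smooth_at M p f"
  then show "f \<in> smooth_functions M"
    unfolding smooth_functions_def using smooth_on_chart matlas_max chart_subset by blast
qed

lemma smooth_functionsD: "f \<in> smooth_functions M \<Longrightarrow> p \<in> mcarrier M \<Longrightarrow> smooth_at M p f"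
  by (simp add: smooth_functions_iff)

lemma smooth_at_chart2:
  assumes p: "p \<in> mcarrier M" and f: "smooth_at M p f" and h: "smooth_at M p h"
  obtains U \<phi> W where "(U, \<phi>) \<in> max_atlas M" "p \<in> U" "mopen W" "\<phi> p \<in> W" "W \<subseteq> \<phi> ` U"
    "smooth_on (mcoords M) W (\<lambda>x. f (inv_into U \<phi> x))" "smooth_on (mcoords M) W (\<lambda>x. h (inv_into U \<phi> x))"
proof -
  obtain U \<phi> where c: "(U, \<phi>) \<in> max_atlas M" "p \<in> U"
    using chart_at[OF p] .
  obtain W where W: "mopen W" "\<phi> p \<in> W" "W \<subseteq> \<phi> ` U" "smooth_on (mcoords M) W (\<lambda>x. f (inv_into U \<phi> x))"
    using smooth_at_chart[OF f c] .
  obtain W' where W': "mopen W'" "\<phi> p \<in> W'" "W' \<subseteq> \<phi> ` U" "smooth_on (mcoords M) W' (\<lambda>x. h (inv_into U \<phi> x))"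
    using smooth_at_chart[OF h c] .
  show ?thesis
    by (rule that[OF c, of "W \<inter> W'"]) (use W W' in \<open>auto intro: smooth_on_mono\<close>)
qed

lemma smooth_at_const: "p \<in> mcarrier M \<Longrightarrow> smooth_at M p (\<lambda>q. c)"
  by (erule chart_at) (auto intro!: smooth_atI chart_image smooth_on_const)

lemma smooth_at_add:
  assumes "p \<in> mcarrier M" "smooth_at M p f" "smooth_at M p h"
  shows "smooth_at M p (\<lambda>q. f q + h q)"
proof -
  obtain U \<phi> W where "(U, \<phi>) \<in> max_atlas M" "p \<in> U" and W: "mopen W" "\<phi> p \<in> W" "W \<subseteq> \<phi> ` U"
    "smooth_on (mcoords M) W (\<lambda>x. f (inv_into U \<phi> x))" "smooth_on (mcoords M) W (\<lambda>x. h (inv_into U \<phi> x))"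
    using smooth_at_chart2[OF assms] .
  then show ?thesis
    using smooth_on_add[OF W(1,4,5)] by (intro smooth_atI)
qed

lemma smooth_at_mult:
  assumes "p \<in> mcarrier M" "smooth_at M p f" "smooth_at M p h"
  shows "smooth_at M p (\<lambda>q. f q * h q)"
proof -
  obtain U \<phi> W where "(U, \<phi>) \<in> max_atlas M" "p \<in> U" and W: "mopen W" "\<phi> p \<in> W" "W \<subseteq> \<phi> ` U"
    "smooth_on (mcoords M) W (\<lambda>x. f (inv_into U \<phi> x))" "smooth_on (mcoords M) W (\<lambda>x. h (inv_into U \<phi> x))"
    using smooth_at_chart2[OF assms] .
  then show ?thesis
    using smooth_on_mult[OF W(1,4,5)] by (intro smooth_atI)
qed

lemma smooth_at_diff:
  assumes "p \<in> mcarrier M" "smooth_at M p f" "smooth_at M p h"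
  shows "smooth_at M p (\<lambda>q. f q - h q)"
proof -
  obtain U \<phi> W where "(U, \<phi>) \<in> max_atlas M" "p \<in> U" and W: "mopen W" "\<phi> p \<in> W" "W \<subseteq> \<phi> ` U"
    "smooth_on (mcoords M) W (\<lambda>x. f (inv_into U \<phi> x))" "smooth_on (mcoords M) W (\<lambda>x. h (inv_into U \<phi> x))"
    using smooth_at_chart2[OF assms] .
  then show ?thesis
    using smooth_on_diff[OF W(1,4,5)] by (intro smooth_atI)
qed

lemma smooth_at_sum:
  "p \<in> mcarrier M \<Longrightarrow> (\<And>i. i \<in> I \<Longrightarrow> smooth_at M p (f i)) \<Longrightarrow> smooth_at M p (\<lambda>q. \<Sum>i\<in>I. f i q)"
  by (induction I rule: infinite_finite_induct) (auto intro: smooth_at_const smooth_at_add)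

lemma smooth_at_cong:
  assumes p: "p \<in> mcarrier M" and ev: "\<forall>\<^sub>F q in near p. f q = h q" and f: "smooth_at M p f"
  shows "smooth_at M p h"
proof -
  obtain V where V: "openin (mtop M) V" "p \<in> V" "\<And>q. q \<in> V \<Longrightarrow> f q = h q"
    using ev p unfolding eventually_nhdsin by blast
  obtain U \<phi> where c: "(U, \<phi>) \<in> max_atlas M" "p \<in> U"
    using chart_at[OF p] .
  obtain W where W: "mopen W" "\<phi> p \<in> W" "W \<subseteq> \<phi> ` U" "smooth_on (mcoords M) W (\<lambda>x. f (inv_into U \<phi> x))"
    using smooth_at_chart[OF f c] .
  let ?W = "W \<inter> \<phi> ` (U \<inter> V)"
  have o: "mopen ?W"
    by (intro openin_Int W(1) chart_image_openin[OF c(1)] chart_openin[OF c(1)] V(1)) auto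
  show ?thesis
  proof (rule smooth_atI[OF c o])
    show "smooth_on (mcoords M) ?W (\<lambda>x. h (inv_into U \<phi> x))"
      by (rule smooth_on_cong[OF o smooth_on_mono[OF W(4)]]) (auto simp: chart_inv[OF c(1)] V(3))
  qed (use W V c in auto)
qed

lemma eventually_smooth_at:
  assumes p: "p \<in> mcarrier M" and f: "smooth_at M p f"
  shows "\<forall>\<^sub>F q in near p. smooth_at M q f"
proof -
  obtain U \<phi> where c: "(U, \<phi>) \<in> max_atlas M" "p \<in> U"
    using chart_at[OF p] .
  obtain W where W: "mopen W" "\<phi> p \<in> W" "W \<subseteq> \<phi> ` U" "smooth_on (mcoords M) W (\<lambda>x. f (inv_into U \<phi> x))"
    using smooth_at_chart[OF f c] .
  have "\<forall>\<^sub>F q in near p. q \<in> {q \<in> U. \<phi> q \<in> W}"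
    by (rule eventually_nhdsin_openin[OF chart_vimage_openin[OF c(1) W(1)]]) (use c W in auto)
  then show ?thesis
    by eventually_elim (use smooth_atI[OF c(1) _ W(1) _ W(3,4)] in blast)
qed

lemma eventually_smooth_at_pos:
  assumes p: "p \<in> mcarrier M" and f: "smooth_at M p f" and pos: "f p > 0"
  shows "\<forall>\<^sub>F q in near p. f q > 0"
proof -
  obtain U \<phi> where c: "(U, \<phi>) \<in> max_atlas M" "p \<in> U"
    using chart_at[OF p] .
  obtain W where W: "mopen W" "\<phi> p \<in> W" "W \<subseteq> \<phi> ` U" "smooth_on (mcoords M) W (\<lambda>x. f (inv_into U \<phi> x))"
    using smooth_at_chart[OF f c] .
  let ?V = "{x \<in> W. f (inv_into U \<phi> x) > 0}"
  have "openin (top_of_set W) (W \<inter> (\<lambda>x. f (inv_into U \<phi> x)) -` {0<..})"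
    using smooth_on_continuous[OF W(4)] by (rule continuous_openin_preimage_gen) simp
  also have "W \<inter> (\<lambda>x. f (inv_into U \<phi> x)) -` {0<..} = ?V"
    by auto
  finally have V: "mopen ?V"
    using W(1) openin_trans by blast
  have "\<forall>\<^sub>F q in near p. q \<in> {q \<in> U. \<phi> q \<in> ?V}"
    by (rule eventually_nhdsin_openin[OF chart_vimage_openin[OF c(1) V]])
      (use c W pos in \<open>auto simp: chart_inv\<close>)
  then show ?thesis
    by eventually_elim (auto simp: chart_inv[OF c(1)])
qed

lemma smooth_at_inverse_sqrt:
  assumes p: "p \<in> mcarrier M" and f: "smooth_at M p f" and pos: "f p > 0"
  shows "smooth_at M p (\<lambda>q. 1 / sqrt (f q))"
proof -
  obtain V where V: "openin (mtop M) V" "p \<in> V" "\<And>q. q \<in> V \<Longrightarrow> f q > 0"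
    using eventually_smooth_at_pos[OF assms] p unfolding eventually_nhdsin by blast
  obtain U \<phi> where c: "(U, \<phi>) \<in> max_atlas M" "p \<in> U"
    using chart_at[OF p] .
  obtain W where W: "mopen W" "\<phi> p \<in> W" "W \<subseteq> \<phi> ` U" "smooth_on (mcoords M) W (\<lambda>x. f (inv_into U \<phi> x))"
    using smooth_at_chart[OF f c] .
  let ?W = "W \<inter> \<phi> ` (U \<inter> V)"
  have o: "mopen ?W"
    by (intro openin_Int W(1) chart_image_openin[OF c(1)] chart_openin[OF c(1)] V(1)) auto
  show ?thesis
  proof (rule smooth_atI[OF c o])
    show "smooth_on (mcoords M) ?W (\<lambda>x. 1 / sqrt (f (inv_into U \<phi> x)))"
      by (rule smooth_on_inverse_sqrt[OF o smooth_on_mono[OF W(4)]]) (auto simp: chart_inv[OF c(1)] V(3))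
  qed (use W V c in auto)
qed

lemma smooth_at_coordinate:
  assumes c: "(U, \<phi>) \<in> max_atlas M" "p \<in> U"
  shows "smooth_at M p (\<lambda>q. \<phi> q \<bullet> b)"
  by (rule smooth_atI[OF c chart_image[OF c(1)]])
    (use c in \<open>auto intro!: smooth_on_cong[OF chart_image[OF c(1)] smooth_on_inner[OF chart_image[OF c(1)]]]
      simp: chart_inv\<close>)

text \<open>The coordinate bump function vanishes off a compact part K of a closed ball inside the
  chart image; half the radius of the open ball provides the room. The preimage of K is compact,
  hence closed in the Hausdorff space, so the extension by 0 vanishes near every point outside V and
  is smooth.\<close>

lemma bump:
  assumes V: "openin (mtop M) V" "p \<in> V"
  obtains \<rho> where "\<rho> \<in> smooth_functions M" "\<forall>\<^sub>F q in near p. \<rho> q = 1"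
    "\<And>q. q \<in> mcarrier M - V \<Longrightarrow> \<forall>\<^sub>F r in near q. \<rho> r = 0"
proof -
  have p: "p \<in> mcarrier M"
    using V openin_subset by blast
  obtain U \<phi> where c: "(U, \<phi>) \<in> max_atlas M" "p \<in> U"
    using chart_at[OF p] .
  have spanU: "\<phi> ` U \<subseteq> span (mcoords M)"
    using openin_subset[OF chart_image[OF c(1)]] by simp
  have "mopen (\<phi> ` (U \<inter> V))"
    by (intro chart_image_openin[OF c(1)] openin_Int chart_openin[OF c(1)] V(1)) auto
  then obtain r where r: "r > 0" "ball (\<phi> p) r \<inter> span (mcoords M) \<subseteq> \<phi> ` (U \<inter> V)"
    using c(2) V(2) by (metis IntI imageI openin_contains_ball)
  define s where "s = r / 2"
  have s: "s > 0" "s < r"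
    using r(1) by (auto simp: s_def)
  have ps: "\<phi> p \<in> span (mcoords M)"
    using spanU c(2) by blast
  obtain \<rho>0 where \<rho>0: "smooth_on (mcoords M) (span (mcoords M)) \<rho>0"
    "\<And>x. x \<in> span (mcoords M) \<Longrightarrow> dist (\<phi> p) x < s / 2 \<Longrightarrow> \<rho>0 x = 1"
    "\<And>x. x \<in> span (mcoords M) \<Longrightarrow> s \<le> dist (\<phi> p) x \<Longrightarrow> \<rho>0 x = (0::real)"
    using bump_function[OF coords_Basis ps s(1)] by blast
  define \<rho> where "\<rho> q = (if q \<in> U then \<rho>0 (\<phi> q) else 0)" for q
  define K where "K = cball (\<phi> p) s \<inter> span (mcoords M)"
  have KU: "K \<subseteq> \<phi> ` (U \<inter> V)"
    using r(2) s(2) by (force simp: K_def)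
  have "compact K"
    unfolding K_def by (intro compact_Int_closed closed_subspace subspace_span compact_cball)
  then have "compactin (top_of_set (\<phi> ` U)) K"
    using KU by (auto simp: compactin_subtopology)
  moreover obtain \<psi> where \<psi>: "homeomorphic_maps (subtopology (mtop M) U) (top_of_set (\<phi> ` U)) \<phi> \<psi>"
    using chart_homeo[OF c(1)] by (auto simp: homeomorphic_map_maps)
  then have "continuous_map (top_of_set (\<phi> ` U)) (mtop M) \<psi>"
    by (auto simp: homeomorphic_maps_def continuous_map_in_subtopology)
  ultimately have "compactin (mtop M) (\<psi> ` K)"
    by (rule image_compactin)
  then have clo: "closedin (mtop M) (\<psi> ` K)"
    using Hausdorff compactin_imp_closedin by blast
  have \<psi>\<phi>: "\<psi> (\<phi> q) = q" if "q \<in> U" for q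
    using \<psi> that chart_subset[OF c(1)] by (auto simp: homeomorphic_maps_def)
  have zero: "\<rho> q = 0" if "q \<notin> \<psi> ` K" for q
  proof (cases "q \<in> U")
    case True
    then have "\<phi> q \<notin> K" "\<phi> q \<in> span (mcoords M)"
      using \<psi>\<phi>[OF True] that spanU by (metis imageI, blast)
    then show ?thesis
      using \<rho>0(3) by (auto simp: \<rho>_def K_def)
  qed (simp add: \<rho>_def)
  have KV: "\<psi> ` K \<subseteq> U \<inter> V"
    using KU \<psi>\<phi> by force
  have ev0: "\<forall>\<^sub>F r in near q. \<rho> r = 0" if "q \<in> mcarrier M - (U \<inter> V)" for q
  proof -
    have "\<forall>\<^sub>F r in near q. r \<in> mcarrier M - \<psi> ` K"
      by (rule eventually_nhdsin_openin) (use clo that KV in \<open>auto simp: closedin_def\<close>)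
    then show ?thesis
      by eventually_elim (simp add: zero)
  qed
  show ?thesis
  proof
    show "\<rho> \<in> smooth_functions M"
      unfolding smooth_functions_iff
    proof
      fix q assume q: "q \<in> mcarrier M"
      show "smooth_at M q \<rho>"
      proof (cases "q \<in> U")
        case True
        show ?thesis
        proof (rule smooth_atI[OF c(1) True chart_image[OF c(1)]])
          show "smooth_on (mcoords M) (\<phi> ` U) (\<lambda>x. \<rho> (inv_into U \<phi> x))"
            by (rule smooth_on_cong[OF chart_image[OF c(1)] smooth_on_mono[OF \<rho>0(1) spanU order_refl]])
              (auto simp: chart_inv[OF c(1)] \<rho>_def)
        qed (use True in auto)
      next
        case False
        then show ?thesis
          using smooth_at_cong[OF q _ smooth_at_const[OF q, of 0]] ev0[of q] q
          by (auto elim: eventually_mono)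
      qed
    qed
    have "mopen (ball (\<phi> p) (s/2) \<inter> span (mcoords M))"
      by (simp add: Int_commute openin_open_Int)
    then have "\<forall>\<^sub>F q in near p. q \<in> {q \<in> U. \<phi> q \<in> ball (\<phi> p) (s/2) \<inter> span (mcoords M)}"
      by (intro eventually_nhdsin_openin chart_vimage_openin[OF c(1)]) (use c(2) s ps in auto)
    then show "\<forall>\<^sub>F q in near p. \<rho> q = 1"
      by eventually_elim (auto simp: \<rho>_def \<rho>0(2))
    show "\<forall>\<^sub>F r in near q. \<rho> r = 0" if "q \<in> mcarrier M - V" for q
      using ev0 that by blast
  qed
qed

text \<open>Derivations act on global functions, so a function that is smooth near p only, such as a
  coordinate, has to be replaced by a global one with the same germ.\<close>

lemma smooth_extension:
  assumes p: "p \<in> mcarrier M" and f: "smooth_at M p f"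
  obtains h where "h \<in> smooth_functions M" "\<forall>\<^sub>F q in near p. h q = f q"
proof -
  obtain V where V: "openin (mtop M) V" "p \<in> V" "\<And>q. q \<in> V \<Longrightarrow> smooth_at M q f"
    using eventually_smooth_at[OF p f] p unfolding eventually_nhdsin by blast
  obtain \<rho> where \<rho>: "\<rho> \<in> smooth_functions M" "\<forall>\<^sub>F q in near p. \<rho> q = 1"
    "\<And>q. q \<in> mcarrier M - V \<Longrightarrow> \<forall>\<^sub>F r in near q. \<rho> r = 0"
    using bump[OF V(1,2)] by blast
  show ?thesis
  proof
    show "(\<lambda>q. \<rho> q * f q) \<in> smooth_functions M"
      unfolding smooth_functions_iff
    proof
      fix q assume q: "q \<in> mcarrier M"
      show "smooth_at M q (\<lambda>q. \<rho> q * f q)"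
      proof (cases "q \<in> V")
        case True
        then show ?thesis
          using smooth_at_mult[OF q smooth_functionsD[OF \<rho>(1) q] V(3)] by blast
      next
        case False
        then have "\<forall>\<^sub>F r in near q. 0 = \<rho> r * f r"
          using \<rho>(3)[of q] q by (auto elim: eventually_mono)
        then show ?thesis
          by (rule smooth_at_cong[OF q _ smooth_at_const[OF q]])
      qed
    qed
    show "\<forall>\<^sub>F q in near p. \<rho> q * f q = f q"
      using \<rho>(2) by eventually_elim simp
  qed
qed

lemma smooth_function_add: "f \<in> smooth_functions M \<Longrightarrow> h \<in> smooth_functions M \<Longrightarrow> (\<lambda>q. f q + h q) \<in> smooth_functions M"
  by (simp add: smooth_functions_iff smooth_at_add)

lemma smooth_function_diff: "f \<in> smooth_functions M \<Longrightarrow> h \<in> smooth_functions M \<Longrightarrow> (\<lambda>q. f q - h q) \<in> smooth_functions M"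
  by (simp add: smooth_functions_iff smooth_at_diff)

lemma smooth_function_mult: "f \<in> smooth_functions M \<Longrightarrow> h \<in> smooth_functions M \<Longrightarrow> (\<lambda>q. f q * h q) \<in> smooth_functions M"
  by (simp add: smooth_functions_iff smooth_at_mult)

lemma smooth_function_const: "(\<lambda>q. c) \<in> smooth_functions M"
  by (simp add: smooth_functions_iff smooth_at_const)

lemma smooth_function_sum:
  "(\<And>i. i \<in> I \<Longrightarrow> f i \<in> smooth_functions M) \<Longrightarrow> (\<lambda>q. \<Sum>i\<in>I. f i q) \<in> smooth_functions M"
  by (simp add: smooth_functions_iff smooth_at_sum)

lemma smooth_function_cong:
  assumes "f \<in> smooth_functions M" "\<And>q. q \<in> mcarrier M \<Longrightarrow> f q = h q"
  shows "h \<in> smooth_functions M"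
  unfolding smooth_functions_iff
proof
  fix p assume p: "p \<in> mcarrier M"
  have "\<forall>\<^sub>F q in near p. q \<in> mcarrier M"
    using eventually_nhdsin_openin[OF openin_topspace p] .
  then have "\<forall>\<^sub>F q in near p. f q = h q"
    by eventually_elim (rule assms(2))
  then show "smooth_at M p h"
    using smooth_at_cong[OF p _ smooth_functionsD[OF assms(1) p]] by blast
qed

end


subsection \<open>Tangent vectors and vector fields\<close>

text \<open>The coordinate vector field of a chart. The value 0 on other functions follows the
  convention of \<open>tangent_space\<close>.\<close>

definition coord_vec ::
    "('a, 'e::euclidean_space) manifold \<Rightarrow> 'a set \<Rightarrow> ('a \<Rightarrow> 'e) \<Rightarrow> 'e \<Rightarrow> 'a vfield" where
  "coord_vec M U \<phi> b q f =
     (if f \<in> smooth_functions M then partial_deriv b (\<lambda>x. f (inv_into U \<phi> x)) (\<phi> q) else 0)"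

context smooth_mfd
begin

lemma tangent_add:
  "v \<in> tangent_space M p \<Longrightarrow> f \<in> smooth_functions M \<Longrightarrow> h \<in> smooth_functions M \<Longrightarrow> v (\<lambda>x. f x + h x) = v f + v h"
  by (simp add: tangent_space_def)

lemma tangent_scale:
  "v \<in> tangent_space M p \<Longrightarrow> f \<in> smooth_functions M \<Longrightarrow> v (\<lambda>x. c * f x) = c * v f"
  by (simp add: tangent_space_def)

lemma tangent_mult:
  "v \<in> tangent_space M p \<Longrightarrow> f \<in> smooth_functions M \<Longrightarrow> h \<in> smooth_functions M \<Longrightarrow>
   v (\<lambda>x. f x * h x) = f p * v h + h p * v f"
  by (simp add: tangent_space_def)

lemma tangent_nonsmooth: "v \<in> tangent_space M p \<Longrightarrow> f \<notin> smooth_functions M \<Longrightarrow> v f = 0"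
  by (simp add: tangent_space_def)

lemma tangentI:
  assumes "\<And>f h. f \<in> smooth_functions M \<Longrightarrow> h \<in> smooth_functions M \<Longrightarrow> v (\<lambda>x. f x + h x) = v f + v h"
    and "\<And>c f. f \<in> smooth_functions M \<Longrightarrow> v (\<lambda>x. c * f x) = c * v f"
    and "\<And>f h. f \<in> smooth_functions M \<Longrightarrow> h \<in> smooth_functions M \<Longrightarrow>
      v (\<lambda>x. f x * h x) = f p * v h + h p * v f"
    and "\<And>f. f \<notin> smooth_functions M \<Longrightarrow> v f = 0"
  shows "v \<in> tangent_space M p"
  using assms by (simp add: tangent_space_def)

lemma tangent_zero: "(\<lambda>f. 0) \<in> tangent_space M p"
  by (simp add: tangent_space_def)

lemma tangent_space_add:
  "v \<in> tangent_space M p \<Longrightarrow> w \<in> tangent_space M p \<Longrightarrow> (\<lambda>f. v f + w f) \<in> tangent_space M p"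
  by (simp add: tangent_space_def algebra_simps)

lemma tangent_space_scale:
  "v \<in> tangent_space M p \<Longrightarrow> (\<lambda>f. c * v f) \<in> tangent_space M p"
  by (simp add: tangent_space_def algebra_simps)

lemma tangent_space_lincomb:
  "(\<And>b. b \<in> A \<Longrightarrow> v b \<in> tangent_space M p) \<Longrightarrow> (\<lambda>f. \<Sum>b\<in>A. c b * v b f) \<in> tangent_space M p"
proof (induction A rule: infinite_finite_induct)
  case (insert a A)
  then show ?case
    using tangent_space_add[OF tangent_space_scale[of "v a" p "c a"], of "\<lambda>f. \<Sum>b\<in>A. c b * v b f"] by simp
qed (simp_all add: tangent_zero)

lemma tangent_diff:
  assumes v: "v \<in> tangent_space M p" and f: "f \<in> smooth_functions M" and h: "h \<in> smooth_functions M"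
  shows "v (\<lambda>x. f x - h x) = v f - v h"
proof -
  have "(\<lambda>x. (-1) * h x) \<in> smooth_functions M"
    by (intro smooth_function_mult smooth_function_const h)
  then show ?thesis
    using tangent_add[OF v f, of "\<lambda>x. (-1) * h x"] tangent_scale[OF v h, of "-1"] by simp
qed

lemma tangent_const:
  assumes v: "v \<in> tangent_space M p"
  shows "v (\<lambda>x. c) = 0"
proof -
  have "v (\<lambda>x. 1 * 1) = 1 * v (\<lambda>x. 1) + 1 * v (\<lambda>x. 1)"
    by (rule tangent_mult[OF v smooth_function_const smooth_function_const])
  then have "v (\<lambda>x. 1) = 0"
    by simp
  then show ?thesis
    using tangent_scale[OF v smooth_function_const, of c 1] by simp
qed

lemma tangent_sum:
  assumes v: "v \<in> tangent_space M p"
  shows "(\<And>i. i \<in> I \<Longrightarrow> f i \<in> smooth_functions M) \<Longrightarrow> v (\<lambda>x. \<Sum>i\<in>I. f i x) = (\<Sum>i\<in>I. v (f i))"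
proof (induction I rule: infinite_finite_induct)
  case (insert i I)
  then show ?case
    using tangent_add[OF v, of "f i" "\<lambda>x. \<Sum>i\<in>I. f i x"] smooth_function_sum[of I f] by simp
qed (simp_all add: tangent_const[OF v])

text \<open>A function that is supported off the carrier is smooth, so values off the carrier are junk that
  has to be cut away by hand.\<close>

lemma smooth_function_off: "(\<lambda>q. if q \<in> mcarrier M then 0 else 1) \<in> smooth_functions M"
  by (rule smooth_function_cong[OF smooth_function_const[of 0]]) simp

text \<open>Such an f equals its product with the smooth function that is 0 on the carrier and 1 off
  it. Both factors vanish at p, so the product rule gives 0.\<close>

lemma tangent_zero_on_carrier:
  assumes p: "p \<in> mcarrier M" and v: "v \<in> tangent_space M p"
    and f: "\<And>q. q \<in> mcarrier M \<Longrightarrow> f q = 0"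
  shows "v f = 0"
proof -
  let ?\<chi> = "\<lambda>q. if q \<in> mcarrier M then 0 else (1::real)"
  have fC: "f \<in> smooth_functions M"
    by (rule smooth_function_cong[OF smooth_function_const[of 0]]) (simp add: f)
  have "(\<lambda>q. ?\<chi> q * f q) = f"
    using f by auto
  then show ?thesis
    using tangent_mult[OF v smooth_function_off fC] f[OF p] p by simp
qed

text \<open>A bump function \<rho> makes \<rho> (f - h) vanish on the carrier. Since \<rho> p = 1
  and f - h vanishes at p, the product rule leaves v (f - h) = 0.\<close>

lemma tangent_local:
  assumes p: "p \<in> mcarrier M" and v: "v \<in> tangent_space M p"
    and f: "f \<in> smooth_functions M" and h: "h \<in> smooth_functions M"
    and ev: "\<forall>\<^sub>F q in near p. f q = h q"
  shows "v f = v h"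
proof -
  obtain V where V: "openin (mtop M) V" "p \<in> V" "\<And>q. q \<in> V \<Longrightarrow> f q = h q"
    using ev p unfolding eventually_nhdsin by blast
  obtain \<rho> where \<rho>: "\<rho> \<in> smooth_functions M" "\<forall>\<^sub>F q in near p. \<rho> q = 1"
    "\<And>q. q \<in> mcarrier M - V \<Longrightarrow> \<forall>\<^sub>F r in near q. \<rho> r = 0"
    using bump[OF V(1,2)] by blast
  have \<rho>p: "\<rho> p = 1"
    using eventually_nhdsin_self[OF \<rho>(2) p] .
  have \<rho>0: "\<rho> q = 0" if "q \<in> mcarrier M" "q \<notin> V" for q
    using eventually_nhdsin_self[OF \<rho>(3)[of q]] that by simp
  have d: "(\<lambda>q. f q - h q) \<in> smooth_functions M"
    by (rule smooth_function_diff[OF f h])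
  have "v (\<lambda>q. \<rho> q * (f q - h q)) = 0"
    by (rule tangent_zero_on_carrier[OF p v]) (use \<rho>0 V(3) in fastforce)
  then have "v (\<lambda>q. f q - h q) = 0"
    using tangent_mult[OF v \<rho>(1) d] \<rho>p V(2,3) by simp
  then show ?thesis
    using tangent_diff[OF v f h] by simp
qed

lemma tangent_cong:
  assumes p: "p \<in> mcarrier M" and v: "v \<in> tangent_space M p"
    and f: "f \<in> smooth_functions M" and eq: "\<And>q. q \<in> mcarrier M \<Longrightarrow> f q = h q"
  shows "v f = v h"
proof (rule tangent_local[OF p v f smooth_function_cong[OF f eq]])
  show "\<forall>\<^sub>F q in near p. f q = h q"
    using eventually_nhdsin_openin[OF openin_topspace p] by eventually_elim (rule eq)
qed

lemma smooth_on_chart_function: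
  "(U, \<phi>) \<in> max_atlas M \<Longrightarrow> f \<in> smooth_functions M \<Longrightarrow>
   smooth_on (mcoords M) (\<phi> ` U) (\<lambda>x. f (inv_into U \<phi> x))"
  using smooth_on_chart smooth_functionsD chart_subset by blast

lemma coord_vec_deriv:
  assumes c: "(U, \<phi>) \<in> max_atlas M" "q \<in> U" and b: "b \<in> mcoords M" and f: "f \<in> smooth_functions M"
  shows "((\<lambda>t. f (inv_into U \<phi> (\<phi> q + t *\<^sub>R b))) has_real_derivative coord_vec M U \<phi> b q f) (at 0)"
  using smooth_on_has_partial[OF smooth_on_chart_function[OF c(1) f] b, of "\<phi> q"] c(2) f
  by (simp add: coord_vec_def)

lemma coord_vec_eqI:
  assumes "f \<in> smooth_functions M"
    "((\<lambda>t. f (inv_into U \<phi> (\<phi> q + t *\<^sub>R b))) has_real_derivative D) (at 0)"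
  shows "coord_vec M U \<phi> b q f = D"
  using DERIV_imp_deriv[OF assms(2)] assms(1) by (simp add: coord_vec_def partial_deriv_def)

lemma coord_vec_tangent:
  assumes c: "(U, \<phi>) \<in> max_atlas M" "q \<in> U" and b: "b \<in> mcoords M"
  shows "coord_vec M U \<phi> b q \<in> tangent_space M q"
proof (rule tangentI)
  fix f h assume f: "f \<in> smooth_functions M" and h: "h \<in> smooth_functions M"
  note df = coord_vec_deriv[OF c b f] and dh = coord_vec_deriv[OF c b h]
  show "coord_vec M U \<phi> b q (\<lambda>x. f x + h x) = coord_vec M U \<phi> b q f + coord_vec M U \<phi> b q h"
    by (rule coord_vec_eqI[OF smooth_function_add[OF f h] DERIV_add[OF df dh]])
  show "coord_vec M U \<phi> b q (\<lambda>x. f x * h x) = f q * coord_vec M U \<phi> b q h + h q * coord_vec M U \<phi> b q f"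
    using coord_vec_eqI[OF smooth_function_mult[OF f h] DERIV_mult[OF df dh]] chart_inv[OF c]
    by simp
next
  fix k f assume f: "f \<in> smooth_functions M"
  show "coord_vec M U \<phi> b q (\<lambda>x. k * f x) = k * coord_vec M U \<phi> b q f"
    by (rule coord_vec_eqI[OF smooth_function_mult[OF smooth_function_const f]
          DERIV_cmult[OF coord_vec_deriv[OF c b f]]])
qed (simp add: coord_vec_def)

lemma coord_vec_smooth_at:
  assumes c: "(U, \<phi>) \<in> max_atlas M" "q \<in> U" and b: "b \<in> mcoords M" and f: "f \<in> smooth_functions M"
  shows "smooth_at M q (\<lambda>q. coord_vec M U \<phi> b q f)"
proof (rule smooth_atI[OF c chart_image[OF c(1)]])
  show "smooth_on (mcoords M) (\<phi> ` U) (\<lambda>x. coord_vec M U \<phi> b (inv_into U \<phi> x) f)"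
    by (rule smooth_on_cong[OF chart_image[OF c(1)] smooth_on_partial[OF smooth_on_chart_function[OF c(1) f] b]])
      (auto simp: coord_vec_def f chart_inv[OF c(1)])
qed (use c in auto)

lemma coord_vec_coordinate:
  assumes c: "(U, \<phi>) \<in> max_atlas M" "q \<in> U" and b: "b \<in> mcoords M" "d \<in> mcoords M"
    and x: "x \<in> smooth_functions M" "\<forall>\<^sub>F r in near q. x r = \<phi> r \<bullet> d"
  shows "coord_vec M U \<phi> b q x = (if b = d then 1 else 0)"
proof -
  obtain V where V: "openin (mtop M) V" "q \<in> V" "\<And>r. r \<in> V \<Longrightarrow> x r = \<phi> r \<bullet> d"
    using x(2) c chart_subset[OF c(1)] unfolding eventually_nhdsin by blast
  have o: "mopen (\<phi> ` (U \<inter> V))"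
    by (intro chart_image_openin[OF c(1)] openin_Int chart_openin[OF c(1)] V(1)) auto
  have "partial_deriv b (\<lambda>y. x (inv_into U \<phi> y)) (\<phi> q) = partial_deriv b (\<lambda>y. y \<bullet> d) (\<phi> q)"
    by (rule partial_cong(1)[OF o _ _ b(1)]) (use c V in \<open>auto simp: chart_inv\<close>)
  also have "\<dots> = b \<bullet> d"
    unfolding partial_deriv_def
    by (rule DERIV_imp_deriv) (auto intro!: derivative_eq_intros simp: inner_add_left)
  also have "\<dots> = (if b = d then 1 else 0)"
    using b coords_Basis by (auto simp: inner_Basis subset_iff)
  finally show ?thesis
    using x(1) by (simp add: coord_vec_def)
qed

text \<open>By Hadamard's lemma f is, near q, a constant plus a sum of products of centred
  coordinates with functions whose values at q are the partial derivatives. The product rule for v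
  then leaves only the coefficients v (x b).\<close>

lemma tangent_expansion:
  assumes c: "(U, \<phi>) \<in> max_atlas M" "q \<in> U" and v: "v \<in> tangent_space M q"
    and x: "\<And>b. b \<in> mcoords M \<Longrightarrow> x b \<in> smooth_functions M"
      "\<And>b. b \<in> mcoords M \<Longrightarrow> \<forall>\<^sub>F r in near q. x b r = \<phi> r \<bullet> b"
  shows "v f = (\<Sum>b\<in>mcoords M. v (x b) * coord_vec M U \<phi> b q f)"
proof (cases "f \<in> smooth_functions M")
  case False
  then show ?thesis
    using tangent_nonsmooth[OF v] by (simp add: coord_vec_def)
next
  case f: True
  let ?B = "mcoords M" and ?F = "\<lambda>x. f (inv_into U \<phi> x)"
  have q: "q \<in> mcarrier M"
    using c chart_subset by blast
  obtain r where r: "r > 0" "ball (\<phi> q) r \<inter> span ?B \<subseteq> \<phi> ` U"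
    using chart_image[OF c(1)] c(2) by (metis imageI openin_contains_ball)
  define W where "W = ball (\<phi> q) r \<inter> span ?B"
  have W: "mopen W"
    unfolding W_def by (simp add: Int_commute openin_open_Int)
  have cvx: "convex W"
    unfolding W_def by (intro convex_Int convex_ball subspace_imp_convex subspace_span)
  have qW: "\<phi> q \<in> W"
    using r(1) c(2) openin_subset[OF chart_image[OF c(1)]] by (auto simp: W_def)
  have FW: "smooth_on ?B W ?F"
    using smooth_on_chart_function[OF c(1) f] by (rule smooth_on_mono) (use r in \<open>auto simp: W_def\<close>)
  obtain h where h: "\<And>b. b \<in> ?B \<Longrightarrow> smooth_on ?B W (h b)" "\<And>b. h b (\<phi> q) = partial_deriv b ?F (\<phi> q)"
    "\<And>x. x \<in> W \<Longrightarrow> ?F x = ?F (\<phi> q) + (\<Sum>b\<in>?B. ((x - \<phi> q) \<bullet> b) * h b x)"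
    using smooth_on_hadamard[OF coords_Basis W cvx qW FW] by blast
  \<comment> \<open>The Hadamard coefficients live on a ball in the chart; v can be applied only
    after they have been replaced by global functions with the same germs.\<close>
  have "\<exists>k. k \<in> smooth_functions M \<and> (\<forall>\<^sub>F r in near q. k r = h b (\<phi> r))" if b: "b \<in> ?B" for b
  proof -
    have "smooth_at M q (\<lambda>r. h b (\<phi> r))"
    proof (rule smooth_atI[OF c W qW])
      show WU: "W \<subseteq> \<phi> ` U"
        using r(2) by (auto simp: W_def)
      show "smooth_on ?B W (\<lambda>x. h b (\<phi> (inv_into U \<phi> x)))"
        by (rule smooth_on_cong[OF W h(1)[OF b]]) (use WU in \<open>auto simp: f_inv_into_f\<close>)
    qed
    then show ?thesis
      using smooth_extension[OF q] by metis
  qed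
  then obtain k where k: "\<And>b. b \<in> ?B \<Longrightarrow> k b \<in> smooth_functions M"
    "\<And>b. b \<in> ?B \<Longrightarrow> \<forall>\<^sub>F r in near q. k b r = h b (\<phi> r)"
    by metis
  let ?y = "\<lambda>b r. x b r - \<phi> q \<bullet> b"
  have y: "?y b \<in> smooth_functions M" if "b \<in> ?B" for b
    by (intro smooth_function_diff x smooth_function_const that)
  let ?G = "\<lambda>r. f q + (\<Sum>b\<in>?B. ?y b r * k b r)"
  have G: "?G \<in> smooth_functions M" "(\<lambda>r. \<Sum>b\<in>?B. ?y b r * k b r) \<in> smooth_functions M"
    by (intro smooth_function_add smooth_function_const smooth_function_sum smooth_function_mult y k; assumption)+
  have ev: "\<forall>\<^sub>F r in near q. \<forall>b\<in>?B. x b r = \<phi> r \<bullet> b \<and> k b r = h b (\<phi> r)"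
    using x(2) k(2) by (intro eventually_ball_finite finite_coords ballI eventually_conj) auto
  moreover have "\<forall>\<^sub>F r in near q. r \<in> {r \<in> U. \<phi> r \<in> W}"
    by (rule eventually_nhdsin_openin[OF chart_vimage_openin[OF c(1) W]]) (use c qW in auto)
  ultimately have "\<forall>\<^sub>F r in near q. f r = ?G r"
  proof eventually_elim
    case (elim r)
    then have "f r = f q + (\<Sum>b\<in>?B. ((\<phi> r - \<phi> q) \<bullet> b) * h b (\<phi> r))"
      using h(3)[of "\<phi> r"] c by (simp add: chart_inv)
    also have "\<dots> = ?G r"
      using elim(1) by (simp add: inner_diff_left)
    finally show ?case .
  qed
  then have "v f = v ?G"
    by (rule tangent_local[OF q v f G(1)])
  also have "\<dots> = (\<Sum>b\<in>?B. v (\<lambda>r. ?y b r * k b r))"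
  proof -
    have "v ?G = v (\<lambda>r. f q) + v (\<lambda>r. \<Sum>b\<in>?B. ?y b r * k b r)"
      by (rule tangent_add[OF v smooth_function_const G(2)])
    also have "v (\<lambda>r. \<Sum>b\<in>?B. ?y b r * k b r) = (\<Sum>b\<in>?B. v (\<lambda>r. ?y b r * k b r))"
      by (rule tangent_sum[OF v]) (intro smooth_function_mult y k)
    finally show ?thesis
      by (simp add: tangent_const[OF v])
  qed
  also have "\<dots> = (\<Sum>b\<in>?B. v (x b) * coord_vec M U \<phi> b q f)"
  proof (rule sum.cong)
    fix b assume b: "b \<in> ?B"
    have e: "x b q = \<phi> q \<bullet> b" "k b q = h b (\<phi> q)"
      using eventually_nhdsin_self[OF ev q] b by auto
    have "v (\<lambda>r. ?y b r * k b r) = ?y b q * v (k b) + k b q * v (?y b)"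
      by (rule tangent_mult[OF v y[OF b] k(1)[OF b]])
    also have "v (?y b) = v (x b)"
      using tangent_diff[OF v x(1)[OF b] smooth_function_const] tangent_const[OF v] by simp
    finally show "v (\<lambda>r. ?y b r * k b r) = v (x b) * coord_vec M U \<phi> b q f"
      using e h(2) f by (simp add: coord_vec_def)
  qed simp
  finally show ?thesis .
qed

section \<open>Vector fields, Lie bracket and local frames\<close>

lemma field_tangent: "X \<in> vector_fields M \<Longrightarrow> p \<in> mcarrier M \<Longrightarrow> X p \<in> tangent_space M p"
  by (simp add: vector_fields_def)

lemma field_smooth: "X \<in> vector_fields M \<Longrightarrow> f \<in> smooth_functions M \<Longrightarrow> (\<lambda>p. X p f) \<in> smooth_functions M"
  by (simp add: vector_fields_def)

lemma fieldI:
  assumes "\<And>p. p \<in> mcarrier M \<Longrightarrow> X p \<in> tangent_space M p"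
    and "\<And>p f. p \<in> mcarrier M \<Longrightarrow> f \<in> smooth_functions M \<Longrightarrow> smooth_at M p (\<lambda>q. X q f)"
  shows "X \<in> vector_fields M"
  using assms by (simp add: vector_fields_def smooth_functions_iff)

lemma field_add:
  "X \<in> vector_fields M \<Longrightarrow> Y \<in> vector_fields M \<Longrightarrow> (\<lambda>q f. X q f + Y q f) \<in> vector_fields M"
  by (simp add: vector_fields_def tangent_space_add smooth_function_add)

lemma field_mult:
  "h \<in> smooth_functions M \<Longrightarrow> X \<in> vector_fields M \<Longrightarrow> (\<lambda>q f. h q * X q f) \<in> vector_fields M"
  by (simp add: vector_fields_def tangent_space_scale smooth_function_mult)

lemma field_zero: "(\<lambda>q f. 0) \<in> vector_fields M"
  by (simp add: vector_fields_def tangent_zero smooth_function_const)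

lemma field_lincomb:
  assumes "\<And>b. b \<in> A \<Longrightarrow> E b \<in> vector_fields M" "\<And>b. b \<in> A \<Longrightarrow> h b \<in> smooth_functions M"
  shows "(\<lambda>q f. \<Sum>b\<in>A. h b q * E b q f) \<in> vector_fields M"
  using assms by (auto simp: vector_fields_def intro!: tangent_space_lincomb smooth_function_sum smooth_function_mult)

lemma field_off_nonsmooth:
  "X \<in> vector_fields M \<Longrightarrow> q \<in> mcarrier M \<Longrightarrow> f \<notin> smooth_functions M \<Longrightarrow> X q f = 0"
  using tangent_nonsmooth[OF field_tangent] .

lemma field_field_nonsmooth:
  assumes "X \<in> vector_fields M" "v \<in> tangent_space M p" "p \<in> mcarrier M" "f \<notin> smooth_functions M"
  shows "v (\<lambda>q. X q f) = 0"
  by (rule tangent_zero_on_carrier[OF assms(3,2)]) (rule field_off_nonsmooth[OF assms(1) _ assms(4)])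

text \<open>\<open>Z\<close> obeys these rules at points of the carrier, while v is applied to
  functions on the whole type; \<open>tangent_cong\<close> bridges the gap. The mixed terms of the
  product rule are those that cancel in a Lie bracket.\<close>

lemma tangent_field:
  assumes p: "p \<in> mcarrier M" and v: "v \<in> tangent_space M p" and Z: "Z \<in> vector_fields M"
    and f: "f \<in> smooth_functions M"
  shows tangent_field_add: "h \<in> smooth_functions M \<Longrightarrow>
      v (\<lambda>q. Z q (\<lambda>x. f x + h x)) = v (\<lambda>q. Z q f) + v (\<lambda>q. Z q h)"
    and tangent_field_scale: "v (\<lambda>q. Z q (\<lambda>x. c * f x)) = c * v (\<lambda>q. Z q f)"
    and tangent_field_mult: "h \<in> smooth_functions M \<Longrightarrow> v (\<lambda>q. Z q (\<lambda>x. f x * h x)) =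
      f p * v (\<lambda>q. Z q h) + Z p h * v f + (h p * v (\<lambda>q. Z q f) + Z p f * v h)"
proof -
  note Zf = field_smooth[OF Z f]
  show "v (\<lambda>q. Z q (\<lambda>x. c * f x)) = c * v (\<lambda>q. Z q f)"
    using tangent_cong[OF p v field_smooth[OF Z smooth_function_mult[OF smooth_function_const f]],
        of c "\<lambda>q. c * Z q f"] tangent_scale[OF field_tangent[OF Z] f] tangent_scale[OF v Zf] by simp
  assume h: "h \<in> smooth_functions M"
  note Zh = field_smooth[OF Z h]
  show "v (\<lambda>q. Z q (\<lambda>x. f x + h x)) = v (\<lambda>q. Z q f) + v (\<lambda>q. Z q h)"
    using tangent_cong[OF p v field_smooth[OF Z smooth_function_add[OF f h]],
        of "\<lambda>q. Z q f + Z q h"] tangent_add[OF field_tangent[OF Z] f h] tangent_add[OF v Zf Zh] by simp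
  have "v (\<lambda>q. Z q (\<lambda>x. f x * h x)) = v (\<lambda>q. f q * Z q h + h q * Z q f)"
    using tangent_cong[OF p v field_smooth[OF Z smooth_function_mult[OF f h]],
        of "\<lambda>q. f q * Z q h + h q * Z q f"] tangent_mult[OF field_tangent[OF Z] f h] by simp
  also have "\<dots> = v (\<lambda>q. f q * Z q h) + v (\<lambda>q. h q * Z q f)"
    using tangent_add[OF v smooth_function_mult[OF f Zh] smooth_function_mult[OF h Zf]] .
  finally show "v (\<lambda>q. Z q (\<lambda>x. f x * h x)) =
      f p * v (\<lambda>q. Z q h) + Z p h * v f + (h p * v (\<lambda>q. Z q f) + Z p f * v h)"
    using tangent_mult[OF v f Zh] tangent_mult[OF v h Zf] by simp
qed

lemma bracket_field:
  assumes X: "X \<in> vector_fields M" and Y: "Y \<in> vector_fields M"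
  shows "lie_bracket X Y \<in> vector_fields M"
proof (rule fieldI)
  fix p assume p: "p \<in> mcarrier M"
  note Xp = field_tangent[OF X p] and Yp = field_tangent[OF Y p]
  note add = tangent_field_add[OF p] and scale = tangent_field_scale[OF p] and mult = tangent_field_mult[OF p]
  show "lie_bracket X Y p \<in> tangent_space M p"
  proof (rule tangentI)
    fix f h assume f: "f \<in> smooth_functions M" and h: "h \<in> smooth_functions M"
    show "lie_bracket X Y p (\<lambda>x. f x + h x) = lie_bracket X Y p f + lie_bracket X Y p h"
      unfolding lie_bracket_def add[OF Xp Y f h] add[OF Yp X f h] by simp
    show "lie_bracket X Y p (\<lambda>x. f x * h x) = f p * lie_bracket X Y p h + h p * lie_bracket X Y p f"
      unfolding lie_bracket_def mult[OF Xp Y f h] mult[OF Yp X f h] by (simp add: algebra_simps)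
  next
    fix f c assume f: "f \<in> smooth_functions M"
    show "lie_bracket X Y p (\<lambda>x. c * f x) = c * lie_bracket X Y p f"
      unfolding lie_bracket_def scale[OF Xp Y f] scale[OF Yp X f] by (simp add: algebra_simps)
  next
    fix f assume f: "f \<notin> smooth_functions M"
    show "lie_bracket X Y p f = 0"
      unfolding lie_bracket_def field_field_nonsmooth[OF X Yp p f] field_field_nonsmooth[OF Y Xp p f] by simp
  qed
  fix f assume f: "f \<in> smooth_functions M"
  show "smooth_at M p (\<lambda>q. lie_bracket X Y q f)"
    unfolding lie_bracket_def
    by (rule smooth_at_diff[OF p smooth_functionsD[OF field_smooth[OF X field_smooth[OF Y f]] p]
          smooth_functionsD[OF field_smooth[OF Y field_smooth[OF X f]] p]])
qed

text \<open>The functions x b play the role of dual coordinates, so the coefficients of v are the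
  numbers v (x b). These depend smoothly on the point when v runs through a smooth field.\<close>

definition dual_frame_at :: "'a \<Rightarrow> ('e \<Rightarrow> 'a \<Rightarrow> real) \<Rightarrow> ('e \<Rightarrow> 'a vfield) \<Rightarrow> bool" where
  "dual_frame_at q x E \<longleftrightarrow>
     (\<forall>b\<in>mcoords M. \<forall>d\<in>mcoords M. E b q (x d) = (if b = d then 1 else 0)) \<and>
     (\<forall>v\<in>tangent_space M q. \<forall>f. v f = (\<Sum>b\<in>mcoords M. v (x b) * E b q f))"

text \<open>Coordinates are extended by \<open>smooth_extension\<close> and coordinate fields by a
  bump function. The extensions agree with the chart only near p, which is why every property is
  stated as an eventual one.\<close>

lemma local_frame:
  assumes c: "(U, \<phi>) \<in> max_atlas M" "p \<in> U"
  obtains x E where "\<And>b. x b \<in> smooth_functions M" "\<And>b. b \<in> mcoords M \<Longrightarrow> E b \<in> vector_fields M"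
    "\<forall>\<^sub>F q in near p. q \<in> U \<and> (\<forall>b\<in>mcoords M. x b q = \<phi> q \<bullet> b \<and> E b q = coord_vec M U \<phi> b q) \<and>
       dual_frame_at q x E"
proof -
  have p: "p \<in> mcarrier M"
    using c chart_subset by blast
  have "\<exists>x. x \<in> smooth_functions M \<and> (\<forall>\<^sub>F q in near p. x q = \<phi> q \<bullet> b)" for b
    using smooth_extension[OF p smooth_at_coordinate[OF c]] by metis
  then obtain x where x: "\<And>b. x b \<in> smooth_functions M" "\<And>b. \<forall>\<^sub>F q in near p. x b q = \<phi> q \<bullet> b"
    by metis
  obtain \<rho> where \<rho>: "\<rho> \<in> smooth_functions M" "\<forall>\<^sub>F q in near p. \<rho> q = 1"
    "\<And>q. q \<in> mcarrier M - U \<Longrightarrow> \<forall>\<^sub>F r in near q. \<rho> r = 0"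
    using bump[OF chart_openin[OF c(1)] c(2)] by blast
  define E where "E b q f = (if q \<in> U then \<rho> q * coord_vec M U \<phi> b q f else 0)" for b q f
  have E: "E b \<in> vector_fields M" if b: "b \<in> mcoords M" for b
  proof (rule fieldI)
    fix q assume q: "q \<in> mcarrier M"
    show "E b q \<in> tangent_space M q"
    proof (cases "q \<in> U")
      case True
      then show ?thesis
        using tangent_space_scale[OF coord_vec_tangent[OF c(1) True b]] by (simp add: E_def[abs_def])
    qed (simp add: E_def[abs_def] tangent_zero)
    fix f assume f: "f \<in> smooth_functions M"
    show "smooth_at M q (\<lambda>q. E b q f)"
    proof (cases "q \<in> U")
      case True
      have "\<forall>\<^sub>F r in near q. \<rho> r * coord_vec M U \<phi> b r f = E b r f"
        using eventually_nhdsin_openin[OF chart_openin[OF c(1)] True]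
        by eventually_elim (simp add: E_def)
      then show ?thesis
        by (rule smooth_at_cong[OF q _ smooth_at_mult[OF q smooth_functionsD[OF \<rho>(1) q]
              coord_vec_smooth_at[OF c(1) True b f]]])
    next
      case False
      then have "\<forall>\<^sub>F r in near q. 0 = E b r f"
        using \<rho>(3)[of q] q by (auto simp: E_def elim: eventually_mono)
      then show ?thesis
        by (rule smooth_at_cong[OF q _ smooth_at_const[OF q]])
    qed
  qed
  have "\<forall>\<^sub>F q in near p. \<forall>b\<in>mcoords M. x b q = \<phi> q \<bullet> b"
    using x(2) by (intro eventually_ball_finite finite_coords ballI)
  \<comment> \<open>Evaluating coordinate vectors at q on x b requires that x b is the coordinate in
    a neighbourhood of q, not only at q.\<close>
  from eventually_eventually_nhdsin[OF this]
  have "\<forall>\<^sub>F q in near p. q \<in> U \<and> (\<forall>b\<in>mcoords M. x b q = \<phi> q \<bullet> b \<and> E b q = coord_vec M U \<phi> b q) \<and>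
       dual_frame_at q x E"
    using \<rho>(2) eventually_nhdsin_openin[OF chart_openin[OF c(1)] c(2)]
  proof eventually_elim
    case (elim q)
    have q: "q \<in> mcarrier M"
      using elim(3) c chart_subset by blast
    have xq: "\<forall>\<^sub>F r in near q. x b r = \<phi> r \<bullet> b" if "b \<in> mcoords M" for b
      using elim(1) by eventually_elim (use that in blast)
    have Eq: "E b q = coord_vec M U \<phi> b q" for b
      using elim by (auto simp: E_def)
    show ?case
      using elim(3) eventually_nhdsin_self[OF elim(1) q] Eq
        coord_vec_coordinate[OF c(1) elim(3) _ _ x(1) xq]
        tangent_expansion[OF c(1) elim(3) _ x(1) xq] by (auto simp: dual_frame_at_def)
  qed
  then show ?thesis
    using that x(1) E by blast
qed

lemma local_frame_at:
  assumes p: "p \<in> mcarrier M"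
  obtains x E where "\<And>b. x b \<in> smooth_functions M" "\<And>b. b \<in> mcoords M \<Longrightarrow> E b \<in> vector_fields M"
    "\<forall>\<^sub>F q in near p. dual_frame_at q x E"
proof -
  obtain U \<phi> where c: "(U, \<phi>) \<in> max_atlas M" "p \<in> U"
    using chart_at[OF p] .
  obtain x E where *: "\<And>b. x b \<in> smooth_functions M" "\<And>b. b \<in> mcoords M \<Longrightarrow> E b \<in> vector_fields M"
    "\<forall>\<^sub>F q in near p. q \<in> U \<and> (\<forall>b\<in>mcoords M. x b q = \<phi> q \<bullet> b \<and> E b q = coord_vec M U \<phi> b q) \<and>
       dual_frame_at q x E"
    using local_frame[OF c] by blast
  have "\<forall>\<^sub>F q in near p. dual_frame_at q x E"
    using *(3) by (rule eventually_mono) blast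
  then show ?thesis
    using that *(1,2) by blast
qed

lemma extend_tangent:
  assumes p: "p \<in> mcarrier M" and v: "v \<in> tangent_space M p"
  obtains X where "X \<in> vector_fields M" "X p = v"
proof -
  obtain x E where E: "\<And>b. b \<in> mcoords M \<Longrightarrow> E b \<in> vector_fields M"
    and ev: "\<forall>\<^sub>F q in near p. dual_frame_at q x E"
    by (rule local_frame_at[OF p]) (rule that)
  show ?thesis
  proof
    show "(\<lambda>q f. \<Sum>b\<in>mcoords M. v (x b) * E b q f) \<in> vector_fields M"
      by (rule field_lincomb[OF E smooth_function_const])
    show "(\<lambda>f. \<Sum>b\<in>mcoords M. v (x b) * E b p f) = v"
      using eventually_nhdsin_self[OF ev p] v by (auto simp: dual_frame_at_def)
  qed
qed

end


section \<open>Tensoriality: dependence on the value at one point\<close>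

definition (in smooth_mfd) tensorial :: "'a \<Rightarrow> ('a vfield \<Rightarrow> real) \<Rightarrow> bool" where
  "tensorial p T \<longleftrightarrow>
     (\<forall>X\<in>vector_fields M. \<forall>Y\<in>vector_fields M. T (\<lambda>q f. X q f + Y q f) = T X + T Y) \<and>
     (\<forall>h\<in>smooth_functions M. \<forall>X\<in>vector_fields M. T (\<lambda>q f. h q * X q f) = h p * T X)"

context smooth_mfd
begin

lemma tensorialD:
  assumes "tensorial p T"
  shows tensorial_add: "X \<in> vector_fields M \<Longrightarrow> Y \<in> vector_fields M \<Longrightarrow> T (\<lambda>q f. X q f + Y q f) = T X + T Y"
    and tensorial_mult: "h \<in> smooth_functions M \<Longrightarrow> X \<in> vector_fields M \<Longrightarrow> T (\<lambda>q f. h q * X q f) = h p * T X"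
  using assms by (auto simp: tensorial_def)

lemma tensorial_sum:
  assumes T: "tensorial p T"
  shows "finite A \<Longrightarrow> (\<And>b. b \<in> A \<Longrightarrow> E b \<in> vector_fields M) \<Longrightarrow> (\<And>b. b \<in> A \<Longrightarrow> h b \<in> smooth_functions M) \<Longrightarrow>
    T (\<lambda>q f. \<Sum>b\<in>A. h b q * E b q f) = (\<Sum>b\<in>A. h b p * T (E b))"
proof (induction A rule: finite_induct)
  case empty
  then show ?case
    using tensorial_mult[OF T smooth_function_const[of 0] field_zero] by simp
next
  case (insert a A)
  have "T (\<lambda>q f. h a q * E a q f + (\<Sum>b\<in>A. h b q * E b q f)) =
      T (\<lambda>q f. h a q * E a q f) + T (\<lambda>q f. \<Sum>b\<in>A. h b q * E b q f)"
    using insert.prems by (intro tensorial_add[OF T] field_mult field_lincomb) auto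
  then show ?case
    using insert tensorial_mult[OF T, of "h a" "E a"] by simp
qed

text \<open>Fields may differ as HOL functions off the carrier. Their difference is unchanged by
  multiplication with the function that is 0 on the carrier and 1 off it, and T extracts the factor
  0 at p.\<close>

lemma tensorial_cong_carrier:
  assumes T: "tensorial p T" and p: "p \<in> mcarrier M"
    and X: "X \<in> vector_fields M" and Y: "Y \<in> vector_fields M"
    and eq: "\<And>q. q \<in> mcarrier M \<Longrightarrow> X q = Y q"
  shows "T X = T Y"
proof -
  let ?\<chi> = "\<lambda>q. if q \<in> mcarrier M then 0 else (1::real)"
  let ?D = "\<lambda>q f. X q f + (\<lambda>q f. (-1) * Y q f) q f"
  have Y': "(\<lambda>q f. (-1) * Y q f) \<in> vector_fields M"
    by (rule field_mult[OF smooth_function_const Y])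
  then have D: "?D \<in> vector_fields M"
    using field_add[OF X Y'] by simp
  have "(\<lambda>q f. ?\<chi> q * ?D q f) = ?D"
    using eq by (auto simp: fun_eq_iff)
  then have "T ?D = 0"
    using tensorial_mult[OF T smooth_function_off D] p by simp
  then show ?thesis
    using tensorial_add[OF T X Y'] tensorial_mult[OF T smooth_function_const Y, of "-1"] by simp
qed

text \<open>The heart is the case of a field Z vanishing at p. A bump function \<rho> supported
  where a frame E is available changes nothing at p, and \<rho> Z is globally the combination of the
  E b with coefficients \<rho> * Z (x b), which vanish at p. The general case applies this to the
  difference of the two sides.\<close>

lemma tensorial_lincomb:
  assumes T: "tensorial p T" and p: "p \<in> mcarrier M" and X: "X \<in> vector_fields M"
    and A: "finite A" "\<And>b. b \<in> A \<Longrightarrow> E b \<in> vector_fields M"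
    and eq: "X p = (\<lambda>f. \<Sum>b\<in>A. k b * E b p f)"
  shows "T X = (\<Sum>b\<in>A. k b * T (E b))"
proof -
  have zero: "T Z = 0" if Z: "Z \<in> vector_fields M" and Zp: "Z p = (\<lambda>f. 0)" for Z
  proof -
    obtain x E where x: "\<And>b. x b \<in> smooth_functions M" and E: "\<And>b. b \<in> mcoords M \<Longrightarrow> E b \<in> vector_fields M"
      and ev: "\<forall>\<^sub>F q in near p. dual_frame_at q x E"
      by (rule local_frame_at[OF p]) (rule that)
    obtain V where V: "openin (mtop M) V" "p \<in> V"
      "\<And>q. q \<in> V \<Longrightarrow> dual_frame_at q x E"
      using ev p unfolding eventually_nhdsin by blast
    obtain \<rho> where \<rho>: "\<rho> \<in> smooth_functions M" "\<forall>\<^sub>F q in near p. \<rho> q = 1"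
      "\<And>q. q \<in> mcarrier M - V \<Longrightarrow> \<forall>\<^sub>F r in near q. \<rho> r = 0"
      using bump[OF V(1,2)] by blast
    have \<rho>p: "\<rho> p = 1"
      using eventually_nhdsin_self[OF \<rho>(2) p] .
    have \<rho>0: "\<rho> q = 0" if "q \<in> mcarrier M" "q \<notin> V" for q
      using eventually_nhdsin_self[OF \<rho>(3)[of q]] that by simp
    let ?h = "\<lambda>b q. \<rho> q * Z q (x b)"
    have h: "?h b \<in> smooth_functions M" for b
      by (rule smooth_function_mult[OF \<rho>(1) field_smooth[OF Z x]])
    have "T Z = T (\<lambda>q f. \<rho> q * Z q f)"
      using tensorial_mult[OF T \<rho>(1) Z] \<rho>p by simp
    also have "\<dots> = T (\<lambda>q f. \<Sum>b\<in>mcoords M. ?h b q * E b q f)"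
    proof (rule tensorial_cong_carrier[OF T p field_mult[OF \<rho>(1) Z] field_lincomb[OF E h]])
      fix q assume q: "q \<in> mcarrier M"
      show "(\<lambda>f. \<rho> q * Z q f) = (\<lambda>f. \<Sum>b\<in>mcoords M. ?h b q * E b q f)"
      proof
        fix f
        show "\<rho> q * Z q f = (\<Sum>b\<in>mcoords M. ?h b q * E b q f)"
        proof (cases "q \<in> V")
          case True
          then have "Z q f = (\<Sum>b\<in>mcoords M. Z q (x b) * E b q f)"
            using V(3)[OF True] field_tangent[OF Z q] unfolding dual_frame_at_def by blast
          then show ?thesis
            by (simp add: sum_distrib_left mult.assoc)
        qed (simp add: \<rho>0[OF q])
      qed
    qed
    also have "\<dots> = (\<Sum>b\<in>mcoords M. ?h b p * T (E b))"
      by (rule tensorial_sum[OF T finite_coords E h])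
    finally show ?thesis
      using Zp by simp
  qed
  let ?S = "\<lambda>q f. \<Sum>b\<in>A. k b * E b q f"
  have S: "?S \<in> vector_fields M"
    by (rule field_lincomb[OF A(2) smooth_function_const])
  have S': "(\<lambda>q f. (-1) * ?S q f) \<in> vector_fields M"
    by (rule field_mult[OF smooth_function_const S])
  have "T (\<lambda>q f. X q f + (\<lambda>q f. (-1) * ?S q f) q f) = 0"
    by (rule zero[OF field_add[OF X S']]) (simp add: eq)
  then have "T X = T ?S"
    using tensorial_add[OF T X S'] tensorial_mult[OF T smooth_function_const S, of "-1"] by simp
  then show ?thesis
    using tensorial_sum[OF T A smooth_function_const] by simp
qed

lemma tensorial_cong:
  assumes "tensorial p T" "p \<in> mcarrier M" "X \<in> vector_fields M" "Y \<in> vector_fields M" "X p = Y p"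
  shows "T X = T Y"
  using tensorial_lincomb[OF assms(1-3), of "{()}" "\<lambda>_. Y" "\<lambda>_. 1"] assms(4,5) by simp

end


subsection \<open>Orthonormal frames\<close>

locale riem_mfd = smooth_mfd M for M :: "('a, 'e::euclidean_space) manifold" +
  fixes g :: "'a form2"
  assumes metric: "riemannian_metric M g"
begin

lemma metric_add_left:
  "p \<in> mcarrier M \<Longrightarrow> u \<in> tangent_space M p \<Longrightarrow> v \<in> tangent_space M p \<Longrightarrow> w \<in> tangent_space M p \<Longrightarrow>
   g p (\<lambda>f. u f + v f) w = g p u w + g p v w"
  and metric_scale_left:
  "p \<in> mcarrier M \<Longrightarrow> u \<in> tangent_space M p \<Longrightarrow> w \<in> tangent_space M p \<Longrightarrow>
   g p (\<lambda>f. c * u f) w = c * g p u w"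
  and metric_sym:
  "p \<in> mcarrier M \<Longrightarrow> u \<in> tangent_space M p \<Longrightarrow> w \<in> tangent_space M p \<Longrightarrow> g p u w = g p w u"
  and metric_pos:
  "p \<in> mcarrier M \<Longrightarrow> u \<in> tangent_space M p \<Longrightarrow> u \<noteq> (\<lambda>f. 0) \<Longrightarrow> g p u u > 0"
  and metric_smooth:
  "X \<in> vector_fields M \<Longrightarrow> Y \<in> vector_fields M \<Longrightarrow> (\<lambda>p. g p (X p) (Y p)) \<in> smooth_functions M"
  using metric unfolding riemannian_metric_def by blast+

lemma metric_lincomb_left:
  assumes p: "p \<in> mcarrier M" and w: "w \<in> tangent_space M p"
  shows "(\<And>b. b \<in> A \<Longrightarrow> v b \<in> tangent_space M p) \<Longrightarrow>
    g p (\<lambda>f. \<Sum>b\<in>A. c b * v b f) w = (\<Sum>b\<in>A. c b * g p (v b) w)"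
proof (induction A rule: infinite_finite_induct)
  case (insert a A)
  then have "g p (\<lambda>f. c a * v a f + (\<Sum>b\<in>A. c b * v b f)) w =
      g p (\<lambda>f. c a * v a f) w + g p (\<lambda>f. \<Sum>b\<in>A. c b * v b f) w"
    by (intro metric_add_left p w tangent_space_scale tangent_space_lincomb) auto
  then show ?case
    using insert metric_scale_left[OF p _ w, of "v a" "c a"] by simp
qed (use metric_scale_left[OF p tangent_zero w, of 0] in simp_all)

lemma metric_lincomb_right:
  assumes p: "p \<in> mcarrier M" and w: "w \<in> tangent_space M p"
    and v: "\<And>b. b \<in> A \<Longrightarrow> v b \<in> tangent_space M p"
  shows "g p w (\<lambda>f. \<Sum>b\<in>A. c b * v b f) = (\<Sum>b\<in>A. c b * g p w (v b))"
proof -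
  have "g p w (\<lambda>f. \<Sum>b\<in>A. c b * v b f) = g p (\<lambda>f. \<Sum>b\<in>A. c b * v b f) w"
    by (rule metric_sym[OF p w tangent_space_lincomb[OF v]])
  also have "\<dots> = (\<Sum>b\<in>A. c b * g p (v b) w)"
    by (rule metric_lincomb_left[OF p w v])
  also have "\<dots> = (\<Sum>b\<in>A. c b * g p w (v b))"
    using metric_sym[OF p w v] by (intro sum.cong) auto
  finally show ?thesis .
qed

lemma metric_add_right:
  "p \<in> mcarrier M \<Longrightarrow> u \<in> tangent_space M p \<Longrightarrow> v \<in> tangent_space M p \<Longrightarrow> w \<in> tangent_space M p \<Longrightarrow>
   g p w (\<lambda>f. u f + v f) = g p w u + g p w v"
  using metric_add_left[of p u v w] metric_sym[of p w] tangent_space_add[of u p v] by simp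

lemma metric_scale_right:
  "p \<in> mcarrier M \<Longrightarrow> u \<in> tangent_space M p \<Longrightarrow> w \<in> tangent_space M p \<Longrightarrow>
   g p w (\<lambda>f. c * u f) = c * g p w u"
  using metric_scale_left[of p u w c] metric_sym[of p w] tangent_space_scale[of u p c] by simp


lemma tangent_space_diff:
  "v \<in> tangent_space M p \<Longrightarrow> w \<in> tangent_space M p \<Longrightarrow> (\<lambda>f. v f - w f) \<in> tangent_space M p"
  using tangent_space_add[OF _ tangent_space_scale[of w p "-1"], of v] by simp

lemma metric_diff_left:
  assumes "p \<in> mcarrier M" "u \<in> tangent_space M p" "v \<in> tangent_space M p" "w \<in> tangent_space M p"
  shows "g p (\<lambda>f. u f - v f) w = g p u w - g p v w"
  using metric_add_left[OF assms(1,2) tangent_space_scale[OF assms(3), of "-1"] assms(4)]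
    metric_scale_left[OF assms(1,3,4), of "-1"] by simp

lemma metric_eqI:
  assumes p: "p \<in> mcarrier M" and v: "v \<in> tangent_space M p" and w: "w \<in> tangent_space M p"
    and eq: "\<And>u. u \<in> tangent_space M p \<Longrightarrow> g p v u = g p w u"
  shows "v = w"
proof -
  let ?d = "\<lambda>f. v f - w f"
  have d: "?d \<in> tangent_space M p"
    by (rule tangent_space_diff[OF v w])
  have "g p ?d ?d = 0"
    using metric_diff_left[OF p v w d] eq[OF d] by simp
  then have "?d = (\<lambda>f. 0)"
    using metric_pos[OF p d] by fastforce
  then show ?thesis
    by (auto simp: fun_eq_iff)
qed

section \<open>Gram-Schmidt within a module of vector fields\<close>

definition submodule :: "'a vfield set \<Rightarrow> bool" where
  "submodule \<V> \<longleftrightarrow> \<V> \<subseteq> vector_fields M \<and> (\<lambda>q f. 0) \<in> \<V> \<and>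
     (\<forall>X\<in>\<V>. \<forall>Y\<in>\<V>. (\<lambda>q f. X q f + Y q f) \<in> \<V>) \<and>
     (\<forall>h\<in>smooth_functions M. \<forall>X\<in>\<V>. (\<lambda>q f. h q * X q f) \<in> \<V>)"

lemma submodule_add: "submodule \<V> \<Longrightarrow> X \<in> \<V> \<Longrightarrow> Y \<in> \<V> \<Longrightarrow> (\<lambda>q f. X q f + Y q f) \<in> \<V>"
  by (simp add: submodule_def)

lemma submodule_mult:
  "submodule \<V> \<Longrightarrow> h \<in> smooth_functions M \<Longrightarrow> X \<in> \<V> \<Longrightarrow> (\<lambda>q f. h q * X q f) \<in> \<V>"
  by (simp add: submodule_def)

lemma submodule_lincomb:
  assumes V: "submodule \<V>"
  shows "(\<And>b. b \<in> A \<Longrightarrow> E b \<in> \<V>) \<Longrightarrow> (\<And>b. b \<in> A \<Longrightarrow> h b \<in> smooth_functions M) \<Longrightarrow>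
    (\<lambda>q f. \<Sum>b\<in>A. h b q * E b q f) \<in> \<V>"
proof (induction A rule: infinite_finite_induct)
  case (insert a A)
  have 1: "(\<lambda>q f. h a q * E a q f) \<in> \<V>"
    by (rule submodule_mult[OF V]) (use insert.prems in auto)
  have 2: "(\<lambda>q f. \<Sum>b\<in>A. h b q * E b q f) \<in> \<V>"
    by (rule insert.IH) (use insert.prems in auto)
  have "(\<lambda>q f. (\<lambda>q f. h a q * E a q f) q f + (\<lambda>q f. \<Sum>b\<in>A. h b q * E b q f) q f) \<in> \<V>"
    by (rule submodule_add[OF V 1 2])
  then show ?case
    using insert.hyps by simp
qed (use V in \<open>simp_all add: submodule_def\<close>)

text \<open>The second clause is the orthogonal expansion of the F b in the family E: it says that E
  spans everything that F spans at q.\<close>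

definition orthonormalizes_at :: "'a \<Rightarrow> 'i set \<Rightarrow> ('i \<Rightarrow> 'a vfield) \<Rightarrow> ('i \<Rightarrow> 'a vfield) \<Rightarrow> bool" where
  "orthonormalizes_at q A F E \<longleftrightarrow>
     (\<forall>b\<in>A. \<forall>c\<in>A. g q (E b q) (E c q) = (if b = c then 1 else 0)) \<and>
     (\<forall>b\<in>A. \<forall>f. F b q f = (\<Sum>c\<in>A. g q (F b q) (E c q) * E c q f))"

text \<open>Stated for an arbitrary module so that vertical fields are orthonormalized within the
  vertical fields. Independence is assumed at p alone, hence orthonormality is only obtained near p.
  The coefficients k of the E b p in terms of the F c p are carried along because the next step
  needs them to see that its new vector does not vanish at p.\<close>

lemma gram_schmidt:
  assumes p: "p \<in> mcarrier M" and V: "submodule \<V>"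
  shows "finite A \<Longrightarrow> (\<And>b. b \<in> A \<Longrightarrow> F b \<in> \<V>) \<Longrightarrow>
    (\<And>k. (\<And>f. (\<Sum>b\<in>A. k b * F b p f) = 0) \<Longrightarrow> \<forall>b\<in>A. k b = 0) \<Longrightarrow>
    \<exists>E k. (\<forall>b\<in>A. E b \<in> \<V>) \<and> (\<forall>b\<in>A. \<forall>f. E b p f = (\<Sum>c\<in>A. k b c * F c p f)) \<and>
     (\<forall>\<^sub>F q in near p. orthonormalizes_at q (A) F E)"
proof (induction A rule: finite_induct)
  case empty
  show ?case by (simp add: orthonormalizes_at_def always_eventually)
next
  case (insert a A)
  have fields: "X \<in> \<V> \<Longrightarrow> X \<in> vector_fields M" for X
    using V by (auto simp: submodule_def)
  have ind: "\<forall>b\<in>A. k b = 0" if "\<And>f. (\<Sum>b\<in>A. k b * F b p f) = 0" for k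
  proof -
    have "(\<Sum>b\<in>insert a A. (k(a := 0)) b * F b p f) = (\<Sum>b\<in>A. k b * F b p f)" for f
      using insert.hyps by (auto intro!: sum.cong)
    then have "\<forall>b\<in>insert a A. (k(a := 0)) b = 0"
      by (intro insert.prems(2)) (use that in simp)
    then show ?thesis
      using insert.hyps by (auto split: if_splits)
  qed
  obtain E k where E: "\<And>b. b \<in> A \<Longrightarrow> E b \<in> \<V>" and k: "\<And>b f. b \<in> A \<Longrightarrow> E b p f = (\<Sum>c\<in>A. k b c * F c p f)"
    and ev: "\<forall>\<^sub>F q in near p. orthonormalizes_at q (A) F E"
  proof -
    have "\<exists>E k. (\<forall>b\<in>A. E b \<in> \<V>) \<and> (\<forall>b\<in>A. \<forall>f. E b p f = (\<Sum>c\<in>A. k b c * F c p f)) \<and>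
        (\<forall>\<^sub>F q in near p. orthonormalizes_at q A F E)"
      by (rule insert.IH) (use insert.prems(1) ind in auto)
    then show ?thesis
      by (elim exE conjE) (rule that, auto)
  qed
  have Fa: "F a \<in> \<V>"
    using insert.prems(1) by simp
  let ?h = "\<lambda>c q. g q (F a q) (E c q)"
  have h: "?h c \<in> smooth_functions M" if "c \<in> A" for c
    using metric_smooth[OF fields[OF Fa] fields[OF E[OF that]]] .
  define G where "G q f = F a q f + (-1) * (\<Sum>c\<in>A. ?h c q * E c q f)" for q f
  have S: "(\<lambda>q f. \<Sum>c\<in>A. ?h c q * E c q f) \<in> \<V>"
    by (rule submodule_lincomb[OF V E h])
  have "(\<lambda>q f. (-1) * (\<Sum>c\<in>A. ?h c q * E c q f)) \<in> \<V>"
    by (rule submodule_mult[OF V smooth_function_const S])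
  then have G: "G \<in> \<V>"
    unfolding G_def[abs_def] by (rule submodule_add[OF V Fa])
  \<comment> \<open>If G p were zero, inserting the expansions of the E c p would produce a linear
    relation among the F b p in which F a p has coefficient 1.\<close>
  have Gp0: "G p \<noteq> (\<lambda>f. 0)"
  proof
    assume G0: "G p = (\<lambda>f. 0)"
    let ?k = "\<lambda>d. if d = a then 1 else - (\<Sum>c\<in>A. ?h c p * k c d)"
    have "(\<Sum>b\<in>insert a A. ?k b * F b p f) = 0" for f
    proof -
      have "(\<Sum>b\<in>insert a A. ?k b * F b p f) = F a p f + (\<Sum>b\<in>A. ?k b * F b p f)"
        using insert.hyps by simp
      also have "(\<Sum>b\<in>A. ?k b * F b p f) = (\<Sum>b\<in>A. - (\<Sum>c\<in>A. ?h c p * k c b * F b p f))"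
        using insert.hyps by (intro sum.cong) (auto simp: sum_distrib_right)
      also have "\<dots> = - (\<Sum>c\<in>A. \<Sum>b\<in>A. ?h c p * k c b * F b p f)"
        by (subst sum.swap) (simp add: sum_negf)
      also have "\<dots> = - (\<Sum>c\<in>A. ?h c p * E c p f)"
        by (simp add: k sum_distrib_left mult.assoc)
      finally show ?thesis
        using fun_cong[OF G0, of f] by (simp add: G_def)
    qed
    then have "\<forall>b\<in>insert a A. ?k b = 0"
      by (rule insert.prems(2))
    then show False
      by auto
  qed
  define n where "n q = g q (G q) (G q)" for q
  have nC: "n \<in> smooth_functions M"
    unfolding n_def[abs_def] by (rule metric_smooth[OF fields[OF G] fields[OF G]])
  have np: "n p > 0"
    unfolding n_def by (rule metric_pos[OF p field_tangent[OF fields[OF G] p] Gp0])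
  \<comment> \<open>The normalizing factor 1 / sqrt n is smooth only where n is positive; w is a
    global function that has its germ at p.\<close>
  obtain w where w: "w \<in> smooth_functions M" "\<forall>\<^sub>F q in near p. w q = 1 / sqrt (n q)"
    using smooth_extension[OF p smooth_at_inverse_sqrt[OF p smooth_functionsD[OF nC p] np]] by blast
  have evn: "\<forall>\<^sub>F q in near p. n q > 0"
    by (rule eventually_smooth_at_pos[OF p smooth_functionsD[OF nC p] np])
  define E' where "E' = E(a := \<lambda>q f. w q * G q f)"
  have E'A: "E' b = E b" if "b \<in> A" for b
    using that insert.hyps by (auto simp: E'_def)
  have E'a: "E' a = (\<lambda>q f. w q * G q f)"
    by (simp add: E'_def)
  have E': "E' b \<in> \<V>" if "b \<in> insert a A" for b
  proof (cases "b = a")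
    case True
    show ?thesis
      unfolding True E'a by (rule submodule_mult[OF V w(1) G])
  next
    case False
    then show ?thesis
      using that E E'A by auto
  qed
  define k' where "k' b d = (if b = a then w p * (if d = a then 1 else - (\<Sum>c\<in>A. ?h c p * k c d))
      else if d = a then 0 else k b d)" for b d
  have k': "E' b p f = (\<Sum>c\<in>insert a A. k' b c * F c p f)" if "b \<in> insert a A" for b f
  proof (cases "b = a")
    case True
    have "(\<Sum>c\<in>insert a A. k' b c * F c p f) = w p * F a p f + (\<Sum>d\<in>A. - (\<Sum>c\<in>A. w p * (?h c p * (k c d * F d p f))))"
      using insert.hyps True
      by (simp add: k'_def) (intro sum.cong; auto simp: sum_distrib_right sum_distrib_left mult.assoc)
    also have "(\<Sum>d\<in>A. - (\<Sum>c\<in>A. w p * (?h c p * (k c d * F d p f)))) =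
        - (\<Sum>c\<in>A. \<Sum>d\<in>A. w p * (?h c p * (k c d * F d p f)))"
      by (subst sum.swap) (simp add: sum_negf)
    also have "\<dots> = - (w p * (\<Sum>c\<in>A. ?h c p * E c p f))"
      by (simp add: k sum_distrib_left)
    finally show ?thesis
      by (simp add: True E'a G_def algebra_simps)
  next
    case False
    then have b: "b \<in> A"
      using that by simp
    have "(\<Sum>c\<in>insert a A. k' b c * F c p f) = (\<Sum>c\<in>A. k b c * F c p f)"
      using insert.hyps False by (simp add: k'_def) (intro sum.cong; auto)
    then show ?thesis
      using k[OF b] E'A[OF b] by simp
  qed
  have evc: "\<forall>\<^sub>F q in near p. q \<in> mcarrier M"
    by (rule eventually_nhdsin_openin[OF openin_topspace p])
  have "\<forall>\<^sub>F q in near p. orthonormalizes_at q (insert a A) F E'"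
    using ev w(2) evn evc
  proof eventually_elim
    case (elim q)
    note q = elim(4)
    have Et: "E b q \<in> tangent_space M q" if "b \<in> A" for b
      using field_tangent[OF fields[OF E[OF that]] q] .
    have Gt: "G q \<in> tangent_space M q" and Fat: "F a q \<in> tangent_space M q"
      using field_tangent[OF fields[OF G] q] field_tangent[OF fields[OF Fa] q] .
    have St: "(\<lambda>f. \<Sum>c\<in>A. ?h c q * E c q f) \<in> tangent_space M q"
      by (rule tangent_space_lincomb[OF Et])
    have ortho: "g q (E b q) (E c q) = (if b = c then 1 else 0)" if "b \<in> A" "c \<in> A" for b c
      using elim(1) that unfolding orthonormalizes_at_def by blast
    have Gdiff: "G q = (\<lambda>f. F a q f - (\<lambda>f. \<Sum>c\<in>A. ?h c q * E c q f) f)"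
      by (auto simp: G_def)
    have GE: "g q (G q) (E b q) = 0" if b: "b \<in> A" for b
    proof -
      have "g q (\<lambda>f. \<Sum>c\<in>A. ?h c q * E c q f) (E b q) = (\<Sum>c\<in>A. ?h c q * g q (E c q) (E b q))"
        by (rule metric_lincomb_left[OF q Et[OF b] Et])
      also have "\<dots> = (\<Sum>c\<in>A. if c = b then ?h b q else 0)"
        using ortho b by (intro sum.cong) auto
      also have "\<dots> = ?h b q"
        using b insert.hyps by simp
      finally show ?thesis
        using metric_diff_left[OF q Fat St Et[OF b]] by (subst Gdiff) simp
    qed
    have EG: "g q (E b q) (G q) = 0" if b: "b \<in> A" for b
      using GE[OF b] metric_sym[OF q Et[OF b] Gt] by simp
    have FG: "g q (F a q) (G q) = n q"
    proof -
      have "g q (\<lambda>f. \<Sum>c\<in>A. ?h c q * E c q f) (G q) = (\<Sum>c\<in>A. ?h c q * g q (E c q) (G q))"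
        by (rule metric_lincomb_left[OF q Gt Et])
      also have "\<dots> = 0"
        using EG by simp
      finally have "g q (G q) (G q) = g q (F a q) (G q)"
        using metric_diff_left[OF q Fat St Gt] by (subst (1) Gdiff) simp
      then show ?thesis
        by (simp add: n_def)
    qed
    have ww: "w q * w q * n q = 1"
      using elim(2,3) by simp
    have wt: "(\<lambda>f. w q * G q f) \<in> tangent_space M q"
      by (rule tangent_space_scale[OF Gt])
    have aa: "g q (E' a q) (E' a q) = 1"
      using metric_scale_left[OF q Gt wt, of "w q"] metric_scale_right[OF q Gt Gt, of "w q"] ww
      by (simp add: E'a n_def)
    have ab: "g q (E' a q) (E' b q) = 0" "g q (E' b q) (E' a q) = 0" if b: "b \<in> A" for b
      using metric_scale_left[OF q Gt Et[OF b], of "w q"] metric_scale_right[OF q Gt Et[OF b], of "w q"]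
        GE[OF b] EG[OF b] by (simp_all add: E'a E'A[OF b])
    have na: "a \<noteq> b" if "b \<in> A" for b
      using that insert.hyps by blast
    have 1: "g q (E' b q) (E' c q) = (if b = c then 1 else 0)" if "b \<in> insert a A" "c \<in> insert a A" for b c
      using that aa ab ortho E'A na by (auto dest: na)
    have 2: "F b q f = (\<Sum>c\<in>insert a A. g q (F b q) (E' c q) * E' c q f)" if b: "b \<in> insert a A" for b f
    proof (cases "b = a")
      case True
      have "g q (F a q) (E' a q) * E' a q f = (w q * w q * n q) * G q f"
        using metric_scale_right[OF q Gt Fat, of "w q"] FG by (simp add: E'a)
      also have "\<dots> = G q f"
        by (simp add: ww)
      finally have "g q (F a q) (E' a q) * E' a q f = G q f" .
      moreover have "(\<Sum>c\<in>A. g q (F a q) (E' c q) * E' c q f) = (\<Sum>c\<in>A. ?h c q * E c q f)"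
        using E'A by (intro sum.cong) auto
      ultimately show ?thesis
        using insert.hyps by (simp add: True G_def)
    next
      case False
      then have bA: "b \<in> A"
        using b by simp
      have Fb: "F b q f = (\<Sum>c\<in>A. g q (F b q) (E c q) * E c q f)" for f
        using elim(1) bA unfolding orthonormalizes_at_def by blast
      have Fbeq: "F b q = (\<lambda>f. \<Sum>c\<in>A. g q (F b q) (E c q) * E c q f)"
        by (rule ext) (rule Fb)
      have "g q (\<lambda>f. \<Sum>c\<in>A. g q (F b q) (E c q) * E c q f) (G q) =
          (\<Sum>c\<in>A. g q (F b q) (E c q) * g q (E c q) (G q))"
        by (rule metric_lincomb_left[OF q Gt]) (rule Et)
      then have "g q (F b q) (G q) = (\<Sum>c\<in>A. g q (F b q) (E c q) * g q (E c q) (G q))"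
        unfolding Fbeq[symmetric] .
      then have "g q (F b q) (G q) = 0"
        using EG by simp
      then have "g q (F b q) (E' a q) = 0"
        using metric_scale_right[OF q Gt field_tangent[OF fields q], of "F b" "w q"] insert.prems(1)[OF b]
        by (simp add: E'a)
      moreover have "(\<Sum>c\<in>A. g q (F b q) (E' c q) * E' c q f) = (\<Sum>c\<in>A. g q (F b q) (E c q) * E c q f)"
        using E'A by (intro sum.cong) auto
      ultimately show ?thesis
        using insert.hyps Fb by simp
    qed
    show ?case
      unfolding orthonormalizes_at_def using 1 2 by blast
  qed
  then show ?case
    using E' k' by (intro exI[of _ E'] exI[of _ k']) blast
qed

lemma submodule_fields: "submodule (vector_fields M)"
  unfolding submodule_def using field_zero field_add field_mult by blast

lemma orthonormalizes_expansion:
  assumes q: "q \<in> mcarrier M" and Ft: "\<And>b. b \<in> A \<Longrightarrow> F b q \<in> tangent_space M q"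
    and Et: "\<And>b. b \<in> A \<Longrightarrow> E b q \<in> tangent_space M q" and o: "orthonormalizes_at q A F E"
    and ve: "\<And>f. v f = (\<Sum>b\<in>A. k b * F b q f)"
  shows "v = (\<lambda>f. \<Sum>b\<in>A. g q v (E b q) * E b q f)"
proof
  fix f
  have veq: "v = (\<lambda>f. \<Sum>b\<in>A. k b * F b q f)"
    by (rule ext) (rule ve)
  have gv: "g q v (E c q) = (\<Sum>b\<in>A. k b * g q (F b q) (E c q))" if c: "c \<in> A" for c
  proof -
    have "g q (\<lambda>f. \<Sum>b\<in>A. k b * F b q f) (E c q) = (\<Sum>b\<in>A. k b * g q (F b q) (E c q))"
      by (rule metric_lincomb_left[OF q Et[OF c]]) (rule Ft)
    then show ?thesis
      unfolding veq[symmetric] .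
  qed
  have "v f = (\<Sum>b\<in>A. k b * F b q f)"
    by (rule ve)
  also have "\<dots> = (\<Sum>b\<in>A. k b * (\<Sum>c\<in>A. g q (F b q) (E c q) * E c q f))"
  proof (rule sum.cong)
    fix b assume "b \<in> A"
    then have "F b q f = (\<Sum>c\<in>A. g q (F b q) (E c q) * E c q f)"
      using o unfolding orthonormalizes_at_def by blast
    then show "k b * F b q f = k b * (\<Sum>c\<in>A. g q (F b q) (E c q) * E c q f)"
      by (rule arg_cong)
  qed simp
  also have "\<dots> = (\<Sum>b\<in>A. \<Sum>c\<in>A. k b * g q (F b q) (E c q) * E c q f)"
    by (simp add: sum_distrib_left mult.assoc)
  also have "\<dots> = (\<Sum>c\<in>A. \<Sum>b\<in>A. k b * g q (F b q) (E c q) * E c q f)"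
    by (rule sum.swap)
  also have "\<dots> = (\<Sum>c\<in>A. g q v (E c q) * E c q f)"
    by (intro sum.cong refl) (simp add: gv sum_distrib_right)
  finally show "v f = (\<Sum>c\<in>A. g q v (E c q) * E c q f)" .
qed

lemma local_orthonormal_frame:
  assumes p: "p \<in> mcarrier M"
  obtains E where "\<And>b. b \<in> mcoords M \<Longrightarrow> E b \<in> vector_fields M"
    "\<forall>\<^sub>F q in near p. (\<forall>b\<in>mcoords M. \<forall>c\<in>mcoords M. g q (E b q) (E c q) = (if b = c then 1 else 0)) \<and>
       (\<forall>v\<in>tangent_space M q. v = (\<lambda>f. \<Sum>b\<in>mcoords M. g q v (E b q) * E b q f))"
proof -
  let ?B = "mcoords M"
  obtain x F where x: "\<And>b. x b \<in> smooth_functions M" and F: "\<And>b. b \<in> ?B \<Longrightarrow> F b \<in> vector_fields M"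
    and ev: "\<forall>\<^sub>F q in near p. dual_frame_at q x F"
    by (rule local_frame_at[OF p]) (rule that)
  have ind: "\<forall>b\<in>?B. k b = 0" if k: "\<And>f. (\<Sum>b\<in>?B. k b * F b p f) = 0" for k
  proof
    fix d assume d: "d \<in> ?B"
    have "(\<Sum>b\<in>?B. k b * F b p (x d)) = (\<Sum>b\<in>?B. if b = d then k b else 0)"
      using eventually_nhdsin_self[OF ev p] d by (intro sum.cong) (auto simp: dual_frame_at_def)
    then show "k d = 0"
      using k[of "x d"] d finite_coords by simp
  qed
  obtain E where E: "\<forall>b\<in>?B. E b \<in> vector_fields M"
    and ev': "\<forall>\<^sub>F q in near p. orthonormalizes_at q (?B) F E"
  proof -
    have "\<exists>E k. (\<forall>b\<in>?B. E b \<in> vector_fields M) \<and> (\<forall>b\<in>?B. \<forall>f. E b p f = (\<Sum>c\<in>?B. k b c * F c p f)) \<and>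
        (\<forall>\<^sub>F q in near p. orthonormalizes_at q ?B F E)"
      by (rule gram_schmidt[OF p submodule_fields finite_coords]) (use F ind in auto)
    then show ?thesis
      by (elim exE conjE) (rule that, auto)
  qed
  have "\<forall>\<^sub>F q in near p. (\<forall>b\<in>?B. \<forall>c\<in>?B. g q (E b q) (E c q) = (if b = c then 1 else 0)) \<and>
       (\<forall>v\<in>tangent_space M q. v = (\<lambda>f. \<Sum>b\<in>?B. g q v (E b q) * E b q f))"
    using ev ev' eventually_nhdsin_openin[OF openin_topspace p]
  proof eventually_elim
    case (elim q)
    have Ft: "F b q \<in> tangent_space M q" and Et: "E b q \<in> tangent_space M q" if "b \<in> ?B" for b
      using field_tangent elim(3) F E that by blast+
    have "v = (\<lambda>f. \<Sum>b\<in>?B. g q v (E b q) * E b q f)" if v: "v \<in> tangent_space M q" for v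
    proof (rule orthonormalizes_expansion[OF elim(3) Ft Et elim(2)])
      show "v f = (\<Sum>b\<in>?B. v (x b) * F b q f)" for f
        using elim(1) v unfolding dual_frame_at_def by blast
    qed
    then show ?case
      using elim(2) unfolding orthonormalizes_at_def by blast
  qed
  then show ?thesis
    using that E by blast
qed

section \<open>Orthonormal expansions and invariance of traces\<close>

lemma parseval:
  assumes p: "p \<in> mcarrier M" and e: "\<And>b. b \<in> A \<Longrightarrow> e b \<in> tangent_space M p"
    and v: "v \<in> tangent_space M p" and w: "w \<in> tangent_space M p"
    and ve: "v = (\<lambda>f. \<Sum>b\<in>A. g p v (e b) * e b f)"
  shows "g p v w = (\<Sum>b\<in>A. g p v (e b) * g p w (e b))"
proof -
  have "g p v w = g p (\<lambda>f. \<Sum>b\<in>A. g p v (e b) * e b f) w"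
    using ve by simp
  also have "\<dots> = (\<Sum>b\<in>A. g p v (e b) * g p (e b) w)"
    by (rule metric_lincomb_left[OF p w e])
  also have "\<dots> = (\<Sum>b\<in>A. g p v (e b) * g p w (e b))"
    using metric_sym[OF p w e] by (intro sum.cong) auto
  finally show ?thesis .
qed

text \<open>Coefficients with respect to one orthonormal frame turn any other orthonormal family of the same
  size into an orthonormal family in the coordinate space, which spans by counting dimensions.\<close>

lemma orthonormal_expansion:
  assumes p: "p \<in> mcarrier M" and e: "\<And>b. b \<in> mcoords M \<Longrightarrow> e b \<in> tangent_space M p"
    and ortho: "\<And>b c. b \<in> mcoords M \<Longrightarrow> c \<in> mcoords M \<Longrightarrow> g p (e b) (e c) = (if b = c then 1 else 0)"
    and v: "v \<in> tangent_space M p"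
  shows "v = (\<lambda>f. \<Sum>b\<in>mcoords M. g p v (e b) * e b f)"
proof -
  let ?B = "mcoords M"
  obtain E where E: "\<And>b. b \<in> ?B \<Longrightarrow> E b \<in> vector_fields M"
    and ev: "\<forall>\<^sub>F q in near p. (\<forall>b\<in>?B. \<forall>c\<in>?B. g q (E b q) (E c q) = (if b = c then 1 else 0)) \<and>
       (\<forall>v\<in>tangent_space M q. v = (\<lambda>f. \<Sum>b\<in>?B. g q v (E b q) * E b q f))"
    by (rule local_orthonormal_frame[OF p]) (rule that)
  have Et: "E b p \<in> tangent_space M p" if "b \<in> ?B" for b
    by (rule field_tangent[OF E[OF that] p])
  have Eexp: "w = (\<lambda>f. \<Sum>b\<in>?B. g p w (E b p) * E b p f)" if "w \<in> tangent_space M p" for w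
    using eventually_nhdsin_self[OF ev p] that by blast
  \<comment> \<open>The coordinates in the reference frame E, collected into a vector of the
    coordinate space. By Parseval u carries the metric at p to the inner product, so dimensions can
    be counted in \<open>span ?B\<close>.\<close>
  define u where "u w = (\<Sum>c\<in>?B. g p w (E c p) *\<^sub>R c)" for w
  have uB: "u w \<in> span ?B" for w
    unfolding u_def by (intro span_sum span_scale span_base)
  have uc: "u w \<bullet> c = g p w (E c p)" if "c \<in> ?B" for w c
  proof -
    have "u w \<bullet> c = (\<Sum>d\<in>?B. if d = c then g p w (E d p) else 0)"
      unfolding u_def inner_sum_left using coords_Basis that
      by (intro sum.cong) (auto simp: inner_Basis subset_iff)
    then show ?thesis
      using finite_coords that by simp
  qed
  have uu: "u w \<bullet> u w' = g p w w'" if "w \<in> tangent_space M p" "w' \<in> tangent_space M p" for w w'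
  proof -
    have "u w \<bullet> u w' = (\<Sum>c\<in>?B. g p w' (E c p) * (u w \<bullet> c))"
      unfolding u_def[of w'] inner_sum_right by simp
    also have "\<dots> = (\<Sum>c\<in>?B. g p w (E c p) * g p w' (E c p))"
      using uc by (intro sum.cong) auto
    finally show ?thesis
      using parseval[OF p Et that Eexp[OF that(1)]] by simp
  qed
  let ?S = "(\<lambda>b. u (e b)) ` ?B"
  have ue: "u (e b) \<bullet> u (e c) = (if b = c then 1 else 0)" if "b \<in> ?B" "c \<in> ?B" for b c
    using uu[OF e[OF that(1)] e[OF that(2)]] ortho[OF that] by simp
  have inj: "inj_on (\<lambda>b. u (e b)) ?B"
  proof (rule inj_onI, rule ccontr)
    fix b c assume *: "b \<in> ?B" "c \<in> ?B" "u (e b) = u (e c)" "b \<noteq> c"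
    show False
      using ue[OF *(1,1)] ue[OF *(1,2)] *(3,4) by simp
  qed
  have "pairwise orthogonal ?S"
    by (auto simp: pairwise_def orthogonal_def ue)
  moreover have "0 \<notin> ?S"
    using ue by force
  ultimately have indep: "independent ?S"
    by (rule pairwise_orthogonal_independent)
  have "independent ?B"
    using independent_Basis coords_Basis by (rule independent_mono)
  then have "dim ?B = card ?S"
    using dim_eq_card_independent[of ?B] card_image[OF inj] by simp
  then have "span ?B \<subseteq> span ?S"
    using card_ge_dim_independent[of ?S "span ?B"] indep uB by (auto simp: dim_span)
  \<comment> \<open>The part of v that the e b do not capture. Its image under u is orthogonal to
    all u (e b); their span contains \<open>span ?B\<close> and thus this image itself, so
    \<open>?d\<close> has length 0.\<close>
  let ?d = "\<lambda>f. v f - (\<lambda>f. \<Sum>b\<in>?B. g p v (e b) * e b f) f"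
  have sumt: "(\<lambda>f. \<Sum>b\<in>?B. g p v (e b) * e b f) \<in> tangent_space M p"
    by (rule tangent_space_lincomb[OF e])
  have d: "?d \<in> tangent_space M p"
    by (rule tangent_space_diff[OF v sumt])
  have de: "g p ?d (e c) = 0" if c: "c \<in> ?B" for c
  proof -
    have "g p (\<lambda>f. \<Sum>b\<in>?B. g p v (e b) * e b f) (e c) = (\<Sum>b\<in>?B. g p v (e b) * g p (e b) (e c))"
      by (rule metric_lincomb_left[OF p e[OF c] e])
    also have "\<dots> = (\<Sum>b\<in>?B. if b = c then g p v (e b) else 0)"
      using ortho c by (intro sum.cong) auto
    also have "\<dots> = g p v (e c)"
      using c finite_coords by simp
    finally show ?thesis
      using metric_diff_left[OF p v sumt e[OF c]] by simp
  qed
  have "orthogonal (u ?d) y" if "y \<in> ?S" for y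
    using that de uu[OF d e] by (auto simp: orthogonal_def)
  then have "orthogonal (u ?d) (u ?d)"
    using orthogonal_to_span[of "u ?d" ?S "u ?d"] \<open>span ?B \<subseteq> span ?S\<close> uB by blast
  then have "g p ?d ?d = 0"
    using uu[OF d d] by (simp add: orthogonal_def)
  then have "?d = (\<lambda>f. 0)"
    using metric_pos[OF p d] by fastforce
  then show ?thesis
    by (auto simp: fun_eq_iff)
qed

text \<open>The matrix between two orthonormal frames is orthogonal. Expanding T in both arguments
  leaves the sums of products of two columns of this matrix, which Parseval evaluates to 1 or
  0.\<close>

lemma trace_invariant:
  assumes p: "p \<in> mcarrier M" and E: "orthonormal_at M g p E" and E': "orthonormal_at M g p E'"
    and T1: "\<And>Y. Y \<in> vector_fields M \<Longrightarrow> tensorial p (\<lambda>X. T X Y)"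
    and T2: "\<And>X. X \<in> vector_fields M \<Longrightarrow> tensorial p (\<lambda>Y. T X Y)"
  shows "(\<Sum>b\<in>mcoords M. T (E b) (E b)) = (\<Sum>b\<in>mcoords M. T (E' b) (E' b))"
proof -
  let ?B = "mcoords M"
  have F: "E b \<in> vector_fields M" "E' b \<in> vector_fields M" if "b \<in> ?B" for b
    using E E' that by (auto simp: orthonormal_at_def)
  have t: "E b p \<in> tangent_space M p" "E' b p \<in> tangent_space M p" if "b \<in> ?B" for b
    using field_tangent[OF F(1)[OF that] p] field_tangent[OF F(2)[OF that] p] .
  have o: "g p (E b p) (E c p) = (if b = c then 1 else 0)" "g p (E' b p) (E' c p) = (if b = c then 1 else 0)"
    if "b \<in> ?B" "c \<in> ?B" for b c
    using E E' that by (auto simp: orthonormal_at_def)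
  let ?a = "\<lambda>b c. g p (E' b p) (E c p)"
  have exp: "E' b p = (\<lambda>f. \<Sum>c\<in>?B. ?a b c * E c p f)" if "b \<in> ?B" for b
    by (rule orthonormal_expansion[OF p t(1) o(1) t(2)[OF that]])
  have "T (E' b) (E' b) = (\<Sum>c\<in>?B. \<Sum>d\<in>?B. (?a b c * ?a b d) * T (E c) (E d))" if b: "b \<in> ?B" for b
  proof -
    have "T (E' b) (E' b) = (\<Sum>c\<in>?B. ?a b c * T (E c) (E' b))"
      by (rule tensorial_lincomb[OF T1[OF F(2)[OF b]] p F(2)[OF b] finite_coords F(1) exp[OF b]])
    also have "\<dots> = (\<Sum>c\<in>?B. ?a b c * (\<Sum>d\<in>?B. ?a b d * T (E c) (E d)))"
    proof (rule sum.cong)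
      fix c assume c: "c \<in> ?B"
      show "?a b c * T (E c) (E' b) = ?a b c * (\<Sum>d\<in>?B. ?a b d * T (E c) (E d))"
        using tensorial_lincomb[OF T2[OF F(1)[OF c]] p F(2)[OF b] finite_coords F(1) exp[OF b]] by simp
    qed simp
    finally show ?thesis
      by (simp add: sum_distrib_left mult.assoc)
  qed
  then have "(\<Sum>b\<in>?B. T (E' b) (E' b)) = (\<Sum>b\<in>?B. \<Sum>c\<in>?B. \<Sum>d\<in>?B. (?a b c * ?a b d) * T (E c) (E d))"
    by simp
  also have "\<dots> = (\<Sum>c\<in>?B. \<Sum>b\<in>?B. \<Sum>d\<in>?B. (?a b c * ?a b d) * T (E c) (E d))"
    by (rule sum.swap)
  also have "\<dots> = (\<Sum>c\<in>?B. \<Sum>d\<in>?B. \<Sum>b\<in>?B. (?a b c * ?a b d) * T (E c) (E d))"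
    by (rule sum.cong[OF refl sum.swap])
  also have "\<dots> = (\<Sum>c\<in>?B. \<Sum>d\<in>?B. if d = c then T (E c) (E d) else 0)"
  proof (intro sum.cong refl)
    fix c d assume c: "c \<in> ?B" and d: "d \<in> ?B"
    have "g p (E c p) (E d p) = (\<Sum>b\<in>?B. g p (E c p) (E' b p) * g p (E d p) (E' b p))"
      by (rule parseval[OF p t(2) t(1)[OF c] t(1)[OF d] orthonormal_expansion[OF p t(2) o(2) t(1)[OF c]]])
    also have "\<dots> = (\<Sum>b\<in>?B. ?a b c * ?a b d)"
      using metric_sym[OF p t(1)[OF c] t(2)] metric_sym[OF p t(1)[OF d] t(2)] by (intro sum.cong) auto
    finally have "(\<Sum>b\<in>?B. ?a b c * ?a b d) = (if d = c then 1 else 0)"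
      using o(1)[OF c d] by auto
    then show "(\<Sum>b\<in>?B. (?a b c * ?a b d) * T (E c) (E d)) = (if d = c then T (E c) (E d) else 0)"
      by (simp add: sum_distrib_right[symmetric])
  qed
  also have "\<dots> = (\<Sum>c\<in>?B. T (E c) (E c))"
    using finite_coords by simp
  finally show ?thesis
    by simp
qed

text \<open>Since P determines the value at each point, the pointwise choice coincides near every
  point with a local solution and inherits its smoothness.\<close>

lemma glue_field:
  assumes loc: "\<And>p. p \<in> mcarrier M \<Longrightarrow> \<exists>Y\<in>vector_fields M. \<forall>\<^sub>F q in near p. P q (Y q)"
    and unique: "\<And>p v w. P p v \<Longrightarrow> P p w \<Longrightarrow> p \<in> mcarrier M \<Longrightarrow> v = w"
  obtains X where "X \<in> vector_fields M" "\<And>p. p \<in> mcarrier M \<Longrightarrow> P p (X p)"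
proof -
  define X where "X p = (SOME v. P p v)" for p
  have PX: "P p (X p)" if p: "p \<in> mcarrier M" for p
    unfolding X_def using loc[OF p] eventually_nhdsin_self[OF _ p] by (metis someI_ex)
  have "X \<in> vector_fields M"
  proof (rule fieldI)
    fix p assume p: "p \<in> mcarrier M"
    obtain Y where Y: "Y \<in> vector_fields M" "\<forall>\<^sub>F q in near p. P q (Y q)"
      using loc[OF p] by blast
    then show "X p \<in> tangent_space M p"
      using unique[OF PX[OF p] eventually_nhdsin_self[OF Y(2) p] p] field_tangent[OF Y(1) p] by simp
    fix f assume f: "f \<in> smooth_functions M"
    have "\<forall>\<^sub>F q in near p. Y q f = X q f"
      using Y(2) eventually_nhdsin_openin[OF openin_topspace p]
    proof eventually_elim
      case (elim q)
      then show ?case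
        using unique[OF PX[OF elim(2)] elim(1) elim(2)] by simp
    qed
    then show "smooth_at M p (\<lambda>q. X q f)"
      by (rule smooth_at_cong[OF p _ smooth_functionsD[OF field_smooth[OF Y(1) f] p]])
  qed
  then show ?thesis
    using that PX by blast
qed

text \<open>In a local orthonormal frame E the representing field is the sum of the \<alpha> (E b) E
  b. Representing vectors are unique because the metric is definite and every vector extends to a
  field, so the local solutions glue.\<close>

lemma riesz:
  assumes smooth: "\<And>Z. Z \<in> vector_fields M \<Longrightarrow> (\<lambda>p. \<alpha> p Z) \<in> smooth_functions M"
    and tens: "\<And>p. p \<in> mcarrier M \<Longrightarrow> tensorial p (\<alpha> p)"
  obtains X where "X \<in> vector_fields M"
    "\<And>Z p. Z \<in> vector_fields M \<Longrightarrow> p \<in> mcarrier M \<Longrightarrow> g p (X p) (Z p) = \<alpha> p Z"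
proof -
  let ?B = "mcoords M"
  define P where "P p v \<longleftrightarrow> v \<in> tangent_space M p \<and> (\<forall>Z\<in>vector_fields M. g p v (Z p) = \<alpha> p Z)" for p v
  have unique: "v = w" if v: "P p v" and w: "P p w" and p: "p \<in> mcarrier M" for p v w
  proof (rule metric_eqI[OF p])
    fix u assume u: "u \<in> tangent_space M p"
    obtain Z where "Z \<in> vector_fields M" "Z p = u"
      using extend_tangent[OF p u] .
    then show "g p v u = g p w u"
      using v w by (auto simp: P_def)
  qed (use v w in \<open>auto simp: P_def\<close>)
  have loc: "\<exists>Y\<in>vector_fields M. \<forall>\<^sub>F q in near p. P q (Y q)" if p: "p \<in> mcarrier M" for p
  proof -
    obtain E where E: "\<And>b. b \<in> ?B \<Longrightarrow> E b \<in> vector_fields M"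
      and ev: "\<forall>\<^sub>F q in near p. (\<forall>b\<in>?B. \<forall>c\<in>?B. g q (E b q) (E c q) = (if b = c then 1 else 0)) \<and>
       (\<forall>v\<in>tangent_space M q. v = (\<lambda>f. \<Sum>b\<in>?B. g q v (E b q) * E b q f))"
      by (rule local_orthonormal_frame[OF p]) (rule that)
    let ?Y = "\<lambda>q f. \<Sum>b\<in>?B. \<alpha> q (E b) * E b q f"
    have Y: "?Y \<in> vector_fields M"
      by (rule field_lincomb[OF E smooth[OF E]])
    have "\<forall>\<^sub>F q in near p. P q (?Y q)"
      using ev eventually_nhdsin_openin[OF openin_topspace p]
    proof eventually_elim
      case (elim q)
      have Et: "E b q \<in> tangent_space M q" if "b \<in> ?B" for b
        using field_tangent[OF E[OF that] elim(2)] .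
      have "g q (?Y q) (Z q) = \<alpha> q Z" if Z: "Z \<in> vector_fields M" for Z
      proof -
        have Zt: "Z q \<in> tangent_space M q"
          using field_tangent[OF Z elim(2)] .
        have "Z q = (\<lambda>f. \<Sum>b\<in>?B. g q (Z q) (E b q) * E b q f)"
          using elim(1) Zt by blast
        from tensorial_lincomb[OF tens[OF elim(2)] elim(2) Z finite_coords E this]
        have "\<alpha> q Z = (\<Sum>b\<in>?B. g q (Z q) (E b q) * \<alpha> q (E b))" .
        also have "\<dots> = (\<Sum>b\<in>?B. \<alpha> q (E b) * g q (E b q) (Z q))"
          using metric_sym[OF elim(2) Zt Et] by (intro sum.cong) auto
        also have "\<dots> = g q (?Y q) (Z q)"
          by (rule metric_lincomb_left[OF elim(2) Zt Et, symmetric])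
        finally show ?thesis ..
      qed
      then show ?case
        using field_tangent[OF Y elim(2)] by (simp add: P_def)
    qed
    then show ?thesis
      by (rule bexI[of _ ?Y, OF _ Y])
  qed
  obtain X where "X \<in> vector_fields M" "\<And>p. p \<in> mcarrier M \<Longrightarrow> P p (X p)"
    by (rule glue_field[of P, OF loc unique]) (auto simp: P_def intro: that)
  then show ?thesis
    using that by (auto simp: P_def)
qed

end


subsection \<open>The Levi-Civita connection\<close>

context smooth_mfd
begin

lemma bracket_antisym: "lie_bracket Y X p = (\<lambda>f. - lie_bracket X Y p f)"
  by (simp add: lie_bracket_def)

lemma tangent_field_sum:
  assumes p: "p \<in> mcarrier M" and v: "v \<in> tangent_space M p"
    and X: "X \<in> vector_fields M" and Y: "Y \<in> vector_fields M"
  shows "v (\<lambda>q. X q f + Y q f) = v (\<lambda>q. X q f) + v (\<lambda>q. Y q f)"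
proof (cases "f \<in> smooth_functions M")
  case True
  show ?thesis
    by (rule tangent_add[OF v field_smooth[OF X True] field_smooth[OF Y True]])
next
  case False
  then show ?thesis
    using field_field_nonsmooth[OF field_add[OF X Y] v p False]
      field_field_nonsmooth[OF X v p False] field_field_nonsmooth[OF Y v p False] by simp
qed

lemma tangent_field_product:
  assumes p: "p \<in> mcarrier M" and v: "v \<in> tangent_space M p"
    and h: "h \<in> smooth_functions M" and X: "X \<in> vector_fields M"
  shows "v (\<lambda>q. h q * X q f) = h p * v (\<lambda>q. X q f) + X p f * v h"
proof (cases "f \<in> smooth_functions M")
  case True
  show ?thesis
    by (rule tangent_mult[OF v h field_smooth[OF X True]])
next
  case False
  then show ?thesis
    using field_field_nonsmooth[OF field_mult[OF h X] v p False]
      field_field_nonsmooth[OF X v p False] field_off_nonsmooth[OF X p False] by simp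
qed

lemma bracket_add_right:
  assumes "p \<in> mcarrier M" "X \<in> vector_fields M" "Y \<in> vector_fields M" "Z \<in> vector_fields M"
  shows "lie_bracket X (\<lambda>q f. Y q f + Z q f) p = (\<lambda>f. lie_bracket X Y p f + lie_bracket X Z p f)"
  unfolding lie_bracket_def tangent_field_sum[OF assms(1) field_tangent[OF assms(2,1)] assms(3,4)]
  by (simp add: algebra_simps)

lemma bracket_mult_right:
  assumes "p \<in> mcarrier M" "X \<in> vector_fields M" "h \<in> smooth_functions M" "Y \<in> vector_fields M"
  shows "lie_bracket X (\<lambda>q f. h q * Y q f) p = (\<lambda>f. h p * lie_bracket X Y p f + X p h * Y p f)"
  unfolding lie_bracket_def tangent_field_product[OF assms(1) field_tangent[OF assms(2,1)] assms(3,4)]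
  by (simp add: algebra_simps)

lemma bracket_add_left:
  assumes "p \<in> mcarrier M" "X \<in> vector_fields M" "Y \<in> vector_fields M" "Z \<in> vector_fields M"
  shows "lie_bracket (\<lambda>q f. Y q f + Z q f) X p = (\<lambda>f. lie_bracket Y X p f + lie_bracket Z X p f)"
  unfolding lie_bracket_def tangent_field_sum[OF assms(1) field_tangent[OF assms(2,1)] assms(3,4)]
  by (simp add: algebra_simps)

lemma bracket_mult_left:
  assumes "p \<in> mcarrier M" "X \<in> vector_fields M" "h \<in> smooth_functions M" "Y \<in> vector_fields M"
  shows "lie_bracket (\<lambda>q f. h q * Y q f) X p = (\<lambda>f. h p * lie_bracket Y X p f - X p h * Y p f)"
  unfolding lie_bracket_def tangent_field_product[OF assms(1) field_tangent[OF assms(2,1)] assms(3,4)]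
  by (simp add: algebra_simps)

end

context riem_mfd
begin

section \<open>The Koszul formula and the existence of the connection\<close>

lemma metric_deriv_sym:
  assumes p: "p \<in> mcarrier M" and v: "v \<in> tangent_space M p"
    and X: "X \<in> vector_fields M" and Y: "Y \<in> vector_fields M"
  shows "v (\<lambda>q. g q (X q) (Y q)) = v (\<lambda>q. g q (Y q) (X q))"
  by (rule tangent_cong[OF p v metric_smooth[OF X Y]])
    (rule metric_sym[OF _ field_tangent[OF X] field_tangent[OF Y]])

lemma metric_deriv_add:
  assumes p: "p \<in> mcarrier M" and v: "v \<in> tangent_space M p"
    and X: "X \<in> vector_fields M" and Y: "Y \<in> vector_fields M" and Z: "Z \<in> vector_fields M"
  shows "v (\<lambda>q. g q (\<lambda>f. X q f + Y q f) (Z q)) = v (\<lambda>q. g q (X q) (Z q)) + v (\<lambda>q. g q (Y q) (Z q))"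
proof -
  have "v (\<lambda>q. g q (\<lambda>f. X q f + Y q f) (Z q)) = v (\<lambda>q. g q (X q) (Z q) + g q (Y q) (Z q))"
    by (rule tangent_cong[OF p v metric_smooth[OF field_add[OF X Y] Z]])
      (rule metric_add_left[OF _ field_tangent[OF X] field_tangent[OF Y] field_tangent[OF Z]])
  then show ?thesis
    using tangent_add[OF v metric_smooth[OF X Z] metric_smooth[OF Y Z]] by simp
qed

lemma metric_deriv_mult:
  assumes p: "p \<in> mcarrier M" and v: "v \<in> tangent_space M p" and h: "h \<in> smooth_functions M"
    and X: "X \<in> vector_fields M" and Z: "Z \<in> vector_fields M"
  shows "v (\<lambda>q. g q (\<lambda>f. h q * X q f) (Z q)) = h p * v (\<lambda>q. g q (X q) (Z q)) + g p (X p) (Z p) * v h"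
proof -
  have "v (\<lambda>q. g q (\<lambda>f. h q * X q f) (Z q)) = v (\<lambda>q. h q * g q (X q) (Z q))"
    by (rule tangent_cong[OF p v metric_smooth[OF field_mult[OF h X] Z]])
      (rule metric_scale_left[OF _ field_tangent[OF X] field_tangent[OF Z]])
  then show ?thesis
    using tangent_mult[OF v h metric_smooth[OF X Z]] by simp
qed

lemma metric_deriv_add_right:
  assumes p: "p \<in> mcarrier M" and v: "v \<in> tangent_space M p"
    and X: "X \<in> vector_fields M" and Y: "Y \<in> vector_fields M" and Z: "Z \<in> vector_fields M"
  shows "v (\<lambda>q. g q (Z q) (\<lambda>f. X q f + Y q f)) = v (\<lambda>q. g q (Z q) (X q)) + v (\<lambda>q. g q (Z q) (Y q))"
  using metric_deriv_add[OF assms] metric_deriv_sym[OF p v Z field_add[OF X Y]]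
    metric_deriv_sym[OF p v Z X] metric_deriv_sym[OF p v Z Y] by simp

lemma metric_deriv_mult_right:
  assumes p: "p \<in> mcarrier M" and v: "v \<in> tangent_space M p" and h: "h \<in> smooth_functions M"
    and X: "X \<in> vector_fields M" and Z: "Z \<in> vector_fields M"
  shows "v (\<lambda>q. g q (Z q) (\<lambda>f. h q * X q f)) = h p * v (\<lambda>q. g q (Z q) (X q)) + g p (Z p) (X p) * v h"
  using metric_deriv_mult[OF assms] metric_deriv_sym[OF p v Z field_mult[OF h X]]
    metric_deriv_sym[OF p v Z X] metric_sym[OF p field_tangent[OF Z p] field_tangent[OF X p]] by simp

text \<open>The right-hand side of the Koszul formula: the value that 2 g(D X Y, Z) must have for a
  torsion-free metric connection D.\<close>

definition koszul :: "'a vfield \<Rightarrow> 'a vfield \<Rightarrow> 'a vfield \<Rightarrow> 'a \<Rightarrow> real" where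
  "koszul X Y Z p =
     X p (\<lambda>q. g q (Y q) (Z q)) + Y p (\<lambda>q. g q (Z q) (X q)) - Z p (\<lambda>q. g q (X q) (Y q))
     + g p (lie_bracket X Y p) (Z p) - g p (lie_bracket X Z p) (Y p) - g p (lie_bracket Y Z p) (X p)"

context
  fixes p assumes p: "p \<in> mcarrier M"
begin

lemma metric_bracket_mult_right:
  assumes X: "X \<in> vector_fields M" and h: "h \<in> smooth_functions M" and Y: "Y \<in> vector_fields M"
    and w: "w \<in> tangent_space M p"
  shows "g p (lie_bracket X (\<lambda>q f. h q * Y q f) p) w = h p * g p (lie_bracket X Y p) w + X p h * g p (Y p) w"
  using metric_add_left[OF p tangent_space_scale[OF field_tangent[OF bracket_field[OF X Y] p]]
      tangent_space_scale[OF field_tangent[OF Y p]] w]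
    metric_scale_left[OF p field_tangent[OF bracket_field[OF X Y] p] w]
    metric_scale_left[OF p field_tangent[OF Y p] w]
  by (simp add: bracket_mult_right[OF p X h Y])

lemma metric_bracket_antisym:
  assumes X: "X \<in> vector_fields M" and Y: "Y \<in> vector_fields M" and w: "w \<in> tangent_space M p"
  shows "g p (lie_bracket Y X p) w = - g p (lie_bracket X Y p) w"
  using metric_scale_left[OF p field_tangent[OF bracket_field[OF X Y] p] w, of "-1"]
  by (simp add: bracket_antisym[of Y X p])

lemma metric_bracket_mult_left:
  assumes X: "X \<in> vector_fields M" and h: "h \<in> smooth_functions M" and Y: "Y \<in> vector_fields M"
    and w: "w \<in> tangent_space M p"
  shows "g p (lie_bracket (\<lambda>q f. h q * Y q f) X p) w = h p * g p (lie_bracket Y X p) w - X p h * g p (Y p) w"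
  using metric_bracket_mult_right[OF X h Y w] metric_bracket_antisym[OF X field_mult[OF h Y] w]
    metric_bracket_antisym[OF X Y w] by simp

lemma metric_bracket_add_right:
  assumes X: "X \<in> vector_fields M" and Y: "Y \<in> vector_fields M" and Z: "Z \<in> vector_fields M"
    and w: "w \<in> tangent_space M p"
  shows "g p (lie_bracket X (\<lambda>q f. Y q f + Z q f) p) w = g p (lie_bracket X Y p) w + g p (lie_bracket X Z p) w"
  using metric_add_left[OF p field_tangent[OF bracket_field[OF X Y] p] field_tangent[OF bracket_field[OF X Z] p] w]
  by (simp add: bracket_add_right[OF p X Y Z])

lemma metric_bracket_add_left:
  assumes X: "X \<in> vector_fields M" and Y: "Y \<in> vector_fields M" and Z: "Z \<in> vector_fields M"
    and w: "w \<in> tangent_space M p"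
  shows "g p (lie_bracket (\<lambda>q f. Y q f + Z q f) X p) w = g p (lie_bracket Y X p) w + g p (lie_bracket Z X p) w"
  using metric_bracket_add_right[OF X Y Z w] metric_bracket_antisym[OF X field_add[OF Y Z] w]
    metric_bracket_antisym[OF X Y w] metric_bracket_antisym[OF X Z w] by simp

lemmas tp = field_tangent[OF _ p]

lemma koszul_add1:
  assumes "X \<in> vector_fields M" "X' \<in> vector_fields M" "Y \<in> vector_fields M" "Z \<in> vector_fields M"
  shows "koszul (\<lambda>q f. X q f + X' q f) Y Z p = koszul X Y Z p + koszul X' Y Z p"
  unfolding koszul_def
  using metric_deriv_add[OF p tp[OF assms(4)] assms(1,2,3)] metric_deriv_add_right[OF p tp[OF assms(3)] assms(1,2,4)]
    metric_bracket_add_left[OF assms(3,1,2) tp[OF assms(4)]] metric_bracket_add_left[OF assms(4,1,2) tp[OF assms(3)]]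
    metric_add_right[OF p tp[OF assms(1)] tp[OF assms(2)] tp[OF bracket_field[OF assms(3,4)]]]
  by simp

lemma koszul_add2:
  assumes "X \<in> vector_fields M" "Y \<in> vector_fields M" "Y' \<in> vector_fields M" "Z \<in> vector_fields M"
  shows "koszul X (\<lambda>q f. Y q f + Y' q f) Z p = koszul X Y Z p + koszul X Y' Z p"
  unfolding koszul_def
  using metric_deriv_add[OF p tp[OF assms(1)] assms(2,3,4)] metric_deriv_add_right[OF p tp[OF assms(4)] assms(2,3,1)]
    metric_bracket_add_right[OF assms(1,2,3) tp[OF assms(4)]] metric_bracket_add_left[OF assms(4,2,3) tp[OF assms(1)]]
    metric_add_right[OF p tp[OF assms(2)] tp[OF assms(3)] tp[OF bracket_field[OF assms(1,4)]]]
  by simp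

lemma koszul_add3:
  assumes "X \<in> vector_fields M" "Y \<in> vector_fields M" "Z \<in> vector_fields M" "Z' \<in> vector_fields M"
  shows "koszul X Y (\<lambda>q f. Z q f + Z' q f) p = koszul X Y Z p + koszul X Y Z' p"
  unfolding koszul_def
  using metric_deriv_add_right[OF p tp[OF assms(1)] assms(3,4,2)] metric_deriv_add[OF p tp[OF assms(2)] assms(3,4,1)]
    metric_bracket_add_right[OF assms(1,3,4) tp[OF assms(2)]] metric_bracket_add_right[OF assms(2,3,4) tp[OF assms(1)]]
    metric_add_right[OF p tp[OF assms(3)] tp[OF assms(4)] tp[OF bracket_field[OF assms(1,2)]]]
  by simp

lemma koszul_mult1:
  assumes X: "X \<in> vector_fields M" and Y: "Y \<in> vector_fields M" and Z: "Z \<in> vector_fields M"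
    and h: "h \<in> smooth_functions M"
  shows "koszul (\<lambda>q f. h q * X q f) Y Z p = h p * koszul X Y Z p"
  unfolding koszul_def
  using metric_deriv_mult[OF p tp[OF Z] h X Y] metric_deriv_mult_right[OF p tp[OF Y] h X Z]
    metric_bracket_mult_left[OF Y h X tp[OF Z]] metric_bracket_mult_left[OF Z h X tp[OF Y]]
    metric_scale_right[OF p tp[OF X] tp[OF bracket_field[OF Y Z]], of "h p"]
    metric_sym[OF p tp[OF X] tp[OF Z]]
  by (simp add: algebra_simps)

text \<open>In the first and the third argument the derivatives of h cancel between the metric terms
  and the brackets. In the second argument they add up, to twice the Leibniz term of a
  connection.\<close>

lemma koszul_mult2:
  assumes X: "X \<in> vector_fields M" and Y: "Y \<in> vector_fields M" and Z: "Z \<in> vector_fields M"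
    and h: "h \<in> smooth_functions M"
  shows "koszul X (\<lambda>q f. h q * Y q f) Z p = h p * koszul X Y Z p + 2 * (X p h * g p (Y p) (Z p))"
  unfolding koszul_def
  using metric_deriv_mult[OF p tp[OF X] h Y Z] metric_deriv_mult_right[OF p tp[OF Z] h Y X]
    metric_bracket_mult_right[OF X h Y tp[OF Z]] metric_bracket_mult_left[OF Z h Y tp[OF X]]
    metric_scale_right[OF p tp[OF Y] tp[OF bracket_field[OF X Z]], of "h p"]
    metric_sym[OF p tp[OF X] tp[OF Y]]
  by (simp add: algebra_simps)

lemma koszul_mult3:
  assumes X: "X \<in> vector_fields M" and Y: "Y \<in> vector_fields M" and Z: "Z \<in> vector_fields M"
    and h: "h \<in> smooth_functions M"
  shows "koszul X Y (\<lambda>q f. h q * Z q f) p = h p * koszul X Y Z p"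
  unfolding koszul_def
  using metric_deriv_mult_right[OF p tp[OF X] h Z Y] metric_deriv_mult[OF p tp[OF Y] h Z X]
    metric_bracket_mult_right[OF X h Z tp[OF Y]] metric_bracket_mult_right[OF Y h Z tp[OF X]]
    metric_scale_right[OF p tp[OF Z] tp[OF bracket_field[OF X Y]], of "h p"]
    metric_sym[OF p tp[OF Y] tp[OF Z]]
  by (simp add: algebra_simps)

lemma koszul_torsion:
  assumes X: "X \<in> vector_fields M" and Y: "Y \<in> vector_fields M" and Z: "Z \<in> vector_fields M"
  shows "koszul X Y Z p - koszul Y X Z p = 2 * g p (lie_bracket X Y p) (Z p)"
  unfolding koszul_def
  using metric_deriv_sym[OF p tp[OF X] Y Z] metric_deriv_sym[OF p tp[OF Y] Z X]
    metric_deriv_sym[OF p tp[OF Z] X Y] metric_bracket_antisym[OF X Y tp[OF Z]]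
  by simp

lemma koszul_metric:
  assumes X: "X \<in> vector_fields M" and Y: "Y \<in> vector_fields M" and Z: "Z \<in> vector_fields M"
  shows "koszul X Y Z p + koszul X Z Y p = 2 * X p (\<lambda>q. g q (Y q) (Z q))"
  unfolding koszul_def
  using metric_deriv_sym[OF p tp[OF X] Y Z] metric_deriv_sym[OF p tp[OF Y] Z X]
    metric_deriv_sym[OF p tp[OF Z] X Y] metric_bracket_antisym[OF Y Z tp[OF X]]
  by simp

end

lemma field_eqI:
  assumes p: "p \<in> mcarrier M" and v: "v \<in> tangent_space M p" and w: "w \<in> tangent_space M p"
    and eq: "\<And>Z. Z \<in> vector_fields M \<Longrightarrow> g p v (Z p) = g p w (Z p)"
  shows "v = w"
proof (rule metric_eqI[OF p v w])
  fix u assume u: "u \<in> tangent_space M p"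
  obtain Z where "Z \<in> vector_fields M" "Z p = u"
    using extend_tangent[OF p u] .
  then show "g p v u = g p w u"
    using eq by blast
qed

lemma koszul_smooth:
  assumes X: "X \<in> vector_fields M" and Y: "Y \<in> vector_fields M" and Z: "Z \<in> vector_fields M"
  shows "koszul X Y Z \<in> smooth_functions M"
  unfolding koszul_def[abs_def]
  by (rule smooth_function_diff[OF smooth_function_diff[OF smooth_function_add[OF
          smooth_function_diff[OF smooth_function_add[OF field_smooth[OF X metric_smooth[OF Y Z]]
              field_smooth[OF Y metric_smooth[OF Z X]]] field_smooth[OF Z metric_smooth[OF X Y]]]
          metric_smooth[OF bracket_field[OF X Y] Z]] metric_smooth[OF bracket_field[OF X Z] Y]]
        metric_smooth[OF bracket_field[OF Y Z] X]])

lemma koszul_connection: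
  assumes X: "X \<in> vector_fields M" and Y: "Y \<in> vector_fields M"
  shows "\<exists>W\<in>vector_fields M. \<forall>Z\<in>vector_fields M. \<forall>p\<in>mcarrier M. 2 * g p (W p) (Z p) = koszul X Y Z p"
proof -
  obtain W where W: "W \<in> vector_fields M"
    "\<And>Z p. Z \<in> vector_fields M \<Longrightarrow> p \<in> mcarrier M \<Longrightarrow> g p (W p) (Z p) = 1/2 * koszul X Y Z p"
  proof (rule riesz[of "\<lambda>p Z. 1/2 * koszul X Y Z p"])
    show "(\<lambda>p. 1/2 * koszul X Y Z p) \<in> smooth_functions M" if "Z \<in> vector_fields M" for Z
      by (rule smooth_function_mult[OF smooth_function_const koszul_smooth[OF X Y that]])
    show "tensorial p (\<lambda>Z. 1/2 * koszul X Y Z p)" if "p \<in> mcarrier M" for p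
      unfolding tensorial_def
      by (simp add: koszul_add3[OF that X Y] koszul_mult3[OF that X Y])
  qed (rule that)
  then show ?thesis
    by (intro bexI[of _ W]) (auto simp: mult.commute)
qed

text \<open>The witness is defined by 2 g(D X Y, Z) = koszul X Y Z. Vector identities at p are
  tested against all fields W through \<open>field_eqI\<close>, and each axiom becomes one of the
  identities for \<open>koszul\<close>.\<close>

lemma levi_civita_exists: "\<exists>D. is_levi_civita M g D"
proof -
  define D where "D X Y = (SOME W. W \<in> vector_fields M \<and>
      (\<forall>Z\<in>vector_fields M. \<forall>p\<in>mcarrier M. 2 * g p (W p) (Z p) = koszul X Y Z p))" for X Y
  have D: "D X Y \<in> vector_fields M \<and>
      (\<forall>Z\<in>vector_fields M. \<forall>p\<in>mcarrier M. 2 * g p (D X Y p) (Z p) = koszul X Y Z p)"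
    if "X \<in> vector_fields M" "Y \<in> vector_fields M" for X Y
    using someI_ex[OF koszul_connection[OF that, unfolded Bex_def]] unfolding D_def .
  have DF: "D X Y \<in> vector_fields M" if "X \<in> vector_fields M" "Y \<in> vector_fields M" for X Y
    using D[OF that] by blast
  have DK: "g p (D X Y p) (Z p) = koszul X Y Z p / 2"
    if "X \<in> vector_fields M" "Y \<in> vector_fields M" "Z \<in> vector_fields M" "p \<in> mcarrier M" for X Y Z p
  proof -
    have "2 * g p (D X Y p) (Z p) = koszul X Y Z p"
      using D[OF that(1,2)] that(3,4) by blast
    then show ?thesis
      by simp
  qed
  have "affine_connection M D"
    unfolding affine_connection_def
  proof (intro ballI conjI)
    fix X Y Z h assume X: "X \<in> vector_fields M" and Y: "Y \<in> vector_fields M" and Z: "Z \<in> vector_fields M"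
      and h: "h \<in> smooth_functions M"
    show "D X Y \<in> vector_fields M"
      by (rule DF[OF X Y])
    fix p assume p: "p \<in> mcarrier M"
    note t = field_tangent[OF _ p]
    show "D (\<lambda>q f. X q f + Y q f) Z p = (\<lambda>f. D X Z p f + D Y Z p f)"
    proof (rule field_eqI[OF p t[OF DF[OF field_add[OF X Y] Z]] tangent_space_add[OF t[OF DF[OF X Z]] t[OF DF[OF Y Z]]]])
      fix W assume W: "W \<in> vector_fields M"
      show "g p (D (\<lambda>q f. X q f + Y q f) Z p) (W p) = g p (\<lambda>f. D X Z p f + D Y Z p f) (W p)"
        using metric_add_left[OF p t[OF DF[OF X Z]] t[OF DF[OF Y Z]] t[OF W]] DK[OF field_add[OF X Y] Z W p]
          DK[OF X Z W p] DK[OF Y Z W p] koszul_add1[OF p X Y Z W] by simp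
    qed
    show "D X (\<lambda>q f. Y q f + Z q f) p = (\<lambda>f. D X Y p f + D X Z p f)"
    proof (rule field_eqI[OF p t[OF DF[OF X field_add[OF Y Z]]] tangent_space_add[OF t[OF DF[OF X Y]] t[OF DF[OF X Z]]]])
      fix W assume W: "W \<in> vector_fields M"
      show "g p (D X (\<lambda>q f. Y q f + Z q f) p) (W p) = g p (\<lambda>f. D X Y p f + D X Z p f) (W p)"
        using metric_add_left[OF p t[OF DF[OF X Y]] t[OF DF[OF X Z]] t[OF W]] DK[OF X field_add[OF Y Z] W p]
          DK[OF X Z W p] DK[OF X Y W p] koszul_add2[OF p X Y Z W] by simp
    qed
    show "D (\<lambda>q f. h q * X q f) Y p = (\<lambda>f. h p * D X Y p f)"
    proof (rule field_eqI[OF p t[OF DF[OF field_mult[OF h X] Y]] tangent_space_scale[OF t[OF DF[OF X Y]]]])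
      fix W assume W: "W \<in> vector_fields M"
      show "g p (D (\<lambda>q f. h q * X q f) Y p) (W p) = g p (\<lambda>f. h p * D X Y p f) (W p)"
        using metric_scale_left[OF p t[OF DF[OF X Y]] t[OF W], of "h p"] DK[OF field_mult[OF h X] Y W p]
          DK[OF X Y W p] koszul_mult1[OF p X Y W h] by simp
    qed
    show "D X (\<lambda>q f. h q * Y q f) p = (\<lambda>f. X p h * Y p f + h p * D X Y p f)"
    proof (rule field_eqI[OF p t[OF DF[OF X field_mult[OF h Y]]]
          tangent_space_add[OF tangent_space_scale[OF t[OF Y]] tangent_space_scale[OF t[OF DF[OF X Y]]]]])
      fix W assume W: "W \<in> vector_fields M"
      show "g p (D X (\<lambda>q f. h q * Y q f) p) (W p) = g p (\<lambda>f. X p h * Y p f + h p * D X Y p f) (W p)"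
        using metric_add_left[OF p tangent_space_scale[OF t[OF Y], of "X p h"] tangent_space_scale[OF t[OF DF[OF X Y]], of "h p"] t[OF W]]
          metric_scale_left[OF p t[OF Y] t[OF W], of "X p h"] metric_scale_left[OF p t[OF DF[OF X Y]] t[OF W], of "h p"]
          DK[OF X field_mult[OF h Y] W p] DK[OF X Y W p] koszul_mult2[OF p X Y W h]
        by (simp add: field_simps)
    qed
  qed
  moreover have "(\<lambda>f. D X Y p f - D Y X p f) = lie_bracket X Y p"
    if X: "X \<in> vector_fields M" and Y: "Y \<in> vector_fields M" and p: "p \<in> mcarrier M" for X Y p
  proof (rule field_eqI[OF p])
    note t = field_tangent[OF _ p]
    show "(\<lambda>f. D X Y p f - D Y X p f) \<in> tangent_space M p"
      by (rule tangent_space_diff[OF t[OF DF[OF X Y]] t[OF DF[OF Y X]]])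
    show "lie_bracket X Y p \<in> tangent_space M p"
      by (rule t[OF bracket_field[OF X Y]])
    fix W assume W: "W \<in> vector_fields M"
    show "g p (\<lambda>f. D X Y p f - D Y X p f) (W p) = g p (lie_bracket X Y p) (W p)"
      using metric_diff_left[OF p t[OF DF[OF X Y]] t[OF DF[OF Y X]] t[OF W]]
        DK[OF X Y W p] DK[OF Y X W p] koszul_torsion[OF p X Y W] by simp
  qed
  moreover have "X p (\<lambda>q. g q (Y q) (Z q)) = g p (D X Y p) (Z p) + g p (Y p) (D X Z p)"
    if X: "X \<in> vector_fields M" and Y: "Y \<in> vector_fields M" and Z: "Z \<in> vector_fields M"
      and p: "p \<in> mcarrier M" for X Y Z p
    using DK[OF X Y Z p] DK[OF X Z Y p] koszul_metric[OF p X Y Z]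
      metric_sym[OF p field_tangent[OF Y p] field_tangent[OF DF[OF X Z] p]] by simp
  ultimately have "is_levi_civita M g D"
    unfolding is_levi_civita_def by blast
  then show ?thesis
    by (intro exI[of _ D])
qed

abbreviation "\<D> \<equiv> levi_civita M g"

lemma levi_civita: "is_levi_civita M g \<D>"
  unfolding levi_civita_def by (rule someI_ex[OF levi_civita_exists])

lemma nabla_field: "X \<in> vector_fields M \<Longrightarrow> Y \<in> vector_fields M \<Longrightarrow> \<D> X Y \<in> vector_fields M"
  using levi_civita unfolding is_levi_civita_def affine_connection_def
  using smooth_function_const by blast

lemma nabla_linear:
  assumes "p \<in> mcarrier M" "X \<in> vector_fields M" "Y \<in> vector_fields M"
  shows nabla_add_left: "Z \<in> vector_fields M \<Longrightarrow> \<D> (\<lambda>q f. X q f + Y q f) Z p = (\<lambda>f. \<D> X Z p f + \<D> Y Z p f)"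
    and nabla_add_right: "Z \<in> vector_fields M \<Longrightarrow> \<D> X (\<lambda>q f. Y q f + Z q f) p = (\<lambda>f. \<D> X Y p f + \<D> X Z p f)"
    and nabla_mult_left: "h \<in> smooth_functions M \<Longrightarrow> \<D> (\<lambda>q f. h q * X q f) Y p = (\<lambda>f. h p * \<D> X Y p f)"
    and nabla_mult_right: "h \<in> smooth_functions M \<Longrightarrow> \<D> X (\<lambda>q f. h q * Y q f) p = (\<lambda>f. X p h * Y p f + h p * \<D> X Y p f)"
proof -
  have *: "\<D> (\<lambda>q f. X q f + Y q f) Z p = (\<lambda>f. \<D> X Z p f + \<D> Y Z p f) \<and>
      \<D> (\<lambda>q f. h q * X q f) Y p = (\<lambda>f. h p * \<D> X Y p f) \<and>
      \<D> X (\<lambda>q f. Y q f + Z q f) p = (\<lambda>f. \<D> X Y p f + \<D> X Z p f) \<and>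
      \<D> X (\<lambda>q f. h q * Y q f) p = (\<lambda>f. X p h * Y p f + h p * \<D> X Y p f)"
    if "Z \<in> vector_fields M" "h \<in> smooth_functions M" for Z h
    using levi_civita assms that unfolding is_levi_civita_def affine_connection_def by blast
  show "Z \<in> vector_fields M \<Longrightarrow> \<D> (\<lambda>q f. X q f + Y q f) Z p = (\<lambda>f. \<D> X Z p f + \<D> Y Z p f)"
    and "Z \<in> vector_fields M \<Longrightarrow> \<D> X (\<lambda>q f. Y q f + Z q f) p = (\<lambda>f. \<D> X Y p f + \<D> X Z p f)"
    using *[OF _ smooth_function_const[of 0]] by blast+
  show "h \<in> smooth_functions M \<Longrightarrow> \<D> (\<lambda>q f. h q * X q f) Y p = (\<lambda>f. h p * \<D> X Y p f)"
    and "h \<in> smooth_functions M \<Longrightarrow> \<D> X (\<lambda>q f. h q * Y q f) p = (\<lambda>f. X p h * Y p f + h p * \<D> X Y p f)"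
    using *[OF assms(2)] by blast+
qed

lemma nabla_torsion:
  "X \<in> vector_fields M \<Longrightarrow> Y \<in> vector_fields M \<Longrightarrow> p \<in> mcarrier M \<Longrightarrow>
   lie_bracket X Y p = (\<lambda>f. \<D> X Y p f - \<D> Y X p f)"
  using levi_civita unfolding is_levi_civita_def by metis

lemma nabla_metric:
  "X \<in> vector_fields M \<Longrightarrow> Y \<in> vector_fields M \<Longrightarrow> Z \<in> vector_fields M \<Longrightarrow> p \<in> mcarrier M \<Longrightarrow>
   X p (\<lambda>q. g q (Y q) (Z q)) = g p (\<D> X Y p) (Z p) + g p (Y p) (\<D> X Z p)"
  using levi_civita unfolding is_levi_civita_def by blast

text \<open>Conversely the axioms force the formula: derivatives of the metric are expanded by
  compatibility and brackets by vanishing torsion. This is how the chosen connections of two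
  manifolds are compared later.\<close>

lemma koszul_formula:
  assumes X: "X \<in> vector_fields M" and Y: "Y \<in> vector_fields M" and Z: "Z \<in> vector_fields M"
    and p: "p \<in> mcarrier M"
  shows "2 * g p (\<D> X Y p) (Z p) = koszul X Y Z p"
proof -
  note t = field_tangent[OF _ p]
  have br: "g p (lie_bracket U V p) (W p) = g p (\<D> U V p) (W p) - g p (\<D> V U p) (W p)"
    if U: "U \<in> vector_fields M" and V: "V \<in> vector_fields M" and W: "W \<in> vector_fields M" for U V W
    unfolding nabla_torsion[OF U V p]
    by (rule metric_diff_left[OF p t[OF nabla_field[OF U V]] t[OF nabla_field[OF V U]] t[OF W]])
  have sym: "g p (U p) (\<D> V W p) = g p (\<D> V W p) (U p)"
    if U: "U \<in> vector_fields M" and V: "V \<in> vector_fields M" and W: "W \<in> vector_fields M" for U V W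
    by (rule metric_sym[OF p t[OF U] t[OF nabla_field[OF V W]]])
  show ?thesis
    unfolding koszul_def nabla_metric[OF X Y Z p] nabla_metric[OF Y Z X p] nabla_metric[OF Z X Y p]
      br[OF X Y Z] br[OF X Z Y] br[OF Y Z X] sym[OF Y X Z] sym[OF Z Y X] sym[OF X Z Y]
    by simp
qed

lemma nabla_tensorial:
  assumes p: "p \<in> mcarrier M" and Y: "Y \<in> vector_fields M"
  shows "tensorial p (\<lambda>X. \<D> X Y p f)"
  unfolding tensorial_def
  using nabla_add_left[OF p _ _ Y] nabla_mult_left[OF p _ Y] by simp

text \<open>The connection is not tensorial in its second argument, yet values off the carrier do
  not matter. The difference of the two fields is unchanged by multiplication with the function that
  is 0 on the carrier and 1 off it; the Leibniz rule at p then gives 0, because the difference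
  itself vanishes at p.\<close>

lemma nabla_cong_right:
  assumes p: "p \<in> mcarrier M" and X: "X \<in> vector_fields M" and Y: "Y \<in> vector_fields M"
    and Z: "Z \<in> vector_fields M" and eq: "\<And>q. q \<in> mcarrier M \<Longrightarrow> Y q = Z q"
  shows "\<D> X Y p = \<D> X Z p"
proof -
  let ?\<chi> = "\<lambda>q. if q \<in> mcarrier M then 0 else (1::real)"
  let ?N = "\<lambda>q f. (-1) * Z q f"
  let ?D = "\<lambda>q f. Y q f + ?N q f"
  have N: "?N \<in> vector_fields M"
    by (rule field_mult[OF smooth_function_const Z])
  have D: "?D \<in> vector_fields M"
    by (rule field_add[OF Y N])
  have "(\<lambda>q f. ?\<chi> q * ?D q f) = ?D"
    using eq by (auto simp: fun_eq_iff)
  then have "\<D> X ?D p = (\<lambda>f. X p ?\<chi> * ?D p f + ?\<chi> p * \<D> X ?D p f)"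
    using nabla_mult_right[OF p X D smooth_function_off] by simp
  then have 1: "\<D> X ?D p = (\<lambda>f. 0)"
    using p eq[OF p] by simp
  have 2: "\<D> X ?D p = (\<lambda>f. \<D> X Y p f + \<D> X ?N p f)"
    by (rule nabla_add_right[OF p X Y N])
  have 3: "\<D> X ?N p = (\<lambda>f. X p (\<lambda>q. -1) * Z p f + (-1) * \<D> X Z p f)"
    by (rule nabla_mult_right[OF p X Z smooth_function_const])
  show ?thesis
  proof
    fix f
    show "\<D> X Y p f = \<D> X Z p f"
      using fun_cong[OF 1, of f] fun_cong[OF 2, of f] fun_cong[OF 3, of f]
        tangent_const[OF field_tangent[OF X p], of "-1"] by simp
  qed
qed

end


subsection \<open>Curvature\<close>

context riem_mfd
begin

lemma curvature_eq:
  "curvature M g X Y Z p f = \<D> X (\<D> Y Z) p f - \<D> Y (\<D> X Z) p f - \<D> (lie_bracket X Y) Z p f"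
  by (simp add: curvature_def Let_def)

lemma curvature_tangent:
  assumes X: "X \<in> vector_fields M" and Y: "Y \<in> vector_fields M" and Z: "Z \<in> vector_fields M"
    and p: "p \<in> mcarrier M"
  shows "curvature M g X Y Z p \<in> tangent_space M p"
proof -
  note t = field_tangent[OF _ p]
  have "(\<lambda>f. (\<lambda>f. \<D> X (\<D> Y Z) p f - \<D> Y (\<D> X Z) p f) f - \<D> (lie_bracket X Y) Z p f) \<in> tangent_space M p"
    by (rule tangent_space_diff[OF tangent_space_diff[OF t[OF nabla_field[OF X nabla_field[OF Y Z]]]
            t[OF nabla_field[OF Y nabla_field[OF X Z]]]] t[OF nabla_field[OF bracket_field[OF X Y] Z]]])
  then show ?thesis
    by (simp add: curvature_eq[abs_def])
qed

context
  fixes p assumes p: "p \<in> mcarrier M"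
begin

lemma curvature_antisym:
  assumes X: "X \<in> vector_fields M" and Y: "Y \<in> vector_fields M" and Z: "Z \<in> vector_fields M"
  shows "curvature M g Y X Z p = (\<lambda>f. - curvature M g X Y Z p f)"
proof
  fix f
  have "\<D> (lie_bracket Y X) Z p f = \<D> (\<lambda>q f. (-1) * lie_bracket X Y q f) Z p f"
    by (rule tensorial_cong[OF nabla_tensorial[OF p Z] p bracket_field[OF Y X]
          field_mult[OF smooth_function_const bracket_field[OF X Y]]]) (simp add: bracket_antisym[of Y X])
  also have "\<dots> = - \<D> (lie_bracket X Y) Z p f"
    using nabla_mult_left[OF p bracket_field[OF X Y] Z smooth_function_const[of "-1"]] by simp
  finally show "curvature M g Y X Z p f = - curvature M g X Y Z p f"
    by (simp add: curvature_eq)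
qed

lemma curvature_add1:
  assumes X: "X \<in> vector_fields M" and X': "X' \<in> vector_fields M" and Y: "Y \<in> vector_fields M"
    and Z: "Z \<in> vector_fields M"
  shows "curvature M g (\<lambda>q f. X q f + X' q f) Y Z p = (\<lambda>f. curvature M g X Y Z p f + curvature M g X' Y Z p f)"
proof
  fix f
  let ?S = "\<lambda>q f. X q f + X' q f"
  have S: "?S \<in> vector_fields M"
    by (rule field_add[OF X X'])
  have 1: "\<D> ?S (\<D> Y Z) p f = \<D> X (\<D> Y Z) p f + \<D> X' (\<D> Y Z) p f"
    using nabla_add_left[OF p X X' nabla_field[OF Y Z]] by simp
  have "\<D> Y (\<D> ?S Z) p = \<D> Y (\<lambda>q f. \<D> X Z q f + \<D> X' Z q f) p"
    by (rule nabla_cong_right[OF p Y nabla_field[OF S Z] field_add[OF nabla_field[OF X Z] nabla_field[OF X' Z]]])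
      (rule nabla_add_left[OF _ X X' Z])
  then have 2: "\<D> Y (\<D> ?S Z) p f = \<D> Y (\<D> X Z) p f + \<D> Y (\<D> X' Z) p f"
    using nabla_add_right[OF p Y nabla_field[OF X Z] nabla_field[OF X' Z]] by simp
  have "\<D> (lie_bracket ?S Y) Z p f = \<D> (\<lambda>q f. lie_bracket X Y q f + lie_bracket X' Y q f) Z p f"
    by (rule tensorial_cong[OF nabla_tensorial[OF p Z] p bracket_field[OF S Y]
          field_add[OF bracket_field[OF X Y] bracket_field[OF X' Y]] bracket_add_left[OF p Y X X']])
  then have 3: "\<D> (lie_bracket ?S Y) Z p f = \<D> (lie_bracket X Y) Z p f + \<D> (lie_bracket X' Y) Z p f"
    using nabla_add_left[OF p bracket_field[OF X Y] bracket_field[OF X' Y] Z] by simp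
  show "curvature M g ?S Y Z p f = curvature M g X Y Z p f + curvature M g X' Y Z p f"
    by (simp add: curvature_eq 1 2 3)
qed

text \<open>Since [hX, Y] = h [X, Y] - (Y h) X, the bracket term contributes a multiple of Y h which
  cancels the derivative of h that arises when the connection along Y is applied to h times the
  derivative of Z along X.\<close>

lemma curvature_mult1:
  assumes X: "X \<in> vector_fields M" and Y: "Y \<in> vector_fields M" and Z: "Z \<in> vector_fields M"
    and h: "h \<in> smooth_functions M"
  shows "curvature M g (\<lambda>q f. h q * X q f) Y Z p = (\<lambda>f. h p * curvature M g X Y Z p f)"
proof
  fix f
  let ?S = "\<lambda>q f. h q * X q f"
  have S: "?S \<in> vector_fields M"
    by (rule field_mult[OF h X])
  have 1: "\<D> ?S (\<D> Y Z) p f = h p * \<D> X (\<D> Y Z) p f"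
    using nabla_mult_left[OF p X nabla_field[OF Y Z] h] by simp
  have "\<D> Y (\<D> ?S Z) p = \<D> Y (\<lambda>q f. h q * \<D> X Z q f) p"
    by (rule nabla_cong_right[OF p Y nabla_field[OF S Z] field_mult[OF h nabla_field[OF X Z]]])
      (rule nabla_mult_left[OF _ X Z h])
  then have 2: "\<D> Y (\<D> ?S Z) p f = Y p h * \<D> X Z p f + h p * \<D> Y (\<D> X Z) p f"
    using nabla_mult_right[OF p Y nabla_field[OF X Z] h] by simp
  let ?k = "\<lambda>q. (-1) * Y q h"
  have k: "?k \<in> smooth_functions M"
    by (rule smooth_function_mult[OF smooth_function_const field_smooth[OF Y h]])
  have B: "(\<lambda>q f. h q * lie_bracket X Y q f) \<in> vector_fields M" "(\<lambda>q f. ?k q * X q f) \<in> vector_fields M"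
    by (rule field_mult[OF h bracket_field[OF X Y]], rule field_mult[OF k X])
  have "\<D> (lie_bracket ?S Y) Z p f = \<D> (\<lambda>q f. h q * lie_bracket X Y q f + ?k q * X q f) Z p f"
    by (rule tensorial_cong[OF nabla_tensorial[OF p Z] p bracket_field[OF S Y] field_add[OF B]])
      (simp add: bracket_mult_left[OF p Y h X])
  then have 3: "\<D> (lie_bracket ?S Y) Z p f = h p * \<D> (lie_bracket X Y) Z p f - Y p h * \<D> X Z p f"
    using nabla_add_left[OF p B Z] nabla_mult_left[OF p bracket_field[OF X Y] Z h]
      nabla_mult_left[OF p X Z k] by simp
  show "curvature M g ?S Y Z p f = h p * curvature M g X Y Z p f"
    by (simp add: curvature_eq 1 2 3 algebra_simps)
qed

lemma curvature_add3:
  assumes X: "X \<in> vector_fields M" and Y: "Y \<in> vector_fields M" and Z: "Z \<in> vector_fields M"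
    and Z': "Z' \<in> vector_fields M"
  shows "curvature M g X Y (\<lambda>q f. Z q f + Z' q f) p = (\<lambda>f. curvature M g X Y Z p f + curvature M g X Y Z' p f)"
proof
  fix f
  let ?S = "\<lambda>q f. Z q f + Z' q f"
  have S: "?S \<in> vector_fields M"
    by (rule field_add[OF Z Z'])
  have 1: "\<D> U (\<D> W ?S) p f = \<D> U (\<D> W Z) p f + \<D> U (\<D> W Z') p f"
    if U: "U \<in> vector_fields M" and W: "W \<in> vector_fields M" for U W
  proof -
    have "\<D> U (\<D> W ?S) p = \<D> U (\<lambda>q f. \<D> W Z q f + \<D> W Z' q f) p"
      by (rule nabla_cong_right[OF p U nabla_field[OF W S] field_add[OF nabla_field[OF W Z] nabla_field[OF W Z']]])
        (rule nabla_add_right[OF _ W Z Z'])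
    then show ?thesis
      using nabla_add_right[OF p U nabla_field[OF W Z] nabla_field[OF W Z']] by simp
  qed
  show "curvature M g X Y ?S p f = curvature M g X Y Z p f + curvature M g X Y Z' p f"
    using nabla_add_right[OF p bracket_field[OF X Y] Z Z'] by (simp add: curvature_eq 1[OF X Y] 1[OF Y X])
qed

text \<open>The first derivatives of h occur symmetrically in X and Y and cancel. The second
  derivatives combine to [X, Y] h, which the bracket term of the curvature removes.\<close>

lemma curvature_mult3:
  assumes X: "X \<in> vector_fields M" and Y: "Y \<in> vector_fields M" and Z: "Z \<in> vector_fields M"
    and h: "h \<in> smooth_functions M"
  shows "curvature M g X Y (\<lambda>q f. h q * Z q f) p = (\<lambda>f. h p * curvature M g X Y Z p f)"
proof
  fix f
  let ?S = "\<lambda>q f. h q * Z q f"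
  have S: "?S \<in> vector_fields M"
    by (rule field_mult[OF h Z])
  have 1: "\<D> U (\<D> W ?S) p f = U p (\<lambda>q. W q h) * Z p f + W p h * \<D> U Z p f + (U p h * \<D> W Z p f + h p * \<D> U (\<D> W Z) p f)"
    if U: "U \<in> vector_fields M" and W: "W \<in> vector_fields M" for U W
  proof -
    have A: "(\<lambda>q f. W q h * Z q f) \<in> vector_fields M" "(\<lambda>q f. h q * \<D> W Z q f) \<in> vector_fields M"
      by (rule field_mult[OF field_smooth[OF W h] Z], rule field_mult[OF h nabla_field[OF W Z]])
    have "\<D> U (\<D> W ?S) p = \<D> U (\<lambda>q f. W q h * Z q f + h q * \<D> W Z q f) p"
      by (rule nabla_cong_right[OF p U nabla_field[OF W S] field_add[OF A]])
        (rule nabla_mult_right[OF _ W Z h])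
    then show ?thesis
      using nabla_add_right[OF p U A] nabla_mult_right[OF p U Z field_smooth[OF W h]]
        nabla_mult_right[OF p U nabla_field[OF W Z] h] by simp
  qed
  have "\<D> (lie_bracket X Y) ?S p f =
      (X p (\<lambda>q. Y q h) - Y p (\<lambda>q. X q h)) * Z p f + h p * \<D> (lie_bracket X Y) Z p f"
    using nabla_mult_right[OF p bracket_field[OF X Y] Z h] by (simp add: lie_bracket_def)
  then show "curvature M g X Y ?S p f = h p * curvature M g X Y Z p f"
    by (simp add: curvature_eq 1[OF X Y] 1[OF Y X] algebra_simps)
qed

lemma curvature_tensorial:
  assumes X: "X \<in> vector_fields M" and Y: "Y \<in> vector_fields M" and Z: "Z \<in> vector_fields M"
    and W: "W \<in> vector_fields M"
  shows curvature_tensorial1: "tensorial p (\<lambda>X. g p (curvature M g X Y Z p) (W p))"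
    and curvature_tensorial2: "tensorial p (\<lambda>Y. g p (curvature M g X Y Z p) (W p))"
    and curvature_tensorial3: "tensorial p (\<lambda>Z. g p (curvature M g X Y Z p) (W p))"
    and curvature_tensorial4: "tensorial p (\<lambda>W. g p (curvature M g X Y Z p) (W p))"
proof -
  note t = field_tangent[OF _ p] and c = curvature_tangent[OF _ _ _ p]
  note add = metric_add_left[OF p _ _ t[OF W]] and scale = metric_scale_left[OF p _ t[OF W]]
  have 1: "tensorial p (\<lambda>X. g p (curvature M g X Y Z p) (W p))" if Y: "Y \<in> vector_fields M" for Y
    unfolding tensorial_def
    by (simp add: curvature_add1[OF _ _ Y Z] curvature_mult1[OF _ Y Z] add[OF c[OF _ Y Z] c[OF _ Y Z]]
        scale[OF c[OF _ Y Z]])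
  show "tensorial p (\<lambda>X. g p (curvature M g X Y Z p) (W p))"
    by (rule 1[OF Y])
  have anti: "g p (curvature M g X Y Z p) (W p) = - g p (curvature M g Y X Z p) (W p)"
    if Y: "Y \<in> vector_fields M" for Y
    using scale[OF c[OF Y X Z], of "-1"] by (simp add: curvature_antisym[OF Y X Z])
  show "tensorial p (\<lambda>Y. g p (curvature M g X Y Z p) (W p))"
    using 1[OF X] by (simp add: tensorial_def anti field_add field_mult)
  show "tensorial p (\<lambda>Z. g p (curvature M g X Y Z p) (W p))"
    unfolding tensorial_def
    by (simp add: curvature_add3[OF X Y] curvature_mult3[OF X Y] add[OF c[OF X Y] c[OF X Y]]
        scale[OF c[OF X Y]])
  show "tensorial p (\<lambda>W. g p (curvature M g X Y Z p) (W p))"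
    unfolding tensorial_def
    by (simp add: metric_add_right[OF p t t c[OF X Y Z]] metric_scale_right[OF p t c[OF X Y Z]])
qed

text \<open>This justifies the \<open>THE\<close> of the definition. The double sum passes from E to
  E' one trace at a time: first the trace over b with c fixed, then, after exchanging the sums, the
  trace over c with b fixed.\<close>

lemma scalar_curvature_frame:
  assumes E: "orthonormal_at M g p E"
  shows "scalar_curvature M g p =
    (\<Sum>c\<in>mcoords M. \<Sum>b\<in>mcoords M. g p (curvature M g (E b) (E c) (E c) p) (E b p))"
proof -
  let ?B = "mcoords M"
  have eq: "(\<Sum>c\<in>?B. \<Sum>b\<in>?B. g p (curvature M g (E b) (E c) (E c) p) (E b p)) =
      (\<Sum>c\<in>?B. \<Sum>b\<in>?B. g p (curvature M g (E' b) (E' c) (E' c) p) (E' b p))"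
    if E': "orthonormal_at M g p E'" for E'
  proof -
    have F: "E b \<in> vector_fields M" "E' b \<in> vector_fields M" if "b \<in> ?B" for b
      using E E' that by (auto simp: orthonormal_at_def)
    have "(\<Sum>c\<in>?B. \<Sum>b\<in>?B. g p (curvature M g (E b) (E c) (E c) p) (E b p)) =
        (\<Sum>c\<in>?B. \<Sum>b\<in>?B. g p (curvature M g (E' b) (E c) (E c) p) (E' b p))"
    proof (rule sum.cong)
      fix c assume c: "c \<in> ?B"
      show "(\<Sum>b\<in>?B. g p (curvature M g (E b) (E c) (E c) p) (E b p)) =
        (\<Sum>b\<in>?B. g p (curvature M g (E' b) (E c) (E c) p) (E' b p))"
      proof (rule trace_invariant[OF p E E', of "\<lambda>X W. g p (curvature M g X (E c) (E c) p) (W p)"])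
        fix X assume X: "X \<in> vector_fields M"
        show "tensorial p (\<lambda>U. g p (curvature M g U (E c) (E c) p) (X p))"
          by (rule curvature_tensorial1[OF X F(1)[OF c] F(1)[OF c] X])
        show "tensorial p (\<lambda>W. g p (curvature M g X (E c) (E c) p) (W p))"
          by (rule curvature_tensorial4[OF X F(1)[OF c] F(1)[OF c] X])
      qed
    qed simp
    also have "\<dots> = (\<Sum>b\<in>?B. \<Sum>c\<in>?B. g p (curvature M g (E' b) (E c) (E c) p) (E' b p))"
      by (rule sum.swap)
    also have "\<dots> = (\<Sum>b\<in>?B. \<Sum>c\<in>?B. g p (curvature M g (E' b) (E' c) (E' c) p) (E' b p))"
    proof (rule sum.cong)
      fix b assume b: "b \<in> ?B"
      show "(\<Sum>c\<in>?B. g p (curvature M g (E' b) (E c) (E c) p) (E' b p)) =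
        (\<Sum>c\<in>?B. g p (curvature M g (E' b) (E' c) (E' c) p) (E' b p))"
      proof (rule trace_invariant[OF p E E', of "\<lambda>Y Z. g p (curvature M g (E' b) Y Z p) (E' b p)"])
        fix X assume X: "X \<in> vector_fields M"
        show "tensorial p (\<lambda>Y. g p (curvature M g (E' b) Y X p) (E' b p))"
          by (rule curvature_tensorial2[OF F(2)[OF b] X X F(2)[OF b]])
        show "tensorial p (\<lambda>Z. g p (curvature M g (E' b) X Z p) (E' b p))"
          by (rule curvature_tensorial3[OF F(2)[OF b] X X F(2)[OF b]])
      qed
    qed simp
    also have "\<dots> = (\<Sum>c\<in>?B. \<Sum>b\<in>?B. g p (curvature M g (E' b) (E' c) (E' c) p) (E' b p))"
      by (rule sum.swap)
    finally show ?thesis .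
  qed
  show ?thesis
    unfolding scalar_curvature_def ricci_frame_def
  proof (rule the_equality)
    show "\<exists>E'. orthonormal_at M g p E' \<and>
        (\<Sum>c\<in>?B. \<Sum>b\<in>?B. g p (curvature M g (E b) (E c) (E c) p) (E b p)) =
        (\<Sum>c\<in>?B. \<Sum>b\<in>?B. g p (curvature M g (E' b) (E' c) (E' c) p) (E' b p))"
      using E by blast
    fix r
    assume "\<exists>E'. orthonormal_at M g p E' \<and>
        r = (\<Sum>c\<in>?B. \<Sum>b\<in>?B. g p (curvature M g (E' b) (E' c) (E' c) p) (E' b p))"
    then obtain E' where E': "orthonormal_at M g p E'"
      "r = (\<Sum>c\<in>?B. \<Sum>b\<in>?B. g p (curvature M g (E' b) (E' c) (E' c) p) (E' b p))"
      by (elim exE conjE) (rule that)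
    show "r = (\<Sum>c\<in>?B. \<Sum>b\<in>?B. g p (curvature M g (E b) (E c) (E c) p) (E b p))"
      unfolding E'(2) by (rule eq[OF E'(1), symmetric])
  qed
qed

text \<open>The term (V h) g(X, Y) from differentiating the metric is cancelled by the one from
  [V, hX]. Therefore fields on a fiber may later be exchanged for restrictions of ambient fields
  with the same value at p.\<close>

lemma lie_derivative_tensorial:
  assumes V: "V \<in> vector_fields M" and Y: "Y \<in> vector_fields M"
  shows lie_derivative_tensorial1: "tensorial p (\<lambda>X. lie_derivative2 V g X Y p)"
    and lie_derivative_tensorial2: "tensorial p (\<lambda>X. lie_derivative2 V g Y X p)"
proof -
  note t = field_tangent[OF _ p]
  show 1: "tensorial p (\<lambda>X. lie_derivative2 V g X Y p)"
    unfolding tensorial_def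
  proof (intro conjI ballI)
    fix X Z assume X: "X \<in> vector_fields M" and Z: "Z \<in> vector_fields M"
    show "lie_derivative2 V g (\<lambda>q f. X q f + Z q f) Y p = lie_derivative2 V g X Y p + lie_derivative2 V g Z Y p"
      unfolding lie_derivative2_def
      using metric_deriv_add[OF p t[OF V] X Z Y] metric_bracket_add_right[OF p V X Z t[OF Y]]
        metric_add_left[OF p t[OF X] t[OF Z] t[OF bracket_field[OF V Y]]] by simp
  next
    fix h X assume h: "h \<in> smooth_functions M" and X: "X \<in> vector_fields M"
    show "lie_derivative2 V g (\<lambda>q f. h q * X q f) Y p = h p * lie_derivative2 V g X Y p"
      unfolding lie_derivative2_def
      using metric_deriv_mult[OF p t[OF V] h X Y] metric_bracket_mult_right[OF p V h X t[OF Y]]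
        metric_scale_left[OF p t[OF X] t[OF bracket_field[OF V Y]], of "h p"]
      by (simp add: algebra_simps)
  qed
  have "lie_derivative2 V g Y X p = lie_derivative2 V g X Y p" if X: "X \<in> vector_fields M" for X
    unfolding lie_derivative2_def
    using metric_deriv_sym[OF p t[OF V] X Y] metric_sym[OF p t[OF bracket_field[OF V X]] t[OF Y]]
      metric_sym[OF p t[OF X] t[OF bracket_field[OF V Y]]] by simp
  then show "tensorial p (\<lambda>X. lie_derivative2 V g Y X p)"
    using 1 by (simp add: tensorial_def field_add field_mult)
qed

end

end


subsection \<open>Charts adapted to a submersion\<close>

lemma smooth_on_linear:
  fixes B :: "'e::euclidean_space set" and l :: "'e \<Rightarrow> real"
  assumes B: "B \<subseteq> Basis" and W: "openin (top_of_set (span B)) W" and l: "linear l"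
  shows "smooth_on B W l"
proof (rule smooth_on_cong[OF W])
  show "smooth_on B W (\<lambda>x. \<Sum>b\<in>B. (x \<bullet> b) * l b)"
    by (intro smooth_on_sum[OF W] smooth_on_mult[OF W] smooth_on_inner[OF W] smooth_on_const[OF W])
  fix x assume "x \<in> W"
  then have "x \<in> span B"
    using openin_subset[OF W] by auto
  then have "l x = l (\<Sum>b\<in>B. (x \<bullet> b) *\<^sub>R b)"
    using span_lincomb[OF B] by simp
  then show "(\<Sum>b\<in>B. (x \<bullet> b) * l b) = l x"
    by (simp add: linear_sum[OF l] linear_scale[OF l])
qed

lemma inner_lincomb:
  fixes B :: "'e::euclidean_space set"
  assumes "B \<subseteq> Basis" "d \<in> Basis"
  shows "(\<Sum>b\<in>B. k b *\<^sub>R b) \<bullet> d = (if d \<in> B then k d else 0)"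
proof -
  have fin: "finite B"
    using assms(1) finite_Basis finite_subset by blast
  have "(\<Sum>b\<in>B. k b *\<^sub>R b) \<bullet> d = (\<Sum>b\<in>B. if b = d then k b else 0)"
    unfolding inner_sum_left using assms by (intro sum.cong) (auto simp: inner_Basis subset_iff)
  then show ?thesis
    using fin by simp
qed

lemma span_eqI:
  fixes B :: "'e::euclidean_space set"
  assumes B: "B \<subseteq> Basis" and v: "v \<in> span B" and w: "w \<in> span B"
    and eq: "\<And>b. b \<in> B \<Longrightarrow> v \<bullet> b = w \<bullet> b"
  shows "v = w"
  using span_lincomb[OF B v] span_lincomb[OF B w] eq by (metis (mono_tags, lifting) sum.cong)

lemma span_inner_0:
  fixes B :: "'e::euclidean_space set"
  assumes B: "B \<subseteq> Basis" and v: "v \<in> span B" and d: "d \<in> Basis" "d \<notin> B"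
  shows "v \<bullet> d = 0"
  using inner_lincomb[OF B d(1), of "\<lambda>b. v \<bullet> b"] span_lincomb[OF B v] d(2) by simp

lemma span_subset_iff_inner:
  fixes B :: "'e::euclidean_space set"
  assumes B: "B \<subseteq> Basis" and K: "K \<subseteq> B" and v: "v \<in> span B"
  shows "v \<in> span K \<longleftrightarrow> (\<forall>b\<in>B - K. v \<bullet> b = 0)"
proof
  assume "v \<in> span K"
  then show "\<forall>b\<in>B - K. v \<bullet> b = 0"
    using span_inner_0[of K v] B K by blast
next
  assume *: "\<forall>b\<in>B - K. v \<bullet> b = 0"
  have fin: "finite B"
    using B finite_Basis finite_subset by blast
  have "v = (\<Sum>b\<in>B. (v \<bullet> b) *\<^sub>R b)"
    using span_lincomb[OF B v] by simp
  also have "\<dots> = (\<Sum>b\<in>K. (v \<bullet> b) *\<^sub>R b)"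
    by (rule sum.mono_neutral_right[OF fin K]) (use * in auto)
  also have "\<dots> \<in> span K"
    by (intro span_sum span_scale span_base)
  finally show "v \<in> span K" .
qed

text \<open>A linear surjection \<open>L\<close> of coordinate spaces is completed to an isomorphism by a linear map
  \<open>A\<close> into the complementary coordinates which is injective on the kernel.\<close>

lemma linear_completion:
  fixes B K :: "'e::euclidean_space set" and C :: "'f::euclidean_space set" and L :: "'e \<Rightarrow> 'f"
  assumes B: "B \<subseteq> Basis" and C: "C \<subseteq> Basis" and K: "K \<subseteq> B" and card: "card B = card K + card C"
    and L: "linear L" and surj: "\<And>c. c \<in> C \<Longrightarrow> \<exists>u\<in>span B. L u = c" and LC: "\<And>v. L v \<in> span C"
  obtains A where "linear A" "\<And>v. v \<in> span B \<Longrightarrow> A v \<in> span K"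
    "\<And>v. v \<in> span B \<Longrightarrow> A v = 0 \<Longrightarrow> L v = 0 \<Longrightarrow> v = (0::'e)"
proof -
  have finC: "finite C" and finB: "finite B"
    using B C finite_Basis finite_subset by blast+
  obtain u where u: "\<And>c. c \<in> C \<Longrightarrow> u c \<in> span B" "\<And>c. c \<in> C \<Longrightarrow> L (u c) = c"
    using surj by metis
  \<comment> \<open>The u c are preimages of the c, and Q projects \<open>span B\<close> onto the
    kernel Z of L along the span R of these preimages.\<close>
  define Q where "Q v = v - (\<Sum>c\<in>C. (L v \<bullet> c) *\<^sub>R u c)" for v
  define Z where "Z = {v \<in> span B. L v = 0}"
  define R where "R = span (u ` C)"
  have linQ: "linear Q"
    unfolding Q_def
    by (rule linearI) (simp_all add: linear_add[OF L] linear_scale[OF L] inner_add_left scaleR_add_left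
        sum.distrib scaleR_sum_right algebra_simps)
  have Q: "Q v \<in> Z" if "v \<in> span B" for v
  proof -
    have "L (Q v) = L v - (\<Sum>c\<in>C. (L v \<bullet> c) *\<^sub>R c)"
      using u(2) by (simp add: Q_def linear_diff[OF L] linear_sum[OF L] linear_scale[OF L])
    then have "L (Q v) = 0"
      using span_lincomb[OF C LC] by simp
    moreover have "Q v \<in> span B"
      unfolding Q_def using u(1) that by (intro span_diff span_sum span_scale)
    ultimately show ?thesis
      by (simp add: Z_def)
  qed
  have subZ: "subspace Z"
    unfolding Z_def subspace_def
    by (auto simp: linear_0[OF L] linear_add[OF L] linear_scale[OF L] span_zero span_add span_scale)
  have RB: "R \<subseteq> span B"
    unfolding R_def using u(1) by (intro span_minimal) auto
  have sums: "{x + y |x y. x \<in> Z \<and> y \<in> R} = span B"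
  proof
    show "{x + y |x y. x \<in> Z \<and> y \<in> R} \<subseteq> span B"
      using RB by (auto simp: Z_def intro: span_add)
    show "span B \<subseteq> {x + y |x y. x \<in> Z \<and> y \<in> R}"
    proof
      fix v assume "v \<in> span B"
      moreover have "v = Q v + (\<Sum>c\<in>C. (L v \<bullet> c) *\<^sub>R u c)"
        by (simp add: Q_def)
      moreover have "(\<Sum>c\<in>C. (L v \<bullet> c) *\<^sub>R u c) \<in> R"
        unfolding R_def by (intro span_sum span_scale span_base) auto
      ultimately show "v \<in> {x + y |x y. x \<in> Z \<and> y \<in> R}"
        using Q by blast
    qed
  qed
  \<comment> \<open>\<open>span B\<close> is the direct sum of Z and R, and R has dimension
    \<open>card C\<close>. The hypothesis on cardinalities then gives Z the dimension of
    \<open>span K\<close>, so the two are isometric, and composing Q with the isometry yields the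
    completion.\<close>
  have "dim {x + y |x y. x \<in> Z \<and> y \<in> R} + dim (Z \<inter> R) = dim Z + dim R"
    by (rule dim_sums_Int[OF subZ]) (simp add: R_def)
  moreover have "Z \<inter> R = {0}"
  proof
    show "Z \<inter> R \<subseteq> {0}"
    proof
      fix v assume v: "v \<in> Z \<inter> R"
      then have "v \<in> span (u ` C)"
        by (simp add: R_def)
      then obtain k where k: "v = (\<Sum>x\<in>u ` C. k x *\<^sub>R x)"
        using finC by (auto simp: span_finite)
      have inj: "inj_on u C"
        by (rule inj_on_inverseI[of _ L]) (rule u(2))
      have v2: "v = (\<Sum>c\<in>C. k (u c) *\<^sub>R u c)"
        unfolding k using inj by (simp add: sum.reindex)
      have "L v = (\<Sum>c\<in>C. k (u c) *\<^sub>R c)"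
        unfolding v2 using u(2) by (simp add: linear_sum[OF L] linear_scale[OF L])
      then have "(\<Sum>c\<in>C. k (u c) *\<^sub>R c) = 0"
        using v by (simp add: Z_def)
      then have "k (u c) = 0" if "c \<in> C" for c
        using inner_lincomb[OF C, of c "\<lambda>c. k (u c)"] that C by auto
      then show "v \<in> {0}"
        using v2 by simp
    qed
    show "{0} \<subseteq> Z \<inter> R"
      using subspace_0[OF subZ] by (simp add: R_def span_zero)
  qed
  moreover have "dim R = card C"
  proof -
    have "dim (L ` R) \<le> dim R"
      by (rule dim_image_le[OF L])
    moreover have "C \<subseteq> L ` R"
    proof
      fix c assume "c \<in> C"
      then show "c \<in> L ` R"
        using u(2)[of c] by (force simp: R_def intro: span_base image_eqI[of _ _ "u c"])
    qed
    then have "dim C \<le> dim (L ` R)"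
      by (rule dim_subset)
    moreover have "dim C = card C"
      by (rule dim_eq_card_independent[OF independent_mono[OF independent_Basis C]])
    moreover have "dim R \<le> card C"
      unfolding R_def dim_span using finC by (metis card_image_le dim_le_card' finite_imageI le_trans)
    ultimately show ?thesis
      by linarith
  qed
  moreover have "dim (span B) = card B" "dim (span K) = card K"
    using dim_eq_card_independent[OF independent_mono[OF independent_Basis B]]
      dim_eq_card_independent[OF independent_mono[OF independent_Basis, of K]] B K by simp_all
  ultimately have "dim Z = dim (span K)"
    using sums card by simp
  then obtain J where J: "linear J" "J ` Z = span K" "\<And>x. x \<in> Z \<Longrightarrow> norm (J x) = norm x"
    using isometries_subspaces[OF subZ subspace_span, of K] by metis
  show ?thesis
  proof (rule that[of "\<lambda>v. J (Q v)"])
    show "linear (\<lambda>v. J (Q v))"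
      using linear_compose[OF linQ J(1)] by (simp add: o_def)
    show "J (Q v) \<in> span K" if "v \<in> span B" for v
      using Q[OF that] J(2) by blast
    fix v assume v: "v \<in> span B" "J (Q v) = 0" "L v = 0"
    have "Q v = 0"
      using J(3)[OF Q[OF v(1)]] v(2) by simp
    then show "v = 0"
      using v(3) by (simp add: Q_def)
  qed
qed

context smooth_mfd
begin

text \<open>A chart followed by a diffeomorphism H of an open part of the coordinate space is again
  compatible with the atlas. This admits the charts produced by the inverse function theorem into
  \<open>max_atlas\<close>.\<close>

lemma compose_chart:
  assumes c0: "(U0, \<phi>0) \<in> max_atlas M" and W: "mopen W" "W \<subseteq> \<phi>0 ` U0"
    and H: "\<And>b. b \<in> mcoords M \<Longrightarrow> smooth_on (mcoords M) W (\<lambda>x. H x \<bullet> b)"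
    and HW: "mopen (H ` W)" and hom: "homeomorphism W (H ` W) H G"
    and G: "\<And>b. b \<in> mcoords M \<Longrightarrow> smooth_on (mcoords M) (H ` W) (\<lambda>y. G y \<bullet> b)"
  shows "({q \<in> U0. \<phi>0 q \<in> W}, \<lambda>q. H (\<phi>0 q)) \<in> max_atlas M"
proof -
  let ?U = "{q \<in> U0. \<phi>0 q \<in> W}" and ?\<phi> = "\<lambda>q. H (\<phi>0 q)"
  have U: "openin (mtop M) ?U"
    by (rule chart_vimage_openin[OF c0 W(1)])
  have im0: "\<phi>0 ` ?U = W"
    using W(2) by auto
  have im: "?\<phi> ` ?U = H ` W"
    using im0 by (metis image_image)
  have GH: "G (H x) = x" if "x \<in> W" for x
    using hom that by (simp add: homeomorphism_def)
  have injH: "inj_on H W"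
    by (rule inj_on_inverseI[of _ G]) (rule GH)
  have "homeomorphic_map (subtopology (subtopology (mtop M) U0) ?U) (subtopology (top_of_set (\<phi>0 ` U0)) W) \<phi>0"
    by (rule homeomorphic_map_subtopologies[OF chart_homeo[OF c0]])
      (use im0 W(2) chart_subset[OF c0] in auto)
  moreover have "subtopology (subtopology (mtop M) U0) ?U = subtopology (mtop M) ?U"
  proof -
    have "U0 \<inter> ?U = ?U"
      by auto
    then show ?thesis
      by (simp only: subtopology_subtopology)
  qed
  moreover have "subtopology (top_of_set (\<phi>0 ` U0)) W = top_of_set W"
    using W(2) by (simp add: subtopology_subtopology inf_absorb2)
  ultimately have h1: "homeomorphic_map (subtopology (mtop M) ?U) (top_of_set W) \<phi>0"
    by simp
  have h2: "homeomorphic_map (top_of_set W) (top_of_set (H ` W)) H"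
    unfolding homeomorphic_map_maps
    by (rule exI[of _ G]) (use hom in \<open>auto simp: homeomorphic_maps_def homeomorphism_def\<close>)
  have "is_chart M (?U, ?\<phi>)"
    unfolding is_chart_def case_prod_conv im
    using U HW homeomorphic_map_compose[OF h1 h2] by (simp add: o_def)
  moreover have inv: "inv_into ?U ?\<phi> y = inv_into U0 \<phi>0 (G y)" if "y \<in> H ` W" for y
  proof -
    obtain q where q: "q \<in> ?U" "y = ?\<phi> q"
    proof -
      obtain x where x: "x \<in> W" "y = H x"
        using \<open>y \<in> H ` W\<close> by blast
      then obtain q where "q \<in> ?U" "x = \<phi>0 q"
        using im0 by blast
      then show thesis
        using x that by blast
    qed
    have inj: "inj_on ?\<phi> ?U"
      using injH chart_inj[OF c0] by (auto simp: inj_on_def)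
    show ?thesis
      using q GH inv_into_f_f[OF inj q(1)] chart_inv[OF c0] by auto
  qed
  moreover have "smooth_transition M (?U, ?\<phi>) (U', \<phi>') \<and> smooth_transition M (U', \<phi>') (?U, ?\<phi>)"
    if m: "(U', \<phi>') \<in> matlas M" for U' \<phi>'
  proof -
    have c': "(U', \<phi>') \<in> max_atlas M"
      by (rule matlas_max[OF m])
    have injO: "openin (mtop M) (?U \<inter> U')"
      by (rule openin_Int[OF U chart_openin[OF c']])
    have o1: "mopen (\<phi>0 ` (?U \<inter> U'))" and o2: "mopen (\<phi>' ` (U' \<inter> ?U))"
      using injO by (auto intro!: chart_image_openin[OF c0] chart_image_openin[OF c'] simp: Int_commute)
    have sub: "?\<phi> ` (?U \<inter> U') \<subseteq> H ` W"
      using im by blast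
    have o3: "mopen (?\<phi> ` (?U \<inter> U'))"
    proof -
      have "openin (top_of_set W) (\<phi>0 ` (?U \<inter> U'))"
        by (rule openin_subset_trans[OF o1]) (use openin_subset[OF W(1)] in auto)
      then have "openin (top_of_set (H ` W)) (H ` \<phi>0 ` (?U \<inter> U'))"
        using homeomorphic_imp_open_map[OF h2] by (simp add: open_map_def)
      from openin_trans[OF this HW] show ?thesis
        by (simp only: image_image)
    qed
    show ?thesis
      unfolding smooth_transition_def case_prod_conv
    proof (intro conjI ballI)
      fix b assume b: "b \<in> mcoords M"
      have t: "smooth_on (mcoords M) (\<phi>0 ` (?U \<inter> U')) (\<lambda>x. \<phi>' (inv_into U0 \<phi>0 x) \<bullet> b)"
        by (rule smooth_on_mono[OF smooth_transitionD[OF max_transition[OF c0 c'] b]]) auto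
      have "smooth_on (mcoords M) (?\<phi> ` (?U \<inter> U')) (\<lambda>y. \<phi>' (inv_into U0 \<phi>0 (G y)) \<bullet> b)"
        by (rule smooth_on_compose[OF o3 coords_Basis coords_Basis o1 smooth_on_mono[OF G sub order_refl] _ t])
          (use GH in auto)
      then show "smooth_on (mcoords M) (?\<phi> ` (?U \<inter> U')) (\<lambda>x. \<phi>' (inv_into ?U ?\<phi> x) \<bullet> b)"
        by (rule smooth_on_cong[OF o3]) (use inv sub in \<open>auto simp: subset_iff\<close>)
      have t': "smooth_on (mcoords M) (\<phi>' ` (U' \<inter> ?U)) (\<lambda>x. \<phi>0 (inv_into U' \<phi>' x) \<bullet> d)"
        if "d \<in> mcoords M" for d
        by (rule smooth_on_mono[OF smooth_transitionD[OF max_transition[OF c' c0] that]]) auto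
      show "smooth_on (mcoords M) (\<phi>' ` (U' \<inter> ?U)) (\<lambda>x. ?\<phi> (inv_into U' \<phi>' x) \<bullet> b)"
        by (rule smooth_on_compose[OF o2 coords_Basis coords_Basis W(1) t' _ H[OF b]])
          (auto simp: chart_inv[OF c'])
    qed
  qed
  ultimately show ?thesis
    unfolding max_atlas_def by auto
qed

end

text \<open>The part of the theory that involves no metric. \<open>surj\<close> is the rank
  condition, and K lists the coordinates meant to run along the fibers, so that \<open>cardK\<close>
  splits the dimension of M into fiber and base.\<close>

locale submersion = M: smooth_mfd M + N: smooth_mfd N
  for M :: "('a, 'e::euclidean_space) manifold" and N :: "('b, 'f::euclidean_space) manifold" +
  fixes \<pi> :: "'a \<Rightarrow> 'b" and K :: "'e set"
  assumes smooth: "smooth_map M N \<pi>"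
    and surj: "\<And>p. p \<in> mcarrier M \<Longrightarrow> differential M N \<pi> ` tangent_space M p = tangent_space N (\<pi> p)"
    and K: "K \<subseteq> mcoords M" and cardK: "card (mcoords M) = card K + card (mcoords N)"
begin

section \<open>Pullback of functions and charts adapted to the projection\<close>

lemma proj_carrier: "p \<in> mcarrier M \<Longrightarrow> \<pi> p \<in> mcarrier N"
  using smooth unfolding smooth_map_def by (auto simp: continuous_map_def)

lemma proj_vimage_openin: "openin (mtop N) W \<Longrightarrow> openin (mtop M) {p \<in> mcarrier M. \<pi> p \<in> W}"
  using smooth unfolding smooth_map_def by (auto intro: openin_continuous_map_preimage)

lemma eventually_proj:
  assumes "p \<in> mcarrier M" "\<forall>\<^sub>F q in N.near (\<pi> p). P q"
  shows "\<forall>\<^sub>F q in M.near p. P (\<pi> q)"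
proof -
  obtain W where W: "openin (mtop N) W" "\<pi> p \<in> W" "\<And>q. q \<in> W \<Longrightarrow> P q"
    using assms proj_carrier[OF assms(1)] unfolding eventually_nhdsin by blast
  have "\<forall>\<^sub>F q in M.near p. q \<in> {p \<in> mcarrier M. \<pi> p \<in> W}"
    by (rule eventually_nhdsin_openin[OF proj_vimage_openin[OF W(1)]]) (use assms W in auto)
  then show ?thesis
    by eventually_elim (use W(3) in blast)
qed

lemma differential_tangent:
  "p \<in> mcarrier M \<Longrightarrow> v \<in> tangent_space M p \<Longrightarrow> differential M N \<pi> v \<in> tangent_space N (\<pi> p)"
  using surj by blast

lemma smooth_chart_map:
  assumes c: "(U, \<phi>) \<in> matlas M" and d: "(W, \<psi>) \<in> matlas N" and b: "b \<in> mcoords N"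
  shows "smooth_on (mcoords M) (\<phi> ` (U \<inter> \<pi> -` W)) (\<lambda>x. \<psi> (\<pi> (inv_into U \<phi> x)) \<bullet> b)"
  using smooth c d b unfolding smooth_map_def by fastforce

lemma chart_domain_openin:
  assumes c: "(U, \<phi>) \<in> matlas M" and d: "(W, \<psi>) \<in> matlas N"
  shows "openin (mtop M) (U \<inter> \<pi> -` W)" "M.mopen (\<phi> ` (U \<inter> \<pi> -` W))"
proof -
  note c' = M.matlas_max[OF c] and d' = N.matlas_max[OF d]
  have "U \<inter> \<pi> -` W = U \<inter> {p \<in> mcarrier M. \<pi> p \<in> W}"
    using M.chart_subset[OF c'] by auto
  then show o: "openin (mtop M) (U \<inter> \<pi> -` W)"
    using openin_Int[OF M.chart_openin[OF c'] proj_vimage_openin[OF N.chart_openin[OF d']]] by simp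
  show "M.mopen (\<phi> ` (U \<inter> \<pi> -` W))"
    by (rule M.chart_image_openin[OF c' o]) auto
qed

lemma pullback_smooth:
  assumes f: "f \<in> smooth_functions N"
  shows "(\<lambda>p. f (\<pi> p)) \<in> smooth_functions M"
  unfolding M.smooth_functions_iff
proof
  fix p assume p: "p \<in> mcarrier M"
  obtain U \<phi> where c: "(U, \<phi>) \<in> matlas M" "p \<in> U"
    using M.atlas_chart_at[OF p] .
  obtain W \<psi> where d: "(W, \<psi>) \<in> matlas N" "\<pi> p \<in> W"
    using N.atlas_chart_at[OF proj_carrier[OF p]] .
  note c' = M.matlas_max[OF c(1)] and d' = N.matlas_max[OF d(1)]
  let ?V = "\<phi> ` (U \<inter> \<pi> -` W)"
  have V: "M.mopen ?V"
    by (rule chart_domain_openin[OF c(1) d(1)])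
  have "smooth_on (mcoords M) ?V (\<lambda>x. f (inv_into W \<psi> (\<psi> (\<pi> (inv_into U \<phi> x)))))"
    by (rule smooth_on_compose[OF V M.coords_Basis N.coords_Basis N.chart_image[OF d'] smooth_chart_map[OF c(1) d(1)]
          _ N.smooth_on_chart_function[OF d' f]]) (auto simp: M.chart_inv[OF c'])
  then have "smooth_on (mcoords M) ?V (\<lambda>x. f (\<pi> (inv_into U \<phi> x)))"
    by (rule smooth_on_cong[OF V]) (auto simp: M.chart_inv[OF c'] N.chart_inv[OF d'])
  then show "smooth_at M p (\<lambda>p. f (\<pi> p))"
    by (rule M.smooth_atI[OF c' c(2) V, rotated 2]) (use c d in auto)
qed

text \<open>In a chart around p, the coordinates of \<pi> are taken as the new coordinates outside
  K, and \<open>linear_completion\<close> supplies those in K; the inverse function theorem turns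
  the result into a chart. Subtracting \<psi> (\<pi> p) puts the fiber through p at the linear slice
  \<open>span K\<close>.\<close>

lemma adapted_chart:
  assumes p: "p \<in> mcarrier M"
  obtains U \<phi> W \<psi> \<beta> where "(U, \<phi>) \<in> max_atlas M" "p \<in> U" "(W, \<psi>) \<in> matlas N" "\<pi> ` U \<subseteq> W"
    "bij_betw \<beta> (mcoords M - K) (mcoords N)"
    "\<And>r b. r \<in> U \<Longrightarrow> b \<in> mcoords M - K \<Longrightarrow> \<phi> r \<bullet> b = (\<psi> (\<pi> r) - \<psi> (\<pi> p)) \<bullet> \<beta> b"
proof -
  let ?B = "mcoords M" and ?C = "mcoords N"
  have B: "?B \<subseteq> Basis" and C: "?C \<subseteq> Basis" and finB: "finite ?B" and finC: "finite ?C"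
    using M.coords_Basis N.coords_Basis M.finite_coords N.finite_coords .
  have finK: "finite K"
    using K finB by (rule finite_subset)
  have KB: "K \<subseteq> Basis"
    using K B by blast
  obtain U0 \<phi>0 where c: "(U0, \<phi>0) \<in> matlas M" "p \<in> U0"
    using M.atlas_chart_at[OF p] .
  obtain W \<psi> where d: "(W, \<psi>) \<in> matlas N" "\<pi> p \<in> W"
    using N.atlas_chart_at[OF proj_carrier[OF p]] .
  note c' = M.matlas_max[OF c(1)] and d' = N.matlas_max[OF d(1)]
  define \<Omega> where "\<Omega> = \<phi>0 ` (U0 \<inter> \<pi> -` W)"
  have \<Omega>: "M.mopen \<Omega>"
    unfolding \<Omega>_def by (rule chart_domain_openin[OF c(1) d(1)])
  define F where "F x = \<psi> (\<pi> (inv_into U0 \<phi>0 x))" for x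
  define a where "a = \<phi>0 p"
  have a: "a \<in> \<Omega>"
    using c d by (auto simp: a_def \<Omega>_def)
  have Fs: "smooth_on ?B \<Omega> (\<lambda>x. F x \<bullet> b)" if "b \<in> ?C" for b
    unfolding F_def \<Omega>_def by (rule smooth_chart_map[OF c(1) d(1) that])
  \<comment> \<open>The derivative at a of the local representation F of the projection.\<close>
  define L where "L v = (\<Sum>e\<in>?C. (\<Sum>b\<in>?B. (v \<bullet> b) * partial_deriv b (\<lambda>x. F x \<bullet> e) a) *\<^sub>R e)" for v
  have linL: "linear L"
    unfolding L_def
    by (rule linearI) (simp_all add: inner_add_left distrib_right sum.distrib scaleR_add_left
        scaleR_sum_right sum_distrib_left mult.assoc)
  have Le: "L v \<bullet> e = (\<Sum>b\<in>?B. (v \<bullet> b) * partial_deriv b (\<lambda>x. F x \<bullet> e) a)" if "e \<in> ?C" for v e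
    unfolding L_def using inner_lincomb[OF C] that C by auto
  have LC: "L v \<in> span ?C" for v
    unfolding L_def by (intro span_sum span_scale span_base)
  \<comment> \<open>Surjectivity is given for derivations. The coordinate vector of N in direction e
    is the image of some v, and the coefficients of v form a vector u with L u = e.\<close>
  have surjL: "\<exists>u\<in>span ?B. L u = e" if e: "e \<in> ?C" for e
  proof -
    obtain x E where x: "\<And>b. x b \<in> smooth_functions M"
      and evx: "\<forall>\<^sub>F q in M.near p. q \<in> U0 \<and> (\<forall>b\<in>?B. x b q = \<phi>0 q \<bullet> b \<and> E b q = coord_vec M U0 \<phi>0 b q) \<and>
         M.dual_frame_at q x E"
      by (rule M.local_frame[OF c' c(2)]) (rule that)
    obtain y G where y: "\<And>b. y b \<in> smooth_functions N"
      and evy: "\<forall>\<^sub>F q in N.near (\<pi> p). q \<in> W \<and> (\<forall>b\<in>?C. y b q = \<psi> q \<bullet> b \<and> G b q = coord_vec N W \<psi> b q) \<and>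
         N.dual_frame_at q y G"
      by (rule N.local_frame[OF d' d(2)]) (rule that)
    note ex = eventually_nhdsin_self[OF evx p] and ey = eventually_nhdsin_self[OF evy proj_carrier[OF p]]
    have "coord_vec N W \<psi> e (\<pi> p) \<in> tangent_space N (\<pi> p)"
      by (rule N.coord_vec_tangent[OF d' d(2) e])
    then obtain v where v: "v \<in> tangent_space M p" "differential M N \<pi> v = coord_vec N W \<psi> e (\<pi> p)"
      using surj[OF p] by (metis imageE)
    define u where "u = (\<Sum>b\<in>?B. v (x b) *\<^sub>R b)"
    have uB: "u \<in> span ?B"
      unfolding u_def by (intro span_sum span_scale span_base)
    have "L u \<bullet> i = e \<bullet> i" if i: "i \<in> ?C" for i
    proof -
      have pb: "(\<lambda>q. y i (\<pi> q)) \<in> smooth_functions M"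
        by (rule pullback_smooth[OF y])
      have "\<forall>\<^sub>F q in N.near (\<pi> p). y i q = \<psi> q \<bullet> i"
        using evy by eventually_elim (use i in blast)
      then have "\<forall>\<^sub>F q in M.near p. y i (\<pi> q) = \<psi> (\<pi> q) \<bullet> i"
        by (rule eventually_proj[OF p])
      then obtain V where V: "openin (mtop M) V" "p \<in> V" "\<And>q. q \<in> V \<Longrightarrow> y i (\<pi> q) = \<psi> (\<pi> q) \<bullet> i"
        using p unfolding eventually_nhdsin by blast
      have o: "M.mopen (\<phi>0 ` (U0 \<inter> V))"
        by (intro M.chart_image_openin[OF c'] openin_Int M.chart_openin[OF c'] V(1)) auto
      have cv: "coord_vec M U0 \<phi>0 b p (\<lambda>q. y i (\<pi> q)) = partial_deriv b (\<lambda>x. F x \<bullet> i) a" if "b \<in> ?B" for b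
        unfolding coord_vec_def a_def using pb
        by (simp, intro partial_cong(1)[OF o _ _ that]) (use c V in \<open>auto simp: F_def M.chart_inv[OF c']\<close>)
      have "v (\<lambda>q. y i (\<pi> q)) = (\<Sum>b\<in>?B. v (x b) * E b p (\<lambda>q. y i (\<pi> q)))"
        using ex v(1) unfolding M.dual_frame_at_def by blast
      also have "\<dots> = (\<Sum>b\<in>?B. v (x b) * partial_deriv b (\<lambda>x. F x \<bullet> i) a)"
        using ex cv by (intro sum.cong) auto
      also have "\<dots> = (\<Sum>b\<in>?B. (u \<bullet> b) * partial_deriv b (\<lambda>x. F x \<bullet> i) a)"
        unfolding u_def using inner_lincomb[OF B] B by (intro sum.cong) auto
      also have "\<dots> = L u \<bullet> i"
        using Le[OF i] by simp
      finally have "L u \<bullet> i = differential M N \<pi> v (y i)"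
        using y by (simp add: differential_def)
      also have "\<dots> = (if e = i then 1 else 0)"
        unfolding v(2) using ey e i unfolding N.dual_frame_at_def by metis
      finally show ?thesis
        using e i C by (auto simp: inner_Basis subset_iff)
    qed
    then have "L u = e"
      by (intro span_eqI[OF C LC span_base[OF e]])
    then show ?thesis
      using uB by blast
  qed
  obtain A where A: "linear A" "\<And>v. v \<in> span ?B \<Longrightarrow> A v \<in> span K"
    "\<And>v. v \<in> span ?B \<Longrightarrow> A v = 0 \<Longrightarrow> L v = 0 \<Longrightarrow> v = 0"
    by (rule linear_completion[OF B C K cardK linL surjL LC]) (assumption | rule that)+
  have "card (?B - K) = card ?C"
    using card_Diff_subset[OF finK K] cardK by simp
  then obtain \<beta> where \<beta>: "bij_betw \<beta> (?B - K) ?C"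
    using finB finC by (meson finite_Diff finite_same_card_bij)
  have \<beta>C: "\<beta> b \<in> ?C" if "b \<in> ?B - K" for b
    using \<beta> that by (auto simp: bij_betw_def)
  have BK: "?B - K \<subseteq> Basis"
    using B by blast
  \<comment> \<open>A takes values in \<open>span K\<close> and fills the coordinates in K, while F
    fills the others through the matching \<beta>. The shift by a and F a makes H a = 0.\<close>
  define H where "H x = A (x - a) + (\<Sum>b\<in>?B - K. ((F x - F a) \<bullet> \<beta> b) *\<^sub>R b)" for x
  have \<Omega>B: "\<Omega> \<subseteq> span ?B"
    using openin_subset[OF \<Omega>] by simp
  have linAb: "linear (\<lambda>x. A x \<bullet> b)" for b
    by (rule linearI) (simp_all add: linear_add[OF A(1)] linear_scale[OF A(1)] inner_add_left)
  have Hb: "H x \<bullet> b = A x \<bullet> b - A a \<bullet> b + (if b \<in> ?B - K then F x \<bullet> \<beta> b - F a \<bullet> \<beta> b else 0)"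
    if "b \<in> ?B" for x b
    using inner_lincomb[OF BK, of b "\<lambda>b. (F x - F a) \<bullet> \<beta> b"] that B
    by (auto simp: H_def inner_add_left inner_diff_left linear_diff[OF A(1)])
  have Hs: "smooth_on ?B \<Omega> (\<lambda>x. H x \<bullet> b)" if b: "b \<in> ?B" for b
  proof -
    have "smooth_on ?B \<Omega> (\<lambda>x. if b \<in> ?B - K then F x \<bullet> \<beta> b - F a \<bullet> \<beta> b else 0)"
    proof (cases "b \<in> ?B - K")
      case True
      then show ?thesis
        using smooth_on_diff[OF \<Omega> Fs[OF \<beta>C[OF True]] smooth_on_const[OF \<Omega>]] by simp
    qed (auto intro: smooth_on_const[OF \<Omega>])
    then show ?thesis
      unfolding Hb[OF b]
      by (intro smooth_on_add[OF \<Omega>] smooth_on_diff[OF \<Omega>] smooth_on_const[OF \<Omega>] smooth_on_linear[OF B \<Omega> linAb])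
  qed
  have Hspan: "H x \<in> span ?B" if "x \<in> \<Omega>" for x
  proof -
    have "x - a \<in> span ?B"
      using \<Omega>B that a by (intro span_diff) auto
    then have "A (x - a) \<in> span ?B"
      using A(2) span_mono[OF K] by blast
    then show ?thesis
      unfolding H_def by (intro span_add span_sum span_scale) (auto intro: span_base)
  qed
  have pdH: "partial_deriv i (\<lambda>x. H x \<bullet> b) a = A i \<bullet> b + (if b \<in> ?B - K then partial_deriv i (\<lambda>x. F x \<bullet> \<beta> b) a else 0)"
    if b: "b \<in> ?B" and i: "i \<in> ?B" for b i
  proof -
    have dF: "((\<lambda>t. F (a + t *\<^sub>R i) \<bullet> \<beta> b) has_real_derivative partial_deriv i (\<lambda>x. F x \<bullet> \<beta> b) a) (at 0)"
      if "b \<in> ?B - K"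
      by (rule smooth_on_has_partial[OF Fs[OF \<beta>C[OF that]] i a])
    have dA: "((\<lambda>t. A (a + t *\<^sub>R i) \<bullet> b) has_real_derivative A i \<bullet> b) (at 0)"
      unfolding linear_add[OF A(1)] linear_scale[OF A(1)] inner_add_left inner_scaleR_left
      by (auto intro!: derivative_eq_intros)
    have "((\<lambda>t. H (a + t *\<^sub>R i) \<bullet> b) has_real_derivative
        A i \<bullet> b + (if b \<in> ?B - K then partial_deriv i (\<lambda>x. F x \<bullet> \<beta> b) a else 0)) (at 0)"
    proof (cases "b \<in> ?B - K")
      case True
      show ?thesis
        unfolding Hb[OF b] if_P[OF True]
        using DERIV_add[OF DERIV_diff[OF dA DERIV_const] DERIV_diff[OF dF[OF True] DERIV_const]] by simp
    next
      case False
      show ?thesis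
        unfolding Hb[OF b] if_not_P[OF False]
        using DERIV_diff[OF dA DERIV_const[of "A a \<bullet> b"]] by simp
    qed
    then show ?thesis
      unfolding partial_deriv_def by (rule DERIV_imp_deriv)
  qed
  \<comment> \<open>The derivative of H shows A v in the coordinates of K and L v in the remaining
    ones. If it kills v, both vanish, and then v = 0 by the choice of A.\<close>
  have inj: "v = 0" if v: "v \<in> span ?B"
    and z: "\<And>b. b \<in> ?B \<Longrightarrow> (\<Sum>i\<in>?B. (v \<bullet> i) * partial_deriv i (\<lambda>x. H x \<bullet> b) a) = 0" for v
  proof -
    have sumA: "(\<Sum>i\<in>?B. (v \<bullet> i) * (A i \<bullet> b)) = A v \<bullet> b" for b
    proof -
      have "A v = A (\<Sum>i\<in>?B. (v \<bullet> i) *\<^sub>R i)"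
        using span_lincomb[OF B v] by simp
      then show ?thesis
        by (simp add: linear_sum[OF A(1)] linear_scale[OF A(1)] inner_sum_left)
    qed
    have eq: "A v \<bullet> b + (if b \<in> ?B - K then L v \<bullet> \<beta> b else 0) = 0" if b: "b \<in> ?B" for b
    proof -
      have "(\<Sum>i\<in>?B. (v \<bullet> i) * partial_deriv i (\<lambda>x. H x \<bullet> b) a) =
          (\<Sum>i\<in>?B. (v \<bullet> i) * (A i \<bullet> b) + (if b \<in> ?B - K then (v \<bullet> i) * partial_deriv i (\<lambda>x. F x \<bullet> \<beta> b) a else 0))"
        using pdH[OF b] by (intro sum.cong) (auto simp: algebra_simps)
      also have "\<dots> = A v \<bullet> b + (if b \<in> ?B - K then L v \<bullet> \<beta> b else 0)"
        using Le[OF \<beta>C, of b v] by (auto simp: sum.distrib sumA)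
      finally show ?thesis
        using z[OF b] by simp
    qed
    have AvK: "A v \<in> span K"
      by (rule A(2)[OF v])
    have "A v \<bullet> b = 0" if "b \<in> K" for b
      using eq[of b] that K by auto
    then have Av: "A v = 0"
      using span_eqI[OF KB AvK span_zero] by simp
    have "L v \<bullet> e = 0" if e: "e \<in> ?C" for e
    proof -
      obtain b where "b \<in> ?B - K" "\<beta> b = e"
        using \<beta> e unfolding bij_betw_def by (metis imageE)
      then show ?thesis
        using eq[of b] Av by auto
    qed
    then have "L v = 0"
      using span_eqI[OF C LC span_zero] by simp
    then show "v = 0"
      using A(3)[OF v Av] by blast
  qed
  obtain W1 G where W1: "W1 \<subseteq> \<Omega>" "a \<in> W1" "M.mopen W1" "M.mopen (H ` W1)" "homeomorphism W1 (H ` W1) H G"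
    "\<And>b. b \<in> ?B \<Longrightarrow> smooth_on ?B (H ` W1) (\<lambda>y. G y \<bullet> b)"
    by (rule smooth_inverse_function[OF B \<Omega> a Hs Hspan inj]) (assumption | rule that)+
  let ?U = "{q \<in> U0. \<phi>0 q \<in> W1}" and ?\<phi> = "\<lambda>q. H (\<phi>0 q)"
  have sub: "W1 \<subseteq> \<phi>0 ` U0"
    using W1(1) by (auto simp: \<Omega>_def)
  have F0: "F (\<phi>0 q) = \<psi> (\<pi> q)" if "q \<in> U0" for q
    using M.chart_inv[OF c' that] by (simp add: F_def)
  show ?thesis
  proof (rule that[of ?U ?\<phi> W \<psi> \<beta>])
    show "(?U, ?\<phi>) \<in> max_atlas M"
      by (rule M.compose_chart[OF c' W1(3) sub smooth_on_mono[OF Hs W1(1) order_refl] W1(4,5,6)])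
    show "p \<in> ?U"
      using c(2) W1(2) by (simp add: a_def)
    show "\<pi> ` ?U \<subseteq> W"
    proof
      fix y assume "y \<in> \<pi> ` ?U"
      then obtain q where q: "q \<in> U0" "\<phi>0 q \<in> W1" "y = \<pi> q" by blast
      then obtain q' where "q' \<in> U0 \<inter> \<pi> -` W" "\<phi>0 q = \<phi>0 q'"
        using W1(1) by (auto simp: \<Omega>_def)
      then show "y \<in> W"
        using q M.chart_inj[OF c'] by (auto simp: inj_on_def)
    qed
    fix r b assume r: "r \<in> ?U" and b: "b \<in> ?B - K"
    have "\<phi>0 r - a \<in> span ?B"
      using r W1(1) \<Omega>B a by (intro span_diff) auto
    then have "A (\<phi>0 r - a) \<bullet> b = 0"
      using span_inner_0[OF KB A(2)] b B by blast
    then have "A (\<phi>0 r) \<bullet> b - A a \<bullet> b = 0"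
      by (simp add: linear_diff[OF A(1)] inner_diff_left)
    then show "?\<phi> r \<bullet> b = (\<psi> (\<pi> r) - \<psi> (\<pi> p)) \<bullet> \<beta> b"
      using Hb[of b "\<phi>0 r"] b r F0[of r] F0[of p] c(2) by (simp add: a_def inner_diff_left)
  qed (use d \<beta> in auto)
qed

end


subsection \<open>Adapted frames and fibers\<close>

lemma differential_id: "f \<in> smooth_functions M \<Longrightarrow> incl S M v f = v f"
  by (simp add: differential_def)

context submersion
begin

text \<open>The last clause says that for b outside K the differential of x b is the pullback of
  that of y (\<beta> b). It makes verticality visible in the coefficients of a vector.\<close>

definition adapted_at ::
    "'a \<Rightarrow> 'a set \<Rightarrow> ('a \<Rightarrow> 'e) \<Rightarrow> ('e \<Rightarrow> 'a \<Rightarrow> real) \<Rightarrow> ('e \<Rightarrow> 'a vfield) \<Rightarrow>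
     ('f \<Rightarrow> 'b \<Rightarrow> real) \<Rightarrow> ('f \<Rightarrow> 'b vfield) \<Rightarrow> ('e \<Rightarrow> 'f) \<Rightarrow> 'a \<Rightarrow> bool" where
  "adapted_at p U \<phi> x E y G \<beta> q \<longleftrightarrow>
     q \<in> U \<and> (\<forall>b\<in>mcoords M. x b q = \<phi> q \<bullet> b \<and> E b q = coord_vec M U \<phi> b q) \<and>
     M.dual_frame_at q x E \<and> N.dual_frame_at (\<pi> q) y G \<and>
     (\<forall>v\<in>tangent_space M q. \<forall>b\<in>mcoords M - K. v (x b) = differential M N \<pi> v (y (\<beta> b)))"

definition adapted_frame ::
    "'a \<Rightarrow> 'a set \<Rightarrow> ('a \<Rightarrow> 'e) \<Rightarrow> ('e \<Rightarrow> 'a \<Rightarrow> real) \<Rightarrow> ('e \<Rightarrow> 'a vfield) \<Rightarrow>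
     ('f \<Rightarrow> 'b \<Rightarrow> real) \<Rightarrow> ('f \<Rightarrow> 'b vfield) \<Rightarrow> ('e \<Rightarrow> 'f) \<Rightarrow> bool" where
  "adapted_frame p U \<phi> x E y G \<beta> \<longleftrightarrow>
     (U, \<phi>) \<in> max_atlas M \<and> p \<in> U \<and> (\<forall>r\<in>U. \<phi> r \<in> span K \<longleftrightarrow> \<pi> r = \<pi> p) \<and>
     (\<forall>b. x b \<in> smooth_functions M) \<and> (\<forall>b\<in>mcoords M. E b \<in> vector_fields M) \<and>
     (\<forall>c. y c \<in> smooth_functions N) \<and> bij_betw \<beta> (mcoords M - K) (mcoords N) \<and>
     (\<forall>\<^sub>F q in M.near p. adapted_at p U \<phi> x E y G \<beta> q)"

lemma adapted_frame_exists:
  assumes p: "p \<in> mcarrier M"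
  obtains U \<phi> x E y G \<beta> where "adapted_frame p U \<phi> x E y G \<beta>"
proof -
  let ?B = "mcoords M" and ?C = "mcoords N"
  obtain U \<phi> W \<psi> \<beta> where c: "(U, \<phi>) \<in> max_atlas M" "p \<in> U" and d: "(W, \<psi>) \<in> matlas N" "\<pi> ` U \<subseteq> W"
    and \<beta>: "bij_betw \<beta> (?B - K) ?C"
    and ad: "\<And>r b. r \<in> U \<Longrightarrow> b \<in> ?B - K \<Longrightarrow> \<phi> r \<bullet> b = (\<psi> (\<pi> r) - \<psi> (\<pi> p)) \<bullet> \<beta> b"
    by (rule adapted_chart[OF p]) (rule that)
  note d' = N.matlas_max[OF d(1)]
  have UW: "\<pi> r \<in> W" if "r \<in> U" for r
    using d(2) that by blast
  have \<beta>C: "\<beta> b \<in> ?C" if "b \<in> ?B - K" for b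
    using \<beta> that by (auto simp: bij_betw_def)
  obtain x E where x: "\<And>b. x b \<in> smooth_functions M" and E: "\<And>b. b \<in> ?B \<Longrightarrow> E b \<in> vector_fields M"
    and evx: "\<forall>\<^sub>F q in M.near p. q \<in> U \<and> (\<forall>b\<in>?B. x b q = \<phi> q \<bullet> b \<and> E b q = coord_vec M U \<phi> b q) \<and>
       M.dual_frame_at q x E"
    by (rule M.local_frame[OF c]) (rule that)
  obtain y G where y: "\<And>b. y b \<in> smooth_functions N" and G: "\<And>b. b \<in> ?C \<Longrightarrow> G b \<in> vector_fields N"
    and evy: "\<forall>\<^sub>F q in N.near (\<pi> p). q \<in> W \<and> (\<forall>b\<in>?C. y b q = \<psi> q \<bullet> b \<and> G b q = coord_vec N W \<psi> b q) \<and>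
       N.dual_frame_at q y G"
    by (rule N.local_frame[OF d' UW[OF c(2)]]) (rule that)
  \<comment> \<open>Outside K the coordinates of \<phi> r are those of \<psi> (\<pi> r) - \<psi>
    (\<pi> p). They all vanish exactly when r lies on the fiber through p.\<close>
  have slice: "\<phi> r \<in> span K \<longleftrightarrow> \<pi> r = \<pi> p" if r: "r \<in> U" for r
  proof -
    have \<phi>r: "\<phi> r \<in> span ?B"
      using openin_subset[OF M.chart_image[OF c(1)]] r by auto
    have \<psi>: "\<psi> (\<pi> r) \<in> span ?C" "\<psi> (\<pi> p) \<in> span ?C"
      using openin_subset[OF N.chart_image[OF d']] UW r c(2) by auto
    have "\<phi> r \<in> span K \<longleftrightarrow> (\<forall>b\<in>?B - K. (\<psi> (\<pi> r) - \<psi> (\<pi> p)) \<bullet> \<beta> b = 0)"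
      using span_subset_iff_inner[OF M.coords_Basis K \<phi>r] ad[OF r] by simp
    also have "\<dots> \<longleftrightarrow> (\<forall>e\<in>?C. (\<psi> (\<pi> r) - \<psi> (\<pi> p)) \<bullet> e = 0)"
      using \<beta> unfolding bij_betw_def by (metis (no_types, lifting) imageE image_eqI)
    also have "\<dots> \<longleftrightarrow> \<psi> (\<pi> r) = \<psi> (\<pi> p)"
      using span_eqI[OF N.coords_Basis \<psi>] by (auto simp: inner_diff_left)
    also have "\<dots> \<longleftrightarrow> \<pi> r = \<pi> p"
      using N.chart_inj[OF d'] UW r c(2) by (auto simp: inj_on_def)
    finally show ?thesis .
  qed
  have "\<forall>\<^sub>F q in M.near p. adapted_at p U \<phi> x E y G \<beta> q"
    using evx eventually_eventually_nhdsin[OF evx] eventually_proj[OF p evy]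
      eventually_eventually_nhdsin[OF eventually_proj[OF p evy]]
      eventually_nhdsin_openin[OF openin_topspace p]
  proof eventually_elim
    case (elim q)
    have q: "q \<in> mcarrier M"
      by (rule elim(5))
    \<comment> \<open>Near q the functions x b and y (\<beta> b) composed with \<pi> differ by the
      constant \<open>?k\<close>, which every derivation kills.\<close>
    have "v (x b) = differential M N \<pi> v (y (\<beta> b))" if v: "v \<in> tangent_space M q" and b: "b \<in> ?B - K" for v b
    proof -
      let ?k = "\<psi> (\<pi> p) \<bullet> \<beta> b"
      have pb: "(\<lambda>r. y (\<beta> b) (\<pi> r)) \<in> smooth_functions M"
        by (rule pullback_smooth[OF y])
      have "\<forall>\<^sub>F r in M.near q. x b r = y (\<beta> b) (\<pi> r) - ?k"
        using elim(2,4)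
      proof eventually_elim
        case (elim r)
        then show ?case
          using ad[of r b] b \<beta>C[OF b] by (simp add: inner_diff_left)
      qed
      then have "v (x b) = v (\<lambda>r. y (\<beta> b) (\<pi> r) - ?k)"
        by (rule M.tangent_local[OF q v x M.smooth_function_diff[OF pb M.smooth_function_const]])
      also have "\<dots> = v (\<lambda>r. y (\<beta> b) (\<pi> r))"
        using M.tangent_diff[OF v pb M.smooth_function_const] M.tangent_const[OF v] by simp
      finally show ?thesis
        using y by (simp add: differential_def)
    qed
    then show ?case
      using elim(1,3) unfolding adapted_at_def by blast
  qed
  then have "adapted_frame p U \<phi> x E y G \<beta>"
    unfolding adapted_frame_def using c \<beta> slice x E y by blast
  then show ?thesis
    by (rule that)
qed

lemma adapted_frameD:
  assumes "adapted_frame p U \<phi> x E y G \<beta>"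
  shows "(U, \<phi>) \<in> max_atlas M" "p \<in> U" "\<And>r. r \<in> U \<Longrightarrow> \<phi> r \<in> span K \<longleftrightarrow> \<pi> r = \<pi> p"
    "\<And>b. x b \<in> smooth_functions M" "\<And>b. b \<in> mcoords M \<Longrightarrow> E b \<in> vector_fields M"
    "\<And>c. y c \<in> smooth_functions N" "bij_betw \<beta> (mcoords M - K) (mcoords N)"
    "\<forall>\<^sub>F q in M.near p. adapted_at p U \<phi> x E y G \<beta> q"
  using assms unfolding adapted_frame_def by blast+

lemma adapted_atD:
  assumes "adapted_at p U \<phi> x E y G \<beta> q"
  shows "q \<in> U" "\<And>b. b \<in> mcoords M \<Longrightarrow> x b q = \<phi> q \<bullet> b" "\<And>b. b \<in> mcoords M \<Longrightarrow> E b q = coord_vec M U \<phi> b q"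
    "\<And>b d. b \<in> mcoords M \<Longrightarrow> d \<in> mcoords M \<Longrightarrow> E b q (x d) = (if b = d then 1 else 0)"
    "\<And>v f. v \<in> tangent_space M q \<Longrightarrow> v f = (\<Sum>b\<in>mcoords M. v (x b) * E b q f)"
    "\<And>w h. w \<in> tangent_space N (\<pi> q) \<Longrightarrow> w h = (\<Sum>c\<in>mcoords N. w (y c) * G c (\<pi> q) h)"
    "\<And>v b. v \<in> tangent_space M q \<Longrightarrow> b \<in> mcoords M - K \<Longrightarrow> v (x b) = differential M N \<pi> v (y (\<beta> b))"
  using assms unfolding adapted_at_def M.dual_frame_at_def N.dual_frame_at_def by blast+

abbreviation "vert \<equiv> vertical_space M N \<pi>"

lemma vertical_space_iff:
  "v \<in> vert p \<longleftrightarrow> v \<in> tangent_space M p \<and> (\<forall>h\<in>smooth_functions N. v (\<lambda>x. h (\<pi> x)) = 0)"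
  by (simp add: vertical_space_def differential_def fun_eq_iff Ball_def)

lemma vertical_tangent: "v \<in> vert p \<Longrightarrow> v \<in> tangent_space M p"
  by (simp add: vertical_space_def)

lemma vertical_zero: "(\<lambda>f. 0) \<in> vert p"
  by (simp add: vertical_space_def M.tangent_zero differential_def)

lemma vertical_add: "v \<in> vert p \<Longrightarrow> w \<in> vert p \<Longrightarrow> (\<lambda>f. v f + w f) \<in> vert p"
  by (simp add: vertical_space_iff M.tangent_space_add)

lemma vertical_scale: "v \<in> vert p \<Longrightarrow> (\<lambda>f. c * v f) \<in> vert p"
  by (simp add: vertical_space_iff M.tangent_space_scale)

text \<open>A tangent vector of N is determined by its values on the y c. For the image of v under
  the differential these are, up to the matching \<beta>, the values of v on the x b with b outside
  K.\<close>

lemma vertical_iff: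
  assumes ad: "adapted_frame p U \<phi> x E y G \<beta>" and q: "adapted_at p U \<phi> x E y G \<beta> q"
    and qM: "q \<in> mcarrier M" and v: "v \<in> tangent_space M q"
  shows "v \<in> vert q \<longleftrightarrow> (\<forall>b\<in>mcoords M - K. v (x b) = 0)"
proof
  assume "v \<in> vert q"
  then show "\<forall>b\<in>mcoords M - K. v (x b) = 0"
    using adapted_atD(7)[OF q v] by (simp add: vertical_space_def)
next
  assume z: "\<forall>b\<in>mcoords M - K. v (x b) = 0"
  have "differential M N \<pi> v (y c) = 0" if "c \<in> mcoords N" for c
  proof -
    have "c \<in> \<beta> ` (mcoords M - K)"
      using bij_betw_imp_surj_on[OF adapted_frameD(7)[OF ad]] that by simp
    then obtain b where b: "c = \<beta> b" "b \<in> mcoords M - K"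
      by (rule imageE)
    have "v (x b) = differential M N \<pi> v (y (\<beta> b))"
      by (rule adapted_atD(7)[OF q v b(2)])
    then show ?thesis
      using z b by simp
  qed
  then have "(\<Sum>c\<in>mcoords N. differential M N \<pi> v (y c) * G c (\<pi> q) h) = 0" for h
    by simp
  then have "differential M N \<pi> v h = 0" for h
    by (rule trans[OF adapted_atD(6)[OF q differential_tangent[OF qM v]]])
  then show "v \<in> vert q"
    using v by (simp add: vertical_space_def fun_eq_iff)
qed

lemma vertical_expansion:
  assumes ad: "adapted_frame p U \<phi> x E y G \<beta>" and q: "adapted_at p U \<phi> x E y G \<beta> q"
    and qM: "q \<in> mcarrier M" and v: "v \<in> vert q"
  shows "v f = (\<Sum>b\<in>K. v (x b) * E b q f)"
proof -
  have "v f = (\<Sum>b\<in>mcoords M. v (x b) * E b q f)"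
    by (rule adapted_atD(5)[OF q vertical_tangent[OF v]])
  also have "\<dots> = (\<Sum>b\<in>K. v (x b) * E b q f)"
    using vertical_iff[OF ad q qM vertical_tangent[OF v]] v
    by (intro sum.mono_neutral_right M.finite_coords K) auto
  finally show ?thesis .
qed

lemma frame_vertical:
  assumes ad: "adapted_frame p U \<phi> x E y G \<beta>" and q: "adapted_at p U \<phi> x E y G \<beta> q"
    and qM: "q \<in> mcarrier M" and b: "b \<in> K"
  shows "E b q \<in> vert q"
proof -
  have bB: "b \<in> mcoords M"
    using b K by blast
  have t: "E b q \<in> tangent_space M q"
    by (rule M.field_tangent[OF adapted_frameD(5)[OF ad bB] qM])
  show ?thesis
    using vertical_iff[OF ad q qM t] adapted_atD(4)[OF q bB] b by auto
qed

lemma vertical_fieldsD: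
  "X \<in> vertical_fields M N \<pi> \<Longrightarrow> X \<in> vector_fields M"
  "X \<in> vertical_fields M N \<pi> \<Longrightarrow> p \<in> mcarrier M \<Longrightarrow> X p \<in> vert p"
  by (auto simp: vertical_fields_def)

text \<open>The frame fields E b with b in K are known to be vertical only near p; multiplication by
  a bump function makes them vertical everywhere without changing them near p.\<close>

lemma local_vertical_fields:
  assumes p: "p \<in> mcarrier M" and ad: "adapted_frame p U \<phi> x E y G \<beta>"
  obtains F where "\<And>b. b \<in> K \<Longrightarrow> F b \<in> vertical_fields M N \<pi>"
    "\<forall>\<^sub>F q in M.near p. \<forall>b\<in>K. F b q = E b q"
proof -
  obtain V where V: "openin (mtop M) V" "p \<in> V" "\<And>q. q \<in> V \<Longrightarrow> adapted_at p U \<phi> x E y G \<beta> q"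
    using adapted_frameD(8)[OF ad] p unfolding eventually_nhdsin by blast
  obtain \<rho> where \<rho>: "\<rho> \<in> smooth_functions M" "\<forall>\<^sub>F q in M.near p. \<rho> q = 1"
    "\<And>q. q \<in> mcarrier M - V \<Longrightarrow> \<forall>\<^sub>F r in M.near q. \<rho> r = 0"
    using M.bump[OF V(1,2)] by blast
  have \<rho>0: "\<rho> q = 0" if "q \<in> mcarrier M" "q \<notin> V" for q
    using eventually_nhdsin_self[OF \<rho>(3)[of q]] that by simp
  show ?thesis
  proof (rule that[of "\<lambda>b q f. \<rho> q * E b q f"])
    fix b assume b: "b \<in> K"
    have bB: "b \<in> mcoords M"
      using b K by blast
    have "(\<lambda>f. \<rho> q * E b q f) \<in> vert q" if q: "q \<in> mcarrier M" for q
    proof (cases "q \<in> V")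
      case True
      show ?thesis
        by (rule vertical_scale[OF frame_vertical[OF ad V(3)[OF True] q b]])
    next
      case False
      then show ?thesis
        using \<rho>0[OF q False] vertical_zero by simp
    qed
    then show "(\<lambda>q f. \<rho> q * E b q f) \<in> vertical_fields M N \<pi>"
      using M.field_mult[OF \<rho>(1) adapted_frameD(5)[OF ad bB]] by (simp add: vertical_fields_def)
  next
    show "\<forall>\<^sub>F q in M.near p. \<forall>b\<in>K. (\<lambda>f. \<rho> q * E b q f) = E b q"
      using \<rho>(2) by eventually_elim simp
  qed
qed

lemma vertical_fields_add:
  "X \<in> vertical_fields M N \<pi> \<Longrightarrow> Y \<in> vertical_fields M N \<pi> \<Longrightarrow> (\<lambda>q f. X q f + Y q f) \<in> vertical_fields M N \<pi>"
  by (simp add: vertical_fields_def M.field_add vertical_add)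

lemma vertical_fields_mult:
  "h \<in> smooth_functions M \<Longrightarrow> X \<in> vertical_fields M N \<pi> \<Longrightarrow> (\<lambda>q f. h q * X q f) \<in> vertical_fields M N \<pi>"
  by (simp add: vertical_fields_def M.field_mult vertical_scale)

lemma vertical_fields_zero: "(\<lambda>q f. 0) \<in> vertical_fields M N \<pi>"
  by (simp add: vertical_fields_def M.field_zero vertical_zero)

section \<open>The fibers as manifolds\<close>

abbreviation "fib q \<equiv> submanifold M (fiber M \<pi> q) K"

lemma fib_simps: "mtop (fib q) = subtopology (mtop M) (fiber M \<pi> q)" "mcoords (fib q) = K"
  by (simp_all add: submanifold_def)

lemma fib_carrier: "mcarrier (fib q) = fiber M \<pi> q"
  unfolding fib_simps by (auto simp: fiber_def)

lemma fib_atlas: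
  "c \<in> matlas (fib q) \<longleftrightarrow> (\<exists>U \<phi>. c = (U \<inter> fiber M \<pi> q, \<phi>) \<and> (U, \<phi>) \<in> max_atlas M \<and>
     \<phi> ` (U \<inter> fiber M \<pi> q) = \<phi> ` U \<inter> span K)"
  by (auto simp: submanifold_def)

lemma finite_K: "finite K"
  using K M.finite_coords finite_subset by blast

lemma K_Basis: "K \<subseteq> Basis"
  using K M.coords_Basis by blast

lemma inv_slice:
  assumes c: "(U, \<phi>) \<in> max_atlas M" and r: "r \<in> U" "r \<in> fiber M \<pi> q"
  shows "inv_into (U \<inter> fiber M \<pi> q) \<phi> (\<phi> r) = r"
  by (rule inv_into_f_f[OF inj_on_subset[OF M.chart_inj[OF c]]]) (use r in auto)

lemma open_Int_span_K:
  assumes "M.mopen W"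
  shows "openin (top_of_set (span K)) (W \<inter> span K)"
proof -
  obtain T where T: "open T" "W = span (mcoords M) \<inter> T"
    using assms by (auto simp: openin_open)
  have "W \<inter> span K = span K \<inter> T"
    using T(2) span_mono[OF K] by auto
  then show ?thesis
    using openin_open_Int[OF T(1), of "span K"] by simp
qed

text \<open>Injectivity of the chart lets the slice condition pass to smaller domains, in particular
  to the overlap of two slice charts.\<close>

lemma slice_inter:
  assumes c: "(U, \<phi>) \<in> max_atlas M" and sl: "\<phi> ` (U \<inter> fiber M \<pi> q) = \<phi> ` U \<inter> span K" and V: "V \<subseteq> U"
  shows "\<phi> ` (V \<inter> fiber M \<pi> q) = \<phi> ` V \<inter> span K"
proof
  show "\<phi> ` (V \<inter> fiber M \<pi> q) \<subseteq> \<phi> ` V \<inter> span K"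
    using sl V by blast
  show "\<phi> ` V \<inter> span K \<subseteq> \<phi> ` (V \<inter> fiber M \<pi> q)"
  proof
    fix z assume "z \<in> \<phi> ` V \<inter> span K"
    then obtain r where r: "r \<in> V" "z = \<phi> r" "\<phi> r \<in> span K" by blast
    then have "\<phi> r \<in> \<phi> ` (U \<inter> fiber M \<pi> q)"
      unfolding sl using V by blast
    then have "r \<in> fiber M \<pi> q"
      using M.chart_inj[OF c] r(1) V by (auto simp: inj_on_def)
    then show "z \<in> \<phi> ` (V \<inter> fiber M \<pi> q)"
      using r by blast
  qed
qed

lemma fib_chart:
  assumes c: "(U, \<phi>) \<in> max_atlas M" and sl: "\<phi> ` (U \<inter> fiber M \<pi> q) = \<phi> ` U \<inter> span K"
  shows "is_chart (fib q) (U \<inter> fiber M \<pi> q, \<phi>)"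
proof -
  let ?F = "fiber M \<pi> q"
  have "homeomorphic_map (subtopology (subtopology (mtop M) U) (U \<inter> ?F))
      (subtopology (top_of_set (\<phi> ` U)) (\<phi> ` (U \<inter> ?F))) \<phi>"
    by (rule homeomorphic_map_subtopologies[OF M.chart_homeo[OF c]]) (use M.chart_subset[OF c] in auto)
  moreover have "subtopology (subtopology (mtop M) U) (U \<inter> ?F) = subtopology (subtopology (mtop M) ?F) (U \<inter> ?F)"
  proof -
    have "U \<inter> (U \<inter> ?F) = ?F \<inter> (U \<inter> ?F)"
      by blast
    then show ?thesis
      by (simp only: subtopology_subtopology)
  qed
  moreover have "subtopology (top_of_set (\<phi> ` U)) (\<phi> ` (U \<inter> ?F)) = top_of_set (\<phi> ` (U \<inter> ?F))"
  proof -
    have "\<phi> ` U \<inter> \<phi> ` (U \<inter> ?F) = \<phi> ` (U \<inter> ?F)"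
      by blast
    then show ?thesis
      by (simp only: subtopology_subtopology)
  qed
  moreover have "openin (subtopology (mtop M) ?F) (U \<inter> ?F)"
    using M.chart_openin[OF c] by (auto simp: openin_subtopology)
  moreover have "openin (top_of_set (span K)) (\<phi> ` (U \<inter> ?F))"
    unfolding sl by (rule open_Int_span_K[OF M.chart_image[OF c]])
  ultimately show ?thesis
    by (simp add: is_chart_def fib_simps)
qed

text \<open>Transition maps are those of M, restricted to \<open>span K\<close> and differentiated
  only in directions of K. The slice charts cover the fiber because the adapted charts around its
  points are slice charts.\<close>

lemma fib_manifold:
  assumes q: "q \<in> \<pi> ` mcarrier M"
  shows "smooth_manifold (fib q)"
  unfolding smooth_manifold_def
proof (intro conjI ballI)
  let ?F = "fiber M \<pi> q"
  show "mcoords (fib q) \<subseteq> Basis"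
    by (simp add: fib_simps K_Basis)
  show "Hausdorff_space (mtop (fib q))"
    unfolding fib_simps by (rule Hausdorff_space_subtopology[OF M.Hausdorff])
  show "second_countable (mtop (fib q))"
    unfolding fib_simps using M.smooth_manifold
    by (intro second_countable_subtopology) (simp add: smooth_manifold_def)
  show "is_chart (fib q) c" if "c \<in> matlas (fib q)" for c
    using that fib_chart unfolding fib_atlas by blast
  show "smooth_transition (fib q) c c'" if "c \<in> matlas (fib q)" "c' \<in> matlas (fib q)" for c c'
  proof -
    obtain U \<phi> where c: "c = (U \<inter> ?F, \<phi>)" "(U, \<phi>) \<in> max_atlas M" "\<phi> ` (U \<inter> ?F) = \<phi> ` U \<inter> span K"
      using \<open>c \<in> matlas (fib q)\<close> unfolding fib_atlas by blast
    obtain U' \<phi>' where c': "c' = (U' \<inter> ?F, \<phi>')" "(U', \<phi>') \<in> max_atlas M" "\<phi>' ` (U' \<inter> ?F) = \<phi>' ` U' \<inter> span K"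
      using \<open>c' \<in> matlas (fib q)\<close> unfolding fib_atlas by blast
    have eq: "U \<inter> ?F \<inter> (U' \<inter> ?F) = U \<inter> U' \<inter> ?F"
      by blast
    have im: "\<phi> ` (U \<inter> U' \<inter> ?F) = \<phi> ` (U \<inter> U') \<inter> span K"
      by (rule slice_inter[OF c(2,3)]) blast
    have o: "openin (top_of_set (span K)) (\<phi> ` (U \<inter> U' \<inter> ?F))"
      unfolding im by (rule open_Int_span_K[OF M.inter_image_openin[OF c(2) c'(2)]])
    have "smooth_on K (\<phi> ` (U \<inter> U' \<inter> ?F)) (\<lambda>x. \<phi>' (inv_into (U \<inter> ?F) \<phi> x) \<bullet> b)" if b: "b \<in> K" for b
    proof (rule smooth_on_cong[OF o])
      show "smooth_on K (\<phi> ` (U \<inter> U' \<inter> ?F)) (\<lambda>x. \<phi>' (inv_into U \<phi> x) \<bullet> b)"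
        using b K by (intro smooth_on_mono[OF M.smooth_transitionD[OF M.max_transition[OF c(2) c'(2)]] _ K]) auto
      show "\<phi>' (inv_into U \<phi> x) \<bullet> b = \<phi>' (inv_into (U \<inter> ?F) \<phi> x) \<bullet> b" if "x \<in> \<phi> ` (U \<inter> U' \<inter> ?F)" for x
        using that inv_slice[OF c(2)] M.chart_inv[OF c(2)] by auto
    qed
    then show ?thesis
      unfolding c(1) c'(1) smooth_transition_def case_prod_conv fib_simps eq by blast
  qed
  show "\<Union> (fst ` matlas (fib q)) = mcarrier (fib q)"
  proof
    show "\<Union> (fst ` matlas (fib q)) \<subseteq> mcarrier (fib q)"
      unfolding fib_carrier using fib_atlas by fastforce
    show "mcarrier (fib q) \<subseteq> \<Union> (fst ` matlas (fib q))"
    proof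
      fix p assume "p \<in> mcarrier (fib q)"
      then have p: "p \<in> mcarrier M" "\<pi> p = q"
        unfolding fib_carrier by (simp_all add: fiber_def)
      obtain U \<phi> x E y G \<beta> where ad: "adapted_frame p U \<phi> x E y G \<beta>"
        by (rule adapted_frame_exists[OF p(1)])
      note c = adapted_frameD(1,2,3)[OF ad]
      have "\<phi> ` (U \<inter> ?F) = \<phi> ` U \<inter> span K"
        using c(3) p(2) M.chart_subset[OF c(1)] by (auto simp: fiber_def)
      then have "(U \<inter> ?F, \<phi>) \<in> matlas (fib q)"
        using c(1) unfolding fib_atlas by blast
      moreover have "p \<in> U \<inter> ?F"
        using c(2) p by (simp add: fiber_def)
      ultimately show "p \<in> \<Union> (fst ` matlas (fib q))"
        by force
    qed
  qed
qed

end


section \<open>Tangent vectors, fields and tensors on one fiber\<close>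

locale submersion_fiber = submersion M N \<pi> K
  for M :: "('a, 'e::euclidean_space) manifold" and N :: "('b, 'f::euclidean_space) manifold"
    and \<pi> :: "'a \<Rightarrow> 'b" and K :: "'e set" +
  fixes q0 :: 'b
  assumes q0: "q0 \<in> \<pi> ` mcarrier M"
begin

abbreviation "F \<equiv> fiber M \<pi> q0"
abbreviation "S \<equiv> submanifold M (fiber M \<pi> q0) K"

sublocale S: smooth_mfd S
  by unfold_locales (rule fib_manifold[OF q0])

lemma fiberD: "p \<in> F \<Longrightarrow> p \<in> mcarrier M" "p \<in> F \<Longrightarrow> \<pi> p = q0" "p \<in> F \<Longrightarrow> p \<in> mcarrier S"
  unfolding fib_carrier by (simp_all add: fiber_def)

lemma S_carrierD: "p \<in> mcarrier S \<Longrightarrow> p \<in> F"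
  by (simp add: fib_carrier)

lemma near_fiber:
  assumes "p \<in> F" "\<forall>\<^sub>F r in M.near p. P r"
  shows "\<forall>\<^sub>F r in S.near p. P r"
proof -
  obtain V where V: "openin (mtop M) V" "p \<in> V" "\<And>r. r \<in> V \<Longrightarrow> P r"
    using assms fiberD(1)[OF assms(1)] unfolding eventually_nhdsin by blast
  have "openin (mtop S) (V \<inter> F)"
    unfolding fib_simps using V(1) by (auto simp: openin_subtopology)
  then have "\<forall>\<^sub>F r in S.near p. r \<in> V \<inter> F"
    by (rule eventually_nhdsin_openin) (use V assms in auto)
  then show ?thesis
    by eventually_elim (use V(3) in blast)
qed

lemma S_chart:
  assumes c: "(U, \<phi>) \<in> max_atlas M" and sl: "\<phi> ` (U \<inter> F) = \<phi> ` U \<inter> span K"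
  shows "(U \<inter> F, \<phi>) \<in> max_atlas S"
  using c sl fib_atlas by (intro S.matlas_max) blast

lemma frame_slice:
  assumes p: "p \<in> F" and ad: "adapted_frame p U \<phi> x E y G \<beta>"
  shows "\<phi> ` (U \<inter> F) = \<phi> ` U \<inter> span K" "(U \<inter> F, \<phi>) \<in> max_atlas S" "p \<in> U \<inter> F"
proof -
  note c = adapted_frameD(1,2,3)[OF ad]
  show sl: "\<phi> ` (U \<inter> F) = \<phi> ` U \<inter> span K"
    using c(3) fiberD(2)[OF p] M.chart_subset[OF c(1)] by (auto simp: fiber_def)
  show "(U \<inter> F, \<phi>) \<in> max_atlas S"
    by (rule S_chart[OF c(1) sl])
  show "p \<in> U \<inter> F"
    using c(2) p by blast
qed

lemma smooth_restrict:
  assumes f: "f \<in> smooth_functions M"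
  shows "f \<in> smooth_functions S"
  unfolding S.smooth_functions_iff
proof
  fix p assume "p \<in> mcarrier S"
  then have p: "p \<in> F"
    by (rule S_carrierD)
  obtain U \<phi> x E y G \<beta> where ad: "adapted_frame p U \<phi> x E y G \<beta>"
    by (rule adapted_frame_exists[OF fiberD(1)[OF p]])
  note c = adapted_frameD(1,2)[OF ad] and s = frame_slice[OF p ad]
  have o: "openin (top_of_set (span K)) (\<phi> ` (U \<inter> F))"
    using S.chart_image[OF s(2)] by (simp only: fib_simps)
  have "smooth_on K (\<phi> ` (U \<inter> F)) (\<lambda>z. f (inv_into U \<phi> z))"
    by (rule smooth_on_mono[OF M.smooth_on_chart_function[OF c(1) f] _ K]) blast
  then have "smooth_on K (\<phi> ` (U \<inter> F)) (\<lambda>z. f (inv_into (U \<inter> F) \<phi> z))"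
    by (rule smooth_on_cong[OF o]) (auto simp: inv_slice[OF c(1)] M.chart_inv[OF c(1)])
  then show "smooth_at S p f"
    by (intro S.smooth_atI[OF s(2,3) S.chart_image[OF s(2)]]) (use s(3) in \<open>auto simp: fib_simps\<close>)
qed

text \<open>A line in a direction of K stays in the slice, and there the inverse charts of M and of
  the fiber agree.\<close>

lemma coord_vec_slice:
  assumes c: "(U, \<phi>) \<in> max_atlas M" and s: "\<phi> ` (U \<inter> F) = \<phi> ` U \<inter> span K" and p: "p \<in> U \<inter> F" and b: "b \<in> K"
  shows "incl S M (coord_vec S (U \<inter> F) \<phi> b p) = coord_vec M U \<phi> b p"
proof
  fix f
  have o: "openin (top_of_set (span K)) (\<phi> ` (U \<inter> F))"
    using S.chart_image[OF S_chart[OF c s]] by (simp only: fib_simps)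
  have "partial_deriv b (\<lambda>z. f (inv_into (U \<inter> F) \<phi> z)) (\<phi> p) = partial_deriv b (\<lambda>z. f (inv_into U \<phi> z)) (\<phi> p)"
    by (rule partial_cong(1)[OF o _ _ b]) (use p in \<open>auto simp: inv_slice[OF c] M.chart_inv[OF c]\<close>)
  then show "incl S M (coord_vec S (U \<inter> F) \<phi> b p) f = coord_vec M U \<phi> b p f"
    using smooth_restrict by (simp add: differential_def coord_vec_def)
qed

lemma incl_add: "incl S M (\<lambda>f. v f + w f) = (\<lambda>f. incl S M v f + incl S M w f)"
  by (auto simp: differential_def)

lemma incl_scale: "incl S M (\<lambda>f. c * v f) = (\<lambda>f. c * incl S M v f)"
  by (auto simp: differential_def)

lemma incl_zero: "incl S M (\<lambda>f. 0) = (\<lambda>f. 0)"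
  by (auto simp: differential_def)

text \<open>A function pulled back from N is constant on the fiber, so a derivation of functions on
  the fiber kills it.\<close>

lemma incl_vertical:
  assumes p: "p \<in> F" and v: "v \<in> tangent_space S p"
  shows "incl S M v \<in> vert p"
proof -
  have "incl S M v \<in> tangent_space M p"
  proof (rule M.tangentI)
    fix f h assume f: "f \<in> smooth_functions M" and h: "h \<in> smooth_functions M"
    note fS = smooth_restrict[OF f] and hS = smooth_restrict[OF h]
    show "incl S M v (\<lambda>x. f x + h x) = incl S M v f + incl S M v h"
      using S.tangent_add[OF v fS hS] M.smooth_function_add[OF f h] f h by (simp add: differential_def)
    show "incl S M v (\<lambda>x. f x * h x) = f p * incl S M v h + h p * incl S M v f"
      using S.tangent_mult[OF v fS hS] M.smooth_function_mult[OF f h] f h by (simp add: differential_def)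
  next
    fix c f assume f: "f \<in> smooth_functions M"
    show "incl S M v (\<lambda>x. c * f x) = c * incl S M v f"
      using S.tangent_scale[OF v smooth_restrict[OF f]] M.smooth_function_mult[OF M.smooth_function_const f] f
      by (simp add: differential_def)
  qed (simp add: differential_def)
  moreover have "incl S M v (\<lambda>r. h (\<pi> r)) = 0" if h: "h \<in> smooth_functions N" for h
  proof -
    have pb: "(\<lambda>r. h (\<pi> r)) \<in> smooth_functions M"
      by (rule pullback_smooth[OF h])
    have "v (\<lambda>r. h (\<pi> r)) = v (\<lambda>r. h q0)"
      by (rule S.tangent_cong[OF fiberD(3)[OF p] v smooth_restrict[OF pb]]) (simp add: fiberD(2)[OF S_carrierD])
    then show ?thesis
      using pb S.tangent_const[OF v] by (simp add: differential_def)
  qed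
  ultimately show ?thesis
    by (simp add: vertical_space_iff)
qed

lemma incl_tangent: "p \<in> F \<Longrightarrow> v \<in> tangent_space S p \<Longrightarrow> incl S M v \<in> tangent_space M p"
  using incl_vertical vertical_tangent by blast

text \<open>The ambient functions x b with b in K restrict to the coordinates of the slice chart. A
  tangent vector of the fiber is therefore determined by its values on restrictions of ambient
  functions.\<close>

lemma fiber_expansion:
  assumes p: "p \<in> F" and ad: "adapted_frame p U \<phi> x E y G \<beta>"
  shows "\<forall>\<^sub>F r in S.near p. r \<in> U \<inter> F \<and> adapted_at p U \<phi> x E y G \<beta> r \<and>
    (\<forall>v\<in>tangent_space S r. \<forall>f. v f = (\<Sum>b\<in>K. v (x b) * coord_vec S (U \<inter> F) \<phi> b r f))"
proof -
  note c = adapted_frameD[OF ad] and s = frame_slice[OF p ad]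
  have "\<forall>\<^sub>F r in S.near p. r \<in> U \<inter> F"
    by (rule eventually_nhdsin_openin[OF S.chart_openin[OF s(2)] s(3)])
  then show ?thesis
    using near_fiber[OF p eventually_eventually_nhdsin[OF c(8)]] near_fiber[OF p c(8)]
  proof eventually_elim
    case (elim r)
    have r: "r \<in> F"
      using elim(1) by blast
    have near: "\<forall>\<^sub>F z in S.near r. x b z = \<phi> z \<bullet> b" if b: "b \<in> mcoords S" for b
    proof -
      have bB: "b \<in> mcoords M"
        using b K by (auto simp: fib_simps)
      have "\<forall>\<^sub>F z in M.near r. x b z = \<phi> z \<bullet> b"
        using elim(2) by eventually_elim (rule adapted_atD(2)[OF _ bB])
      then show ?thesis
        by (rule near_fiber[OF r])
    qed
    have "v f = (\<Sum>b\<in>K. v (x b) * coord_vec S (U \<inter> F) \<phi> b r f)" if v: "v \<in> tangent_space S r" for v f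
    proof -
      have "v f = (\<Sum>b\<in>mcoords S. v (x b) * coord_vec S (U \<inter> F) \<phi> b r f)"
        by (rule S.tangent_expansion[OF s(2) elim(1) v smooth_restrict[OF c(4)] near])
      then show ?thesis
        by (simp only: fib_simps)
    qed
    then show ?case
      using elim(1,3) by blast
  qed
qed

text \<open>Equality of the images compares v and w only on functions that are smooth on M. By
  \<open>fiber_expansion\<close> the x b among these already determine both vectors.\<close>

lemma incl_inj:
  assumes p: "p \<in> F" and v: "v \<in> tangent_space S p" and w: "w \<in> tangent_space S p"
    and eq: "incl S M v = incl S M w"
  shows "v = w"
proof
  fix f
  obtain U \<phi> x E y G \<beta> where ad: "adapted_frame p U \<phi> x E y G \<beta>"
    by (rule adapted_frame_exists[OF fiberD(1)[OF p]])
  note e = eventually_nhdsin_self[OF fiber_expansion[OF p ad] fiberD(3)[OF p]]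
  have "v (x b) = w (x b)" for b
    using fun_cong[OF eq, of "x b"] adapted_frameD(4)[OF ad] by (simp add: differential_def)
  then have "(\<Sum>b\<in>K. v (x b) * coord_vec S (U \<inter> F) \<phi> b p f) = (\<Sum>b\<in>K. w (x b) * coord_vec S (U \<inter> F) \<phi> b p f)"
    by simp
  moreover have "v f = (\<Sum>b\<in>K. v (x b) * coord_vec S (U \<inter> F) \<phi> b p f)"
    "w f = (\<Sum>b\<in>K. w (x b) * coord_vec S (U \<inter> F) \<phi> b p f)"
    using e v w by blast+
  ultimately show "v f = w f"
    by (simp only:)
qed

text \<open>A vertical vector has coefficients only in K, and the coordinate vectors with index in K
  are images of those of the slice chart.\<close>

lemma incl_surj:
  assumes p: "p \<in> F" and w: "w \<in> vert p"
  obtains v where "v \<in> tangent_space S p" "incl S M v = w"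
proof -
  obtain U \<phi> x E y G \<beta> where ad: "adapted_frame p U \<phi> x E y G \<beta>"
    by (rule adapted_frame_exists[OF fiberD(1)[OF p]])
  note c = adapted_frameD[OF ad] and s = frame_slice[OF p ad]
  note ap = eventually_nhdsin_self[OF c(8) fiberD(1)[OF p]]
  let ?v = "\<lambda>f. \<Sum>b\<in>K. w (x b) * coord_vec S (U \<inter> F) \<phi> b p f"
  have "coord_vec S (U \<inter> F) \<phi> b p \<in> tangent_space S p" if "b \<in> K" for b
    using S.coord_vec_tangent[OF s(2,3)] that by (simp add: fib_simps)
  then have t: "?v \<in> tangent_space S p"
    by (rule S.tangent_space_lincomb)
  have "incl S M ?v f = w f" for f
  proof (cases "f \<in> smooth_functions M")
    case True
    have "incl S M ?v f = (\<Sum>b\<in>K. w (x b) * incl S M (coord_vec S (U \<inter> F) \<phi> b p) f)"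
      using True by (simp add: differential_def)
    also have "\<dots> = (\<Sum>b\<in>K. w (x b) * E b p f)"
    proof (rule sum.cong)
      fix b assume b: "b \<in> K"
      then have "b \<in> mcoords M"
        using K by blast
      then show "w (x b) * incl S M (coord_vec S (U \<inter> F) \<phi> b p) f = w (x b) * E b p f"
        using coord_vec_slice[OF c(1) s(1,3) b] adapted_atD(3)[OF ap] by simp
    qed simp
    also have "\<dots> = w f"
      by (rule vertical_expansion[OF ad ap fiberD(1)[OF p] w, symmetric])
    finally show ?thesis .
  next
    case False
    then show ?thesis
      using M.tangent_nonsmooth[OF vertical_tangent[OF w]] by (simp add: differential_def)
  qed
  then show ?thesis
    using that t by blast
qed

abbreviation "res \<equiv> restrict_field S M"

lemma restrict_field:
  assumes W: "W \<in> vertical_fields M N \<pi>" and p: "p \<in> F"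
  shows "res W p \<in> tangent_space S p" "incl S M (res W p) = W p"
proof -
  have "\<exists>!v. v \<in> tangent_space S p \<and> incl S M v = W p"
    using incl_surj[OF p vertical_fieldsD(2)[OF W fiberD(1)[OF p]]] incl_inj[OF p] by metis
  from theI'[OF this] show "res W p \<in> tangent_space S p" "incl S M (res W p) = W p"
    by (simp_all add: restrict_field_def)
qed

lemma restrict_field_eqI:
  assumes W: "W \<in> vertical_fields M N \<pi>" and p: "p \<in> F" and v: "v \<in> tangent_space S p" "incl S M v = W p"
  shows "res W p = v"
  using incl_inj[OF p restrict_field(1)[OF W p] v(1)] restrict_field(2)[OF W p] v(2) by simp

text \<open>The values come from a \<open>THE\<close>, so smoothness is read off from a local
  formula: near p the restriction is the combination of slice coordinate vectors with the smooth
  coefficients \<open>W r (x b)\<close>.\<close>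

lemma restrict_vector_field:
  assumes W: "W \<in> vertical_fields M N \<pi>"
  shows "res W \<in> vector_fields S"
proof (rule S.fieldI)
  fix p assume pS: "p \<in> mcarrier S"
  then have p: "p \<in> F"
    by (rule S_carrierD)
  show "res W p \<in> tangent_space S p"
    by (rule restrict_field(1)[OF W p])
  fix f assume f: "f \<in> smooth_functions S"
  obtain U \<phi> x E y G \<beta> where ad: "adapted_frame p U \<phi> x E y G \<beta>"
    by (rule adapted_frame_exists[OF fiberD(1)[OF p]])
  note c = adapted_frameD[OF ad] and s = frame_slice[OF p ad]
  let ?h = "\<lambda>r. \<Sum>b\<in>K. W r (x b) * coord_vec S (U \<inter> F) \<phi> b r f"
  have "smooth_at S p ?h"
  proof (rule S.smooth_at_sum[OF pS])
    fix b assume b: "b \<in> K"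
    show "smooth_at S p (\<lambda>r. W r (x b) * coord_vec S (U \<inter> F) \<phi> b r f)"
      by (rule S.smooth_at_mult[OF pS S.smooth_functionsD[OF smooth_restrict[OF M.field_smooth[OF vertical_fieldsD(1)[OF W] c(4)]] pS]])
        (rule S.coord_vec_smooth_at[OF s(2,3) _ f], simp add: fib_simps b)
  qed
  moreover have "\<forall>\<^sub>F r in S.near p. ?h r = res W r f"
    using fiber_expansion[OF p ad]
  proof eventually_elim
    case (elim r)
    then have r: "r \<in> F"
      by blast
    have "res W r (x b) = W r (x b)" for b
      using fun_cong[OF restrict_field(2)[OF W r], of "x b"] c(4) by (simp add: differential_def)
    moreover have "res W r f = (\<Sum>b\<in>K. res W r (x b) * coord_vec S (U \<inter> F) \<phi> b r f)"
      using elim restrict_field(1)[OF W r] by blast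
    ultimately show ?case
      by simp
  qed
  ultimately show "smooth_at S p (\<lambda>r. res W r f)"
    by (rule S.smooth_at_cong[OF pS, rotated])
qed

text \<open>A field on the fiber is not given as the restriction of an ambient field. Its image is
  nevertheless a combination of ambient fields E b with coefficients that are smooth on the fiber,
  which is what makes restricted tensors smooth.\<close>

lemma field_fiber_expansion:
  assumes p: "p \<in> F" and ad: "adapted_frame p U \<phi> x E y G \<beta>" and X: "X \<in> vector_fields S"
  shows "\<forall>\<^sub>F r in S.near p. incl S M (X r) = (\<lambda>f. \<Sum>b\<in>K. X r (x b) * E b r f)"
  using fiber_expansion[OF p ad]
proof eventually_elim
  case (elim r)
  then have r: "r \<in> F" and ar: "adapted_at p U \<phi> x E y G \<beta> r"
    by blast+
  show ?case
  proof
    fix f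
    have "incl S M (X r) f = (\<Sum>b\<in>K. incl S M (X r) (x b) * E b r f)"
      by (rule vertical_expansion[OF ad ar fiberD(1)[OF r] incl_vertical[OF r S.field_tangent[OF X fiberD(3)[OF r]]]])
    then show "incl S M (X r) f = (\<Sum>b\<in>K. X r (x b) * E b r f)"
      using adapted_frameD(4)[OF ad] by (simp add: differential_id)
  qed
qed

lemma smooth_at_coefficient:
  assumes "X \<in> vector_fields S" "x \<in> smooth_functions M" "p \<in> mcarrier S"
  shows "smooth_at S p (\<lambda>r. X r x)"
  by (rule S.smooth_functionsD[OF S.field_smooth[OF assms(1) smooth_restrict[OF assms(2)]] assms(3)])

lemma restrict_one_form:
  assumes \<eta>: "one_form M \<eta>"
  shows "one_form S (restrict_form S M \<eta>)"
proof -
  have add: "\<eta> p (\<lambda>f. v f + w f) = \<eta> p v + \<eta> p w" and scale: "\<eta> p (\<lambda>f. c * v f) = c * \<eta> p v"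
    if "p \<in> mcarrier M" "v \<in> tangent_space M p" "w \<in> tangent_space M p" for p v w c
    using \<eta> that unfolding one_form_def by blast+
  have \<eta>s: "(\<lambda>p. \<eta> p (X p)) \<in> smooth_functions M" if "X \<in> vector_fields M" for X
    using \<eta> that unfolding one_form_def by blast
  have lincomb: "\<eta> p (\<lambda>f. \<Sum>b\<in>A. k b * v b f) = (\<Sum>b\<in>A. k b * \<eta> p (v b))"
    if p: "p \<in> mcarrier M" and A: "finite A" and v: "\<And>b. b \<in> A \<Longrightarrow> v b \<in> tangent_space M p" for p A k v
    using A v
  proof (induction A rule: finite_induct)
    case empty
    show ?case
      using scale[OF p M.tangent_zero M.tangent_zero, of 0] by simp
  next
    case (insert a A)
    have "\<eta> p (\<lambda>f. k a * v a f + (\<Sum>b\<in>A. k b * v b f)) = \<eta> p (\<lambda>f. k a * v a f) + \<eta> p (\<lambda>f. \<Sum>b\<in>A. k b * v b f)"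
      using insert.prems by (intro add p M.tangent_space_scale M.tangent_space_lincomb) auto
    then show ?case
      using insert scale[OF p insert.prems M.tangent_zero, of a "k a"] by simp
  qed
  show ?thesis
    unfolding one_form_def restrict_form_def
  proof (intro conjI ballI allI)
    fix p v w c assume p: "p \<in> mcarrier S" and v: "v \<in> tangent_space S p" and w: "w \<in> tangent_space S p"
    note pF = S_carrierD[OF p]
    show "\<eta> p (incl S M (\<lambda>f. v f + w f)) = \<eta> p (incl S M v) + \<eta> p (incl S M w)"
      unfolding incl_add by (rule add[OF fiberD(1)[OF pF] incl_tangent[OF pF v] incl_tangent[OF pF w]])
    show "\<eta> p (incl S M (\<lambda>f. c * v f)) = c * \<eta> p (incl S M v)"
      unfolding incl_scale by (rule scale[OF fiberD(1)[OF pF] incl_tangent[OF pF v] incl_tangent[OF pF w]])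
  next
    fix X assume X: "X \<in> vector_fields S"
    show "(\<lambda>p. \<eta> p (incl S M (X p))) \<in> smooth_functions S"
      unfolding S.smooth_functions_iff
    proof
      fix p assume pS: "p \<in> mcarrier S"
      then have p: "p \<in> F"
        by (rule S_carrierD)
      obtain U \<phi> x E y G \<beta> where ad: "adapted_frame p U \<phi> x E y G \<beta>"
        by (rule adapted_frame_exists[OF fiberD(1)[OF p]])
      note c = adapted_frameD[OF ad]
      have KB: "b \<in> mcoords M" if "b \<in> K" for b
        using that K by blast
      have "smooth_at S p (\<lambda>r. \<Sum>b\<in>K. X r (x b) * \<eta> r (E b r))"
      proof (rule S.smooth_at_sum[OF pS])
        fix b assume b: "b \<in> K"
        show "smooth_at S p (\<lambda>r. X r (x b) * \<eta> r (E b r))"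
          by (rule S.smooth_at_mult[OF pS smooth_at_coefficient[OF X c(4) pS]
                S.smooth_functionsD[OF smooth_restrict[OF \<eta>s[OF c(5)[OF KB[OF b]]]] pS]])
      qed
      moreover have "\<forall>\<^sub>F r in S.near p. (\<Sum>b\<in>K. X r (x b) * \<eta> r (E b r)) = \<eta> r (incl S M (X r))"
        using field_fiber_expansion[OF p ad X] eventually_nhdsin_openin[OF openin_topspace pS]
      proof eventually_elim
        case (elim r)
        have r: "r \<in> mcarrier M"
          by (rule fiberD(1)[OF S_carrierD[OF elim(2)]])
        show ?case
          unfolding elim(1) by (rule lincomb[OF r finite_K, symmetric]) (rule M.field_tangent[OF c(5)[OF KB] r])
      qed
      ultimately show "smooth_at S p (\<lambda>r. \<eta> r (incl S M (X r)))"
        by (rule S.smooth_at_cong[OF pS, rotated])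
    qed
  qed
qed

lemma induced_riemannian_metric:
  assumes "riemannian_metric M g"
  shows "riemannian_metric S (induced_metric S M g)"
proof -
  interpret R: riem_mfd M g
    by unfold_locales (rule assms)
  show ?thesis
    unfolding riemannian_metric_def induced_metric_def
  proof (intro conjI ballI allI impI)
    fix p u v w c assume p: "p \<in> mcarrier S" and u: "u \<in> tangent_space S p" and v: "v \<in> tangent_space S p"
      and w: "w \<in> tangent_space S p"
    note pF = S_carrierD[OF p]
    note t = incl_tangent[OF pF] and pM = fiberD(1)[OF pF]
    show "g p (incl S M (\<lambda>f. u f + v f)) (incl S M w) = g p (incl S M u) (incl S M w) + g p (incl S M v) (incl S M w)"
      unfolding incl_add by (rule R.metric_add_left[OF pM t[OF u] t[OF v] t[OF w]])
    show "g p (incl S M (\<lambda>f. c * u f)) (incl S M w) = c * g p (incl S M u) (incl S M w)"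
      unfolding incl_scale by (rule R.metric_scale_left[OF pM t[OF u] t[OF w]])
  next
    fix p v w assume p: "p \<in> mcarrier S" and v: "v \<in> tangent_space S p" and w: "w \<in> tangent_space S p"
    note pF = S_carrierD[OF p]
    show "g p (incl S M v) (incl S M w) = g p (incl S M w) (incl S M v)"
      by (rule R.metric_sym[OF fiberD(1)[OF pF] incl_tangent[OF pF v] incl_tangent[OF pF w]])
  next
    fix p v assume p: "p \<in> mcarrier S" and v: "v \<in> tangent_space S p" and n: "v \<noteq> (\<lambda>f. 0)"
    note pF = S_carrierD[OF p]
    have "incl S M v \<noteq> (\<lambda>f. 0)"
      using incl_inj[OF pF v S.tangent_zero] n incl_zero by auto
    then show "0 < g p (incl S M v) (incl S M v)"
      by (rule R.metric_pos[OF fiberD(1)[OF pF] incl_tangent[OF pF v]])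
  next
    fix X Y assume X: "X \<in> vector_fields S" and Y: "Y \<in> vector_fields S"
    show "(\<lambda>p. g p (incl S M (X p)) (incl S M (Y p))) \<in> smooth_functions S"
      unfolding S.smooth_functions_iff
    proof
      fix p assume pS: "p \<in> mcarrier S"
      then have p: "p \<in> F"
        by (rule S_carrierD)
      obtain U \<phi> x E y G \<beta> where ad: "adapted_frame p U \<phi> x E y G \<beta>"
        by (rule adapted_frame_exists[OF fiberD(1)[OF p]])
      note c = adapted_frameD[OF ad]
      have KB: "b \<in> mcoords M" if "b \<in> K" for b
        using that K by blast
      let ?h = "\<lambda>r. \<Sum>b\<in>K. X r (x b) * (\<Sum>d\<in>K. Y r (x d) * g r (E b r) (E d r))"
      have "smooth_at S p ?h"
      proof (intro S.smooth_at_sum[OF pS] S.smooth_at_mult[OF pS])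
        fix b d assume b: "b \<in> K" and d: "d \<in> K"
        show "smooth_at S p (\<lambda>r. X r (x b))"
          by (rule smooth_at_coefficient[OF X c(4) pS])
        show "smooth_at S p (\<lambda>r. Y r (x d))"
          by (rule smooth_at_coefficient[OF Y c(4) pS])
        show "smooth_at S p (\<lambda>r. g r (E b r) (E d r))"
          by (rule S.smooth_functionsD[OF smooth_restrict[OF R.metric_smooth[OF c(5)[OF KB[OF b]] c(5)[OF KB[OF d]]]] pS])
      qed
      moreover have "\<forall>\<^sub>F r in S.near p. ?h r = g r (incl S M (X r)) (incl S M (Y r))"
        using field_fiber_expansion[OF p ad X] field_fiber_expansion[OF p ad Y]
          eventually_nhdsin_openin[OF openin_topspace pS]
      proof eventually_elim
        case (elim r)
        have r: "r \<in> mcarrier M"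
          by (rule fiberD(1)[OF S_carrierD[OF elim(3)]])
        have Et: "E b r \<in> tangent_space M r" if "b \<in> K" for b
          by (rule M.field_tangent[OF c(5)[OF KB[OF that]] r])
        have St: "(\<lambda>f. \<Sum>b\<in>K. Y r (x b) * E b r f) \<in> tangent_space M r"
          by (rule M.tangent_space_lincomb[OF Et])
        have "g r (\<lambda>f. \<Sum>b\<in>K. X r (x b) * E b r f) (\<lambda>f. \<Sum>b\<in>K. Y r (x b) * E b r f) =
            (\<Sum>b\<in>K. X r (x b) * g r (E b r) (\<lambda>f. \<Sum>b\<in>K. Y r (x b) * E b r f))"
          by (rule R.metric_lincomb_left[OF r St]) (rule Et)
        also have "\<dots> = ?h r"
        proof (rule sum.cong)
          fix b assume b: "b \<in> K"
          have "g r (E b r) (\<lambda>f. \<Sum>b\<in>K. Y r (x b) * E b r f) = (\<Sum>d\<in>K. Y r (x d) * g r (E b r) (E d r))"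
            by (rule R.metric_lincomb_right[OF r Et[OF b]]) (rule Et)
          then show "X r (x b) * g r (E b r) (\<lambda>f. \<Sum>b\<in>K. Y r (x b) * E b r f) =
              X r (x b) * (\<Sum>d\<in>K. Y r (x d) * g r (E b r) (E d r))"
            by simp
        qed simp
        finally show ?case
          unfolding elim(1,2) ..
      qed
      ultimately show "smooth_at S p (\<lambda>r. g r (incl S M (X r)) (incl S M (Y r)))"
        by (rule S.smooth_at_cong[OF pS, rotated])
    qed
  qed
qed

end


subsection \<open>Isometrically related vector fields\<close>

definition related_fields ::
    "('a, 'e::euclidean_space) manifold \<Rightarrow> ('b, 'f::euclidean_space) manifold \<Rightarrow> ('a \<Rightarrow> 'b) \<Rightarrow>
     ('a \<Rightarrow> 'a tvec set) \<Rightarrow> ('b \<Rightarrow> 'b tvec set) \<Rightarrow> 'a vfield \<Rightarrow> 'b vfield \<Rightarrow> bool" where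
  "related_fields M N \<Phi> P Q X X' \<longleftrightarrow> X \<in> vector_fields M \<and> X' \<in> vector_fields N \<and>
     (\<forall>p\<in>mcarrier M. X p \<in> P p) \<and> (\<forall>q\<in>mcarrier N. X' q \<in> Q q) \<and>
     (\<forall>p\<in>mcarrier M. differential M N \<Phi> (X p) = X' (\<Phi> p))"

text \<open>A map identifying a parallel distribution \<open>P\<close> isometrically with a parallel distribution \<open>Q\<close>.
  Both horizontal lifts along the submersion and restrictions of vertical fields to a fiber are of
  this form.\<close>

locale isometric_pair = M: riem_mfd M g + N: riem_mfd N gN
  for M :: "('a, 'e::euclidean_space) manifold" and g :: "'a form2"
    and N :: "('b, 'f::euclidean_space) manifold" and gN :: "'b form2" +
  fixes \<Phi> :: "'a \<Rightarrow> 'b" and P :: "'a \<Rightarrow> 'a tvec set" and Q :: "'b \<Rightarrow> 'b tvec set"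
  assumes map: "\<And>p. p \<in> mcarrier M \<Longrightarrow> \<Phi> p \<in> mcarrier N"
    and pull: "\<And>f. f \<in> smooth_functions N \<Longrightarrow> (\<lambda>x. f (\<Phi> x)) \<in> smooth_functions M"
    and P_tangent: "\<And>p v. v \<in> P p \<Longrightarrow> v \<in> tangent_space M p"
    and P_diff: "\<And>p v w. v \<in> P p \<Longrightarrow> w \<in> P p \<Longrightarrow> (\<lambda>f. v f - w f) \<in> P p"
    and Q_tangent: "\<And>q v. v \<in> Q q \<Longrightarrow> v \<in> tangent_space N q"
    and Q_diff: "\<And>q v w. v \<in> Q q \<Longrightarrow> w \<in> Q q \<Longrightarrow> (\<lambda>f. v f - w f) \<in> Q q"
    and dP: "\<And>p v. p \<in> mcarrier M \<Longrightarrow> v \<in> P p \<Longrightarrow> differential M N \<Phi> v \<in> Q (\<Phi> p)"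
    and isometry: "\<And>p v w. p \<in> mcarrier M \<Longrightarrow> v \<in> P p \<Longrightarrow> w \<in> P p \<Longrightarrow>
      gN (\<Phi> p) (differential M N \<Phi> v) (differential M N \<Phi> w) = g p v w"
    and P_parallel: "\<And>X Y p. X \<in> vector_fields M \<Longrightarrow> Y \<in> vector_fields M \<Longrightarrow>
      (\<And>p. p \<in> mcarrier M \<Longrightarrow> Y p \<in> P p) \<Longrightarrow> p \<in> mcarrier M \<Longrightarrow> levi_civita M g X Y p \<in> P p"
    and Q_parallel: "\<And>X Y q. X \<in> vector_fields N \<Longrightarrow> Y \<in> vector_fields N \<Longrightarrow>
      (\<And>q. q \<in> mcarrier N \<Longrightarrow> Y q \<in> Q q) \<Longrightarrow> q \<in> mcarrier N \<Longrightarrow> levi_civita N gN X Y q \<in> Q q"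
    and extend: "\<And>p w. p \<in> mcarrier M \<Longrightarrow> w \<in> Q (\<Phi> p) \<Longrightarrow>
      \<exists>Z Z'. related_fields M N \<Phi> P Q Z Z' \<and> Z' (\<Phi> p) = w"
begin

abbreviation "rel \<equiv> related_fields M N \<Phi> P Q"

lemma relD:
  assumes "rel X X'"
  shows "X \<in> vector_fields M" "X' \<in> vector_fields N"
    "\<And>p. p \<in> mcarrier M \<Longrightarrow> X p \<in> P p" "\<And>q. q \<in> mcarrier N \<Longrightarrow> X' q \<in> Q q"
    "\<And>p. p \<in> mcarrier M \<Longrightarrow> differential M N \<Phi> (X p) = X' (\<Phi> p)"
  using assms unfolding related_fields_def by blast+

lemma rel_apply:
  assumes X: "rel X X'" and p: "p \<in> mcarrier M" and f: "f \<in> smooth_functions N"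
  shows "X p (\<lambda>x. f (\<Phi> x)) = X' (\<Phi> p) f"
  using fun_cong[OF relD(5)[OF X p], of f] f by (simp add: differential_def)

lemma rel_metric:
  assumes X: "rel X X'" and Y: "rel Y Y'" and p: "p \<in> mcarrier M"
  shows "g p (X p) (Y p) = gN (\<Phi> p) (X' (\<Phi> p)) (Y' (\<Phi> p))"
  using isometry[OF p relD(3)[OF X p] relD(3)[OF Y p]] by (simp add: relD(5)[OF X p] relD(5)[OF Y p])

lemma rel_metric_deriv:
  assumes X: "rel X X'" and Y: "rel Y Y'" and Z: "rel Z Z'" and p: "p \<in> mcarrier M"
  shows "X p (\<lambda>q. g q (Y q) (Z q)) = X' (\<Phi> p) (\<lambda>q. gN q (Y' q) (Z' q))"
proof -
  have s: "(\<lambda>q. gN q (Y' q) (Z' q)) \<in> smooth_functions N"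
    by (rule N.metric_smooth[OF relD(2)[OF Y] relD(2)[OF Z]])
  have "X p (\<lambda>q. g q (Y q) (Z q)) = X p (\<lambda>q. gN (\<Phi> q) (Y' (\<Phi> q)) (Z' (\<Phi> q)))"
    by (rule M.tangent_cong[OF p M.field_tangent[OF relD(1)[OF X] p] M.metric_smooth[OF relD(1)[OF Y] relD(1)[OF Z]]])
      (rule rel_metric[OF Y Z])
  then show ?thesis
    using rel_apply[OF X p s] by simp
qed

text \<open>P is involutive, because vanishing torsion expresses the bracket by covariant
  derivatives and these stay in P. The second claim is the naturality of brackets of related
  fields.\<close>

lemma rel_nabla_bracket:
  assumes X: "rel X X'" and Y: "rel Y Y'" and p: "p \<in> mcarrier M"
  shows "lie_bracket X Y p \<in> P p"
    and "differential M N \<Phi> (lie_bracket X Y p) = lie_bracket X' Y' (\<Phi> p)"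
proof -
  show "lie_bracket X Y p \<in> P p"
    unfolding M.nabla_torsion[OF relD(1)[OF X] relD(1)[OF Y] p]
    by (rule P_diff[OF P_parallel[OF relD(1)[OF X] relD(1)[OF Y] relD(3)[OF Y] p]
          P_parallel[OF relD(1)[OF Y] relD(1)[OF X] relD(3)[OF X] p]])
  show "differential M N \<Phi> (lie_bracket X Y p) = lie_bracket X' Y' (\<Phi> p)"
  proof
    fix f
    show "differential M N \<Phi> (lie_bracket X Y p) f = lie_bracket X' Y' (\<Phi> p) f"
    proof (cases "f \<in> smooth_functions N")
      case True
      have half: "A p (\<lambda>q. B q (\<lambda>x. f (\<Phi> x))) = A' (\<Phi> p) (\<lambda>q. B' q f)" if A: "rel A A'" and B: "rel B B'" for A A' B B'
      proof -
        have "A p (\<lambda>q. B q (\<lambda>x. f (\<Phi> x))) = A p (\<lambda>q. B' (\<Phi> q) f)"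
          by (rule M.tangent_cong[OF p M.field_tangent[OF relD(1)[OF A] p] M.field_smooth[OF relD(1)[OF B] pull[OF True]]])
            (rule rel_apply[OF B _ True])
        then show ?thesis
          using rel_apply[OF A p N.field_smooth[OF relD(2)[OF B] True]] by simp
      qed
      show ?thesis
        using True half[OF X Y] half[OF Y X] by (simp add: differential_def lie_bracket_def)
    next
      case False
      then show ?thesis
        using N.tangent_nonsmooth[OF N.field_tangent[OF N.bracket_field[OF relD(2)[OF X] relD(2)[OF Y]] map[OF p]] False]
        by (simp add: differential_def)
    qed
  qed
qed

lemma rel_bracket:
  assumes X: "rel X X'" and Y: "rel Y Y'"
  shows "rel (lie_bracket X Y) (lie_bracket X' Y')"
  unfolding related_fields_def
proof (intro conjI ballI)
  show "lie_bracket X Y \<in> vector_fields M" "lie_bracket X' Y' \<in> vector_fields N"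
    by (rule M.bracket_field[OF relD(1)[OF X] relD(1)[OF Y]], rule N.bracket_field[OF relD(2)[OF X] relD(2)[OF Y]])
  show "lie_bracket X Y p \<in> P p" "differential M N \<Phi> (lie_bracket X Y p) = lie_bracket X' Y' (\<Phi> p)"
    if "p \<in> mcarrier M" for p
    by (rule rel_nabla_bracket[OF X Y that])+
  fix q assume q: "q \<in> mcarrier N"
  show "lie_bracket X' Y' q \<in> Q q"
    unfolding N.nabla_torsion[OF relD(2)[OF X] relD(2)[OF Y] q]
    by (rule Q_diff[OF Q_parallel[OF relD(2)[OF X] relD(2)[OF Y] relD(4)[OF Y] q]
          Q_parallel[OF relD(2)[OF Y] relD(2)[OF X] relD(4)[OF X] q]])
qed

lemma rel_koszul:
  assumes X: "rel X X'" and Y: "rel Y Y'" and Z: "rel Z Z'" and p: "p \<in> mcarrier M"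
  shows "M.koszul X Y Z p = N.koszul X' Y' Z' (\<Phi> p)"
  unfolding M.koszul_def N.koszul_def
  by (simp add: rel_metric_deriv[OF X Y Z p] rel_metric_deriv[OF Y Z X p] rel_metric_deriv[OF Z X Y p]
      rel_metric[OF rel_bracket[OF X Y] Z p] rel_metric[OF rel_bracket[OF X Z] Y p]
      rel_metric[OF rel_bracket[OF Y Z] X p])

text \<open>The Koszul expressions of related fields agree, so the image of the covariant derivative
  upstairs and the covariant derivative downstairs have the same product with every test field from
  \<open>extend\<close>.\<close>

lemma rel_nabla:
  assumes X: "rel X X'" and Y: "rel Y Y'"
  shows "rel (levi_civita M g X Y) (levi_civita N gN X' Y')"
  unfolding related_fields_def
proof (intro conjI ballI)
  let ?D = "levi_civita M g X Y" and ?D' = "levi_civita N gN X' Y'"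
  show F: "?D \<in> vector_fields M" and F': "?D' \<in> vector_fields N"
    by (rule M.nabla_field[OF relD(1)[OF X] relD(1)[OF Y]], rule N.nabla_field[OF relD(2)[OF X] relD(2)[OF Y]])
  show Q: "?D' q \<in> Q q" if "q \<in> mcarrier N" for q
    by (rule Q_parallel[OF relD(2)[OF X] relD(2)[OF Y] relD(4)[OF Y] that])
  fix p assume p: "p \<in> mcarrier M"
  show DP: "?D p \<in> P p"
    by (rule P_parallel[OF relD(1)[OF X] relD(1)[OF Y] relD(3)[OF Y] p])
  let ?v = "differential M N \<Phi> (?D p)" and ?w = "?D' (\<Phi> p)"
  have vQ: "?v \<in> Q (\<Phi> p)"
    by (rule dP[OF p DP])
  have wQ: "?w \<in> Q (\<Phi> p)"
    by (rule Q[OF map[OF p]])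
  \<comment> \<open>Test fields exist only for vectors in Q. The difference of the two candidates
    lies in Q because both distributions are parallel, so it serves as its own test vector and turns
    out to have length 0.\<close>
  let ?d = "\<lambda>f. ?v f - ?w f"
  have dQ: "?d \<in> Q (\<Phi> p)"
    by (rule Q_diff[OF vQ wQ])
  obtain Z Z' where Z: "rel Z Z'" "Z' (\<Phi> p) = ?d"
    using extend[OF p dQ] by (elim exE conjE) (rule that)
  have "2 * g p (?D p) (Z p) = 2 * gN (\<Phi> p) ?w (Z' (\<Phi> p))"
    using M.koszul_formula[OF relD(1)[OF X] relD(1)[OF Y] relD(1)[OF Z(1)] p]
      N.koszul_formula[OF relD(2)[OF X] relD(2)[OF Y] relD(2)[OF Z(1)] map[OF p]]
      rel_koszul[OF X Y Z(1) p] by simp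
  moreover have "g p (?D p) (Z p) = gN (\<Phi> p) ?v (Z' (\<Phi> p))"
    using isometry[OF p DP relD(3)[OF Z(1) p]] by (simp add: relD(5)[OF Z(1) p])
  ultimately have "gN (\<Phi> p) ?v ?d = gN (\<Phi> p) ?w ?d"
    by (simp only: Z(2))
  then have "gN (\<Phi> p) ?d ?d = 0"
    using N.metric_diff_left[OF map[OF p] Q_tangent[OF vQ] Q_tangent[OF wQ] Q_tangent[OF dQ]] by simp
  then have "?d = (\<lambda>f. 0)"
    using N.metric_pos[OF map[OF p] Q_tangent[OF dQ]] by fastforce
  then show "?v = ?w"
    by (auto simp: fun_eq_iff)
qed

text \<open>Iterating \<open>rel_nabla\<close> matches the curvature vectors themselves. The vector
  upstairs stays in P, where \<open>isometry\<close> applies.\<close>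

lemma rel_curvature:
  assumes X: "rel X X'" and Y: "rel Y Y'" and Z: "rel Z Z'" and W: "rel W W'" and p: "p \<in> mcarrier M"
  shows "g p (curvature M g X Y Z p) (W p) = gN (\<Phi> p) (curvature N gN X' Y' Z' (\<Phi> p)) (W' (\<Phi> p))"
proof -
  note 1 = rel_nabla[OF X rel_nabla[OF Y Z]] and 2 = rel_nabla[OF Y rel_nabla[OF X Z]]
    and 3 = rel_nabla[OF rel_bracket[OF X Y] Z]
  have R: "curvature M g X Y Z p = (\<lambda>f. (\<lambda>f. levi_civita M g X (levi_civita M g Y Z) p f -
      levi_civita M g Y (levi_civita M g X Z) p f) f - levi_civita M g (lie_bracket X Y) Z p f)"
    by (rule ext) (simp add: M.curvature_eq)
  have RP: "curvature M g X Y Z p \<in> P p"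
    unfolding R by (rule P_diff[OF P_diff[OF relD(3)[OF 1 p] relD(3)[OF 2 p]] relD(3)[OF 3 p]])
  have dR: "differential M N \<Phi> (curvature M g X Y Z p) = curvature N gN X' Y' Z' (\<Phi> p)"
  proof
    fix f
    show "differential M N \<Phi> (curvature M g X Y Z p) f = curvature N gN X' Y' Z' (\<Phi> p) f"
      using fun_cong[OF relD(5)[OF 1 p], of f] fun_cong[OF relD(5)[OF 2 p], of f] fun_cong[OF relD(5)[OF 3 p], of f]
      by (simp add: differential_def M.curvature_eq N.curvature_eq split: if_splits)
  qed
  show ?thesis
    using isometry[OF p RP relD(3)[OF W p]] by (simp add: dR relD(5)[OF W p])
qed

lemma rel_lie_derivative:
  assumes V: "rel V V'" and X: "rel X X'" and Y: "rel Y Y'" and p: "p \<in> mcarrier M"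
  shows "lie_derivative2 V g X Y p = lie_derivative2 V' gN X' Y' (\<Phi> p)"
  unfolding lie_derivative2_def
  by (simp add: rel_metric_deriv[OF V X Y p] rel_metric[OF rel_bracket[OF V X] Y p]
      rel_metric[OF X rel_bracket[OF V Y] p])

end

text \<open>Every term of the curvature is an iterated covariant derivative of its third argument,
  so only that argument has to lie in the parallel distribution.\<close>

lemma (in riem_mfd) curvature_in_parallel:
  assumes diff: "\<And>v w. v \<in> P p \<Longrightarrow> w \<in> P p \<Longrightarrow> (\<lambda>f. v f - w f) \<in> P p"
    and par: "\<And>X Y p. X \<in> vector_fields M \<Longrightarrow> Y \<in> vector_fields M \<Longrightarrow>
      (\<And>p. p \<in> mcarrier M \<Longrightarrow> Y p \<in> P p) \<Longrightarrow> p \<in> mcarrier M \<Longrightarrow> levi_civita M g X Y p \<in> P p"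
    and X: "X \<in> vector_fields M" and Y: "Y \<in> vector_fields M" and Z: "Z \<in> vector_fields M"
    and ZP: "\<And>p. p \<in> mcarrier M \<Longrightarrow> Z p \<in> P p" and p: "p \<in> mcarrier M"
  shows "curvature M g X Y Z p \<in> P p"
proof -
  have R: "curvature M g X Y Z p = (\<lambda>f. (\<lambda>f. \<D> X (\<D> Y Z) p f - \<D> Y (\<D> X Z) p f) f - \<D> (lie_bracket X Y) Z p f)"
    by (rule ext) (simp add: curvature_eq)
  have 1: "\<D> U Z q \<in> P q" if "U \<in> vector_fields M" "q \<in> mcarrier M" for U q
    by (rule par[OF that(1) Z ZP that(2)])
  have 2: "\<D> U (\<D> W Z) p \<in> P p" if "U \<in> vector_fields M" "W \<in> vector_fields M" for U W
    by (rule par[OF that(1) nabla_field[OF that(2) Z] 1[OF that(2)] p])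
  show ?thesis
    unfolding R by (rule diff[OF diff[OF 2[OF X Y] 2[OF Y X]] 1[OF bracket_field[OF X Y] p]])
qed


subsection \<open>Submersions with parallel vertical distribution\<close>

locale parallel_submersion = submersion M N \<pi> K + M: riem_mfd M g + N: riem_mfd N gN
  for M :: "('a, 'e::euclidean_space) manifold" and g :: "'a form2"
    and N :: "('b, 'f::euclidean_space) manifold" and gN :: "'b form2"
    and \<pi> :: "'a \<Rightarrow> 'b" and K :: "'e set" +
  assumes horizontal_isometry: "\<And>p v. p \<in> mcarrier M \<Longrightarrow> v \<in> horizontal_space M g N \<pi> p \<Longrightarrow>
      gN (\<pi> p) (differential M N \<pi> v) (differential M N \<pi> v) = g p v v"
    and parallel: "vertical_parallel M g N \<pi>"
begin

abbreviation "hor \<equiv> horizontal_space M g N \<pi>"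

lemma hor_tangent: "v \<in> hor p \<Longrightarrow> v \<in> tangent_space M p"
  by (simp add: horizontal_space_def)

lemma hor_vert: "v \<in> hor p \<Longrightarrow> w \<in> vert p \<Longrightarrow> g p v w = 0"
  by (simp add: horizontal_space_def)

lemma horI: "v \<in> tangent_space M p \<Longrightarrow> (\<And>w. w \<in> vert p \<Longrightarrow> g p v w = 0) \<Longrightarrow> v \<in> hor p"
  by (simp add: horizontal_space_def)

lemma vert_diff: "v \<in> vert p \<Longrightarrow> w \<in> vert p \<Longrightarrow> (\<lambda>f. v f - w f) \<in> vert p"
  using vertical_add[OF _ vertical_scale[of w p "-1"], of v] by simp

lemma vertical_submodule: "M.submodule (vertical_fields M N \<pi>)"
  unfolding M.submodule_def
  using vertical_fieldsD(1) vertical_fields_zero vertical_fields_add vertical_fields_mult by auto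

text \<open>Gram-Schmidt is run inside the module of vertical fields: the resulting fields are
  vertical everywhere, and orthonormal near p.\<close>

lemma local_vertical_frame:
  assumes p: "p \<in> mcarrier M"
  obtains e where "\<And>b. b \<in> K \<Longrightarrow> e b \<in> vertical_fields M N \<pi>"
    "\<forall>\<^sub>F q in M.near p. (\<forall>b\<in>K. \<forall>c\<in>K. g q (e b q) (e c q) = (if b = c then 1 else 0)) \<and>
       (\<forall>v\<in>vert q. v = (\<lambda>f. \<Sum>b\<in>K. g q v (e b q) * e b q f))"
proof -
  obtain U \<phi> x E y G \<beta> where ad: "adapted_frame p U \<phi> x E y G \<beta>"
    by (rule adapted_frame_exists[OF p])
  note ap = adapted_frameD(8)[OF ad]
  obtain F where F: "\<And>b. b \<in> K \<Longrightarrow> F b \<in> vertical_fields M N \<pi>"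
    and evF: "\<forall>\<^sub>F q in M.near p. \<forall>b\<in>K. F b q = E b q"
    by (rule local_vertical_fields[OF p ad]) (rule that)
  have KB: "b \<in> mcoords M" if "b \<in> K" for b
    using that K by blast
  have ind: "\<forall>b\<in>K. k b = 0" if k: "\<And>f. (\<Sum>b\<in>K. k b * F b p f) = 0" for k
  proof
    fix d assume d: "d \<in> K"
    have "(\<Sum>b\<in>K. k b * F b p (x d)) = (\<Sum>b\<in>K. if b = d then k b else 0)"
      using eventually_nhdsin_self[OF evF p] adapted_atD(4)[OF eventually_nhdsin_self[OF ap p] KB KB[OF d]]
      by (intro sum.cong) auto
    then show "k d = 0"
      using k[of "x d"] d finite_K by simp
  qed
  have "\<exists>e k. (\<forall>b\<in>K. e b \<in> vertical_fields M N \<pi>) \<and> (\<forall>b\<in>K. \<forall>f. e b p f = (\<Sum>c\<in>K. k b c * F c p f)) \<and>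
      (\<forall>\<^sub>F q in M.near p. M.orthonormalizes_at q K F e)"
    by (rule M.gram_schmidt[OF p vertical_submodule finite_K]) (use F ind in auto)
  then obtain e where e: "\<forall>b\<in>K. e b \<in> vertical_fields M N \<pi>"
    and eve: "\<forall>\<^sub>F q in M.near p. M.orthonormalizes_at q K F e"
    by (elim exE conjE) (rule that)
  have "\<forall>\<^sub>F q in M.near p. (\<forall>b\<in>K. \<forall>c\<in>K. g q (e b q) (e c q) = (if b = c then 1 else 0)) \<and>
       (\<forall>v\<in>vert q. v = (\<lambda>f. \<Sum>b\<in>K. g q v (e b q) * e b q f))"
    using ap evF eve eventually_nhdsin_openin[OF openin_topspace p]
  proof eventually_elim
    case (elim q)
    have Ft: "F b q \<in> tangent_space M q" if "b \<in> K" for b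
      by (rule vertical_tangent[OF vertical_fieldsD(2)[OF F[OF that] elim(4)]])
    have et: "e b q \<in> tangent_space M q" if "b \<in> K" for b
      using vertical_tangent[OF vertical_fieldsD(2)[OF _ elim(4)]] e that by blast
    have "v = (\<lambda>f. \<Sum>b\<in>K. g q v (e b q) * e b q f)" if v: "v \<in> vert q" for v
    proof (rule M.orthonormalizes_expansion[OF elim(4) Ft et elim(3)])
      fix f
      have "v f = (\<Sum>b\<in>K. v (x b) * E b q f)"
        by (rule vertical_expansion[OF ad elim(1) elim(4) v])
      also have "\<dots> = (\<Sum>b\<in>K. v (x b) * F b q f)"
        using elim(2) by (intro sum.cong) auto
      finally show "v f = (\<Sum>b\<in>K. v (x b) * F b q f)" .
    qed
    then show ?case
      using elim(3) unfolding M.orthonormalizes_at_def by blast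
  qed
  then show ?thesis
    using e by (intro that[of e]) auto
qed

lemma extend_vertical:
  assumes p: "p \<in> mcarrier M" and w: "w \<in> vert p"
  obtains W where "W \<in> vertical_fields M N \<pi>" "W p = w"
proof -
  obtain e where e: "\<And>b. b \<in> K \<Longrightarrow> e b \<in> vertical_fields M N \<pi>"
    and ev: "\<forall>\<^sub>F q in M.near p. (\<forall>b\<in>K. \<forall>c\<in>K. g q (e b q) (e c q) = (if b = c then 1 else 0)) \<and>
       (\<forall>v\<in>vert q. v = (\<lambda>f. \<Sum>b\<in>K. g q v (e b q) * e b q f))"
    by (rule local_vertical_frame[OF p]) (rule that)
  show ?thesis
  proof (rule that)
    show "(\<lambda>q f. \<Sum>b\<in>K. g p w (e b p) * e b q f) \<in> vertical_fields M N \<pi>"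
      by (rule M.submodule_lincomb[OF vertical_submodule e M.smooth_function_const])
    show "(\<lambda>f. \<Sum>b\<in>K. g p w (e b p) * e b p f) = w"
      using eventually_nhdsin_self[OF ev p] w by auto
  qed
qed

lemma vertical_nabla:
  assumes X: "X \<in> vector_fields M" and Y: "Y \<in> vector_fields M"
    and Yv: "\<And>p. p \<in> mcarrier M \<Longrightarrow> Y p \<in> vert p" and p: "p \<in> mcarrier M"
  shows "levi_civita M g X Y p \<in> vert p"
proof -
  have "Y \<in> vertical_fields M N \<pi>"
    using Y Yv by (simp add: vertical_fields_def)
  then have "levi_civita M g X Y \<in> vertical_fields M N \<pi>"
    using parallel X unfolding vertical_parallel_def by blast
  then show ?thesis
    by (rule vertical_fieldsD(2)[OF _ p])
qed

text \<open>Extend w to a vertical field W. Then g(Y, W) vanishes identically; in its derivative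
  along X the term with the derivative of W is zero because the vertical distribution is parallel,
  hence so is the other one.\<close>

lemma horizontal_nabla:
  assumes X: "X \<in> vector_fields M" and Y: "Y \<in> vector_fields M"
    and Yh: "\<And>p. p \<in> mcarrier M \<Longrightarrow> Y p \<in> hor p" and p: "p \<in> mcarrier M"
  shows "levi_civita M g X Y p \<in> hor p"
proof (rule horI)
  show "levi_civita M g X Y p \<in> tangent_space M p"
    by (rule M.field_tangent[OF M.nabla_field[OF X Y] p])
  fix w assume w: "w \<in> vert p"
  obtain W where W: "W \<in> vertical_fields M N \<pi>" "W p = w"
    using extend_vertical[OF p w] .
  note WF = vertical_fieldsD(1)[OF W(1)]
  have "X p (\<lambda>q. g q (Y q) (W q)) = 0"
    by (rule M.tangent_zero_on_carrier[OF p M.field_tangent[OF X p]])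
      (rule hor_vert[OF Yh vertical_fieldsD(2)[OF W(1)]])
  moreover have "g p (Y p) (levi_civita M g X W p) = 0"
    by (rule hor_vert[OF Yh[OF p] vertical_nabla[OF X WF vertical_fieldsD(2)[OF W(1)] p]])
  ultimately show "g p (levi_civita M g X Y p) w = 0"
    using M.nabla_metric[OF X Y WF p] W(2) by simp
qed

lemma hor_diff:
  assumes p: "p \<in> mcarrier M" and v: "v \<in> hor p" and w: "w \<in> hor p"
  shows "(\<lambda>f. v f - w f) \<in> hor p"
proof (rule horI)
  show "(\<lambda>f. v f - w f) \<in> tangent_space M p"
    by (rule M.tangent_space_diff[OF hor_tangent[OF v] hor_tangent[OF w]])
  fix u assume u: "u \<in> vert p"
  show "g p (\<lambda>f. v f - w f) u = 0"
    using M.metric_diff_left[OF p hor_tangent[OF v] hor_tangent[OF w] vertical_tangent[OF u]]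
      hor_vert[OF v u] hor_vert[OF w u] by simp
qed

lemma differential_diff:
  "differential M N \<pi> (\<lambda>f. v f - w f) = (\<lambda>h. differential M N \<pi> v h - differential M N \<pi> w h)"
  by (auto simp: differential_def)

text \<open>A Riemannian submersion is defined by lengths of horizontal vectors; polarization with v
  - w gives inner products.\<close>

lemma horizontal_isometry2:
  assumes p: "p \<in> mcarrier M" and v: "v \<in> hor p" and w: "w \<in> hor p"
  shows "gN (\<pi> p) (differential M N \<pi> v) (differential M N \<pi> w) = g p v w"
proof -
  note q = proj_carrier[OF p]
  note vt = hor_tangent[OF v] and wt = hor_tangent[OF w]
  note vn = differential_tangent[OF p vt] and wn = differential_tangent[OF p wt]
  have d: "(\<lambda>f. v f - w f) \<in> hor p"
    by (rule hor_diff[OF p v w])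
  have "g p (\<lambda>f. v f - w f) (\<lambda>f. v f - w f) = g p v v - 2 * g p v w + g p w w"
    using M.metric_diff_left[OF p vt wt hor_tangent[OF d]] M.metric_diff_left[OF p vt wt vt]
      M.metric_diff_left[OF p vt wt wt] M.metric_sym[OF p vt hor_tangent[OF d]]
      M.metric_sym[OF p wt hor_tangent[OF d]] M.metric_sym[OF p vt wt] by simp
  moreover have "gN (\<pi> p) (\<lambda>f. differential M N \<pi> v f - differential M N \<pi> w f)
      (\<lambda>f. differential M N \<pi> v f - differential M N \<pi> w f) =
      gN (\<pi> p) (differential M N \<pi> v) (differential M N \<pi> v)
      - 2 * gN (\<pi> p) (differential M N \<pi> v) (differential M N \<pi> w)
      + gN (\<pi> p) (differential M N \<pi> w) (differential M N \<pi> w)"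
    using N.metric_diff_left[OF q vn wn N.tangent_space_diff[OF vn wn]] N.metric_diff_left[OF q vn wn vn]
      N.metric_diff_left[OF q vn wn wn] N.metric_sym[OF q vn N.tangent_space_diff[OF vn wn]]
      N.metric_sym[OF q wn N.tangent_space_diff[OF vn wn]] N.metric_sym[OF q vn wn] by simp
  ultimately show ?thesis
    using horizontal_isometry[OF p d] horizontal_isometry[OF p v] horizontal_isometry[OF p w]
    unfolding differential_diff by simp
qed

text \<open>Locally, the coordinate fields with index outside K are combined so that the sum
  projects to X; its vertical part is arbitrary and is removed by subtracting the orthogonal
  projection \<open>?V\<close> onto a vertical frame. Two lifts differ by a vector both horizontal
  and vertical, hence by 0, so local lifts glue.\<close>

lemma horizontal_lift:
  assumes X: "X \<in> vector_fields N"
  obtains L where "L \<in> vector_fields M" "\<And>p. p \<in> mcarrier M \<Longrightarrow> L p \<in> hor p"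
    "\<And>p. p \<in> mcarrier M \<Longrightarrow> differential M N \<pi> (L p) = X (\<pi> p)"
proof -
  let ?B = "mcoords M" and ?C = "mcoords N"
  define R where "R p v \<longleftrightarrow> v \<in> hor p \<and> differential M N \<pi> v = X (\<pi> p)" for p v
  have unique: "v = w" if v: "R p v" and w: "R p w" and p: "p \<in> mcarrier M" for p v w
  proof -
    let ?d = "\<lambda>f. v f - w f"
    have d: "?d \<in> hor p"
      using v w by (intro hor_diff[OF p]) (auto simp: R_def)
    have "?d \<in> vert p"
      unfolding vertical_space_def using hor_tangent[OF d] v w by (simp add: R_def differential_diff)
    then have "g p ?d ?d = 0"
      by (rule hor_vert[OF d])
    then have "?d = (\<lambda>f. 0)"
      using M.metric_pos[OF p hor_tangent[OF d]] by fastforce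
    then show ?thesis
      by (auto simp: fun_eq_iff)
  qed
  have loc: "\<exists>Y\<in>vector_fields M. \<forall>\<^sub>F q in M.near p. R q (Y q)" if p: "p \<in> mcarrier M" for p
  proof -
    obtain U \<phi> x E y G \<beta> where ad: "adapted_frame p U \<phi> x E y G \<beta>"
      by (rule adapted_frame_exists[OF p])
    note c = adapted_frameD[OF ad]
    obtain e where e: "\<And>b. b \<in> K \<Longrightarrow> e b \<in> vertical_fields M N \<pi>"
      and ev: "\<forall>\<^sub>F q in M.near p. (\<forall>b\<in>K. \<forall>c\<in>K. g q (e b q) (e c q) = (if b = c then 1 else 0)) \<and>
         (\<forall>v\<in>vert q. v = (\<lambda>f. \<Sum>b\<in>K. g q v (e b q) * e b q f))"
      by (rule local_vertical_frame[OF p]) (rule that)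
    note eF = vertical_fieldsD(1)[OF e]
    define Y where "Y q f = (\<Sum>b\<in>?B - K. X (\<pi> q) (y (\<beta> b)) * E b q f)" for q f
    have Y: "Y \<in> vector_fields M"
      unfolding Y_def[abs_def]
      by (rule M.field_lincomb[of "?B - K" E "\<lambda>b q. X (\<pi> q) (y (\<beta> b))"])
        (use c(5) pullback_smooth[OF N.field_smooth[OF X c(6)]] in auto)
    let ?k = "\<lambda>b q. g q (Y q) (e b q)"
    let ?V = "\<lambda>q f. \<Sum>b\<in>K. ?k b q * e b q f"
    have V: "?V \<in> vertical_fields M N \<pi>"
      by (rule M.submodule_lincomb[OF vertical_submodule e M.metric_smooth[OF Y eF]])
    have nV: "(\<lambda>q f. (-1) * ?V q f) \<in> vector_fields M"
      by (rule M.field_mult[OF M.smooth_function_const vertical_fieldsD(1)[OF V]])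
    let ?L = "\<lambda>q f. Y q f + (-1) * ?V q f"
    have L: "?L \<in> vector_fields M"
      by (rule M.field_add[OF Y nV])
    have "\<forall>\<^sub>F q in M.near p. R q (?L q)"
      using c(8) ev eventually_nhdsin_openin[OF openin_topspace p]
    proof eventually_elim
      case (elim q)
      note q = elim(3)
      have Yt: "Y q \<in> tangent_space M q" and Vv: "?V q \<in> vert q"
        using M.field_tangent[OF Y q] vertical_fieldsD(2)[OF V q] .
      have et: "e b q \<in> tangent_space M q" if "b \<in> K" for b
        by (rule M.field_tangent[OF eF[OF that] q])
      have Leq: "?L q = (\<lambda>f. Y q f - ?V q f)"
        by simp
      have gVe: "g q (?V q) (e d q) = g q (Y q) (e d q)" if d: "d \<in> K" for d
      proof -
        have "g q (?V q) (e d q) = (\<Sum>b\<in>K. ?k b q * g q (e b q) (e d q))"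
          by (rule M.metric_lincomb_left[OF q et[OF d]]) (rule et)
        also have "\<dots> = (\<Sum>b\<in>K. if b = d then ?k b q else 0)"
          using elim(2) d by (intro sum.cong) auto
        finally show ?thesis
          using d finite_K by simp
      qed
      have "?L q \<in> hor q"
      proof (rule horI)
        show "?L q \<in> tangent_space M q"
          by (rule M.field_tangent[OF L q])
        fix w assume w: "w \<in> vert q"
        have we: "w = (\<lambda>f. \<Sum>b\<in>K. g q w (e b q) * e b q f)"
          using elim(2) w by blast
        have "g q (?L q) (\<lambda>f. \<Sum>b\<in>K. g q w (e b q) * e b q f) = (\<Sum>b\<in>K. g q w (e b q) * g q (?L q) (e b q))"
          by (rule M.metric_lincomb_right[OF q M.field_tangent[OF L q]]) (rule et)
        also have "\<dots> = 0"
        proof (rule sum.neutral, rule ballI)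
          fix b assume b: "b \<in> K"
          have "g q (?L q) (e b q) = 0"
            unfolding Leq
            using M.metric_diff_left[OF q Yt vertical_tangent[OF Vv] et[OF b]] gVe[OF b] by simp
          then show "g q w (e b q) * g q (?L q) (e b q) = 0"
            by simp
        qed
        finally show "g q (?L q) w = 0"
          using we by simp
      qed
      moreover have "differential M N \<pi> (?L q) = X (\<pi> q)"
      proof
        fix h
        show "differential M N \<pi> (?L q) h = X (\<pi> q) h"
        proof (cases "h \<in> smooth_functions N")
          case h: True
          have Xt: "X (\<pi> q) \<in> tangent_space N (\<pi> q)"
            by (rule N.field_tangent[OF X proj_carrier[OF q]])
          have Vh: "?V q (\<lambda>r. h (\<pi> r)) = 0"
            using Vv h unfolding vertical_space_iff by blast
          \<comment> \<open>For b outside K the coordinate vector E b projects to the frame vector G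
            (\<beta> b) of N. This is seen by comparing coefficients, which
            \<open>adapted_atD\<close> turns into E b q (x d).\<close>
          have dE: "E b q (\<lambda>r. h (\<pi> r)) = G (\<beta> b) (\<pi> q) h" if b: "b \<in> ?B - K" for b
          proof -
            have bB: "b \<in> ?B"
              using b by blast
            have Et: "E b q \<in> tangent_space M q"
              by (rule M.field_tangent[OF c(5)[OF bB] q])
            have "E b q (\<lambda>r. h (\<pi> r)) = differential M N \<pi> (E b q) h"
              using h by (simp add: differential_def)
            also have "\<dots> = (\<Sum>i\<in>?C. differential M N \<pi> (E b q) (y i) * G i (\<pi> q) h)"
              by (rule adapted_atD(6)[OF elim(1) differential_tangent[OF q Et]])
            also have "\<dots> = (\<Sum>d\<in>?B - K. differential M N \<pi> (E b q) (y (\<beta> d)) * G (\<beta> d) (\<pi> q) h)"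
              by (rule sum.reindex_bij_betw[OF c(7), symmetric])
            also have "\<dots> = (\<Sum>d\<in>?B - K. if d = b then G (\<beta> d) (\<pi> q) h else 0)"
            proof (rule sum.cong)
              fix d assume d: "d \<in> ?B - K"
              have "differential M N \<pi> (E b q) (y (\<beta> d)) = E b q (x d)"
                by (rule adapted_atD(7)[OF elim(1) Et d, symmetric])
              then show "differential M N \<pi> (E b q) (y (\<beta> d)) * G (\<beta> d) (\<pi> q) h = (if d = b then G (\<beta> d) (\<pi> q) h else 0)"
                using adapted_atD(4)[OF elim(1) bB, of d] d by auto
            qed simp
            also have "\<dots> = G (\<beta> b) (\<pi> q) h"
              using b M.finite_coords by simp
            finally show ?thesis .
          qed
          have "differential M N \<pi> (?L q) h = Y q (\<lambda>r. h (\<pi> r))"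
            using h Vh by (simp add: differential_def)
          also have "\<dots> = (\<Sum>b\<in>?B - K. X (\<pi> q) (y (\<beta> b)) * G (\<beta> b) (\<pi> q) h)"
            unfolding Y_def using dE by (intro sum.cong) auto
          also have "\<dots> = (\<Sum>i\<in>?C. X (\<pi> q) (y i) * G i (\<pi> q) h)"
            by (rule sum.reindex_bij_betw[OF c(7)])
          also have "\<dots> = X (\<pi> q) h"
            by (rule adapted_atD(6)[OF elim(1) Xt, symmetric])
          finally show ?thesis .
        next
          case False
          then show ?thesis
            using N.field_off_nonsmooth[OF X proj_carrier[OF q] False] by (simp add: differential_def)
        qed
      qed
      ultimately show ?case
        by (simp only: R_def)
    qed
    then show ?thesis
      by (rule bexI[of _ ?L, OF _ L])
  qed
  obtain L where L: "L \<in> vector_fields M" "\<And>p. p \<in> mcarrier M \<Longrightarrow> R p (L p)"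
    by (rule M.glue_field[of R, OF loc unique]) (assumption | rule that)+
  show ?thesis
    by (rule that[OF L(1)]) (use L(2) in \<open>auto simp: R_def\<close>)
qed

text \<open>The locale asks for closure of P under differences at every p, whereas
  \<open>hor_diff\<close> holds at points of the carrier; the empty set elsewhere fills the gap.
  Test fields are horizontal lifts of extensions of a given vector of N.\<close>

lemma lift_pair: "isometric_pair M g N gN \<pi> (\<lambda>p. if p \<in> mcarrier M then hor p else {}) (tangent_space N)"
proof unfold_locales
  show "\<exists>Z Z'. related_fields M N \<pi> (\<lambda>p. if p \<in> mcarrier M then hor p else {}) (tangent_space N) Z Z' \<and> Z' (\<pi> p) = w"
    if p: "p \<in> mcarrier M" and w: "w \<in> tangent_space N (\<pi> p)" for p w
  proof -
    obtain X where X: "X \<in> vector_fields N" "X (\<pi> p) = w"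
      using N.extend_tangent[OF proj_carrier[OF p] w] .
    obtain L where "L \<in> vector_fields M" "\<And>p. p \<in> mcarrier M \<Longrightarrow> L p \<in> hor p"
      "\<And>p. p \<in> mcarrier M \<Longrightarrow> differential M N \<pi> (L p) = X (\<pi> p)"
      by (rule horizontal_lift[OF X(1)]) (rule that)
    then have "related_fields M N \<pi> (\<lambda>p. if p \<in> mcarrier M then hor p else {}) (tangent_space N) L X"
      using X(1) N.field_tangent by (simp add: related_fields_def)
    then show ?thesis
      using X(2) by blast
  qed
qed (auto simp: proj_carrier pullback_smooth hor_tangent hor_diff N.tangent_space_diff differential_tangent
    horizontal_isometry2 horizontal_nabla N.field_tangent N.nabla_field split: if_splits)

end


section \<open>Curvature of the fibers and the soliton equation\<close>

locale parallel_submersion_fiber = parallel_submersion M g N gN \<pi> K + submersion_fiber M N \<pi> K q0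
  for M :: "('a, 'e::euclidean_space) manifold" and g :: "'a form2"
    and N :: "('b, 'f::euclidean_space) manifold" and gN :: "'b form2"
    and \<pi> :: "'a \<Rightarrow> 'b" and K :: "'e set" and q0 :: 'b
begin

abbreviation "gS \<equiv> induced_metric S M g"

sublocale S: riem_mfd S gS
  by unfold_locales (rule induced_riemannian_metric[OF M.metric])

lemma restrict_related:
  assumes W: "W \<in> vertical_fields M N \<pi>"
  shows "related_fields S M (\<lambda>x. x) (tangent_space S) vert (res W) W"
  unfolding related_fields_def
proof (intro conjI ballI)
  show "res W \<in> vector_fields S" "W \<in> vector_fields M"
    by (rule restrict_vector_field[OF W], rule vertical_fieldsD(1)[OF W])
  show "W q \<in> vert q" if "q \<in> mcarrier M" for q
    by (rule vertical_fieldsD(2)[OF W that])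
  fix p assume p: "p \<in> mcarrier S"
  show "res W p \<in> tangent_space S p" "incl S M (res W p) = W p"
    by (rule restrict_field[OF W S_carrierD[OF p]])+
qed

text \<open>Here the fiber is the source, with all of its tangent vectors as P. Parallelism of Q is
  the hypothesis on the vertical distribution, and test fields arise by restricting vertical
  extensions of a given vertical vector.\<close>

lemma restrict_pair: "isometric_pair S gS M g (\<lambda>x. x) (tangent_space S) vert"
proof unfold_locales
  show "p \<in> mcarrier M" if "p \<in> mcarrier S" for p
    by (rule fiberD(1)[OF S_carrierD[OF that]])
  show "(\<lambda>x. f x) \<in> smooth_functions S" if "f \<in> smooth_functions M" for f
    by (rule smooth_restrict[OF that])
  show "incl S M v \<in> vert p" if "p \<in> mcarrier S" "v \<in> tangent_space S p" for p v
    by (rule incl_vertical[OF S_carrierD[OF that(1)] that(2)])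
  show "g p (incl S M v) (incl S M w) = gS p v w" for p v w
    by (simp add: induced_metric_def)
  show "levi_civita S gS X Y p \<in> tangent_space S p"
    if "X \<in> vector_fields S" "Y \<in> vector_fields S" "p \<in> mcarrier S" for X Y p
    by (rule S.field_tangent[OF S.nabla_field[OF that(1,2)] that(3)])
  show "levi_civita M g X Y q \<in> vert q"
    if "X \<in> vector_fields M" "Y \<in> vector_fields M" "\<And>q. q \<in> mcarrier M \<Longrightarrow> Y q \<in> vert q" "q \<in> mcarrier M" for X Y q
    by (rule vertical_nabla[OF that])
  show "\<exists>Z Z'. related_fields S M (\<lambda>x. x) (tangent_space S) vert Z Z' \<and> Z' p = w"
    if p: "p \<in> mcarrier S" and w: "w \<in> vert p" for p w
  proof -
    obtain W where W: "W \<in> vertical_fields M N \<pi>" "W p = w"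
      using extend_vertical[OF fiberD(1)[OF S_carrierD[OF p]] w] .
    then show ?thesis
      using restrict_related by blast
  qed
qed (auto intro: S.tangent_space_diff vert_diff vertical_tangent)

text \<open>In an orthonormal frame composed of vertical fields and horizontal lifts the mixed curvature
  terms vanish, because both distributions are parallel.\<close>

lemma scalar_curvature_splits:
  assumes p: "p \<in> F"
  shows "scalar_curvature M g p = scalar_curvature S gS p + scalar_curvature N gN q0"
proof -
  let ?B = "mcoords M" and ?C = "mcoords N"
  note pM = fiberD(1)[OF p] and pq = fiberD(2)[OF p] and pS = fiberD(3)[OF p]
  have qN: "q0 \<in> mcarrier N"
    using proj_carrier[OF pM] pq by simp
  interpret L: isometric_pair M g N gN \<pi> "\<lambda>p. if p \<in> mcarrier M then hor p else {}" "tangent_space N"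
    by (rule lift_pair)
  interpret R: isometric_pair S gS M g "\<lambda>x. x" "tangent_space S" vert
    by (rule restrict_pair)
  obtain e where e: "\<And>b. b \<in> K \<Longrightarrow> e b \<in> vertical_fields M N \<pi>"
    and ev: "\<forall>\<^sub>F q in M.near p. (\<forall>b\<in>K. \<forall>c\<in>K. g q (e b q) (e c q) = (if b = c then 1 else 0)) \<and>
       (\<forall>v\<in>vert q. v = (\<lambda>f. \<Sum>b\<in>K. g q v (e b q) * e b q f))"
    by (rule local_vertical_frame[OF pM]) (rule that)
  have oe: "g p (e b p) (e c p) = (if b = c then 1 else 0)" if "b \<in> K" "c \<in> K" for b c
    using eventually_nhdsin_self[OF ev pM] that by blast
  obtain u where u: "\<And>c. c \<in> ?C \<Longrightarrow> u c \<in> vector_fields N"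
    and evu: "\<forall>\<^sub>F q in N.near q0. (\<forall>b\<in>?C. \<forall>c\<in>?C. gN q (u b q) (u c q) = (if b = c then 1 else 0)) \<and>
       (\<forall>v\<in>tangent_space N q. v = (\<lambda>f. \<Sum>b\<in>?C. gN q v (u b q) * u b q f))"
    by (rule N.local_orthonormal_frame[OF qN]) (rule that)
  have ou: "gN q0 (u b q0) (u c q0) = (if b = c then 1 else 0)" if "b \<in> ?C" "c \<in> ?C" for b c
    using eventually_nhdsin_self[OF evu qN] that by blast
  have "\<exists>l. L.rel l (u c)" if c: "c \<in> ?C" for c
  proof -
    obtain l where "l \<in> vector_fields M" "\<And>p. p \<in> mcarrier M \<Longrightarrow> l p \<in> hor p"
      "\<And>p. p \<in> mcarrier M \<Longrightarrow> differential M N \<pi> (l p) = u c (\<pi> p)"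
      by (rule horizontal_lift[OF u[OF c]]) (rule that)
    then have "L.rel l (u c)"
      using u[OF c] N.field_tangent by (simp add: related_fields_def)
    then show ?thesis
      by (rule exI[of _ l])
  qed
  then have "\<exists>l. \<forall>c\<in>?C. L.rel (l c) (u c)"
    by (intro bchoice ballI)
  then obtain l where l: "\<And>c. c \<in> ?C \<Longrightarrow> L.rel (l c) (u c)"
    by (elim exE) (rule that, rule bspec)
  have lh: "l c q \<in> hor q" if "c \<in> ?C" "q \<in> mcarrier M" for c q
    using L.relD(3)[OF l[OF that(1)] that(2)] that(2) by simp
  obtain U \<phi> x E' y G \<beta> where ad: "adapted_frame p U \<phi> x E' y G \<beta>"
    by (rule adapted_frame_exists[OF pM])
  note \<beta> = adapted_frameD(7)[OF ad]
  have \<beta>C: "\<beta> b \<in> ?C" if "b \<in> ?B - K" for b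
    using \<beta> that by (auto simp: bij_betw_def)
  \<comment> \<open>Indices in K carry vertical fields. The remaining ones are matched by \<beta>
    with the coordinates of N and carry horizontal lifts, so that E has one field for every
    coordinate of M.\<close>
  define E where "E b = (if b \<in> K then e b else l (\<beta> b))" for b
  have EK: "E b = e b" if "b \<in> K" for b
    using that by (simp add: E_def)
  have EL: "E b = l (\<beta> b)" if "b \<in> ?B - K" for b
    using that by (simp add: E_def)
  have relK: "R.rel (res (e b)) (E b)" if "b \<in> K" for b
    unfolding EK[OF that] by (rule restrict_related[OF e[OF that]])
  have relL: "L.rel (E b) (u (\<beta> b))" if "b \<in> ?B - K" for b
    unfolding EL[OF that] by (rule l[OF \<beta>C[OF that]])
  have Ev: "E b q \<in> vert q" if "b \<in> K" "q \<in> mcarrier M" for b q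
    by (rule R.relD(4)[OF relK[OF that(1)] that(2)])
  have Eh: "E b q \<in> hor q" if "b \<in> ?B - K" "q \<in> mcarrier M" for b q
    unfolding EL[OF that(1)] by (rule lh[OF \<beta>C[OF that(1)] that(2)])
  have EF: "E b \<in> vector_fields M" if "b \<in> ?B" for b
    using R.relD(2)[OF relK, of b] L.relD(1)[OF relL, of b] that by blast
  have oL: "g p (E b p) (E c p) = (if b = c then 1 else 0)" if "b \<in> ?B - K" "c \<in> ?B - K" for b c
  proof -
    have "g p (E b p) (E c p) = gN q0 (u (\<beta> b) q0) (u (\<beta> c) q0)"
      using L.rel_metric[OF relL[OF that(1)] relL[OF that(2)] pM] by (simp add: pq)
    moreover have "\<beta> b = \<beta> c \<longleftrightarrow> b = c"
      using bij_betw_imp_inj_on[OF \<beta>] that by (auto simp: inj_on_def)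
    ultimately show ?thesis
      using ou[OF \<beta>C[OF that(1)] \<beta>C[OF that(2)]] by simp
  qed
  have hv: "g p v w = 0" "g p w v = 0" if "v \<in> hor p" "w \<in> vert p" for v w
    using hor_vert[OF that] M.metric_sym[OF pM hor_tangent[OF that(1)] vertical_tangent[OF that(2)]] by simp_all
  have oM: "orthonormal_at M g p E"
    unfolding orthonormal_at_def
  proof (intro conjI ballI)
    show "E b \<in> vector_fields M" if "b \<in> ?B" for b
      by (rule EF[OF that])
    fix b c assume b: "b \<in> ?B" and c: "c \<in> ?B"
    show "g p (E b p) (E c p) = (if b = c then 1 else 0)"
    proof (cases "b \<in> K"; cases "c \<in> K")
      assume "b \<in> K" "c \<in> K"
      then show ?thesis
        using oe by (simp add: EK)
    next
      assume "b \<in> K" "c \<notin> K"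
      then show ?thesis
        using hv(2)[OF Eh[OF _ pM, of c] Ev[OF _ pM, of b]] c by auto
    next
      assume "b \<notin> K" "c \<in> K"
      then show ?thesis
        using hv(1)[OF Eh[OF _ pM, of b] Ev[OF _ pM, of c]] b by auto
    next
      assume "b \<notin> K" "c \<notin> K"
      then show ?thesis
        using oL[of b c] b c by simp
    qed
  qed
  have oS: "orthonormal_at S gS p (\<lambda>b. res (e b))"
    unfolding orthonormal_at_def fib_simps
  proof (intro conjI ballI)
    show "res (e b) \<in> vector_fields S" if "b \<in> K" for b
      by (rule restrict_vector_field[OF e[OF that]])
    show "gS p (res (e b) p) (res (e c) p) = (if b = c then 1 else 0)" if "b \<in> K" "c \<in> K" for b c
      using oe[OF that] by (simp add: induced_metric_def restrict_field(2)[OF e p] that)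
  qed
  have oN: "orthonormal_at N gN q0 u"
    unfolding orthonormal_at_def using u ou by blast
  let ?T = "\<lambda>b c. g p (curvature M g (E b) (E c) (E c) p) (E b p)"
  \<comment> \<open>The third argument E c is vertical, so the curvature vector is vertical, while E
    b is horizontal. \<open>Th\<close> below is the same with the two distributions
    exchanged.\<close>
  have Tv: "?T b c = 0" if b: "b \<in> ?B - K" and c: "c \<in> K" for b c
  proof -
    have bB: "b \<in> ?B" and cB: "c \<in> ?B"
      using b c K by blast+
    have "curvature M g (E b) (E c) (E c) p \<in> vert p"
      by (rule M.curvature_in_parallel[of vert, OF vert_diff vertical_nabla EF[OF bB] EF[OF cB] EF[OF cB] Ev[OF c] pM])
    then show ?thesis
      by (rule hv(2)[OF Eh[OF b pM]])
  qed
  have Th: "?T b c = 0" if b: "b \<in> K" and c: "c \<in> ?B - K" for b c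
  proof -
    have bB: "b \<in> ?B" and cB: "c \<in> ?B"
      using b c K by blast+
    have "curvature M g (E b) (E c) (E c) p \<in> hor p"
      by (rule M.curvature_in_parallel[of hor, OF hor_diff[OF pM] horizontal_nabla EF[OF bB] EF[OF cB] EF[OF cB] Eh[OF c] pM])
    then show ?thesis
      by (rule hv(1)[OF _ Ev[OF b pM]])
  qed
  have split: "(\<Sum>b\<in>?B. f b) = (\<Sum>b\<in>K. f b) + (\<Sum>b\<in>?B - K. f b)" for f :: "'e \<Rightarrow> real"
    using sum.subset_diff[OF K M.finite_coords, of f] by simp
  have "scalar_curvature M g p = (\<Sum>c\<in>?B. \<Sum>b\<in>?B. ?T b c)"
    by (rule M.scalar_curvature_frame[OF pM oM])
  also have "\<dots> = (\<Sum>c\<in>K. \<Sum>b\<in>K. ?T b c) + (\<Sum>c\<in>?B - K. \<Sum>b\<in>?B - K. ?T b c)"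
    by (simp add: split Tv Th)
  also have "(\<Sum>c\<in>K. \<Sum>b\<in>K. ?T b c) = scalar_curvature S gS p"
  proof -
    have "scalar_curvature S gS p = (\<Sum>c\<in>K. \<Sum>b\<in>K. gS p (curvature S gS (res (e b)) (res (e c)) (res (e c)) p) (res (e b) p))"
      using S.scalar_curvature_frame[OF pS oS] by (simp only: fib_simps)
    also have "\<dots> = (\<Sum>c\<in>K. \<Sum>b\<in>K. ?T b c)"
      by (intro sum.cong refl R.rel_curvature relK pS)
    finally show ?thesis ..
  qed
  also have "(\<Sum>c\<in>?B - K. \<Sum>b\<in>?B - K. ?T b c) = scalar_curvature N gN q0"
  proof -
    let ?S = "\<lambda>b c. gN q0 (curvature N gN (u b) (u c) (u c) q0) (u b q0)"
    have "(\<Sum>c\<in>?B - K. \<Sum>b\<in>?B - K. ?T b c) = (\<Sum>c\<in>?B - K. \<Sum>b\<in>?B - K. ?S (\<beta> b) (\<beta> c))"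
    proof (intro sum.cong refl)
      fix b c assume c: "c \<in> ?B - K" and b: "b \<in> ?B - K"
      show "?T b c = ?S (\<beta> b) (\<beta> c)"
        using L.rel_curvature[OF relL[OF b] relL[OF c] relL[OF c] relL[OF b] pM] by (simp add: pq)
    qed
    also have "\<dots> = (\<Sum>c\<in>?B - K. \<Sum>b\<in>?C. ?S b (\<beta> c))"
      by (rule sum.cong[OF refl sum.reindex_bij_betw[OF \<beta>]])
    also have "\<dots> = (\<Sum>c\<in>?C. \<Sum>b\<in>?C. ?S b c)"
      by (rule sum.reindex_bij_betw[OF \<beta>])
    also have "\<dots> = scalar_curvature N gN q0"
      by (rule N.scalar_curvature_frame[OF qN oN, symmetric])
    finally show ?thesis .
  qed
  finally show ?thesis .
qed

text \<open>The constant comes from 2 (lam - R_N/2) - R_S = 2 lam - R_M along the fiber over q0. The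
  given fields X and Y live on the fiber only, but all terms of the equation depend just on their
  values at p, so they may be replaced by restrictions of vertical extensions X' and Y', for which
  the equation on M is available.\<close>

lemma fiber_soliton:
  assumes soliton: "eta_yamabe_soliton M g V \<eta> lam mu" and V: "V \<in> vertical_fields M N \<pi>"
  shows "eta_yamabe_soliton S gS (res V) (restrict_form S M \<eta>) (lam - scalar_curvature N gN q0 / 2) mu"
  unfolding eta_yamabe_soliton_def
proof (intro conjI ballI)
  have \<eta>: "one_form M \<eta>"
    using soliton by (simp add: eta_yamabe_soliton_def)
  show "riemannian_manifold S gS"
    unfolding riemannian_manifold_def using S.smooth_manifold S.metric by blast
  show "res V \<in> vector_fields S"
    by (rule restrict_vector_field[OF V])
  show "one_form S (restrict_form S M \<eta>)"
    by (rule restrict_one_form[OF \<eta>])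
  fix X Y p assume X: "X \<in> vector_fields S" and Y: "Y \<in> vector_fields S" and pS: "p \<in> mcarrier S"
  note p = S_carrierD[OF pS]
  note pM = fiberD(1)[OF p]
  interpret R: isometric_pair S gS M g "\<lambda>x. x" "tangent_space S" vert
    by (rule restrict_pair)
  obtain X' where X': "X' \<in> vertical_fields M N \<pi>" "X' p = incl S M (X p)"
    using extend_vertical[OF pM incl_vertical[OF p S.field_tangent[OF X pS]]] .
  obtain Y' where Y': "Y' \<in> vertical_fields M N \<pi>" "Y' p = incl S M (Y p)"
    using extend_vertical[OF pM incl_vertical[OF p S.field_tangent[OF Y pS]]] .
  have Xp: "X p = res X' p" and Yp: "Y p = res Y' p"
    using restrict_field_eqI[OF X'(1) p S.field_tangent[OF X pS]] X'(2)
      restrict_field_eqI[OF Y'(1) p S.field_tangent[OF Y pS]] Y'(2) by simp_all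
  note rV = restrict_vector_field[OF V] and rX = restrict_vector_field[OF X'(1)]
  have "lie_derivative2 (res V) gS X Y p = lie_derivative2 (res V) gS (res X') Y p"
    by (rule S.tensorial_cong[OF S.lie_derivative_tensorial1[OF pS rV Y] pS X rX Xp])
  also have "\<dots> = lie_derivative2 (res V) gS (res X') (res Y') p"
    by (rule S.tensorial_cong[OF S.lie_derivative_tensorial2[OF pS rV rX] pS Y restrict_vector_field[OF Y'(1)] Yp])
  also have "\<dots> = lie_derivative2 V g X' Y' p"
    by (rule R.rel_lie_derivative[OF restrict_related[OF V] restrict_related[OF X'(1)] restrict_related[OF Y'(1)] pS])
  finally have lie: "lie_derivative2 (res V) gS X Y p = lie_derivative2 V g X' Y' p" .
  have "lie_derivative2 V g X' Y' p + (2 * lam - scalar_curvature M g p) * g p (X' p) (Y' p)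
      + 2 * mu * (\<eta> p (X' p) * \<eta> p (Y' p)) = 0"
    using soliton vertical_fieldsD(1)[OF X'(1)] vertical_fieldsD(1)[OF Y'(1)] pM
    unfolding eta_yamabe_soliton_def by blast
  moreover have "gS p (X p) (Y p) = g p (X' p) (Y' p)"
    by (simp add: induced_metric_def X'(2) Y'(2))
  moreover have "restrict_form S M \<eta> p (X p) = \<eta> p (X' p)" "restrict_form S M \<eta> p (Y p) = \<eta> p (Y' p)"
    by (simp_all add: restrict_form_def X'(2) Y'(2))
  ultimately show "lie_derivative2 (res V) gS X Y p
      + (2 * (lam - scalar_curvature N gN q0 / 2) - scalar_curvature S gS p) * gS p (X p) (Y p)
      + 2 * mu * (restrict_form S M \<eta> p (X p) * restrict_form S M \<eta> p (Y p)) = 0"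
    by (simp add: lie scalar_curvature_splits[OF p] algebra_simps)
qed

end

theorem theorem4p5:
  fixes M :: "('a, 'e::euclidean_space) manifold"
    and N :: "('b, 'f::euclidean_space) manifold"
    and g :: "'a form2" and gN :: "'b form2"
    and \<pi> :: "'a \<Rightarrow> 'b" and V :: "'a vfield" and \<eta> :: "'a form1"
    and lam mu :: real and q :: 'b and K :: "'e set" and S :: "('a, 'e) manifold"
  assumes soliton: "eta_yamabe_soliton M g V \<eta> lam mu"
    and submersion: "riemannian_submersion M g N gN \<pi>"
    and vertical: "V \<in> vertical_fields M N \<pi>"
    and parallel: "vertical_parallel M g N \<pi>"
    and q: "q \<in> mcarrier N"
    and K: "K \<subseteq> mcoords M" "card K = mdim M - mdim N"
  defines "S \<equiv> submanifold M (fiber M \<pi> q) K"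
  shows "\<exists>lam' mu'. eta_yamabe_soliton S (induced_metric S M g) (restrict_field S M V)
           (restrict_form S M \<eta>) lam' mu'"
proof -
  note sub = submersion[unfolded riemannian_submersion_def]
  interpret parallel_submersion_fiber M g N gN \<pi> K q
  proof unfold_locales
    show "smooth_manifold M" "riemannian_metric M g" "smooth_manifold N" "riemannian_metric N gN"
      using sub by (auto simp: riemannian_manifold_def)
    show "smooth_map M N \<pi>"
      using sub by blast
    show "differential M N \<pi> ` tangent_space M p = tangent_space N (\<pi> p)" if "p \<in> mcarrier M" for p
      using sub that by blast
    show "K \<subseteq> mcoords M"
      by (rule K(1))
    \<comment> \<open>The inequality of dimensions in \<open>riemannian_submersion\<close> makes the
      natural-number difference in K(2) a genuine one.\<close>
    show "card (mcoords M) = card K + card (mcoords N)"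
      using sub K(2) by (simp add: mdim_def)
    show "gN (\<pi> p) (differential M N \<pi> v) (differential M N \<pi> v) = g p v v"
      if "p \<in> mcarrier M" "v \<in> horizontal_space M g N \<pi> p" for p v
      using sub that by blast
    show "vertical_parallel M g N \<pi>"
      by (rule parallel)
    show "q \<in> \<pi> ` mcarrier M"
      using sub q by simp
  qed
  show ?thesis
    unfolding S_def using fiber_soliton[OF soliton vertical] by blast
qed


end
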